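(* Let $m$ be a positive integer, let $k$ be a commutative ring with identity, and let $\mathscr{C}=\mathscr{C}_1\times\cdots\times\mathscr{C}_m$, where each $\mathscr{C}_i$ ($1\leqslant i\leqslant m$) is a category satisfying conditions (C1)–(C5) and (S1)–(S3) listed in the context. Then the category of $\mathscr{C}$-modules (over $k$) presented in finite degrees is abelian.
   Context: The category of $\mathscr{C}$-modules presented in finite degrees means the full subcategory of the abelian category of all $\mathscr{C}$-modules on the modules presented in finite degrees. Notation: $\mathbb{N}=\{0,1,2,\ldots\}$. For a category $\mathscr{D}$, a $\mathscr{D}$-module is a covariant functor from $\mathscr{D}$ to the category of $k$-modules; homomorphisms are natural transformations. We write $f\cdot v=V(f)(v)$. Conditions on each category $\mathscr{C}_i$: (C1) its set of objects is $\mathbb{N}$; (C2) $\mathscr{C}_i(r,n)$ is nonempty if and only if $r\leqslant n$; (C3) if $r<l<n$, every morphism $f:r\to n$ is a composition $f=hg$ with $g:r\to l$ and $h:l\to n$; (C4) every endomorphism of every object $n$ is an isomorphism; (C5) if $r<n$, the group $\mathscr{C}_i(n,n)$ acts transitively on $\mathscr{C}_i(r,n)$. (S1) There is a given faithful functor $\psi_i:\mathscr{C}_i\to\mathscr{C}_i$ with $\psi_i(n)=n+1$ for every object $n$. For a $\mathscr{C}_i$-module $V$ put $\Psi_iV=V\circ\psi_i$. (S2) There is a given natural transformation $\varepsilon_i:\mathrm{Id}_{\mathscr{C}_i}\to\psi_i$. It induces, for each $\mathscr{C}_i$-module $V$, a natural homomorphism $(\mu_i)_V:V\to\Psi_iV$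 given on $V_n$ by $v\mapsto(\varepsilon_i)_n\cdot v\in V_{n+1}$. (S3) For every $n\in\mathbb{N}$, with $M_i(n)=k\mathscr{C}_i(n,-)$, the homomorphism $(\mu_i)_{M_i(n)}:M_i(n)\to\Psi_iM_i(n)$ is injective and its cokernel is a projective $\mathscr{C}_i$-module of generation degree $\leqslant n-1$. Here the generation degree of a $\mathscr{C}_i$-module $W$ is $\sup\{n : W_n\neq\sum_{r<n}k\mathscr{C}_i(r,n)\cdot W_r\}$, or $-1$ if this set is empty. Objects of $\mathscr{C}$ are tuples $\mathbf{n}=(n_1,\ldots,n_m)\in\mathbb{N}^m$, with $|\mathbf{n}|=\sum_i n_i$. A $\mathscr{C}$-module $V$ is generated in finite degrees if there are a natural number $N$ and a surjective homomorphism $\bigoplus_{\mathbf{n}\in\mathbb{N}^m}M(\mathbf{n})^{\oplus c_{\mathbf{n}}}\to V$, where $M(\mathbf{n})=k\mathscr{C}(\mathbf{n},-)$ is the $k$-linearization of the representable functor, the $c_{\mathbf{n}}$ are possibly infinite multiplicities, and $c_{\mathbf{n}}=0$ whenever $|\mathbf{n}|\geqslant N$. $V$ is presented in finite degrees if there is a surjective homomorphism $\bigoplus_{\mathbf{n}}M(\mathbf{n})^{\oplus c_{\mathbf{n}}}\to V$ such that $V$ and the kernel are both generated in finite degrees. *)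

theory Defs
  imports
    "HOL-Library.Extended_Real"
    "HOL-Algebra.Module"
    "HOL-Algebra.AbelCoset"
begin

text \<open>Small categories with carrier sets of objects and of arrows. \<open>Comp C g f\<close> is
  \<open>f\<close> followed by \<open>g\<close>; nothing is required of non-composable or non-arrow arguments.\<close>

record ('o, 'a) cat =
  Ob :: "'o set"
  Ar :: "'a set"
  Dom :: "'a \<Rightarrow> 'o"
  Cod :: "'a \<Rightarrow> 'o"
  Ident :: "'o \<Rightarrow> 'a"
  Comp :: "'a \<Rightarrow> 'a \<Rightarrow> 'a"

definition Hom :: "('o, 'a) cat \<Rightarrow> 'o \<Rightarrow> 'o \<Rightarrow> 'a set" where
  "Hom C x y = {f \<in> Ar C. Dom C f = x \<and> Cod C f = y}"

definition category :: "('o, 'a) cat \<Rightarrow> bool" where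
  "category C \<longleftrightarrow>
     (\<forall>f \<in> Ar C. Dom C f \<in> Ob C \<and> Cod C f \<in> Ob C) \<and>
     (\<forall>x \<in> Ob C. Ident C x \<in> Hom C x x) \<and>
     (\<forall>f \<in> Ar C. \<forall>g \<in> Ar C. Cod C f = Dom C g \<longrightarrow> Comp C g f \<in> Hom C (Dom C f) (Cod C g)) \<and>
     (\<forall>f \<in> Ar C. Comp C f (Ident C (Dom C f)) = f \<and> Comp C (Ident C (Cod C f)) f = f) \<and>
     (\<forall>f \<in> Ar C. \<forall>g \<in> Ar C. \<forall>h \<in> Ar C. Cod C f = Dom C g \<longrightarrow> Cod C g = Dom C h \<longrightarrow>
        Comp C h (Comp C g f) = Comp C (Comp C h g) f)"

definition is_functor ::
  "('o, 'a) cat \<Rightarrow> ('p, 'b) cat \<Rightarrow> ('o \<Rightarrow> 'p) \<Rightarrow> ('a \<Rightarrow> 'b) \<Rightarrow> bool" where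
  "is_functor C D Fo Fa \<longleftrightarrow>
     (\<forall>x \<in> Ob C. Fo x \<in> Ob D) \<and>
     (\<forall>f \<in> Ar C. Fa f \<in> Hom D (Fo (Dom C f)) (Fo (Cod C f))) \<and>
     (\<forall>x \<in> Ob C. Fa (Ident C x) = Ident D (Fo x)) \<and>
     (\<forall>f \<in> Ar C. \<forall>g \<in> Ar C. Cod C f = Dom C g \<longrightarrow> Fa (Comp C g f) = Comp D (Fa g) (Fa f))"

definition faithful :: "('o, 'a) cat \<Rightarrow> ('a \<Rightarrow> 'b) \<Rightarrow> bool" where
  "faithful C Fa \<longleftrightarrow> (\<forall>x \<in> Ob C. \<forall>y \<in> Ob C. inj_on Fa (Hom C x y))"

definition natural_transformation ::
  "('o, 'a) cat \<Rightarrow> ('p, 'b) cat \<Rightarrow> ('o \<Rightarrow> 'p) \<Rightarrow> ('a \<Rightarrow> 'b) \<Rightarrow> ('o \<Rightarrow> 'p) \<Rightarrow> ('a \<Rightarrow> 'b) \<Rightarrow> ('o \<Rightarrow> 'b) \<Rightarrow> bool"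
  where
  "natural_transformation C D Fo Fa Go Ga \<eta> \<longleftrightarrow>
     (\<forall>x \<in> Ob C. \<eta> x \<in> Hom D (Fo x) (Go x)) \<and>
     (\<forall>f \<in> Ar C. Comp D (\<eta> (Cod C f)) (Fa f) = Comp D (Ga f) (\<eta> (Dom C f)))"

definition prod_cat :: "'i set \<Rightarrow> ('i \<Rightarrow> ('o, 'a) cat) \<Rightarrow> ('i \<Rightarrow> 'o, 'i \<Rightarrow> 'a) cat" where
  "prod_cat I C =
     \<lparr> Ob = (\<Pi>\<^sub>E i\<in>I. Ob (C i)),
       Ar = (\<Pi>\<^sub>E i\<in>I. Ar (C i)),
       Dom = (\<lambda>f. \<lambda>i\<in>I. Dom (C i) (f i)),
       Cod = (\<lambda>f. \<lambda>i\<in>I. Cod (C i) (f i)),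
       Ident = (\<lambda>x. \<lambda>i\<in>I. Ident (C i) (x i)),
       Comp = (\<lambda>g f. \<lambda>i\<in>I. Comp (C i) (g i) (f i)) \<rparr>"

definition full_subcategory :: "('o, 'a) cat \<Rightarrow> ('o \<Rightarrow> bool) \<Rightarrow> ('o, 'a) cat" where
  "full_subcategory C P =
     C\<lparr> Ob := {x \<in> Ob C. P x}, Ar := {f \<in> Ar C. P (Dom C f) \<and> P (Cod C f)} \<rparr>"

definition preadditive ::
  "('o, 'a) cat \<Rightarrow> ('a \<Rightarrow> 'a \<Rightarrow> 'a) \<Rightarrow> ('o \<Rightarrow> 'o \<Rightarrow> 'a) \<Rightarrow> bool" where
  "preadditive C pl zr \<longleftrightarrow> category C \<and>
     (\<forall>x \<in> Ob C. \<forall>y \<in> Ob C. comm_group \<lparr> carrier = Hom C x y, mult = pl, one = zr x y \<rparr>) \<and>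
     (\<forall>x \<in> Ob C. \<forall>y \<in> Ob C. \<forall>z \<in> Ob C.
        \<forall>f \<in> Hom C x y. \<forall>f' \<in> Hom C x y. \<forall>g \<in> Hom C y z. \<forall>g' \<in> Hom C y z.
          Comp C g (pl f f') = pl (Comp C g f) (Comp C g f') \<and>
          Comp C (pl g g') f = pl (Comp C g f) (Comp C g' f))"

definition zero_object :: "('o, 'a) cat \<Rightarrow> 'o \<Rightarrow> bool" where
  "zero_object C z \<longleftrightarrow> z \<in> Ob C \<and>
     (\<forall>x \<in> Ob C. (\<exists>!f. f \<in> Hom C x z) \<and> (\<exists>!f. f \<in> Hom C z x))"

definition biproduct ::
  "('o, 'a) cat \<Rightarrow> ('a \<Rightarrow> 'a \<Rightarrow> 'a) \<Rightarrow> ('o \<Rightarrow> 'o \<Rightarrow> 'a) \<Rightarrow> 'o \<Rightarrow> 'o \<Rightarrow> 'o \<Rightarrow> 'a \<Rightarrow> 'a \<Rightarrow> 'a \<Rightarrow> 'a \<Rightarrow> bool" where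
  "biproduct C pl zr x y b i j p q \<longleftrightarrow> b \<in> Ob C \<and>
     i \<in> Hom C x b \<and> j \<in> Hom C y b \<and> p \<in> Hom C b x \<and> q \<in> Hom C b y \<and>
     Comp C p i = Ident C x \<and> Comp C q j = Ident C y \<and>
     Comp C p j = zr y x \<and> Comp C q i = zr x y \<and>
     pl (Comp C i p) (Comp C j q) = Ident C b"

definition is_kernel :: "('o, 'a) cat \<Rightarrow> ('o \<Rightarrow> 'o \<Rightarrow> 'a) \<Rightarrow> 'a \<Rightarrow> 'a \<Rightarrow> bool" where
  "is_kernel C zr f i \<longleftrightarrow> i \<in> Ar C \<and> Cod C i = Dom C f \<and>
     Comp C f i = zr (Dom C i) (Cod C f) \<and>
     (\<forall>g \<in> Ar C. Cod C g = Dom C f \<longrightarrow> Comp C f g = zr (Dom C g) (Cod C f) \<longrightarrow>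
        (\<exists>!h. h \<in> Hom C (Dom C g) (Dom C i) \<and> Comp C i h = g))"

definition is_cokernel :: "('o, 'a) cat \<Rightarrow> ('o \<Rightarrow> 'o \<Rightarrow> 'a) \<Rightarrow> 'a \<Rightarrow> 'a \<Rightarrow> bool" where
  "is_cokernel C zr f p \<longleftrightarrow> p \<in> Ar C \<and> Dom C p = Cod C f \<and>
     Comp C p f = zr (Dom C f) (Cod C p) \<and>
     (\<forall>g \<in> Ar C. Dom C g = Cod C f \<longrightarrow> Comp C g f = zr (Dom C f) (Cod C g) \<longrightarrow>
        (\<exists>!h. h \<in> Hom C (Cod C p) (Cod C g) \<and> Comp C h p = g))"

definition monic :: "('o, 'a) cat \<Rightarrow> 'a \<Rightarrow> bool" where
  "monic C f \<longleftrightarrow> f \<in> Ar C \<and>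
     (\<forall>g \<in> Ar C. \<forall>h \<in> Ar C. Cod C g = Dom C f \<longrightarrow> Cod C h = Dom C f \<longrightarrow> Dom C g = Dom C h \<longrightarrow>
        Comp C f g = Comp C f h \<longrightarrow> g = h)"

definition epic :: "('o, 'a) cat \<Rightarrow> 'a \<Rightarrow> bool" where
  "epic C f \<longleftrightarrow> f \<in> Ar C \<and>
     (\<forall>g \<in> Ar C. \<forall>h \<in> Ar C. Dom C g = Cod C f \<longrightarrow> Dom C h = Cod C f \<longrightarrow> Cod C g = Cod C h \<longrightarrow>
        Comp C g f = Comp C h f \<longrightarrow> g = h)"

text \<open>The additive structure of an abelian category is determined by the category, so being
  abelian is stated as a property of the bare category.\<close>

definition abelian_category :: "('o, 'a) cat \<Rightarrow> bool" where
  "abelian_category C \<longleftrightarrow> (\<exists>pl zr. preadditive C pl zr \<and>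
     (\<exists>z. zero_object C z) \<and>
     (\<forall>x \<in> Ob C. \<forall>y \<in> Ob C. \<exists>b i j p q. biproduct C pl zr x y b i j p q) \<and>
     (\<forall>f \<in> Ar C. \<exists>i. is_kernel C zr f i) \<and>
     (\<forall>f \<in> Ar C. \<exists>p. is_cokernel C zr f p) \<and>
     (\<forall>f. monic C f \<longrightarrow> (\<exists>g \<in> Ar C. is_kernel C zr g f)) \<and>
     (\<forall>f. epic C f \<longrightarrow> (\<exists>g \<in> Ar C. is_cokernel C zr g f)))"

definition linear_map ::
  "'k ring \<Rightarrow> ('k, 'v) module \<Rightarrow> ('k, 'w) module \<Rightarrow> ('v \<Rightarrow> 'w) \<Rightarrow> bool" where
  "linear_map k M N h \<longleftrightarrow> h \<in> hom (add_monoid M) (add_monoid N) \<and>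
     (\<forall>c \<in> carrier k. \<forall>v \<in> carrier M. h (c \<odot>\<^bsub>M\<^esub> v) = c \<odot>\<^bsub>N\<^esub> h v)"

definition submodule_span :: "'k ring \<Rightarrow> ('k, 'v) module \<Rightarrow> 'v set \<Rightarrow> 'v set" where
  "submodule_span k M S = \<Inter>{H. submodule H k M \<and> S \<subseteq> H}"

text \<open>A covariant functor to \<open>k\<close>-modules: \<open>fib V x\<close> is the module at the object \<open>x\<close> and
  \<open>act V f\<close> the map induced by the arrow \<open>f\<close>. The \<open>mult\<close> and \<open>one\<close> fields that the library's
  module record inherits from rings carry no meaning.\<close>

record ('o, 'a, 'k, 'v) cmod =
  fib :: "'o \<Rightarrow> ('k, 'v) module"
  act :: "'a \<Rightarrow> 'v \<Rightarrow> 'v"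

definition cmodule :: "'k ring \<Rightarrow> ('o, 'a) cat \<Rightarrow> ('o, 'a, 'k, 'v) cmod \<Rightarrow> bool" where
  "cmodule k C V \<longleftrightarrow>
     (\<forall>x \<in> Ob C. Module.module k (fib V x)) \<and>
     (\<forall>f \<in> Ar C. linear_map k (fib V (Dom C f)) (fib V (Cod C f)) (act V f)) \<and>
     (\<forall>x \<in> Ob C. \<forall>v \<in> carrier (fib V x). act V (Ident C x) v = v) \<and>
     (\<forall>f \<in> Ar C. \<forall>g \<in> Ar C. Cod C f = Dom C g \<longrightarrow>
        (\<forall>v \<in> carrier (fib V (Dom C f)). act V (Comp C g f) v = act V g (act V f v)))"

definition cmod_hom ::
  "'k ring \<Rightarrow> ('o, 'a) cat \<Rightarrow> ('o, 'a, 'k, 'v) cmod \<Rightarrow> ('o, 'a, 'k, 'w) cmod \<Rightarrow> ('o \<Rightarrow> 'v \<Rightarrow> 'w) \<Rightarrow> bool"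
  where
  "cmod_hom k C V W \<phi> \<longleftrightarrow>
     (\<forall>x \<in> Ob C. linear_map k (fib V x) (fib W x) (\<phi> x)) \<and>
     (\<forall>f \<in> Ar C. \<forall>v \<in> carrier (fib V (Dom C f)).
        \<phi> (Cod C f) (act V f v) = act W f (\<phi> (Dom C f) v))"

definition cmod_inj ::
  "('o, 'a) cat \<Rightarrow> ('o, 'a, 'k, 'v) cmod \<Rightarrow> ('o \<Rightarrow> 'v \<Rightarrow> 'w) \<Rightarrow> bool" where
  "cmod_inj C V \<phi> \<longleftrightarrow> (\<forall>x \<in> Ob C. inj_on (\<phi> x) (carrier (fib V x)))"

definition cmod_surj ::
  "('o, 'a) cat \<Rightarrow> ('o, 'a, 'k, 'v) cmod \<Rightarrow> ('o, 'a, 'k, 'w) cmod \<Rightarrow> ('o \<Rightarrow> 'v \<Rightarrow> 'w) \<Rightarrow> bool" where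
  "cmod_surj C V W \<phi> \<longleftrightarrow> (\<forall>x \<in> Ob C. \<phi> x ` carrier (fib V x) = carrier (fib W x))"

text \<open>The category of all modules whose underlying sets are subsets of \<open>'v\<close>; the type \<open>'v\<close> plays
  the role of the universe, and for it to be closed under finite direct sums it has to be infinite.
  Arrows are triples (source, target, family of maps); the families are extensional so that
  equality of arrows is equality of natural transformations.\<close>

definition module_category ::
  "'k ring \<Rightarrow> ('o, 'a) cat \<Rightarrow>
   (('o, 'a, 'k, 'v) cmod, ('o, 'a, 'k, 'v) cmod \<times> ('o, 'a, 'k, 'v) cmod \<times> ('o \<Rightarrow> 'v \<Rightarrow> 'v)) cat" where
  "module_category k C =
     \<lparr> Ob = {V. cmodule k C V},
       Ar = {(V, W, \<phi>). cmodule k C V \<and> cmodule k C W \<and> cmod_hom k C V W \<phi> \<and>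
               \<phi> \<in> extensional (Ob C) \<and> (\<forall>x \<in> Ob C. \<phi> x \<in> extensional (carrier (fib V x)))},
       Dom = (\<lambda>(V, W, \<phi>). V),
       Cod = (\<lambda>(V, W, \<phi>). W),
       Ident = (\<lambda>V. (V, V, \<lambda>x \<in> Ob C. \<lambda>v \<in> carrier (fib V x). v)),
       Comp = (\<lambda>(W', X, \<psi>) (V, W, \<phi>).
                 (V, X, \<lambda>x \<in> Ob C. \<lambda>v \<in> carrier (fib V x). \<psi> x (\<phi> x v))) \<rparr>"

definition kernel_cmod ::
  "('o, 'a, 'k, 'v) cmod \<Rightarrow> ('o, 'a, 'k, 'w) cmod \<Rightarrow> ('o \<Rightarrow> 'v \<Rightarrow> 'w) \<Rightarrow> ('o, 'a, 'k, 'v) cmod" where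
  "kernel_cmod V W \<phi> =
     V\<lparr> fib := (\<lambda>x. (fib V x)\<lparr> carrier := a_kernel (fib V x) (fib W x) (\<phi> x) \<rparr>) \<rparr>"

definition quotient_module :: "('k, 'v) module \<Rightarrow> 'v set \<Rightarrow> ('k, 'v set) module" where
  "quotient_module M H =
     \<lparr> carrier = a_rcosets\<^bsub>M\<^esub> H, mult = undefined, one = undefined,
       zero = H, add = set_add M,
       smult = (\<lambda>c X. H <+>\<^bsub>M\<^esub> ((\<lambda>v. c \<odot>\<^bsub>M\<^esub> v) ` X)) \<rparr>"

definition cokernel_cmod ::
  "('o, 'a) cat \<Rightarrow> ('o, 'a, 'k, 'v) cmod \<Rightarrow> ('o, 'a, 'k, 'w) cmod \<Rightarrow> ('o \<Rightarrow> 'v \<Rightarrow> 'w) \<Rightarrow>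
   ('o, 'a, 'k, 'w set) cmod" where
  "cokernel_cmod C V W \<phi> =
     \<lparr> fib = (\<lambda>x. quotient_module (fib W x) (\<phi> x ` carrier (fib V x))),
       act = (\<lambda>f X. (\<phi> (Cod C f) ` carrier (fib V (Cod C f))) <+>\<^bsub>fib W (Cod C f)\<^esub> (act W f ` X)) \<rparr>"

definition direct_sum ::
  "'j set \<Rightarrow> ('j \<Rightarrow> ('o, 'a, 'k, 'v) cmod) \<Rightarrow> ('o, 'a, 'k, 'j \<Rightarrow> 'v) cmod" where
  "direct_sum J W =
     \<lparr> fib = (\<lambda>x.
         \<lparr> carrier = {a \<in> (\<Pi>\<^sub>E j\<in>J. carrier (fib (W j) x)). finite {j \<in> J. a j \<noteq> \<zero>\<^bsub>fib (W j) x\<^esub>}},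
           mult = undefined, one = undefined,
           zero = (\<lambda>j\<in>J. \<zero>\<^bsub>fib (W j) x\<^esub>),
           add = (\<lambda>a b. \<lambda>j\<in>J. a j \<oplus>\<^bsub>fib (W j) x\<^esub> b j),
           smult = (\<lambda>c a. \<lambda>j\<in>J. c \<odot>\<^bsub>fib (W j) x\<^esub> a j) \<rparr>),
       act = (\<lambda>f a. \<lambda>j\<in>J. act (W j) f (a j)) \<rparr>"

text \<open>\<open>M(n) = kC(n,-)\<close>: at \<open>x\<close>, the finitely supported functions \<open>Hom(n,x) \<rightarrow> k\<close>, written as
  formal linear combinations. The pushforward sums over the support only, because
  \<open>finsum\<close> over an infinite index set is \<open>0\<close> by convention.\<close>

definition free_cmod :: "'k ring \<Rightarrow> ('o, 'a) cat \<Rightarrow> 'o \<Rightarrow> ('o, 'a, 'k, 'a \<Rightarrow> 'k) cmod" where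
  "free_cmod k C n =
     \<lparr> fib = (\<lambda>x.
         \<lparr> carrier = {a \<in> Hom C n x \<rightarrow>\<^sub>E carrier k. finite {g \<in> Hom C n x. a g \<noteq> \<zero>\<^bsub>k\<^esub>}},
           mult = undefined, one = undefined,
           zero = (\<lambda>g \<in> Hom C n x. \<zero>\<^bsub>k\<^esub>),
           add = (\<lambda>a b. \<lambda>g \<in> Hom C n x. a g \<oplus>\<^bsub>k\<^esub> b g),
           smult = (\<lambda>c a. \<lambda>g \<in> Hom C n x. c \<otimes>\<^bsub>k\<^esub> a g) \<rparr>),
       act = (\<lambda>f a. \<lambda>h \<in> Hom C n (Cod C f).
         \<Oplus>\<^bsub>k\<^esub>g \<in> {g \<in> Hom C n (Dom C f). a g \<noteq> \<zero>\<^bsub>k\<^esub> \<and> Comp C f g = h}. a g) \<rparr>"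

text \<open>The direct sum of the \<open>M(n)\<close> with multiplicity \<open>c n\<close>, a multiplicity being an index set.\<close>

definition free_sum ::
  "'k ring \<Rightarrow> ('o, 'a) cat \<Rightarrow> ('o \<Rightarrow> 'i set) \<Rightarrow> ('o, 'a, 'k, 'o \<times> 'i \<Rightarrow> 'a \<Rightarrow> 'k) cmod" where
  "free_sum k C c = direct_sum (SIGMA n:Ob C. c n) (\<lambda>(n, i). free_cmod k C n)"

text \<open>Projectivity: lifting along surjections. The lifting property against modules on the two
  indicated element types is the lifting property against all modules: \<open>W\<close> itself lives on the
  type of \<open>B\<close>, and its free cover, the sum over \<open>n\<close> of one copy of \<open>M(n)\<close> for each element of
  \<open>W\<^sub>n\<close>, lives on the type of \<open>A\<close>; so \<open>W\<close> is a direct summand of that cover.\<close>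

definition projective :: "'k ring \<Rightarrow> ('o, 'a) cat \<Rightarrow> ('o, 'a, 'k, 'w) cmod \<Rightarrow> bool" where
  "projective k C W \<longleftrightarrow> cmodule k C W \<and>
     (\<forall>(A :: ('o, 'a, 'k, 'o \<times> 'w \<Rightarrow> 'a \<Rightarrow> 'k) cmod) (B :: ('o, 'a, 'k, 'w) cmod) \<pi> \<beta>.
        cmodule k C A \<longrightarrow> cmodule k C B \<longrightarrow>
        cmod_hom k C A B \<pi> \<longrightarrow> cmod_surj C A B \<pi> \<longrightarrow> cmod_hom k C W B \<beta> \<longrightarrow>
        (\<exists>\<alpha>. cmod_hom k C W A \<alpha> \<and>
          (\<forall>x \<in> Ob C. \<forall>w \<in> carrier (fib W x). \<pi> x (\<alpha> x w) = \<beta> x w)))"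

text \<open>Multiplicities are taken among the subsets of the element type of \<open>V\<close>. This is no
  restriction: \<open>V\<close> is a quotient of a sum of \<open>M(n)\<close>'s if and only if it is already one using,
  for the same \<open>n\<close>'s, one copy of \<open>M(n)\<close> for each element of \<open>V\<^sub>n\<close>.\<close>

definition generated_in_finite_degrees ::
  "'k ring \<Rightarrow> ('o, 'a) cat \<Rightarrow> ('o \<Rightarrow> nat) \<Rightarrow> ('o, 'a, 'k, 'v) cmod \<Rightarrow> bool" where
  "generated_in_finite_degrees k C deg V \<longleftrightarrow>
     (\<exists>(N :: nat) (c :: 'o \<Rightarrow> 'v set) \<phi>.
        (\<forall>n \<in> Ob C. N \<le> deg n \<longrightarrow> c n = {}) \<and>
        cmod_hom k C (free_sum k C c) V \<phi> \<and> cmod_surj C (free_sum k C c) V \<phi>)"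

text \<open>Again larger multiplicities would not change the notion: by Schanuel's lemma, if one such
  surjection onto \<open>V\<close> has a kernel generated in finite degrees and \<open>V\<close> is generated in finite
  degrees, then any surjection onto \<open>V\<close> from a sum of \<open>M(n)\<close>'s of bounded degree also has a
  kernel generated in finite degrees.\<close>

definition presented_in_finite_degrees ::
  "'k ring \<Rightarrow> ('o, 'a) cat \<Rightarrow> ('o \<Rightarrow> nat) \<Rightarrow> ('o, 'a, 'k, 'v) cmod \<Rightarrow> bool" where
  "presented_in_finite_degrees k C deg V \<longleftrightarrow>
     (\<exists>(c :: 'o \<Rightarrow> 'v set) \<phi>.
        cmod_hom k C (free_sum k C c) V \<phi> \<and> cmod_surj C (free_sum k C c) V \<phi> \<and>
        generated_in_finite_degrees k C deg V \<and>
        generated_in_finite_degrees k C deg (kernel_cmod (free_sum k C c) V \<phi>))"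

definition generation_degree ::
  "'k ring \<Rightarrow> (nat, 'a) cat \<Rightarrow> (nat, 'a, 'k, 'v) cmod \<Rightarrow> ereal" where
  "generation_degree k C W =
     (let S = {n. carrier (fib W n) \<noteq>
                  submodule_span k (fib W n)
                    {act W f w | f w r. r < n \<and> f \<in> Hom C r n \<and> w \<in> carrier (fib W r)}}
      in if S = {} then -1 else SUP n\<in>S. ereal (real n))"

definition pullback_cmod ::
  "('p \<Rightarrow> 'o) \<Rightarrow> ('b \<Rightarrow> 'a) \<Rightarrow> ('o, 'a, 'k, 'v) cmod \<Rightarrow> ('p, 'b, 'k, 'v) cmod" where
  "pullback_cmod Fo Fa V = \<lparr> fib = (\<lambda>x. fib V (Fo x)), act = (\<lambda>f. act V (Fa f)) \<rparr>"

abbreviation Shift :: "('a \<Rightarrow> 'a) \<Rightarrow> (nat, 'a, 'k, 'v) cmod \<Rightarrow> (nat, 'a, 'k, 'v) cmod" where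
  "Shift \<psi> V \<equiv> pullback_cmod Suc \<psi> V"

definition shift_map :: "(nat \<Rightarrow> 'a) \<Rightarrow> (nat, 'a, 'k, 'v) cmod \<Rightarrow> nat \<Rightarrow> 'v \<Rightarrow> 'v" where
  "shift_map \<epsilon> V n v = act V (\<epsilon> n) v"

definition combinatorial_category :: "(nat, 'a) cat \<Rightarrow> bool" where
  "combinatorial_category C \<longleftrightarrow> category C \<and>
     Ob C = UNIV \<and>
     (\<forall>r n. Hom C r n \<noteq> {} \<longleftrightarrow> r \<le> n) \<and>
     (\<forall>r l n. r < l \<longrightarrow> l < n \<longrightarrow>
        (\<forall>f \<in> Hom C r n. \<exists>g \<in> Hom C r l. \<exists>h \<in> Hom C l n. f = Comp C h g)) \<and>
     (\<forall>n. \<forall>f \<in> Hom C n n. \<exists>g \<in> Hom C n n. Comp C g f = Ident C n \<and> Comp C f g = Ident C n) \<and>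
     (\<forall>r n. r < n \<longrightarrow>
        (\<forall>f \<in> Hom C r n. \<forall>f' \<in> Hom C r n. \<exists>g \<in> Hom C n n. Comp C g f = f'))"

definition shift_structure ::
  "'k ring \<Rightarrow> (nat, 'a) cat \<Rightarrow> ('a \<Rightarrow> 'a) \<Rightarrow> (nat \<Rightarrow> 'a) \<Rightarrow> bool" where
  "shift_structure k C \<psi> \<epsilon> \<longleftrightarrow>
     is_functor C C Suc \<psi> \<and> faithful C \<psi> \<and>
     natural_transformation C C id id Suc \<psi> \<epsilon> \<and>
     (\<forall>n. let M = free_cmod k C n; Q = cokernel_cmod C M (Shift \<psi> M) (shift_map \<epsilon> M) in
        cmod_inj C M (shift_map \<epsilon> M) \<and>
        projective k C Q \<and> generation_degree k C Q \<le> ereal (real n - 1))"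

end

theory Submission
  imports Defs
begin

text \<open>The crux is coherence: for a module \<open>E\<close> generated in finite degrees, the common kernel \<open>L\<close> of
  any family of homomorphisms from \<open>E\<close> to representables of bounded degree is again generated in
  finite degrees. This is proved by induction on the number of factors and, for a chosen factor, on
  the degree of the representables in that direction. Let \<open>\<Psi>\<close> be the shift in the chosen direction.
  By (S3) the cokernel of \<open>M(n) \<rightarrow> \<Psi> M(n)\<close> embeds into a sum of representables of smaller degree, so
  the elements of \<open>\<Psi> E\<close> mapped into the image of \<open>M(n)\<close> form a common kernel of smaller degree. All
  non-endomorphisms in the chosen direction map these elements into \<open>\<Psi> L + E\<close>, which is therefore
  controlled by finitely many slices, i.e. by fewer factors. Finally \<open>\<Psi> L\<close> is generated by elements
  of bounded degree together with \<open>L\<close>, and hence so is \<open>L\<close>.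

  Coherence implies that the kernel of a map from a module generated in finite degrees to one
  presented in finite degrees is generated in finite degrees: pull the map back along a free cover
  of the target. Closure under kernels, cokernels and finite sums follows.\<close>

section \<open>Modules over a small category\<close>

text \<open>A submodule of a module generated in finite degrees need not be of that kind: inside
  infinitely many copies of one representable, truncations above ever larger degrees are a
  counterexample. Hence only kernels of maps into representables of bounded degree are controlled.
  They are common kernels of arbitrary families rather than kernels of one map into a sum, because
  both steps of the induction multiply functionals: the embedding of the cokernel in (S3) has one
  component for every generator used, and a functional restricted to a slice splits into one
  functional for every arrow of the chosen direction. What stays bounded is each coordinate of the
  representing objects: the shift lowers the chosen one and keeps the others, a slice drops it. So
  the bound is kept coordinate by coordinate.

  The final category has a prescribed element type. Generation is therefore an inductive predicate
  that makes sense on every type, auxiliary modules live wherever convenient, and only sums and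
  quotients have to be carried back.\<close>

lemma HomD:
  assumes "f \<in> Hom C x y"
  shows "f \<in> Ar C" "Dom C f = x" "Cod C f = y"
  using assms by (auto simp: Hom_def)

lemma Ar_Hom: "f \<in> Ar C \<Longrightarrow> f \<in> Hom C (Dom C f) (Cod C f)"
  by (auto simp: Hom_def)

lemma category_Hom_Ob:
  assumes "category C" "f \<in> Hom C x y"
  shows "x \<in> Ob C" "y \<in> Ob C"
  using assms by (auto simp: Hom_def category_def)

lemma category_Ident: "category C \<Longrightarrow> x \<in> Ob C \<Longrightarrow> Ident C x \<in> Hom C x x"
  by (auto simp: category_def)

lemma category_Comp:
  "category C \<Longrightarrow> f \<in> Hom C x y \<Longrightarrow> g \<in> Hom C y z \<Longrightarrow> Comp C g f \<in> Hom C x z"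
  by (auto simp: category_def Hom_def)

lemma category_Comp_Ident:
  assumes "category C" "f \<in> Hom C x y"
  shows "Comp C f (Ident C x) = f" "Comp C (Ident C y) f = f"
  using assms by (auto simp: category_def Hom_def)

lemma category_assoc:
  "category C \<Longrightarrow> f \<in> Hom C w x \<Longrightarrow> g \<in> Hom C x y \<Longrightarrow> h \<in> Hom C y z
   \<Longrightarrow> Comp C h (Comp C g f) = Comp C (Comp C h g) f"
  by (auto simp: category_def Hom_def)

lemma functor_Hom: "is_functor C D Fo Fa \<Longrightarrow> f \<in> Hom C x y \<Longrightarrow> Fa f \<in> Hom D (Fo x) (Fo y)"
  by (auto simp: is_functor_def Hom_def)

lemma functor_Ob: "is_functor C D Fo Fa \<Longrightarrow> x \<in> Ob C \<Longrightarrow> Fo x \<in> Ob D"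
  by (auto simp: is_functor_def)

lemma functor_Ident: "is_functor C D Fo Fa \<Longrightarrow> x \<in> Ob C \<Longrightarrow> Fa (Ident C x) = Ident D (Fo x)"
  by (auto simp: is_functor_def)

lemma functor_Comp:
  "is_functor C D Fo Fa \<Longrightarrow> f \<in> Hom C x y \<Longrightarrow> g \<in> Hom C y z
   \<Longrightarrow> Fa (Comp C g f) = Comp D (Fa g) (Fa f)"
  by (auto simp: is_functor_def Hom_def)

section \<open>Linear maps and homomorphisms of modules over a category\<close>

lemma linear_mapI:
  assumes "\<And>v. v \<in> carrier M \<Longrightarrow> h v \<in> carrier N"
    and "\<And>u v. u \<in> carrier M \<Longrightarrow> v \<in> carrier M \<Longrightarrow> h (u \<oplus>\<^bsub>M\<^esub> v) = h u \<oplus>\<^bsub>N\<^esub> h v"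
    and "\<And>c v. c \<in> carrier k \<Longrightarrow> v \<in> carrier M \<Longrightarrow> h (c \<odot>\<^bsub>M\<^esub> v) = c \<odot>\<^bsub>N\<^esub> h v"
  shows "linear_map k M N h"
  using assms by (auto simp: linear_map_def hom_def)

lemma linear_map_closed: "linear_map k M N h \<Longrightarrow> v \<in> carrier M \<Longrightarrow> h v \<in> carrier N"
  by (auto simp: linear_map_def hom_def)

lemma linear_map_add:
  "linear_map k M N h \<Longrightarrow> u \<in> carrier M \<Longrightarrow> v \<in> carrier M
   \<Longrightarrow> h (u \<oplus>\<^bsub>M\<^esub> v) = h u \<oplus>\<^bsub>N\<^esub> h v"
  by (auto simp: linear_map_def hom_def)

lemma linear_map_smult:
  "linear_map k M N h \<Longrightarrow> c \<in> carrier k \<Longrightarrow> v \<in> carrier M \<Longrightarrow> h (c \<odot>\<^bsub>M\<^esub> v) = c \<odot>\<^bsub>N\<^esub> h v"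
  by (auto simp: linear_map_def)

lemma linear_map_comp:
  assumes "linear_map k L M g" "linear_map k M N h"
  shows "linear_map k L N (\<lambda>u. h (g u))"
  by (rule linear_mapI)
    (simp_all add: linear_map_closed[OF assms(1)] linear_map_closed[OF assms(2)]
      linear_map_add[OF assms(1)] linear_map_add[OF assms(2)]
      linear_map_smult[OF assms(1)] linear_map_smult[OF assms(2)])

lemma linear_map_zero:
  assumes "module k M" "module k N" "linear_map k M N h"
  shows "h \<zero>\<^bsub>M\<^esub> = \<zero>\<^bsub>N\<^esub>"
proof -
  interpret M: module k M by fact
  interpret N: module k N by fact
  have "h \<zero>\<^bsub>M\<^esub> = h (\<zero>\<^bsub>k\<^esub> \<odot>\<^bsub>M\<^esub> \<zero>\<^bsub>M\<^esub>)" by simp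
  also have "\<dots> = \<zero>\<^bsub>k\<^esub> \<odot>\<^bsub>N\<^esub> h \<zero>\<^bsub>M\<^esub>"
    using linear_map_smult[OF assms(3), of "\<zero>\<^bsub>k\<^esub>" "\<zero>\<^bsub>M\<^esub>"] by simp
  finally show ?thesis using linear_map_closed[OF assms(3), of "\<zero>\<^bsub>M\<^esub>"] by simp
qed

lemma (in module) neg_smult: "x \<in> carrier M \<Longrightarrow> \<ominus>\<^bsub>M\<^esub> x = (\<ominus>\<^bsub>R\<^esub> \<one>\<^bsub>R\<^esub>) \<odot>\<^bsub>M\<^esub> x"
  using smult_l_minus[of "\<one>\<^bsub>R\<^esub>" x] by simp

lemma linear_map_neg:
  assumes "module k M" "module k N" "linear_map k M N h" "v \<in> carrier M"
  shows "h (\<ominus>\<^bsub>M\<^esub> v) = \<ominus>\<^bsub>N\<^esub> h v"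
proof -
  interpret M: module k M by fact
  interpret N: module k N by fact
  show ?thesis
    using assms linear_map_smult[OF assms(3), of "\<ominus>\<^bsub>k\<^esub> \<one>\<^bsub>k\<^esub>" v] linear_map_closed[OF assms(3,4)]
    by (simp add: M.neg_smult N.neg_smult)
qed

lemma linear_map_minus:
  assumes "module k M" "module k N" "linear_map k M N h" "u \<in> carrier M" "v \<in> carrier M"
  shows "h (u \<ominus>\<^bsub>M\<^esub> v) = h u \<ominus>\<^bsub>N\<^esub> h v"
proof -
  interpret M: module k M by fact
  interpret N: module k N by fact
  show ?thesis
    using assms linear_map_add[OF assms(3), of u "\<ominus>\<^bsub>M\<^esub> v"] linear_map_neg[OF assms(1-3,5)]
    by (simp add: a_minus_def)
qed

lemma (in abelian_group) minus_eq_zero_iff: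
  assumes "a \<in> carrier G" "b \<in> carrier G"
  shows "a \<ominus> b = \<zero> \<longleftrightarrow> a = b"
  using assms by (metis a_minus_def add.inv_closed minus_equality minus_minus r_neg)

lemma (in abelian_group) add_minus_cancel:
  assumes "a \<in> carrier G" "b \<in> carrier G"
  shows "(a \<oplus> b) \<ominus> a = b"
  using assms by (simp add: a_minus_def a_comm[of a b] a_assoc r_neg)

lemma cmoduleI:
  assumes "category C"
    and "\<And>x. x \<in> Ob C \<Longrightarrow> module k (fib V x)"
    and "\<And>f x y. f \<in> Hom C x y \<Longrightarrow> linear_map k (fib V x) (fib V y) (act V f)"
    and "\<And>x v. x \<in> Ob C \<Longrightarrow> v \<in> carrier (fib V x) \<Longrightarrow> act V (Ident C x) v = v"
    and "\<And>f g x y z v. f \<in> Hom C x y \<Longrightarrow> g \<in> Hom C y z \<Longrightarrow> v \<in> carrier (fib V x)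
      \<Longrightarrow> act V (Comp C g f) v = act V g (act V f v)"
  shows "cmodule k C V"
  using assms by (auto simp: cmodule_def Hom_def)

lemma cmod_homI:
  assumes "\<And>x. x \<in> Ob C \<Longrightarrow> linear_map k (fib V x) (fib W x) (\<phi> x)"
    and "\<And>f x y v. f \<in> Hom C x y \<Longrightarrow> v \<in> carrier (fib V x) \<Longrightarrow> \<phi> y (act V f v) = act W f (\<phi> x v)"
  shows "cmod_hom k C V W \<phi>"
  using assms by (auto simp: cmod_hom_def Hom_def)

locale cmod =
  fixes k :: "'k ring" and C :: "('o, 'a) cat" and V :: "('o, 'a, 'k, 'v) cmod"
  assumes cat: "category C" and cm: "cmodule k C V"
begin

lemma fib_module: "x \<in> Ob C \<Longrightarrow> module k (fib V x)"
  using cm by (auto simp: cmodule_def)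

lemma act_linear: "f \<in> Hom C x y \<Longrightarrow> linear_map k (fib V x) (fib V y) (act V f)"
  using cm by (auto simp: cmodule_def Hom_def)

lemma act_closed: "f \<in> Hom C x y \<Longrightarrow> v \<in> carrier (fib V x) \<Longrightarrow> act V f v \<in> carrier (fib V y)"
  by (rule linear_map_closed[OF act_linear])

lemma act_add: "f \<in> Hom C x y \<Longrightarrow> u \<in> carrier (fib V x) \<Longrightarrow> v \<in> carrier (fib V x)
  \<Longrightarrow> act V f (u \<oplus>\<^bsub>fib V x\<^esub> v) = act V f u \<oplus>\<^bsub>fib V y\<^esub> act V f v"
  by (rule linear_map_add[OF act_linear])

lemma act_smult: "f \<in> Hom C x y \<Longrightarrow> c \<in> carrier k \<Longrightarrow> v \<in> carrier (fib V x)
  \<Longrightarrow> act V f (c \<odot>\<^bsub>fib V x\<^esub> v) = c \<odot>\<^bsub>fib V y\<^esub> act V f v"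
  by (rule linear_map_smult[OF act_linear])

lemma act_zero: "f \<in> Hom C x y \<Longrightarrow> act V f \<zero>\<^bsub>fib V x\<^esub> = \<zero>\<^bsub>fib V y\<^esub>"
  by (rule linear_map_zero[OF fib_module fib_module act_linear]) (auto dest: category_Hom_Ob[OF cat])

lemma act_minus: "f \<in> Hom C x y \<Longrightarrow> u \<in> carrier (fib V x) \<Longrightarrow> v \<in> carrier (fib V x)
  \<Longrightarrow> act V f (u \<ominus>\<^bsub>fib V x\<^esub> v) = act V f u \<ominus>\<^bsub>fib V y\<^esub> act V f v"
  by (rule linear_map_minus[OF fib_module fib_module act_linear]) (auto dest: category_Hom_Ob[OF cat])

lemma act_Ident: "x \<in> Ob C \<Longrightarrow> v \<in> carrier (fib V x) \<Longrightarrow> act V (Ident C x) v = v"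
  using cm by (auto simp: cmodule_def)

lemma act_Comp: "f \<in> Hom C x y \<Longrightarrow> g \<in> Hom C y z \<Longrightarrow> v \<in> carrier (fib V x)
  \<Longrightarrow> act V (Comp C g f) v = act V g (act V f v)"
  using cm by (auto simp: cmodule_def Hom_def)

lemma zero_closed: "x \<in> Ob C \<Longrightarrow> \<zero>\<^bsub>fib V x\<^esub> \<in> carrier (fib V x)"
  by (meson fib_module module_def abelian_group.axioms(1) abelian_monoid.zero_closed)

lemma add_closed: "x \<in> Ob C \<Longrightarrow> u \<in> carrier (fib V x) \<Longrightarrow> v \<in> carrier (fib V x)
  \<Longrightarrow> u \<oplus>\<^bsub>fib V x\<^esub> v \<in> carrier (fib V x)"
  by (meson fib_module module_def abelian_group.axioms(1) abelian_monoid.a_closed)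

lemma smult_closed: "x \<in> Ob C \<Longrightarrow> c \<in> carrier k \<Longrightarrow> v \<in> carrier (fib V x)
  \<Longrightarrow> c \<odot>\<^bsub>fib V x\<^esub> v \<in> carrier (fib V x)"
  by (meson fib_module module.smult_closed)

lemma minus_closed: "x \<in> Ob C \<Longrightarrow> u \<in> carrier (fib V x) \<Longrightarrow> v \<in> carrier (fib V x)
  \<Longrightarrow> u \<ominus>\<^bsub>fib V x\<^esub> v \<in> carrier (fib V x)"
  by (meson fib_module module_def abelian_group.minus_closed)

lemma cring_k: "x \<in> Ob C \<Longrightarrow> cring k"
  using fib_module module_def by blast

end

locale cmod_map = V: cmod k C V + W: cmod k C W
  for k :: "'k ring" and C :: "('o, 'a) cat"
    and V :: "('o, 'a, 'k, 'v) cmod" and W :: "('o, 'a, 'k, 'w) cmod" +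
  fixes \<phi> :: "'o \<Rightarrow> 'v \<Rightarrow> 'w"
  assumes hom: "cmod_hom k C V W \<phi>"
begin

lemma map_linear: "x \<in> Ob C \<Longrightarrow> linear_map k (fib V x) (fib W x) (\<phi> x)"
  using hom by (auto simp: cmod_hom_def)

lemma map_closed: "x \<in> Ob C \<Longrightarrow> v \<in> carrier (fib V x) \<Longrightarrow> \<phi> x v \<in> carrier (fib W x)"
  by (rule linear_map_closed[OF map_linear])

lemma map_add: "x \<in> Ob C \<Longrightarrow> u \<in> carrier (fib V x) \<Longrightarrow> v \<in> carrier (fib V x)
  \<Longrightarrow> \<phi> x (u \<oplus>\<^bsub>fib V x\<^esub> v) = \<phi> x u \<oplus>\<^bsub>fib W x\<^esub> \<phi> x v"
  by (rule linear_map_add[OF map_linear])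

lemma map_smult: "x \<in> Ob C \<Longrightarrow> c \<in> carrier k \<Longrightarrow> v \<in> carrier (fib V x)
  \<Longrightarrow> \<phi> x (c \<odot>\<^bsub>fib V x\<^esub> v) = c \<odot>\<^bsub>fib W x\<^esub> \<phi> x v"
  by (rule linear_map_smult[OF map_linear])

lemma map_zero: "x \<in> Ob C \<Longrightarrow> \<phi> x \<zero>\<^bsub>fib V x\<^esub> = \<zero>\<^bsub>fib W x\<^esub>"
  by (rule linear_map_zero[OF V.fib_module W.fib_module map_linear])

lemma map_minus: "x \<in> Ob C \<Longrightarrow> u \<in> carrier (fib V x) \<Longrightarrow> v \<in> carrier (fib V x)
  \<Longrightarrow> \<phi> x (u \<ominus>\<^bsub>fib V x\<^esub> v) = \<phi> x u \<ominus>\<^bsub>fib W x\<^esub> \<phi> x v"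
  by (rule linear_map_minus[OF V.fib_module W.fib_module map_linear])

lemma map_act: "f \<in> Hom C x y \<Longrightarrow> v \<in> carrier (fib V x) \<Longrightarrow> \<phi> y (act V f v) = act W f (\<phi> x v)"
  using hom by (auto simp: cmod_hom_def Hom_def)

end

lemma cmod_hom_comp:
  assumes "category C" "cmod_hom k C U V \<phi>" "cmod_hom k C V W \<chi>"
  shows "cmod_hom k C U W (\<lambda>x u. \<chi> x (\<phi> x u))"
proof (rule cmod_homI)
  fix x assume "x \<in> Ob C"
  then have "linear_map k (fib U x) (fib V x) (\<phi> x)" "linear_map k (fib V x) (fib W x) (\<chi> x)"
    using assms by (auto simp: cmod_hom_def)
  then show "linear_map k (fib U x) (fib W x) (\<lambda>u. \<chi> x (\<phi> x u))"
    by (rule linear_map_comp)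
next
  fix f x y u assume f: "f \<in> Hom C x y" "u \<in> carrier (fib U x)"
  then have "\<phi> x u \<in> carrier (fib V x)"
    using assms(2) category_Hom_Ob(1)[OF assms(1) f(1)] by (auto simp: cmod_hom_def intro: linear_map_closed)
  then show "\<chi> y (\<phi> y (act U f u)) = act W f (\<chi> x (\<phi> x u))"
    using f assms(2,3) by (auto simp: cmod_hom_def Hom_def)
qed

subsection \<open>Submodules and generators\<close>

definition subm :: "'k ring \<Rightarrow> ('o, 'a) cat \<Rightarrow> ('o, 'a, 'k, 'v) cmod \<Rightarrow> ('o \<Rightarrow> 'v set) \<Rightarrow> bool" where
  "subm k C V L \<longleftrightarrow>
     (\<forall>x \<in> Ob C. L x \<subseteq> carrier (fib V x) \<and> \<zero>\<^bsub>fib V x\<^esub> \<in> L x \<and>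
        (\<forall>u \<in> L x. \<forall>v \<in> L x. u \<oplus>\<^bsub>fib V x\<^esub> v \<in> L x) \<and>
        (\<forall>c \<in> carrier k. \<forall>v \<in> L x. c \<odot>\<^bsub>fib V x\<^esub> v \<in> L x)) \<and>
     (\<forall>x y. \<forall>f \<in> Hom C x y. \<forall>v \<in> L x. act V f v \<in> L y)"

definition sub_cmod :: "('o, 'a, 'k, 'v) cmod \<Rightarrow> ('o \<Rightarrow> 'v set) \<Rightarrow> ('o, 'a, 'k, 'v) cmod" where
  "sub_cmod V L = V\<lparr>fib := (\<lambda>x. (fib V x)\<lparr>carrier := L x\<rparr>)\<rparr>"

lemma submD:
  assumes "subm k C V L"
  shows "x \<in> Ob C \<Longrightarrow> v \<in> L x \<Longrightarrow> v \<in> carrier (fib V x)"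
    and "x \<in> Ob C \<Longrightarrow> \<zero>\<^bsub>fib V x\<^esub> \<in> L x"
    and "x \<in> Ob C \<Longrightarrow> u \<in> L x \<Longrightarrow> v \<in> L x \<Longrightarrow> u \<oplus>\<^bsub>fib V x\<^esub> v \<in> L x"
    and "x \<in> Ob C \<Longrightarrow> c \<in> carrier k \<Longrightarrow> v \<in> L x \<Longrightarrow> c \<odot>\<^bsub>fib V x\<^esub> v \<in> L x"
    and "f \<in> Hom C x y \<Longrightarrow> v \<in> L x \<Longrightarrow> act V f v \<in> L y"
  using assms unfolding subm_def by blast+

lemma sub_cmod_simps [simp]:
  "fib (sub_cmod V L) x = (fib V x)\<lparr>carrier := L x\<rparr>" "act (sub_cmod V L) = act V"
  by (simp_all add: sub_cmod_def)

text \<open>Arrows act on generators only. An induction over \<open>gen\<close> thus has a single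
  case about arrows, and stability under the action becomes a lemma, \<open>gen_act\<close>. Neither
  carriers nor a free cover occur, so the predicate can be transported along maps between modules of
  different element types.\<close>

inductive gen :: "'k ring \<Rightarrow> ('o, 'a) cat \<Rightarrow> ('o, 'a, 'k, 'v) cmod \<Rightarrow> ('o \<Rightarrow> 'v set) \<Rightarrow> 'o \<Rightarrow> 'v \<Rightarrow> bool"
  for k C V S where
  gen_gen: "s \<in> S n \<Longrightarrow> f \<in> Hom C n x \<Longrightarrow> gen k C V S x (act V f s)"
| gen_zero: "x \<in> Ob C \<Longrightarrow> gen k C V S x \<zero>\<^bsub>fib V x\<^esub>"
| gen_add: "gen k C V S x u \<Longrightarrow> gen k C V S x v \<Longrightarrow> gen k C V S x (u \<oplus>\<^bsub>fib V x\<^esub> v)"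
| gen_smult: "c \<in> carrier k \<Longrightarrow> gen k C V S x v \<Longrightarrow> gen k C V S x (c \<odot>\<^bsub>fib V x\<^esub> v)"

text \<open>All elements of degree less than \<open>N\<close>, not a chosen generating set: this
  family is canonical, and it grows both with \<open>N\<close> and with \<open>L\<close>.\<close>

definition below :: "('o \<Rightarrow> nat) \<Rightarrow> nat \<Rightarrow> ('o \<Rightarrow> 'v set) \<Rightarrow> 'o \<Rightarrow> 'v set" where
  "below deg N L n = {v \<in> L n. deg n < N}"

text \<open>\<open>gfd\<close> abbreviates ``generated in finite degrees''.\<close>

definition gfd :: "'k ring \<Rightarrow> ('o, 'a) cat \<Rightarrow> ('o \<Rightarrow> nat) \<Rightarrow> ('o, 'a, 'k, 'v) cmod \<Rightarrow> ('o \<Rightarrow> 'v set) \<Rightarrow> bool"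
  where "gfd k C deg V L \<longleftrightarrow> (\<exists>N. \<forall>x \<in> Ob C. \<forall>v \<in> L x. gen k C V (below deg N L) x v)"

abbreviation car :: "('o, 'a, 'k, 'v) cmod \<Rightarrow> 'o \<Rightarrow> 'v set" where
  "car V \<equiv> (\<lambda>x. carrier (fib V x))"

lemma gen_mono:
  assumes "gen k C V S x v" "\<forall>n \<in> Ob C. S n \<subseteq> T n" "category C"
  shows "gen k C V T x v"
  using assms(1)
proof induction
  case (gen_gen s n f x)
  then have "s \<in> T n" using assms(2) category_Hom_Ob(1)[OF assms(3)] by blast
  then show ?case using gen_gen.hyps(2) by (rule gen.gen_gen)
qed (rule gen.intros; assumption)+

lemma gen_subm: "gen k C V S x v \<Longrightarrow> subm k C V L \<Longrightarrow> category C \<Longrightarrow> (\<forall>n \<in> Ob C. S n \<subseteq> L n) \<Longrightarrow>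
  x \<in> Ob C \<Longrightarrow> v \<in> L x"
proof (induction rule: gen.induct)
  case (gen_gen s n f x)
  then show ?case by (meson category_Hom_Ob(1) subsetD submD(5))
qed (auto dest: submD)

text \<open>\<open>sub_cmod\<close> changes only the carriers, whereas \<open>gen\<close> refers
  only to zero, addition, scalars and the action. Generation of a submodule may therefore always be
  tested in the ambient module.\<close>

lemma gen_sub_cmod: "gen k C (sub_cmod V L) = gen k C V"
proof (intro ext iffI)
  fix S x v
  show "gen k C (sub_cmod V L) S x v \<Longrightarrow> gen k C V S x v"
    by (induction rule: gen.induct) (auto intro: gen.intros)
  show "gen k C V S x v \<Longrightarrow> gen k C (sub_cmod V L) S x v"
  proof (induction rule: gen.induct)
    case (gen_gen s n f x) then show ?case using gen.gen_gen[of s S n f C x k "sub_cmod V L"] by simp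
  next
    case (gen_zero x) then show ?case using gen.gen_zero[of x C k "sub_cmod V L" S] by simp
  next
    case (gen_add x u v) then show ?case using gen.gen_add[of k C "sub_cmod V L" S x u v] by simp
  next
    case (gen_smult c x v) then show ?case using gen.gen_smult[of c k C "sub_cmod V L" S x v] by simp
  qed
qed

lemma gfd_sub_cmod: "gfd k C deg (sub_cmod V L) M = gfd k C deg V M"
  by (simp add: gfd_def gen_sub_cmod)

lemma below_mono: "N \<le> N' \<Longrightarrow> below deg N L n \<subseteq> below deg N' L n"
  by (auto simp: below_def)

context cmod
begin

lemma subm_car: "subm k C V (car V)"
  by (auto simp: subm_def zero_closed add_closed smult_closed act_closed)

lemma submodule_fib:
  assumes "subm k C V L" "x \<in> Ob C"
  shows "submodule (L x) k (fib V x)"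
proof -
  interpret x: module k "fib V x" using fib_module assms by simp
  show ?thesis
  proof (rule x.submoduleI)
    fix a assume "a \<in> L x"
    then show "\<ominus>\<^bsub>fib V x\<^esub> a \<in> L x"
      using submD[OF assms(1)] assms(2) by (simp add: x.neg_smult)
  qed (use submD[OF assms(1)] assms(2) in auto)
qed

lemma subm_minus:
  assumes L: "subm k C V L" and x: "x \<in> Ob C" and "u \<in> L x" "v \<in> L x"
  shows "u \<ominus>\<^bsub>fib V x\<^esub> v \<in> L x"
proof -
  interpret x: module k "fib V x" by (rule fib_module[OF x])
  have "\<ominus>\<^bsub>fib V x\<^esub> v \<in> L x"
    by (rule x.submoduleE(3)[OF submodule_fib[OF L x] assms(4)])
  then show ?thesis unfolding a_minus_def by (rule submD(3)[OF L x assms(3)])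
qed

lemma cmodule_sub:
  assumes "subm k C V L"
  shows "cmodule k C (sub_cmod V L)"
proof (rule cmoduleI[OF cat])
  fix x assume "x \<in> Ob C"
  then show "module k (fib (sub_cmod V L) x)"
    using submodule.submodule_is_module[OF submodule_fib[OF assms]] fib_module by simp
next
  fix f x y assume f: "f \<in> Hom C x y"
  note o = category_Hom_Ob(1)[OF cat f]
  note c = submD(1)[OF assms o]
  show "linear_map k (fib (sub_cmod V L) x) (fib (sub_cmod V L) y) (act (sub_cmod V L) f)"
    by (rule linear_mapI)
      (simp_all add: submD(5)[OF assms f] c act_add[OF f] act_smult[OF f])
next
  fix x v assume x: "x \<in> Ob C" and "v \<in> carrier (fib (sub_cmod V L) x)"
  then show "act (sub_cmod V L) (Ident C x) v = v" using submD(1)[OF assms x] act_Ident by simp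
next
  fix f g x y z v assume fg: "f \<in> Hom C x y" "g \<in> Hom C y z" and "v \<in> carrier (fib (sub_cmod V L) x)"
  then have "v \<in> carrier (fib V x)" using submD(1)[OF assms category_Hom_Ob(1)[OF cat fg(1)]] by simp
  then show "act (sub_cmod V L) (Comp C g f) v = act (sub_cmod V L) g (act (sub_cmod V L) f v)"
    using act_Comp fg by simp
qed

lemma gen_closed: "gen k C V S x v \<Longrightarrow> (\<forall>n \<in> Ob C. S n \<subseteq> car V n) \<Longrightarrow> x \<in> Ob C \<Longrightarrow> v \<in> car V x"
  using gen_subm[OF _ subm_car cat] by blast

lemma gen_act:
  assumes "gen k C V S x v" and S: "\<forall>n \<in> Ob C. S n \<subseteq> car V n" and "f \<in> Hom C x y"
  shows "gen k C V S y (act V f v)"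
  using assms(1,3)
proof (induction arbitrary: y f rule: gen.induct)
  case (gen_gen s n g x)
  have "s \<in> car V n" using gen_gen(1) S category_Hom_Ob(1)[OF cat gen_gen(2)] by blast
  then have "act V f (act V g s) = act V (Comp C f g) s"
    by (rule act_Comp[OF gen_gen(2,3), symmetric])
  then show ?case
    using gen.gen_gen[where S=S and n=n, OF gen_gen(1) category_Comp[OF cat gen_gen(2,3)]] by simp
next
  case (gen_zero x)
  then show ?case by (simp add: act_zero gen.gen_zero category_Hom_Ob[OF cat])
next
  case (gen_add x u v)
  note o = category_Hom_Ob(1)[OF cat gen_add.prems]
  show ?case
    unfolding act_add[OF gen_add.prems gen_closed[OF gen_add.hyps(1) S o] gen_closed[OF gen_add.hyps(2) S o]]
    by (rule gen.gen_add) (use gen_add in auto)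
next
  case (gen_smult c x v)
  note o = category_Hom_Ob(1)[OF cat gen_smult.prems]
  show ?case
    unfolding act_smult[OF gen_smult.prems gen_smult.hyps(1) gen_closed[OF gen_smult.hyps(2) S o]]
    by (rule gen.gen_smult) (use gen_smult in auto)
qed

lemma gen_base:
  assumes "x \<in> Ob C" "s \<in> S x" "\<forall>n \<in> Ob C. S n \<subseteq> car V n"
  shows "gen k C V S x s"
proof -
  have "act V (Ident C x) s = s" using act_Ident[OF assms(1), of s] assms by blast
  then show ?thesis
    using gen.gen_gen[of s S x "Ident C x" C x k V, OF assms(2) category_Ident[OF cat assms(1)]] by simp
qed

lemma subm_gen:
  assumes "\<forall>n \<in> Ob C. S n \<subseteq> car V n"
  shows "subm k C V (\<lambda>x. {v. gen k C V S x v})"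
  unfolding subm_def
proof (intro conjI ballI allI subsetI; (unfold mem_Collect_eq)?)
  fix x v assume "x \<in> Ob C" "gen k C V S x v"
  then show "v \<in> car V x" using gen_closed[OF _ assms] by blast
next
  fix f x y v assume "f \<in> Hom C x y" "gen k C V S x v"
  then show "gen k C V S y (act V f v)" using gen_act[OF _ assms] by blast
qed (rule gen.intros; assumption)+

lemma gfdI:
  assumes "\<forall>n \<in> Ob C. S n \<subseteq> L n" and "\<And>n s. n \<in> Ob C \<Longrightarrow> s \<in> S n \<Longrightarrow> deg n < N"
    and "\<And>x v. x \<in> Ob C \<Longrightarrow> v \<in> L x \<Longrightarrow> gen k C V S x v"
  shows "gfd k C deg V L"
  unfolding gfd_def
proof (intro exI ballI)
  fix x v assume "x \<in> Ob C" "v \<in> L x"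
  then show "gen k C V (below deg N L) x v"
    by (intro gen_mono[OF assms(3) _ cat]) (use assms in \<open>auto simp: below_def\<close>)
qed

text \<open>A bound on generating degrees may be enlarged at will, so that several modules can share
  one bound.\<close>

lemma gfd_bound:
  assumes "gfd k C deg V L"
  obtains N where "\<And>M x v. M \<ge> N \<Longrightarrow> x \<in> Ob C \<Longrightarrow> v \<in> L x \<Longrightarrow> gen k C V (below deg M L) x v"
proof -
  from assms obtain N where N: "\<forall>x \<in> Ob C. \<forall>v \<in> L x. gen k C V (below deg N L) x v"
    by (auto simp: gfd_def)
  show thesis
  proof (rule that)
    fix M x v assume "M \<ge> N" "x \<in> Ob C" "v \<in> L x"
    then show "gen k C V (below deg M L) x v"
      by (intro gen_mono[OF N[rule_format] _ cat]) (auto intro: below_mono[THEN subsetD])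
  qed
qed

end

lemma (in cmod) gfd_cong:
  assumes "gfd k C deg V L" and eq: "\<And>x. x \<in> Ob C \<Longrightarrow> L x = M x"
  shows "gfd k C deg V M"
proof -
  from assms(1) obtain N where N: "\<forall>x \<in> Ob C. \<forall>v \<in> L x. gen k C V (below deg N L) x v"
    by (auto simp: gfd_def)
  show ?thesis
    by (rule gfdI[where N=N and S="below deg N L"]) (use N eq in \<open>auto simp: below_def\<close>)
qed

lemma (in cmod) subm_zero: "subm k C V (\<lambda>x. {\<zero>\<^bsub>fib V x\<^esub>})"
  unfolding subm_def
proof (intro conjI ballI allI)
  fix x assume x: "x \<in> Ob C"
  interpret x: module k "fib V x" by (rule fib_module[OF x])
  show "\<And>u v. u \<in> {\<zero>\<^bsub>fib V x\<^esub>} \<Longrightarrow> v \<in> {\<zero>\<^bsub>fib V x\<^esub>} \<Longrightarrow> u \<oplus>\<^bsub>fib V x\<^esub> v \<in> {\<zero>\<^bsub>fib V x\<^esub>}" by simp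
  show "\<And>c v. c \<in> carrier k \<Longrightarrow> v \<in> {\<zero>\<^bsub>fib V x\<^esub>} \<Longrightarrow> c \<odot>\<^bsub>fib V x\<^esub> v \<in> {\<zero>\<^bsub>fib V x\<^esub>}" by simp
qed (auto simp: zero_closed act_zero)

context cmod_map
begin

lemma gen_image:
  assumes "gen k C V S x v" and S: "\<forall>n \<in> Ob C. S n \<subseteq> car V n" and "x \<in> Ob C"
  shows "gen k C W (\<lambda>n. \<phi> n ` S n) x (\<phi> x v)"
  using assms(1,3)
proof (induction rule: gen.induct)
  case (gen_gen s n f x)
  have s: "s \<in> car V n" using gen_gen(1) S category_Hom_Ob(1)[OF V.cat gen_gen(2)] by blast
  show ?case
    unfolding map_act[OF gen_gen(2) s] by (rule gen.gen_gen[where S="\<lambda>n. \<phi> n ` S n" and n=n, OF _ gen_gen(2)]) (use gen_gen(1) in blast)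
next
  case (gen_zero x) then show ?case by (simp add: map_zero gen.gen_zero)
next
  case (gen_add x u v)
  note o = gen_add.prems
  show ?case
    unfolding map_add[OF o V.gen_closed[OF gen_add.hyps(1) S o] V.gen_closed[OF gen_add.hyps(2) S o]]
    by (rule gen.gen_add) (use gen_add in auto)
next
  case (gen_smult c x v)
  note o = gen_smult.prems
  show ?case
    unfolding map_smult[OF o gen_smult.hyps(1) V.gen_closed[OF gen_smult.hyps(2) S o]]
    by (rule gen.gen_smult) (use gen_smult in auto)
qed

lemma gfd_image:
  assumes "gfd k C deg V L" "\<forall>n \<in> Ob C. L n \<subseteq> car V n"
    and "\<And>x. x \<in> Ob C \<Longrightarrow> M x = \<phi> x ` L x"
  shows "gfd k C deg W M"
proof -
  obtain N where N: "\<And>M x v. M \<ge> N \<Longrightarrow> x \<in> Ob C \<Longrightarrow> v \<in> L x \<Longrightarrow> gen k C V (below deg M L) x v"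
    using V.gfd_bound[OF assms(1)] by blast
  show ?thesis
  proof (rule W.gfdI[where N=N and S="\<lambda>n. \<phi> n ` below deg N L n"])
    fix x w assume x: "x \<in> Ob C" "w \<in> M x"
    then obtain v where v: "v \<in> L x" "w = \<phi> x v" using assms(3) by auto
    show "gen k C W (\<lambda>n. \<phi> n ` below deg N L n) x w"
      unfolding v(2) by (rule gen_image[OF N]) (use x v assms(2) in \<open>auto simp: below_def\<close>)
  qed (use assms(3) in \<open>auto simp: below_def\<close>)
qed

text \<open>The combination expressing \<open>\<phi> x v\<close> through images of generators lifts,
  generator by generator, to some \<open>u\<close> in \<open>L\<close> generated by
  \<open>S\<close>. The difference of \<open>v\<close> and \<open>u\<close> lies in \<open>L\<close>
  and in the kernel of \<open>\<phi>\<close>, where generation is assumed.\<close>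

lemma gen_extension:
  assumes L: "subm k C V L" and S: "\<forall>n \<in> Ob C. S n \<subseteq> L n"
    and K: "\<And>x v. x \<in> Ob C \<Longrightarrow> v \<in> L x \<Longrightarrow> \<phi> x v = \<zero>\<^bsub>fib W x\<^esub> \<Longrightarrow> gen k C V S x v"
    and M: "\<And>x v. x \<in> Ob C \<Longrightarrow> v \<in> L x \<Longrightarrow> gen k C W (\<lambda>n. \<phi> n ` S n) x (\<phi> x v)"
    and x: "x \<in> Ob C" and v: "v \<in> L x"
  shows "gen k C V S x v"
proof -
  have lift: "\<exists>v \<in> L x. gen k C V S x v \<and> \<phi> x v = w" if "gen k C W (\<lambda>n. \<phi> n ` S n) x w" "x \<in> Ob C" for x w
    using that
  proof (induction rule: gen.induct)
    case (gen_gen s n f x)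
    note o = category_Hom_Ob[OF V.cat gen_gen(2)]
    obtain v where v: "v \<in> S n" "\<phi> n v = s" using gen_gen(1) by auto
    then have "v \<in> L n" using S o by auto
    then show ?case
      using gen.gen_gen[of v S n f C x k V] gen_gen map_act[of f n x v] v submD[OF L] o
      by (intro bexI[of _ "act V f v"]) auto
  next
    case (gen_zero x) then show ?case
      using map_zero submD(2)[OF L] by (intro bexI[of _ "\<zero>\<^bsub>fib V x\<^esub>"]) (auto intro: gen.gen_zero)
  next
    case (gen_add x a b)
    then obtain u v where "u \<in> L x" "gen k C V S x u" "\<phi> x u = a" "v \<in> L x" "gen k C V S x v" "\<phi> x v = b" by blast
    then show ?case
      using map_add[of x u v] submD(1,3)[OF L] gen_add.prems
      by (intro bexI[of _ "u \<oplus>\<^bsub>fib V x\<^esub> v"]) (auto intro: gen.gen_add)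
  next
    case (gen_smult c x a)
    then obtain u where "u \<in> L x" "gen k C V S x u" "\<phi> x u = a" by blast
    then show ?case
      using map_smult[of x c u] submD(1,4)[OF L] gen_smult
      by (intro bexI[of _ "c \<odot>\<^bsub>fib V x\<^esub> u"]) (auto intro: gen.gen_smult)
  qed
  interpret x: module k "fib V x" using V.fib_module[OF x] .
  interpret x': module k "fib W x" using W.fib_module[OF x] .
  obtain u where u: "u \<in> L x" "gen k C V S x u" "\<phi> x u = \<phi> x v" using lift[OF M[OF x v] x] by blast
  note c = submD(1)[OF L x v] submD(1)[OF L x u(1)]
  have "gen k C V S x (v \<ominus>\<^bsub>fib V x\<^esub> u)"
    using map_minus[OF x c] u(3) map_closed[OF x c(1)]
    by (intro K[OF x] V.subm_minus[OF L x v u(1)]) (simp add: x'.r_neg a_minus_def)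
  then have "gen k C V S x ((v \<ominus>\<^bsub>fib V x\<^esub> u) \<oplus>\<^bsub>fib V x\<^esub> u)"
    using u(2) by (rule gen.gen_add)
  moreover have "(v \<ominus>\<^bsub>fib V x\<^esub> u) \<oplus>\<^bsub>fib V x\<^esub> u = v"
    using c by (simp add: a_minus_def x.M.add.m_assoc x.l_neg)
  ultimately show ?thesis by simp
qed

text \<open>The outer terms of the exact sequence formed by \<open>K\<close>, \<open>L\<close> and
  \<open>M\<close> control the middle one. The larger of the two bounds serves, because an element
  of \<open>M\<close> lifts to an element of \<open>L\<close> at the same object, hence of the same
  degree.\<close>

lemma gfd_extension:
  assumes K: "gfd k C deg V K" and Kdef: "\<And>x. x \<in> Ob C \<Longrightarrow> K x = {v \<in> L x. \<phi> x v = \<zero>\<^bsub>fib W x\<^esub>}"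
    and L: "subm k C V L" and M: "gfd k C deg W M" and LM: "\<And>x. x \<in> Ob C \<Longrightarrow> \<phi> x ` L x = M x"
  shows "gfd k C deg V L"
proof -
  obtain N1 where N1: "\<And>M x v. M \<ge> N1 \<Longrightarrow> x \<in> Ob C \<Longrightarrow> v \<in> K x \<Longrightarrow> gen k C V (below deg M K) x v"
    using V.gfd_bound[OF K] by blast
  obtain N2 where N2: "\<And>N x v. N \<ge> N2 \<Longrightarrow> x \<in> Ob C \<Longrightarrow> v \<in> M x \<Longrightarrow> gen k C W (below deg N M) x v"
    using W.gfd_bound[OF M] by blast
  define N where "N = max N1 N2"
  show ?thesis
  proof (rule V.gfdI[where N=N and S="below deg N L"])
    fix x v assume x: "x \<in> Ob C" and v: "v \<in> L x"
    show "gen k C V (below deg N L) x v"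
    proof (rule gen_extension[OF L _ _ _ x v])
      show "\<forall>n \<in> Ob C. below deg N L n \<subseteq> L n" by (auto simp: below_def)
    next
      fix x v assume x: "x \<in> Ob C" and "v \<in> L x" "\<phi> x v = \<zero>\<^bsub>fib W x\<^esub>"
      then have "gen k C V (below deg N K) x v" using Kdef by (intro N1) (auto simp: N_def)
      then show "gen k C V (below deg N L) x v"
        by (rule gen_mono) (use Kdef V.cat in \<open>auto simp: below_def\<close>)
    next
      fix x v assume x: "x \<in> Ob C" and "v \<in> L x"
      then have "gen k C W (below deg N M) x (\<phi> x v)" using LM[OF x] by (intro N2) (auto simp: N_def)
      then show "gen k C W (\<lambda>n. \<phi> n ` below deg N L n) x (\<phi> x v)"
        by (rule gen_mono) (use LM[symmetric] V.cat in \<open>auto simp: below_def\<close>)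
    qed
  qed (auto simp: below_def)
qed

lemma subm_kernel: "subm k C V (\<lambda>x. {v \<in> car V x. \<phi> x v = \<zero>\<^bsub>fib W x\<^esub>})"
  unfolding subm_def
proof (intro conjI ballI allI)
  fix x assume x: "x \<in> Ob C"
  interpret x': module k "fib W x" using W.fib_module[OF x] .
  show "\<And>u v. u \<in> {v \<in> car V x. \<phi> x v = \<zero>\<^bsub>fib W x\<^esub>} \<Longrightarrow> v \<in> {v \<in> car V x. \<phi> x v = \<zero>\<^bsub>fib W x\<^esub>}
    \<Longrightarrow> u \<oplus>\<^bsub>fib V x\<^esub> v \<in> {v \<in> car V x. \<phi> x v = \<zero>\<^bsub>fib W x\<^esub>}"
    using x by (simp add: map_add V.add_closed)
  show "\<And>c v. c \<in> carrier k \<Longrightarrow> v \<in> {v \<in> car V x. \<phi> x v = \<zero>\<^bsub>fib W x\<^esub>}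
    \<Longrightarrow> c \<odot>\<^bsub>fib V x\<^esub> v \<in> {v \<in> car V x. \<phi> x v = \<zero>\<^bsub>fib W x\<^esub>}"
    using x by (simp add: map_smult V.smult_closed)
next
  fix x y f v assume "f \<in> Hom C x y" "v \<in> {v \<in> car V x. \<phi> x v = \<zero>\<^bsub>fib W x\<^esub>}"
  then show "act V f v \<in> {v \<in> car V y. \<phi> y v = \<zero>\<^bsub>fib W y\<^esub>}"
    using map_act[of f x y v] V.act_closed W.act_zero by auto
qed (auto simp: map_zero V.zero_closed)

end

subsection \<open>Pullbacks, products and images\<close>

lemma pullback_simps [simp]:
  "fib (pullback_cmod Fo Fa V) x = fib V (Fo x)" "act (pullback_cmod Fo Fa V) f = act V (Fa f)"
  by (simp_all add: pullback_cmod_def)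

lemma cmodule_pullback:
  assumes "category C" "category D" "is_functor C D Fo Fa" "cmodule k D V"
  shows "cmodule k C (pullback_cmod Fo Fa V)"
proof -
  interpret V: cmod k D V using assms by unfold_locales
  show ?thesis
  proof (rule cmoduleI[OF assms(1)])
    fix x assume "x \<in> Ob C"
    then show "module k (fib (pullback_cmod Fo Fa V) x)"
      using V.fib_module functor_Ob[OF assms(3)] by simp
    show "act (pullback_cmod Fo Fa V) (Ident C x) v = v" if "v \<in> car (pullback_cmod Fo Fa V) x" for v
      using V.act_Ident functor_Ob[OF assms(3) \<open>x \<in> Ob C\<close>] functor_Ident[OF assms(3) \<open>x \<in> Ob C\<close>] that by simp
  next
    fix f x y assume f: "f \<in> Hom C x y"
    show "linear_map k (fib (pullback_cmod Fo Fa V) x) (fib (pullback_cmod Fo Fa V) y)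
      (act (pullback_cmod Fo Fa V) f)"
      using V.act_linear[OF functor_Hom[OF assms(3) f]] by (simp add: pullback_cmod_def)
  next
    fix f g x y z v assume f: "f \<in> Hom C x y" "g \<in> Hom C y z" and v: "v \<in> car (pullback_cmod Fo Fa V) x"
    then show "act (pullback_cmod Fo Fa V) (Comp C g f) v
      = act (pullback_cmod Fo Fa V) g (act (pullback_cmod Fo Fa V) f v)"
      using V.act_Comp[OF functor_Hom[OF assms(3) f(1)] functor_Hom[OF assms(3) f(2)]]
        functor_Comp[OF assms(3) f] by simp
  qed
qed

lemma cmod_hom_pullback:
  assumes "category C" "is_functor C D Fo Fa" "cmod_hom k D V W \<phi>"
  shows "cmod_hom k C (pullback_cmod Fo Fa V) (pullback_cmod Fo Fa W) (\<lambda>x. \<phi> (Fo x))"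
proof (rule cmod_homI)
  fix x assume "x \<in> Ob C"
  then show "linear_map k (fib (pullback_cmod Fo Fa V) x) (fib (pullback_cmod Fo Fa W) x) (\<phi> (Fo x))"
    using assms(3) functor_Ob[OF assms(2)] by (simp add: cmod_hom_def)
next
  fix f x y v assume f: "f \<in> Hom C x y" and "v \<in> car (pullback_cmod Fo Fa V) x"
  then show "\<phi> (Fo y) (act (pullback_cmod Fo Fa V) f v) = act (pullback_cmod Fo Fa W) f (\<phi> (Fo x) v)"
    using assms(3) HomD[OF functor_Hom[OF assms(2) f]] by (auto simp: cmod_hom_def)
qed

definition prod_cmod :: "('o, 'a, 'k, 'v) cmod \<Rightarrow> ('o, 'a, 'k, 'w) cmod \<Rightarrow> ('o, 'a, 'k, 'v \<times> 'w) cmod" where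
  "prod_cmod V W =
     \<lparr> fib = (\<lambda>x.
         \<lparr> carrier = carrier (fib V x) \<times> carrier (fib W x), mult = undefined, one = undefined,
           zero = (\<zero>\<^bsub>fib V x\<^esub>, \<zero>\<^bsub>fib W x\<^esub>),
           add = (\<lambda>a b. (fst a \<oplus>\<^bsub>fib V x\<^esub> fst b, snd a \<oplus>\<^bsub>fib W x\<^esub> snd b)),
           smult = (\<lambda>c a. (c \<odot>\<^bsub>fib V x\<^esub> fst a, c \<odot>\<^bsub>fib W x\<^esub> snd a)) \<rparr>),
       act = (\<lambda>f a. (act V f (fst a), act W f (snd a))) \<rparr>"

lemma prod_cmod_simps [simp]:
  "carrier (fib (prod_cmod V W) x) = carrier (fib V x) \<times> carrier (fib W x)"
  "\<zero>\<^bsub>fib (prod_cmod V W) x\<^esub> = (\<zero>\<^bsub>fib V x\<^esub>, \<zero>\<^bsub>fib W x\<^esub>)"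
  "a \<oplus>\<^bsub>fib (prod_cmod V W) x\<^esub> b = (fst a \<oplus>\<^bsub>fib V x\<^esub> fst b, snd a \<oplus>\<^bsub>fib W x\<^esub> snd b)"
  "c \<odot>\<^bsub>fib (prod_cmod V W) x\<^esub> a = (c \<odot>\<^bsub>fib V x\<^esub> fst a, c \<odot>\<^bsub>fib W x\<^esub> snd a)"
  "act (prod_cmod V W) f a = (act V f (fst a), act W f (snd a))"
  by (simp_all add: prod_cmod_def)

lemma cmodule_prod:
  assumes "category C" "cmodule k C V" "cmodule k C W"
  shows "cmodule k C (prod_cmod V W)"
proof -
  interpret V: cmod k C V using assms by unfold_locales
  interpret W: cmod k C W using assms by unfold_locales
  show ?thesis
  proof (rule cmoduleI[OF assms(1)])
    fix x assume x: "x \<in> Ob C"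
    interpret v: module k "fib V x" by (rule V.fib_module[OF x])
    interpret w: module k "fib W x" by (rule W.fib_module[OF x])
    show "module k (fib (prod_cmod V W) x)"
    proof (rule moduleI)
      show "cring k" by (rule V.cring_k[OF x])
      show "abelian_group (fib (prod_cmod V W) x)"
      proof (rule abelian_groupI)
        fix a assume "a \<in> car (prod_cmod V W) x"
        then show "\<exists>b \<in> car (prod_cmod V W) x. b \<oplus>\<^bsub>fib (prod_cmod V W) x\<^esub> a = \<zero>\<^bsub>fib (prod_cmod V W) x\<^esub>"
          by (intro bexI[of _ "(\<ominus>\<^bsub>fib V x\<^esub> fst a, \<ominus>\<^bsub>fib W x\<^esub> snd a)"]) (auto simp: v.l_neg w.l_neg)
      qed (auto simp: v.M.a_ac w.M.a_ac)
    qed (auto simp: v.smult_l_distr w.smult_l_distr v.smult_r_distr w.smult_r_distr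
        v.smult_assoc1 w.smult_assoc1)
  next
    fix f x y assume f: "f \<in> Hom C x y"
    show "linear_map k (fib (prod_cmod V W) x) (fib (prod_cmod V W) y) (act (prod_cmod V W) f)"
      by (rule linear_mapI)
        (auto simp: V.act_add[OF f] W.act_add[OF f] V.act_smult[OF f] W.act_smult[OF f]
          V.act_closed[OF f] W.act_closed[OF f])
  next
    fix f g x y z v assume f: "f \<in> Hom C x y" "g \<in> Hom C y z" "v \<in> car (prod_cmod V W) x"
    then show "act (prod_cmod V W) (Comp C g f) v = act (prod_cmod V W) g (act (prod_cmod V W) f v)"
      using V.act_Comp[OF f(1,2)] W.act_Comp[OF f(1,2)] by auto
  qed (auto simp: V.act_Ident W.act_Ident)
qed

lemma prod_cmod_fst: "cmod_hom k C (prod_cmod V W) V (\<lambda>x. fst)"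
  by (rule cmod_homI) (auto intro!: linear_mapI)

lemma prod_cmod_snd: "cmod_hom k C (prod_cmod V W) W (\<lambda>x. snd)"
  by (rule cmod_homI) (auto intro!: linear_mapI)

lemma cmod_hom_sub:
  assumes "subm k C V L" "cmod_hom k C V W \<phi>" "category C"
  shows "cmod_hom k C (sub_cmod V L) W \<phi>"
proof (rule cmod_homI)
  fix x assume x: "x \<in> Ob C"
  have l: "linear_map k (fib V x) (fib W x) (\<phi> x)" using assms(2) x by (auto simp: cmod_hom_def)
  show "linear_map k (fib (sub_cmod V L) x) (fib W x) (\<phi> x)"
    by (rule linear_mapI)
      (simp_all add: linear_map_closed[OF l] linear_map_add[OF l] linear_map_smult[OF l] submD(1)[OF assms(1) x])
next
  fix f x y v assume f: "f \<in> Hom C x y" "v \<in> car (sub_cmod V L) x"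
  then show "\<phi> y (act (sub_cmod V L) f v) = act W f (\<phi> x v)"
    using assms(2) submD(1)[OF assms(1) category_Hom_Ob(1)[OF assms(3) f(1)]]
    by (auto simp: cmod_hom_def Hom_def)
qed

text \<open>Serves to realise quotients and products on a prescribed element type.\<close>

definition img_cmod ::
  "('o, 'a) cat \<Rightarrow> ('o, 'a, 'k, 'w) cmod \<Rightarrow> ('o \<Rightarrow> 'w \<Rightarrow> 'v) \<Rightarrow> ('o, 'a, 'k, 'v) cmod" where
  "img_cmod C V r =
     (let s = (\<lambda>x. inv_into (carrier (fib V x)) (r x)) in
     \<lparr> fib = (\<lambda>x.
         \<lparr> carrier = r x ` carrier (fib V x), mult = undefined, one = undefined,
           zero = r x \<zero>\<^bsub>fib V x\<^esub>,
           add = (\<lambda>a b. r x (s x a \<oplus>\<^bsub>fib V x\<^esub> s x b)),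
           smult = (\<lambda>c a. r x (c \<odot>\<^bsub>fib V x\<^esub> s x a)) \<rparr>),
       act = (\<lambda>f a. r (Cod C f) (act V f (s (Dom C f) a))) \<rparr>)"

text \<open>The fibres of \<open>r\<close> are the cosets of the submodule \<open>A\<close>, so the
  image of \<open>r\<close> is a copy of the quotient by \<open>A\<close> on the target type of
  \<open>r\<close>. Two cases matter: an injective \<open>r\<close> with \<open>A\<close> zero,
  which moves a module to another type, and an \<open>r\<close> that picks a representative of each
  coset.\<close>

locale cmod_congruence = cmod k C V
  for k :: "'k ring" and C :: "('o, 'a) cat" and V :: "('o, 'a, 'k, 'w) cmod" +
  fixes r :: "'o \<Rightarrow> 'w \<Rightarrow> 'v" and A :: "'o \<Rightarrow> 'w set"
  assumes A: "subm k C V A"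
    and r: "x \<in> Ob C \<Longrightarrow> u \<in> carrier (fib V x) \<Longrightarrow> v \<in> carrier (fib V x)
      \<Longrightarrow> r x u = r x v \<longleftrightarrow> u \<ominus>\<^bsub>fib V x\<^esub> v \<in> A x"
begin

abbreviation "img \<equiv> img_cmod C V r"
abbreviation "sec x \<equiv> inv_into (carrier (fib V x)) (r x)"

lemma sec_closed: "v \<in> carrier (fib V x) \<Longrightarrow> sec x (r x v) \<in> carrier (fib V x)"
  by (simp add: inv_into_into)

lemma r_sec: "v \<in> carrier (fib V x) \<Longrightarrow> r x (sec x (r x v)) = r x v"
  by (simp add: f_inv_into_f)

lemma r_add:
  assumes x: "x \<in> Ob C" and c: "u \<in> car V x" "u' \<in> car V x" "v \<in> car V x" "v' \<in> car V x"
    and "r x u = r x u'" "r x v = r x v'"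
  shows "r x (u \<oplus>\<^bsub>fib V x\<^esub> v) = r x (u' \<oplus>\<^bsub>fib V x\<^esub> v')"
proof -
  interpret x: module k "fib V x" by (rule fib_module[OF x])
  have "(u \<ominus>\<^bsub>fib V x\<^esub> u') \<oplus>\<^bsub>fib V x\<^esub> (v \<ominus>\<^bsub>fib V x\<^esub> v') \<in> A x"
    by (rule submD(3)[OF A x]) (use assms r in auto)
  also have "(u \<ominus>\<^bsub>fib V x\<^esub> u') \<oplus>\<^bsub>fib V x\<^esub> (v \<ominus>\<^bsub>fib V x\<^esub> v')
      = (u \<oplus>\<^bsub>fib V x\<^esub> v) \<ominus>\<^bsub>fib V x\<^esub> (u' \<oplus>\<^bsub>fib V x\<^esub> v')"
    using c by (simp add: a_minus_def x.M.a_ac x.M.minus_add)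
  finally show ?thesis using c by (simp add: r[OF x])
qed

lemma r_smult:
  assumes x: "x \<in> Ob C" and c: "c \<in> carrier k" "u \<in> car V x" "u' \<in> car V x" and "r x u = r x u'"
  shows "r x (c \<odot>\<^bsub>fib V x\<^esub> u) = r x (c \<odot>\<^bsub>fib V x\<^esub> u')"
proof -
  interpret x: module k "fib V x" by (rule fib_module[OF x])
  have "c \<odot>\<^bsub>fib V x\<^esub> (u \<ominus>\<^bsub>fib V x\<^esub> u') \<in> A x"
    by (rule submD(4)[OF A x]) (use assms r in auto)
  also have "c \<odot>\<^bsub>fib V x\<^esub> (u \<ominus>\<^bsub>fib V x\<^esub> u') = c \<odot>\<^bsub>fib V x\<^esub> u \<ominus>\<^bsub>fib V x\<^esub> c \<odot>\<^bsub>fib V x\<^esub> u'"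
    using c by (simp add: a_minus_def x.smult_r_distr x.smult_r_minus)
  finally show ?thesis using c by (simp add: r[OF x])
qed

lemma r_act:
  assumes f: "f \<in> Hom C x y" and c: "u \<in> car V x" "u' \<in> car V x" and "r x u = r x u'"
  shows "r y (act V f u) = r y (act V f u')"
proof -
  note o = category_Hom_Ob[OF cat f]
  have "act V f (u \<ominus>\<^bsub>fib V x\<^esub> u') \<in> A y"
    by (rule submD(5)[OF A f]) (use assms r o in auto)
  then show ?thesis using c by (simp add: act_minus[OF f] r[OF o(2)] act_closed[OF f])
qed

lemma img_simps:
  "carrier (fib img x) = r x ` carrier (fib V x)"
  "\<zero>\<^bsub>fib img x\<^esub> = r x \<zero>\<^bsub>fib V x\<^esub>"
  "x \<in> Ob C \<Longrightarrow> u \<in> carrier (fib V x) \<Longrightarrow> v \<in> carrier (fib V x)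
    \<Longrightarrow> r x u \<oplus>\<^bsub>fib img x\<^esub> r x v = r x (u \<oplus>\<^bsub>fib V x\<^esub> v)"
  "x \<in> Ob C \<Longrightarrow> c \<in> carrier k \<Longrightarrow> u \<in> carrier (fib V x)
    \<Longrightarrow> c \<odot>\<^bsub>fib img x\<^esub> r x u = r x (c \<odot>\<^bsub>fib V x\<^esub> u)"
  "f \<in> Hom C x y \<Longrightarrow> u \<in> carrier (fib V x) \<Longrightarrow> act img f (r x u) = r y (act V f u)"
proof -
  show "x \<in> Ob C \<Longrightarrow> u \<in> carrier (fib V x) \<Longrightarrow> v \<in> carrier (fib V x)
    \<Longrightarrow> r x u \<oplus>\<^bsub>fib img x\<^esub> r x v = r x (u \<oplus>\<^bsub>fib V x\<^esub> v)"
    using r_add[of x "sec x (r x u)" u "sec x (r x v)" v] sec_closed r_sec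
    by (simp add: img_cmod_def Let_def)
  show "x \<in> Ob C \<Longrightarrow> c \<in> carrier k \<Longrightarrow> u \<in> carrier (fib V x)
    \<Longrightarrow> c \<odot>\<^bsub>fib img x\<^esub> r x u = r x (c \<odot>\<^bsub>fib V x\<^esub> u)"
    using r_smult[of x c "sec x (r x u)" u] sec_closed r_sec by (simp add: img_cmod_def Let_def)
  show "f \<in> Hom C x y \<Longrightarrow> u \<in> carrier (fib V x) \<Longrightarrow> act img f (r x u) = r y (act V f u)"
    using r_act[of f x y "sec x (r x u)" u] sec_closed r_sec HomD[of f C x y]
    by (simp add: img_cmod_def Let_def)
qed (simp_all add: img_cmod_def Let_def)

lemma cmodule_img: "cmodule k C img"
proof (rule cmoduleI[OF cat])
  fix x assume x: "x \<in> Ob C"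
  interpret x: module k "fib V x" by (rule fib_module[OF x])
  note s = img_simps(1-2) img_simps(3,4)[OF x]
  show "module k (fib img x)"
  proof (rule moduleI)
    show "cring k" by (rule cring_k[OF x])
    show "abelian_group (fib img x)"
    proof (rule abelian_groupI)
      fix a assume "a \<in> car img x"
      then obtain v where "a = r x v" "v \<in> car V x" by (auto simp: s)
      then show "\<exists>b \<in> car img x. b \<oplus>\<^bsub>fib img x\<^esub> a = \<zero>\<^bsub>fib img x\<^esub>"
        by (intro bexI[of _ "r x (\<ominus>\<^bsub>fib V x\<^esub> v)"]) (auto simp: s x.l_neg)
    qed (auto simp: s x.M.add.m_assoc, auto simp: x.M.a_comm)
  qed (auto simp: s x.smult_l_distr x.smult_r_distr x.smult_assoc1)
next
  fix f x y assume f: "f \<in> Hom C x y"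
  note o = category_Hom_Ob[OF cat f]
  show "linear_map k (fib img x) (fib img y) (act img f)"
    by (rule linear_mapI)
      (auto simp: img_simps(1-2) img_simps(3,4)[OF o(1)] img_simps(3,4)[OF o(2)] img_simps(5)[OF f]
        act_closed[OF f] act_add[OF f] act_smult[OF f] add_closed[OF o(1)] smult_closed[OF o(1)])
next
  fix f g x y z v assume f: "f \<in> Hom C x y" "g \<in> Hom C y z" and "v \<in> car img x"
  then show "act img (Comp C g f) v = act img g (act img f v)"
    by (auto simp: img_simps(1) img_simps(5)[OF f(1)] img_simps(5)[OF f(2)]
        img_simps(5)[OF category_Comp[OF cat f]] act_closed[OF f(1)] act_Comp[OF f])
next
  fix x v assume x: "x \<in> Ob C" "v \<in> car img x"
  then show "act img (Ident C x) v = v"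
    by (auto simp: img_simps(1) img_simps(5)[OF category_Ident[OF cat x(1)]] act_Ident)
qed

lemma hom_img: "cmod_hom k C V img r"
  by (rule cmod_homI) (auto intro!: linear_mapI simp: img_simps)

lemma img_ker: "x \<in> Ob C \<Longrightarrow> v \<in> car V x \<Longrightarrow> r x v = \<zero>\<^bsub>fib img x\<^esub> \<longleftrightarrow> v \<in> A x"
proof -
  assume x: "x \<in> Ob C" and v: "v \<in> car V x"
  interpret x: module k "fib V x" by (rule fib_module[OF x])
  have "\<ominus>\<^bsub>fib V x\<^esub> \<zero>\<^bsub>fib V x\<^esub> = \<zero>\<^bsub>fib V x\<^esub>"
    by (rule x.M.minus_equality) simp_all
  then have "v \<ominus>\<^bsub>fib V x\<^esub> \<zero>\<^bsub>fib V x\<^esub> = v"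
    unfolding a_minus_def by (metis v x.M.r_zero)
  then show ?thesis using r[OF x v zero_closed[OF x]] unfolding img_simps(2) by metis
qed

text \<open>The universal property of the quotient by \<open>A\<close>. The representative returned
  by \<open>sec\<close> is arbitrary, but it differs from \<open>v\<close> by an element of
  \<open>A\<close>, which \<open>g\<close> kills.\<close>

lemma img_lift:
  assumes W: "cmodule k C W" and g: "cmod_hom k C V W g"
    and A0: "\<And>x a. x \<in> Ob C \<Longrightarrow> a \<in> A x \<Longrightarrow> g x a = \<zero>\<^bsub>fib W x\<^esub>"
  shows "\<And>x v. x \<in> Ob C \<Longrightarrow> v \<in> car V x \<Longrightarrow> g x (sec x (r x v)) = g x v"
    and "cmod_hom k C img W (\<lambda>x a. g x (sec x a))"
proof -
  interpret g: cmod_map k C V W g using W g cat cm by unfold_locales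
  show eq: "g x (sec x (r x v)) = g x v" if x: "x \<in> Ob C" and v: "v \<in> car V x" for x v
  proof -
    interpret w: module k "fib W x" by (rule g.W.fib_module[OF x])
    let ?s = "sec x (r x v)"
    have s: "?s \<in> car V x" by (rule sec_closed[OF v])
    have "?s \<ominus>\<^bsub>fib V x\<^esub> v \<in> A x" using r[OF x s v] r_sec[OF v] by simp
    then have "g x ?s \<ominus>\<^bsub>fib W x\<^esub> g x v = \<zero>\<^bsub>fib W x\<^esub>"
      using A0[OF x] by (simp add: g.map_minus[OF x s v, symmetric])
    then show ?thesis
      using g.map_closed[OF x s] g.map_closed[OF x v] by (simp add: w.M.minus_eq_zero_iff)
  qed
  show "cmod_hom k C img W (\<lambda>x a. g x (sec x a))"
  proof (rule cmod_homI)
    fix x assume x: "x \<in> Ob C"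
    show "linear_map k (fib img x) (fib W x) (\<lambda>a. g x (sec x a))"
      by (rule linear_mapI)
        (auto simp: img_simps(1) img_simps(3,4)[OF x] eq[OF x] add_closed[OF x] smult_closed[OF x]
          g.map_closed[OF x] g.map_add[OF x] g.map_smult[OF x])
  next
    fix f x y a assume f: "f \<in> Hom C x y" and a: "a \<in> car img x"
    note o = category_Hom_Ob[OF cat f]
    from a obtain v where "a = r x v" "v \<in> car V x" by (auto simp: img_simps(1))
    then show "g y (sec y (act img f a)) = act W f (g x (sec x a))"
      by (simp add: img_simps(5)[OF f] eq[OF o(1)] eq[OF o(2)] act_closed[OF f] g.map_act[OF f])
  qed
qed

end

section \<open>Free modules\<close>

subsection \<open>Finitely supported families\<close>

text \<open>The direct sum of a family of \<open>k\<close>-modules. Fibres of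
  \<open>direct_sum\<close> and of \<open>free_cmod\<close> both have this form, the latter with all
  summands equal to \<open>k\<close>, so that linear algebra is done only once.\<close>

definition fsum :: "'j set \<Rightarrow> ('j \<Rightarrow> ('k, 'v) module) \<Rightarrow> ('k, 'j \<Rightarrow> 'v) module" where
  "fsum X M =
     \<lparr> carrier = {a \<in> (\<Pi>\<^sub>E j\<in>X. carrier (M j)). finite {j \<in> X. a j \<noteq> \<zero>\<^bsub>M j\<^esub>}},
       mult = undefined, one = undefined,
       zero = (\<lambda>j\<in>X. \<zero>\<^bsub>M j\<^esub>),
       add = (\<lambda>a b. \<lambda>j\<in>X. a j \<oplus>\<^bsub>M j\<^esub> b j),
       smult = (\<lambda>c a. \<lambda>j\<in>X. c \<odot>\<^bsub>M j\<^esub> a j) \<rparr>"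

definition inc :: "'j set \<Rightarrow> ('j \<Rightarrow> ('k, 'v) module) \<Rightarrow> 'j \<Rightarrow> 'v \<Rightarrow> 'j \<Rightarrow> 'v" where
  "inc X M j m = (\<lambda>i\<in>X. if i = j then m else \<zero>\<^bsub>M i\<^esub>)"

text \<open>The map out of a direct sum given by maps on the summands. The sum runs over the support
  of \<open>a\<close> because \<open>finsum\<close> over an infinite index set takes a default
  value.\<close>

definition fext :: "'j set \<Rightarrow> ('j \<Rightarrow> ('k, 'v) module) \<Rightarrow> ('k, 'w) module \<Rightarrow> ('j \<Rightarrow> 'v \<Rightarrow> 'w) \<Rightarrow> ('j \<Rightarrow> 'v) \<Rightarrow> 'w"
  where "fext X M N \<phi> a = (\<Oplus>\<^bsub>N\<^esub>j\<in>{j \<in> X. a j \<noteq> \<zero>\<^bsub>M j\<^esub>}. \<phi> j (a j))"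

lemma fsum_simps:
  "carrier (fsum X M) = {a \<in> (\<Pi>\<^sub>E j\<in>X. carrier (M j)). finite {j \<in> X. a j \<noteq> \<zero>\<^bsub>M j\<^esub>}}"
  "\<zero>\<^bsub>fsum X M\<^esub> = (\<lambda>j\<in>X. \<zero>\<^bsub>M j\<^esub>)"
  "a \<oplus>\<^bsub>fsum X M\<^esub> b = (\<lambda>j\<in>X. a j \<oplus>\<^bsub>M j\<^esub> b j)"
  "c \<odot>\<^bsub>fsum X M\<^esub> a = (\<lambda>j\<in>X. c \<odot>\<^bsub>M j\<^esub> a j)"
  by (simp_all add: fsum_def)

locale fsum_module =
  fixes k :: "'k ring" and X :: "'j set" and M :: "'j \<Rightarrow> ('k, 'v) module"
  assumes k: "cring k" and M: "\<And>j. j \<in> X \<Longrightarrow> module k (M j)"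
begin

lemma M_ag: "j \<in> X \<Longrightarrow> abelian_group (M j)"
  using M by (simp add: module_def)

lemma fsum_closed: "a \<in> carrier (fsum X M) \<Longrightarrow> j \<in> X \<Longrightarrow> a j \<in> carrier (M j)"
  by (auto simp: fsum_simps)

lemma fsum_ext: "a \<in> carrier (fsum X M) \<Longrightarrow> b \<in> carrier (fsum X M) \<Longrightarrow> (\<And>j. j \<in> X \<Longrightarrow> a j = b j) \<Longrightarrow> a = b"
  by (auto simp: fsum_simps intro: PiE_ext)

lemma add_carrier:
  assumes "a \<in> carrier (fsum X M)" "b \<in> carrier (fsum X M)"
  shows "a \<oplus>\<^bsub>fsum X M\<^esub> b \<in> carrier (fsum X M)"
proof -
  have "finite {j \<in> X. (a \<oplus>\<^bsub>fsum X M\<^esub> b) j \<noteq> \<zero>\<^bsub>M j\<^esub>}"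
  proof (rule finite_subset)
    show "{j \<in> X. (a \<oplus>\<^bsub>fsum X M\<^esub> b) j \<noteq> \<zero>\<^bsub>M j\<^esub>} \<subseteq> {j \<in> X. a j \<noteq> \<zero>\<^bsub>M j\<^esub>} \<union> {j \<in> X. b j \<noteq> \<zero>\<^bsub>M j\<^esub>}"
      using abelian_monoid.l_zero[OF abelian_group.axioms(1)[OF M_ag]]
        abelian_monoid.zero_closed[OF abelian_group.axioms(1)[OF M_ag]] by (auto simp: fsum_simps)
  qed (use assms in \<open>simp add: fsum_simps\<close>)
  then show ?thesis
    using assms abelian_monoid.a_closed[OF abelian_group.axioms(1)[OF M_ag]]
    by (auto simp: fsum_simps PiE_iff)
qed

lemma smult_carrier:
  assumes "c \<in> carrier k" "a \<in> carrier (fsum X M)"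
  shows "c \<odot>\<^bsub>fsum X M\<^esub> a \<in> carrier (fsum X M)"
proof -
  have "finite {j \<in> X. (c \<odot>\<^bsub>fsum X M\<^esub> a) j \<noteq> \<zero>\<^bsub>M j\<^esub>}"
  proof (rule finite_subset)
    show "{j \<in> X. (c \<odot>\<^bsub>fsum X M\<^esub> a) j \<noteq> \<zero>\<^bsub>M j\<^esub>} \<subseteq> {j \<in> X. a j \<noteq> \<zero>\<^bsub>M j\<^esub>}"
      using module.smult_r_null[OF M assms(1)] by (auto simp: fsum_simps)
  qed (use assms in \<open>simp add: fsum_simps\<close>)
  then show ?thesis
    using assms module.smult_closed[OF M] by (auto simp: fsum_simps PiE_iff)
qed

lemma inc_carrier:
  assumes "j \<in> X" "m \<in> carrier (M j)"
  shows "inc X M j m \<in> carrier (fsum X M)"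
proof -
  have "finite {i \<in> X. inc X M j m i \<noteq> \<zero>\<^bsub>M i\<^esub>}"
    by (rule finite_subset[of _ "{j}"]) (auto simp: inc_def)
  then show ?thesis
    using assms abelian_monoid.zero_closed[OF abelian_group.axioms(1)[OF M_ag]]
    by (auto simp: fsum_simps inc_def)
qed

lemma zero_carrier: "\<zero>\<^bsub>fsum X M\<^esub> \<in> carrier (fsum X M)"
proof -
  have "{j \<in> X. \<zero>\<^bsub>fsum X M\<^esub> j \<noteq> \<zero>\<^bsub>M j\<^esub>} = {}" by (auto simp: fsum_simps)
  then show ?thesis
    using abelian_monoid.zero_closed[OF abelian_group.axioms(1)[OF M_ag]] by (auto simp: fsum_simps)
qed

lemma module_fsum: "module k (fsum X M)"
proof (rule moduleI[OF k])
  show "abelian_group (fsum X M)"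
  proof (rule abelian_groupI)
    fix a assume a: "a \<in> carrier (fsum X M)"
    have "(\<ominus>\<^bsub>k\<^esub> \<one>\<^bsub>k\<^esub>) \<odot>\<^bsub>fsum X M\<^esub> a \<oplus>\<^bsub>fsum X M\<^esub> a = \<zero>\<^bsub>fsum X M\<^esub>"
    proof -
      have "(\<ominus>\<^bsub>k\<^esub> \<one>\<^bsub>k\<^esub>) \<odot>\<^bsub>M j\<^esub> a j \<oplus>\<^bsub>M j\<^esub> a j = \<zero>\<^bsub>M j\<^esub>" if j: "j \<in> X" for j
      proof -
        interpret j: module k "M j" by (rule M[OF j])
        show ?thesis using fsum_closed[OF a j] by (simp add: j.neg_smult[symmetric] j.M.l_neg)
      qed
      then show ?thesis by (auto simp: fsum_simps fun_eq_iff)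
    qed
    moreover have "\<ominus>\<^bsub>k\<^esub> \<one>\<^bsub>k\<^esub> \<in> carrier k"
      using k by (simp add: cring_def ring_def abelian_group.a_inv_closed monoid.one_closed)
    ultimately show "\<exists>b \<in> carrier (fsum X M). b \<oplus>\<^bsub>fsum X M\<^esub> a = \<zero>\<^bsub>fsum X M\<^esub>"
      using smult_carrier a by blast
    show "\<zero>\<^bsub>fsum X M\<^esub> \<oplus>\<^bsub>fsum X M\<^esub> a = a"
      by (rule fsum_ext[OF add_carrier[OF zero_carrier a] a])
        (use fsum_closed[OF a] abelian_monoid.l_zero[OF abelian_group.axioms(1)[OF M_ag]] in \<open>simp add: fsum_simps\<close>)
  next
    fix a b assume a: "a \<in> carrier (fsum X M)" and b: "b \<in> carrier (fsum X M)"
    show "a \<oplus>\<^bsub>fsum X M\<^esub> b = b \<oplus>\<^bsub>fsum X M\<^esub> a"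
      by (rule fsum_ext[OF add_carrier[OF a b] add_carrier[OF b a]])
        (use fsum_closed[OF a] fsum_closed[OF b] abelian_monoid.a_comm[OF abelian_group.axioms(1)[OF M_ag]]
          in \<open>simp add: fsum_simps\<close>)
    fix c assume c: "c \<in> carrier (fsum X M)"
    show "a \<oplus>\<^bsub>fsum X M\<^esub> b \<oplus>\<^bsub>fsum X M\<^esub> c = a \<oplus>\<^bsub>fsum X M\<^esub> (b \<oplus>\<^bsub>fsum X M\<^esub> c)"
      by (rule fsum_ext[OF add_carrier[OF add_carrier[OF a b] c] add_carrier[OF a add_carrier[OF b c]]])
        (use fsum_closed[OF a] fsum_closed[OF b] fsum_closed[OF c]
          abelian_monoid.a_assoc[OF abelian_group.axioms(1)[OF M_ag]] in \<open>simp add: fsum_simps\<close>)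
  qed (auto intro: add_carrier zero_carrier)
next
  fix c a assume c: "c \<in> carrier k" and a: "a \<in> carrier (fsum X M)"
  show "c \<odot>\<^bsub>fsum X M\<^esub> a \<in> carrier (fsum X M)" by (rule smult_carrier[OF c a])
next
  fix a assume a: "a \<in> carrier (fsum X M)"
  show "\<one>\<^bsub>k\<^esub> \<odot>\<^bsub>fsum X M\<^esub> a = a"
    using a module.smult_one[OF M fsum_closed[OF a]] by (auto simp: fsum_simps fun_eq_iff PiE_def extensional_def)
next
  fix c d a assume c: "c \<in> carrier k" and d: "d \<in> carrier k" and a: "a \<in> carrier (fsum X M)"
  show "(c \<oplus>\<^bsub>k\<^esub> d) \<odot>\<^bsub>fsum X M\<^esub> a = c \<odot>\<^bsub>fsum X M\<^esub> a \<oplus>\<^bsub>fsum X M\<^esub> d \<odot>\<^bsub>fsum X M\<^esub> a"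
    using module.smult_l_distr[OF M c d fsum_closed[OF a]] by (auto simp: fsum_simps fun_eq_iff)
  show "(c \<otimes>\<^bsub>k\<^esub> d) \<odot>\<^bsub>fsum X M\<^esub> a = c \<odot>\<^bsub>fsum X M\<^esub> (d \<odot>\<^bsub>fsum X M\<^esub> a)"
    using module.smult_assoc1[OF M c d fsum_closed[OF a]] by (auto simp: fsum_simps fun_eq_iff)
next
  fix c a b assume c: "c \<in> carrier k" and a: "a \<in> carrier (fsum X M)" and b: "b \<in> carrier (fsum X M)"
  show "c \<odot>\<^bsub>fsum X M\<^esub> (a \<oplus>\<^bsub>fsum X M\<^esub> b) = c \<odot>\<^bsub>fsum X M\<^esub> a \<oplus>\<^bsub>fsum X M\<^esub> c \<odot>\<^bsub>fsum X M\<^esub> b"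
    using module.smult_r_distr[OF M c fsum_closed[OF a] fsum_closed[OF b]] by (auto simp: fsum_simps fun_eq_iff)
qed

lemma inc_linear: "j \<in> X \<Longrightarrow> linear_map k (M j) (fsum X M) (inc X M j)"
proof (rule linear_mapI)
  assume j: "j \<in> X"
  note z = abelian_monoid.l_zero[OF abelian_group.axioms(1)[OF M_ag]]
    abelian_monoid.zero_closed[OF abelian_group.axioms(1)[OF M_ag]]
  show "inc X M j (u \<oplus>\<^bsub>M j\<^esub> v) = inc X M j u \<oplus>\<^bsub>fsum X M\<^esub> inc X M j v" for u v
    by (auto simp: inc_def fsum_simps fun_eq_iff z)
  show "c \<in> carrier k \<Longrightarrow> inc X M j (c \<odot>\<^bsub>M j\<^esub> v) = c \<odot>\<^bsub>fsum X M\<^esub> inc X M j v" for c v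
    using module.smult_r_null[OF M] by (auto simp: inc_def fsum_simps fun_eq_iff)
qed (rule inc_carrier)

lemma proj_linear: "j \<in> X \<Longrightarrow> linear_map k (fsum X M) (M j) (\<lambda>a. a j)"
  by (rule linear_mapI) (simp_all add: fsum_simps PiE_iff)

text \<open>Induction on a finite set containing the support: the family \<open>a\<close> is the sum
  of \<open>a\<close> with its entry at \<open>j\<close> replaced by zero and of the family
  concentrated at \<open>j\<close>.\<close>

lemma fsum_induct [consumes 1, case_names zero add inc]:
  assumes "a \<in> carrier (fsum X M)" and "P \<zero>\<^bsub>fsum X M\<^esub>"
    and "\<And>a b. a \<in> carrier (fsum X M) \<Longrightarrow> b \<in> carrier (fsum X M) \<Longrightarrow> P a \<Longrightarrow> P b
      \<Longrightarrow> P (a \<oplus>\<^bsub>fsum X M\<^esub> b)"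
    and "\<And>j m. j \<in> X \<Longrightarrow> m \<in> carrier (M j) \<Longrightarrow> P (inc X M j m)"
  shows "P a"
proof -
  have "\<forall>a \<in> carrier (fsum X M). {j \<in> X. a j \<noteq> \<zero>\<^bsub>M j\<^esub>} \<subseteq> S \<longrightarrow> P a" if "finite S" for S
    using that
  proof induction
    case empty
    show ?case
    proof (intro ballI impI)
      fix a assume "a \<in> carrier (fsum X M)" "{j \<in> X. a j \<noteq> \<zero>\<^bsub>M j\<^esub>} \<subseteq> {}"
      then have "a = \<zero>\<^bsub>fsum X M\<^esub>" by (intro fsum_ext zero_carrier) (auto simp: fsum_simps)
      then show "P a" using assms(2) by simp
    qed
  next
    case (insert j S)
    show ?case
    proof (intro ballI impI)
      fix a assume a: "a \<in> carrier (fsum X M)" and s: "{j \<in> X. a j \<noteq> \<zero>\<^bsub>M j\<^esub>} \<subseteq> insert j S"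
      show "P a"
      proof (cases "j \<in> X")
        case True
        interpret j: module k "M j" by (rule M[OF True])
        let ?b = "a(j := \<zero>\<^bsub>M j\<^esub>)"
        have f: "finite {i \<in> X. ?b i \<noteq> \<zero>\<^bsub>M i\<^esub>}"
          by (rule finite_subset[of _ "{i \<in> X. a i \<noteq> \<zero>\<^bsub>M i\<^esub>}"]) (use a in \<open>auto simp: fsum_simps\<close>)
        then have b: "?b \<in> carrier (fsum X M)"
          using a True by (auto simp: fsum_simps PiE_iff extensional_def)
        have i: "inc X M j (a j) \<in> carrier (fsum X M)" by (rule inc_carrier[OF True fsum_closed[OF a True]])
        have "P ?b" by (rule insert.IH[rule_format, OF b]) (use s in auto)
        then have "P (?b \<oplus>\<^bsub>fsum X M\<^esub> inc X M j (a j))"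
          by (rule assms(3)[OF b i _ assms(4)[OF True fsum_closed[OF a True]]])
        moreover have "?b \<oplus>\<^bsub>fsum X M\<^esub> inc X M j (a j) = a"
          by (rule fsum_ext[OF add_carrier[OF b i] a])
            (use fsum_closed[OF a] True abelian_monoid.r_zero[OF abelian_group.axioms(1)[OF M_ag]]
              in \<open>auto simp: fsum_simps inc_def\<close>)
        ultimately show ?thesis by simp
      next
        case False
        then have "{j \<in> X. a j \<noteq> \<zero>\<^bsub>M j\<^esub>} \<subseteq> S" using s by auto
        then show ?thesis using insert.IH a by blast
      qed
    qed
  qed
  from this[of "{j \<in> X. a j \<noteq> \<zero>\<^bsub>M j\<^esub>}"] show ?thesis using assms(1) by (simp add: fsum_simps)
qed

lemma linear_ext:
  assumes N: "module k N" and f: "linear_map k (fsum X M) N f" and g: "linear_map k (fsum X M) N g"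
    and "\<And>j m. j \<in> X \<Longrightarrow> m \<in> carrier (M j) \<Longrightarrow> f (inc X M j m) = g (inc X M j m)"
    and "a \<in> carrier (fsum X M)"
  shows "f a = g a"
  using assms(5)
proof (induction rule: fsum_induct)
  case zero
  show ?case by (simp add: linear_map_zero[OF module_fsum N f] linear_map_zero[OF module_fsum N g])
next
  case (add a b)
  then show ?case by (simp add: linear_map_add[OF f] linear_map_add[OF g])
qed (use assms(4) in auto)

context
  fixes N :: "('k, 'w) module" and \<phi> :: "'j \<Rightarrow> 'v \<Rightarrow> 'w"
  assumes N: "module k N" and \<phi>: "\<And>j. j \<in> X \<Longrightarrow> linear_map k (M j) N (\<phi> j)"
begin

interpretation N: module k N by (rule N)

text \<open>Supports change under addition and scaling. Linearity of \<open>fext\<close> is proved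
  by summing over one finite set that contains all supports involved.\<close>

lemma fext_eq:
  assumes a: "a \<in> carrier (fsum X M)" and S: "finite S" "{j \<in> X. a j \<noteq> \<zero>\<^bsub>M j\<^esub>} \<subseteq> S" "S \<subseteq> X"
  shows "fext X M N \<phi> a = (\<Oplus>\<^bsub>N\<^esub>j\<in>S. \<phi> j (a j))"
  unfolding fext_def
proof (rule N.M.add.finprod_mono_neutral_cong_left[OF S(1,2)])
  fix j assume "j \<in> S - {j \<in> X. a j \<noteq> \<zero>\<^bsub>M j\<^esub>}"
  then have "j \<in> X" "a j = \<zero>\<^bsub>M j\<^esub>" using S by auto
  then show "\<phi> j (a j) = \<zero>\<^bsub>N\<^esub>" using linear_map_zero[OF M N \<phi>] by simp
next
  show "(\<lambda>j. \<phi> j (a j)) \<in> S \<rightarrow> carrier N"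
    using S fsum_closed[OF a] linear_map_closed[OF \<phi>] by auto
qed simp

lemma fext_inc:
  assumes "j \<in> X" "m \<in> carrier (M j)"
  shows "fext X M N \<phi> (inc X M j m) = \<phi> j m"
proof -
  have "fext X M N \<phi> (inc X M j m) = (\<Oplus>\<^bsub>N\<^esub>i\<in>{j}. \<phi> i (inc X M j m i))"
    by (rule fext_eq[OF inc_carrier[OF assms]]) (use assms in \<open>auto simp: inc_def\<close>)
  also have "\<dots> = \<phi> j m"
    using linear_map_closed[OF \<phi>[OF assms(1)] assms(2)] assms(1)
    by (simp add: N.M.finsum_insert inc_def)
  finally show ?thesis .
qed

lemma fext_linear: "linear_map k (fsum X M) N (fext X M N \<phi>)"
proof (rule linear_mapI)
  fix a assume a: "a \<in> carrier (fsum X M)"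
  let ?S = "{j \<in> X. a j \<noteq> \<zero>\<^bsub>M j\<^esub>}"
  have fin: "finite ?S" using a by (simp add: fsum_simps)
  have c: "(\<lambda>j. \<phi> j (a j)) \<in> X \<rightarrow> carrier N" using linear_map_closed[OF \<phi>] fsum_closed[OF a] by auto
  show "fext X M N \<phi> a \<in> carrier N"
    unfolding fext_def by (rule N.M.finsum_closed) (use c in auto)
  fix b assume b: "b \<in> carrier (fsum X M)"
  let ?T = "?S \<union> {j \<in> X. b j \<noteq> \<zero>\<^bsub>M j\<^esub>}"
  have fT: "finite ?T" using b fin by (simp add: fsum_simps)
  have d: "(\<lambda>j. \<phi> j (b j)) \<in> X \<rightarrow> carrier N" using linear_map_closed[OF \<phi>] fsum_closed[OF b] by auto
  have s: "{j \<in> X. (a \<oplus>\<^bsub>fsum X M\<^esub> b) j \<noteq> \<zero>\<^bsub>M j\<^esub>} \<subseteq> ?T"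
    using abelian_monoid.l_zero[OF abelian_group.axioms(1)[OF M_ag]]
      abelian_monoid.zero_closed[OF abelian_group.axioms(1)[OF M_ag]] by (auto simp: fsum_simps)
  have "fext X M N \<phi> (a \<oplus>\<^bsub>fsum X M\<^esub> b) = (\<Oplus>\<^bsub>N\<^esub>j\<in>?T. \<phi> j ((a \<oplus>\<^bsub>fsum X M\<^esub> b) j))"
    by (rule fext_eq[OF add_carrier[OF a b] fT s]) auto
  also have "\<dots> = (\<Oplus>\<^bsub>N\<^esub>j\<in>?T. \<phi> j (a j) \<oplus>\<^bsub>N\<^esub> \<phi> j (b j))"
    by (rule N.M.finsum_cong')
      (use c d in \<open>auto simp: fsum_simps(3) linear_map_add[OF \<phi>] fsum_closed[OF a] fsum_closed[OF b]\<close>)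
  also have "\<dots> = (\<Oplus>\<^bsub>N\<^esub>j\<in>?T. \<phi> j (a j)) \<oplus>\<^bsub>N\<^esub> (\<Oplus>\<^bsub>N\<^esub>j\<in>?T. \<phi> j (b j))"
    by (rule N.M.finsum_addf) (use c d in auto)
  also have "(\<Oplus>\<^bsub>N\<^esub>j\<in>?T. \<phi> j (a j)) = fext X M N \<phi> a"
    by (rule fext_eq[OF a fT, symmetric]) auto
  also have "(\<Oplus>\<^bsub>N\<^esub>j\<in>?T. \<phi> j (b j)) = fext X M N \<phi> b"
    by (rule fext_eq[OF b fT, symmetric]) auto
  finally show "fext X M N \<phi> (a \<oplus>\<^bsub>fsum X M\<^esub> b) = fext X M N \<phi> a \<oplus>\<^bsub>N\<^esub> fext X M N \<phi> b" .
next
  fix c a assume cc: "c \<in> carrier k" and a: "a \<in> carrier (fsum X M)"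
  let ?S = "{j \<in> X. a j \<noteq> \<zero>\<^bsub>M j\<^esub>}"
  have fin: "finite ?S" using a by (simp add: fsum_simps)
  have c: "(\<lambda>j. \<phi> j (a j)) \<in> X \<rightarrow> carrier N" using linear_map_closed[OF \<phi>] fsum_closed[OF a] by auto
  have s: "{j \<in> X. (c \<odot>\<^bsub>fsum X M\<^esub> a) j \<noteq> \<zero>\<^bsub>M j\<^esub>} \<subseteq> ?S"
    using module.smult_r_null[OF M cc] by (auto simp: fsum_simps)
  have "fext X M N \<phi> (c \<odot>\<^bsub>fsum X M\<^esub> a) = (\<Oplus>\<^bsub>N\<^esub>j\<in>?S. \<phi> j ((c \<odot>\<^bsub>fsum X M\<^esub> a) j))"
    by (rule fext_eq[OF smult_carrier[OF cc a] fin s]) auto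
  also have "\<dots> = (\<Oplus>\<^bsub>N\<^esub>j\<in>?S. c \<odot>\<^bsub>N\<^esub> \<phi> j (a j))"
    by (rule N.M.finsum_cong')
      (use c cc in \<open>auto simp: fsum_simps(4) linear_map_smult[OF \<phi>] fsum_closed[OF a]\<close>)
  also have "\<dots> = c \<odot>\<^bsub>N\<^esub> fext X M N \<phi> a"
    unfolding fext_def by (rule N.finsum_smult_ldistr[symmetric]) (use c cc fin in auto)
  finally show "fext X M N \<phi> (c \<odot>\<^bsub>fsum X M\<^esub> a) = c \<odot>\<^bsub>N\<^esub> fext X M N \<phi> a" .
qed

end

end

subsection \<open>Direct sums of modules over a category\<close>

lemma direct_sum_fib: "fib (direct_sum J W) x = fsum J (\<lambda>j. fib (W j) x)"
  by (simp add: direct_sum_def fsum_def)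

lemma direct_sum_act: "act (direct_sum J W) f a = (\<lambda>j\<in>J. act (W j) f (a j))"
  by (simp add: direct_sum_def)

locale cmod_family =
  fixes k :: "'k ring" and C :: "('o, 'a) cat" and J :: "'j set" and W :: "'j \<Rightarrow> ('o, 'a, 'k, 'v) cmod"
  assumes k: "cring k" and cat: "category C" and W: "\<And>j. j \<in> J \<Longrightarrow> cmodule k C (W j)"
begin

lemma Wj: "j \<in> J \<Longrightarrow> cmod k C (W j)"
  using cat W by unfold_locales

lemma fm: "x \<in> Ob C \<Longrightarrow> fsum_module k J (\<lambda>j. fib (W j) x)"
  by (rule fsum_module.intro[OF k cmod.fib_module[OF Wj]])

lemma act_linear:
  assumes f: "f \<in> Hom C x y"
  shows "linear_map k (fib (direct_sum J W) x) (fib (direct_sum J W) y) (act (direct_sum J W) f)"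
proof -
  note o = category_Hom_Ob[OF cat f]
  interpret x: fsum_module k J "\<lambda>j. fib (W j) x" by (rule fm[OF o(1)])
  interpret y: fsum_module k J "\<lambda>j. fib (W j) y" by (rule fm[OF o(2)])
  show ?thesis
  proof (rule linear_mapI; unfold direct_sum_fib)
    fix a assume a: "a \<in> carrier (fsum J (\<lambda>j. fib (W j) x))"
    have "finite {j \<in> J. act (direct_sum J W) f a j \<noteq> \<zero>\<^bsub>fib (W j) y\<^esub>}"
      by (rule finite_subset[of _ "{j \<in> J. a j \<noteq> \<zero>\<^bsub>fib (W j) x\<^esub>}"])
        (use a in \<open>auto simp: fsum_simps direct_sum_act cmod.act_zero[OF Wj f]\<close>)
    then show "act (direct_sum J W) f a \<in> carrier (fsum J (\<lambda>j. fib (W j) y))"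
      using cmod.act_closed[OF Wj f] x.fsum_closed[OF a] by (auto simp: fsum_simps direct_sum_act)
    fix b assume b: "b \<in> carrier (fsum J (\<lambda>j. fib (W j) x))"
    show "act (direct_sum J W) f (a \<oplus>\<^bsub>fsum J (\<lambda>j. fib (W j) x)\<^esub> b)
        = act (direct_sum J W) f a \<oplus>\<^bsub>fsum J (\<lambda>j. fib (W j) y)\<^esub> act (direct_sum J W) f b"
      using cmod.act_add[OF Wj f] x.fsum_closed[OF a] x.fsum_closed[OF b]
      by (auto simp: fsum_simps(3) direct_sum_act fun_eq_iff)
  next
    fix c a assume "c \<in> carrier k" and a: "a \<in> carrier (fsum J (\<lambda>j. fib (W j) x))"
    then show "act (direct_sum J W) f (c \<odot>\<^bsub>fsum J (\<lambda>j. fib (W j) x)\<^esub> a)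
        = c \<odot>\<^bsub>fsum J (\<lambda>j. fib (W j) y)\<^esub> act (direct_sum J W) f a"
      using cmod.act_smult[OF Wj f] x.fsum_closed[OF a] by (auto simp: fsum_simps(4) direct_sum_act fun_eq_iff)
  qed
qed

lemma cmodule_direct_sum: "cmodule k C (direct_sum J W)"
proof (rule cmoduleI[OF cat])
  fix x assume "x \<in> Ob C"
  then show "module k (fib (direct_sum J W) x)"
    unfolding direct_sum_fib by (rule fsum_module.module_fsum[OF fm])
next
  fix x v assume x: "x \<in> Ob C" and v: "v \<in> car (direct_sum J W) x"
  then have "v \<in> extensional J" "\<And>j. j \<in> J \<Longrightarrow> v j \<in> car (W j) x"
    by (auto simp: direct_sum_fib fsum_simps PiE_def)
  then show "act (direct_sum J W) (Ident C x) v = v"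
    using cmod.act_Ident[OF Wj x] by (auto simp: direct_sum_act fun_eq_iff extensional_def)
next
  fix f g x y z v assume f: "f \<in> Hom C x y" "g \<in> Hom C y z" and v: "v \<in> car (direct_sum J W) x"
  then have "\<And>j. j \<in> J \<Longrightarrow> v j \<in> car (W j) x" by (auto simp: direct_sum_fib fsum_simps)
  then show "act (direct_sum J W) (Comp C g f) v = act (direct_sum J W) g (act (direct_sum J W) f v)"
    using cmod.act_Comp[OF Wj f] by (auto simp: direct_sum_act fun_eq_iff)
qed (rule act_linear)

lemma hom_proj: "j \<in> J \<Longrightarrow> cmod_hom k C (direct_sum J W) (W j) (\<lambda>x a. a j)"
  by (rule cmod_homI)
    (auto simp: direct_sum_fib direct_sum_act intro: fsum_module.proj_linear[OF fm])

lemma act_inc: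
  assumes f: "f \<in> Hom C x y" and j: "j \<in> J"
  shows "act (direct_sum J W) f (inc J (\<lambda>j. fib (W j) x) j m) = inc J (\<lambda>j. fib (W j) y) j (act (W j) f m)"
  using cmod.act_zero[OF Wj f] j by (auto simp: inc_def direct_sum_act fun_eq_iff)

text \<open>Both sides of the naturality square are linear on a direct sum, so they need to be
  compared only on single summands, where naturality of \<open>\<phi> j\<close> applies.\<close>

lemma hom_fext:
  assumes V: "cmodule k C V" and \<phi>: "\<And>j. j \<in> J \<Longrightarrow> cmod_hom k C (W j) V (\<phi> j)"
  shows "cmod_hom k C (direct_sum J W) V (\<lambda>x. fext J (\<lambda>j. fib (W j) x) (fib V x) (\<lambda>j. \<phi> j x))" (is "cmod_hom k C _ V ?\<Phi>")
proof -
  interpret V: cmod k C V using cat V by unfold_locales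
  have l: "linear_map k (fib (W j) x) (fib V x) (\<phi> j x)" if "x \<in> Ob C" "j \<in> J" for x j
    using \<phi>[OF that(2)] that(1) by (auto simp: cmod_hom_def)
  have lin: "linear_map k (fib (direct_sum J W) x) (fib V x) (?\<Phi> x)" if x: "x \<in> Ob C" for x
    unfolding direct_sum_fib by (rule fsum_module.fext_linear[OF fm[OF x] V.fib_module[OF x] l[OF x]])
  show ?thesis
  proof (rule cmod_homI)
    fix f x y v assume f: "f \<in> Hom C x y" and v: "v \<in> car (direct_sum J W) x"
    note o = category_Hom_Ob[OF cat f]
    show "?\<Phi> y (act (direct_sum J W) f v) = act V f (?\<Phi> x v)"
    proof (rule fsum_module.linear_ext[OF fm[OF o(1)] V.fib_module[OF o(2)]])
      show "linear_map k (fsum J (\<lambda>j. fib (W j) x)) (fib V y) (\<lambda>v. ?\<Phi> y (act (direct_sum J W) f v))"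
        using linear_map_comp[OF act_linear[OF f] lin[OF o(2)]] by (simp add: direct_sum_fib)
      show "linear_map k (fsum J (\<lambda>j. fib (W j) x)) (fib V y) (\<lambda>v. act V f (?\<Phi> x v))"
        using linear_map_comp[OF lin[OF o(1)] V.act_linear[OF f]] by (simp add: direct_sum_fib)
    next
      fix j m assume j: "j \<in> J" and m: "m \<in> car (W j) x"
      have e: "?\<Phi> z (inc J (\<lambda>j. fib (W j) z) j v) = \<phi> j z v" if "z \<in> Ob C" "v \<in> car (W j) z" for z v
        by (rule fsum_module.fext_inc[OF fm[OF that(1)] V.fib_module[OF that(1)] l[OF that(1)] j that(2)])
      show "?\<Phi> y (act (direct_sum J W) f (inc J (\<lambda>j. fib (W j) x) j m))
          = act V f (?\<Phi> x (inc J (\<lambda>j. fib (W j) x) j m))"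
        unfolding act_inc[OF f j] e[OF o(1) m] e[OF o(2) cmod.act_closed[OF Wj[OF j] f m]]
        using \<phi>[OF j] f m by (auto simp: cmod_hom_def Hom_def)
    qed (use v in \<open>simp add: direct_sum_fib\<close>)
  qed (rule lin)
qed

end

subsection \<open>Representable modules and their sums\<close>

text \<open>The regular module, which makes the fibres of a representable module an instance of
  \<open>fsum\<close>.\<close>

definition kmod :: "'k ring \<Rightarrow> ('k, 'k) module" where
  "kmod k = \<lparr> carrier = carrier k, mult = undefined, one = undefined,
     zero = \<zero>\<^bsub>k\<^esub>, add = (\<oplus>\<^bsub>k\<^esub>), smult = (\<otimes>\<^bsub>k\<^esub>) \<rparr>"

lemma kmod_simps [simp]:
  "carrier (kmod k) = carrier k" "\<zero>\<^bsub>kmod k\<^esub> = \<zero>\<^bsub>k\<^esub>" "add (kmod k) = (\<oplus>\<^bsub>k\<^esub>)" "smult (kmod k) = (\<otimes>\<^bsub>k\<^esub>)"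
  by (simp_all add: kmod_def)

lemma finsum_kmod: "finsum (kmod k) = finsum k"
  by (simp add: finsum_def finprod_def fun_eq_iff)

lemma module_kmod:
  assumes "cring k"
  shows "module k (kmod k)"
proof -
  interpret cring k by fact
  show ?thesis
  proof (rule moduleI[OF assms])
    show "abelian_group (kmod k)"
    proof (rule abelian_groupI)
      fix x assume "x \<in> carrier (kmod k)"
      then show "\<exists>y \<in> carrier (kmod k). y \<oplus>\<^bsub>kmod k\<^esub> x = \<zero>\<^bsub>kmod k\<^esub>"
        by (intro bexI[of _ "\<ominus>\<^bsub>k\<^esub> x"]) (auto simp: l_neg)
    qed (auto simp: a_ac)
  qed (auto simp: l_distr r_distr m_assoc)
qed

lemma free_cmod_fib: "fib (free_cmod k C n) x = fsum (Hom C n x) (\<lambda>_. kmod k)"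
  by (simp add: free_cmod_def fsum_def)

definition basis :: "'k ring \<Rightarrow> ('o, 'a) cat \<Rightarrow> 'o \<Rightarrow> 'o \<Rightarrow> 'a \<Rightarrow> 'a \<Rightarrow> 'k" where
  "basis k C n x g = inc (Hom C n x) (\<lambda>_. kmod k) g \<one>\<^bsub>k\<^esub>"

locale free_module =
  fixes k :: "'k ring" and C :: "('o, 'a) cat" and n :: 'o
  assumes k: "cring k" and cat: "category C" and n: "n \<in> Ob C"
begin

interpretation k: cring k by (rule k)

abbreviation "F \<equiv> free_cmod k C n"

lemma fm: "fsum_module k (Hom C n x) (\<lambda>_. kmod k)"
  by (rule fsum_module.intro[OF k module_kmod[OF k]])

lemma basis_closed: "g \<in> Hom C n x \<Longrightarrow> basis k C n x g \<in> car F x"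
  unfolding basis_def free_cmod_fib by (rule fsum_module.inc_carrier[OF fm]) auto

lemma free_induct [consumes 1, case_names zero add smult basis]:
  assumes "a \<in> car F x" and "P \<zero>\<^bsub>fib F x\<^esub>"
    and "\<And>a b. a \<in> car F x \<Longrightarrow> b \<in> car F x \<Longrightarrow> P a \<Longrightarrow> P b \<Longrightarrow> P (a \<oplus>\<^bsub>fib F x\<^esub> b)"
    and "\<And>c a. c \<in> carrier k \<Longrightarrow> a \<in> car F x \<Longrightarrow> P a \<Longrightarrow> P (c \<odot>\<^bsub>fib F x\<^esub> a)"
    and "\<And>g. g \<in> Hom C n x \<Longrightarrow> P (basis k C n x g)"
  shows "P a"
  using assms(1-3) unfolding free_cmod_fib
proof (induction rule: fsum_module.fsum_induct[OF fm, consumes 1, case_names zero add inc])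
  case (inc g c)
  have "inc (Hom C n x) (\<lambda>_. kmod k) g c = c \<odot>\<^bsub>fib F x\<^esub> basis k C n x g"
    using linear_map_smult[OF fsum_module.inc_linear[OF fm inc(1)], of c "\<one>\<^bsub>k\<^esub>"] inc(2)
    by (simp add: basis_def free_cmod_fib)
  then show ?case
    using assms(4)[OF _ basis_closed[OF inc(1)] assms(5)[OF inc(1)], of c] inc(2) by simp
qed auto

lemma fib_module: "module k (fib F x)"
  unfolding free_cmod_fib by (rule fsum_module.module_fsum[OF fm])

lemma free_linear_ext:
  assumes N: "module k N" and f: "linear_map k (fib F x) N f" and g: "linear_map k (fib F x) N g"
    and "\<And>u. u \<in> Hom C n x \<Longrightarrow> f (basis k C n x u) = g (basis k C n x u)"
    and "a \<in> car F x"
  shows "f a = g a"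
  using assms(5)
proof (induction rule: free_induct)
  case zero
  show ?case by (simp add: linear_map_zero[OF fib_module N f] linear_map_zero[OF fib_module N g])
next
  case (add a b)
  then show ?case by (simp add: linear_map_add[OF f] linear_map_add[OF g])
next
  case (smult c a)
  then show ?case by (simp add: linear_map_smult[OF f] linear_map_smult[OF g])
qed (use assms(4) in auto)

lemma coeff_linear:
  "linear_map k (kmod k) (kmod k) (\<lambda>c. if P then c else \<zero>\<^bsub>k\<^esub>)"
  by (rule linear_mapI) auto

text \<open>Each coefficient of the pushforward is exhibited as a map induced on a direct sum by
  linear maps on the summands. Linearity of the action then comes from \<open>fext_linear\<close>
  and is not proved by manipulating sums.\<close>

lemma act_coeff:
  assumes f: "f \<in> Hom C x y" and a: "a \<in> car F x" and h: "h \<in> Hom C n y"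
  shows "act F f a h = fext (Hom C n x) (\<lambda>_. kmod k) (kmod k) (\<lambda>g c. if Comp C f g = h then c else \<zero>\<^bsub>k\<^esub>) a"
proof -
  have fin: "finite {g \<in> Hom C n x. a g \<noteq> \<zero>\<^bsub>k\<^esub>}" using a by (simp add: free_cmod_fib fsum_simps)
  have c: "g \<in> Hom C n x \<Longrightarrow> a g \<in> carrier k" for g using a by (auto simp: free_cmod_fib fsum_simps)
  have "act F f a h = (\<Oplus>\<^bsub>k\<^esub>g \<in> {g \<in> Hom C n x. a g \<noteq> \<zero>\<^bsub>k\<^esub> \<and> Comp C f g = h}. a g)"
    using h HomD[OF f] by (simp add: free_cmod_def)
  also have "\<dots> = (\<Oplus>\<^bsub>k\<^esub>g \<in> {g \<in> Hom C n x. a g \<noteq> \<zero>\<^bsub>k\<^esub>}. if Comp C f g = h then a g else \<zero>\<^bsub>k\<^esub>)"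
    by (rule k.add.finprod_mono_neutral_cong_left[OF fin]) (auto simp: c)
  finally show ?thesis by (simp add: fext_def finsum_kmod)
qed

lemma act_linear:
  assumes f: "f \<in> Hom C x y"
  shows "linear_map k (fib F x) (fib F y) (act F f)"
proof -
  have lin: "linear_map k (fib F x) (kmod k)
      (fext (Hom C n x) (\<lambda>_. kmod k) (kmod k) (\<lambda>g c. if Comp C f g = h then c else \<zero>\<^bsub>k\<^esub>))" for h
    unfolding free_cmod_fib by (rule fsum_module.fext_linear[OF fm module_kmod[OF k] coeff_linear])
  note c = act_coeff[OF f]
  have ext: "act F f a \<in> extensional (Hom C n y)" for a
    using HomD[OF f] by (simp add: free_cmod_def)
  interpret x: module k "fib F x" by (rule fib_module)
  show ?thesis
  proof (rule linear_mapI)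
    fix a assume a: "a \<in> car F x"
    \<comment> \<open>Coefficients vanish away from the image of the support of \<open>a\<close>
      under composition with \<open>f\<close>, since there the sum is empty.\<close>
    have "finite {h \<in> Hom C n y. act F f a h \<noteq> \<zero>\<^bsub>k\<^esub>}"
    proof (rule finite_subset)
      show "finite (Comp C f ` {g \<in> Hom C n x. a g \<noteq> \<zero>\<^bsub>k\<^esub>})"
        using a by (simp add: free_cmod_fib fsum_simps)
      show "{h \<in> Hom C n y. act F f a h \<noteq> \<zero>\<^bsub>k\<^esub>} \<subseteq> Comp C f ` {g \<in> Hom C n x. a g \<noteq> \<zero>\<^bsub>k\<^esub>}"
      proof
        fix h assume h: "h \<in> {h \<in> Hom C n y. act F f a h \<noteq> \<zero>\<^bsub>k\<^esub>}"
        then have "(\<Oplus>\<^bsub>k\<^esub>g \<in> {g \<in> Hom C n x. a g \<noteq> \<zero>\<^bsub>k\<^esub> \<and> Comp C f g = h}. a g) \<noteq> \<zero>\<^bsub>k\<^esub>"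
          using HomD[OF f] by (auto simp: free_cmod_def)
        then have "{g \<in> Hom C n x. a g \<noteq> \<zero>\<^bsub>k\<^esub> \<and> Comp C f g = h} \<noteq> {}"
          by (rule contrapos_nn) (simp only: k.finsum_empty)
        then show "h \<in> Comp C f ` {g \<in> Hom C n x. a g \<noteq> \<zero>\<^bsub>k\<^esub>}" by auto
      qed
    qed
    moreover have "act F f a h \<in> carrier k" if "h \<in> Hom C n y" for h
      using linear_map_closed[OF lin a, of h] c[OF a that] by simp
    ultimately show "act F f a \<in> car F y"
      using ext by (auto simp: free_cmod_fib fsum_simps PiE_def)
    fix b assume b: "b \<in> car F x"
    show "act F f (a \<oplus>\<^bsub>fib F x\<^esub> b) = act F f a \<oplus>\<^bsub>fib F y\<^esub> act F f b"
    proof (rule extensionalityI[OF ext])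
      show "act F f a \<oplus>\<^bsub>fib F y\<^esub> act F f b \<in> extensional (Hom C n y)"
        by (simp add: free_cmod_fib fsum_simps)
      fix h assume h: "h \<in> Hom C n y"
      then show "act F f (a \<oplus>\<^bsub>fib F x\<^esub> b) h = (act F f a \<oplus>\<^bsub>fib F y\<^esub> act F f b) h"
        using linear_map_add[OF lin a b] a b
        by (simp add: c[OF _ h] free_cmod_fib[of k C n y] fsum_simps(3))
    qed
  next
    fix r a assume r: "r \<in> carrier k" and a: "a \<in> car F x"
    show "act F f (r \<odot>\<^bsub>fib F x\<^esub> a) = r \<odot>\<^bsub>fib F y\<^esub> act F f a"
    proof (rule extensionalityI[OF ext])
      show "r \<odot>\<^bsub>fib F y\<^esub> act F f a \<in> extensional (Hom C n y)"
        by (simp add: free_cmod_fib fsum_simps)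
      fix h assume h: "h \<in> Hom C n y"
      then show "act F f (r \<odot>\<^bsub>fib F x\<^esub> a) h = (r \<odot>\<^bsub>fib F y\<^esub> act F f a) h"
        using linear_map_smult[OF lin r a] r a
        by (simp add: c[OF _ h] free_cmod_fib[of k C n y] fsum_simps(4))
    qed
  qed
qed

lemma act_basis:
  assumes f: "f \<in> Hom C x y" and g: "g \<in> Hom C n x"
  shows "act F f (basis k C n x g) = basis k C n y (Comp C f g)"
proof (rule extensionalityI)
  show "act F f (basis k C n x g) \<in> extensional (Hom C n y)"
    using HomD[OF f] by (simp add: free_cmod_def)
  fix h assume h: "h \<in> Hom C n y"
  show "act F f (basis k C n x g) h = basis k C n y (Comp C f g) h"
    unfolding act_coeff[OF f basis_closed[OF g] h]
    unfolding basis_def[of k C n x g] using h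
    by (subst fsum_module.fext_inc[OF fm module_kmod[OF k] coeff_linear g])
       (auto simp: basis_def inc_def)
qed (simp add: basis_def inc_def)

lemma cmodule_free: "cmodule k C F"
proof (rule cmoduleI[OF cat fib_module act_linear])
  fix x v assume x: "x \<in> Ob C" and v: "v \<in> car F x"
  note i = category_Ident[OF cat x]
  show "act F (Ident C x) v = v"
    by (rule free_linear_ext[OF fib_module act_linear[OF i] _ _ v])
       (auto intro: linear_mapI simp: act_basis[OF i] category_Comp_Ident(2)[OF cat])
next
  fix f g x y z v assume f: "f \<in> Hom C x y" and g: "g \<in> Hom C y z" and v: "v \<in> car F x"
  note fg = category_Comp[OF cat f g]
  show "act F (Comp C g f) v = act F g (act F f v)"
    by (rule free_linear_ext[OF fib_module act_linear[OF fg] linear_map_comp[OF act_linear[OF f] act_linear[OF g]] _ v])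
       (simp add: act_basis[OF f] act_basis[OF g] act_basis[OF fg] category_Comp[OF cat _ f] category_assoc[OF cat _ f g])
qed

lemma gen_free:
  assumes a: "a \<in> car F x" and x: "x \<in> Ob C"
  shows "gen k C F (\<lambda>r. if r = n then {basis k C n n (Ident C n)} else {}) x a"
  using a
proof (induction rule: free_induct)
  case (basis g)
  have "act F g (basis k C n n (Ident C n)) = basis k C n x g"
    using act_basis[OF basis category_Ident[OF cat n]] category_Comp_Ident(1)[OF cat basis] by simp
  then show ?case
    using gen_gen[of "basis k C n n (Ident C n)" "\<lambda>r. if r = n then {basis k C n n (Ident C n)} else {}" n g C x k F]
      basis by simp
qed (auto intro: gen.intros x)

text \<open>The homomorphism out of the representable module that sends the identity of
  \<open>n\<close> to \<open>v\<close>.\<close>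

definition yoneda :: "('o, 'a, 'k, 'v) cmod \<Rightarrow> 'v \<Rightarrow> 'o \<Rightarrow> ('a \<Rightarrow> 'k) \<Rightarrow> 'v" where
  "yoneda V v x = fext (Hom C n x) (\<lambda>_. kmod k) (fib V x) (\<lambda>g c. c \<odot>\<^bsub>fib V x\<^esub> act V g v)"

context
  fixes V :: "('o, 'a, 'k, 'v) cmod" and v
  assumes V: "cmodule k C V" and v: "v \<in> car V n"
begin

interpretation V: cmod k C V using cat V by unfold_locales

lemma yoneda_coeff_linear:
  assumes "x \<in> Ob C" "g \<in> Hom C n x"
  shows "linear_map k (kmod k) (fib V x) (\<lambda>c. c \<odot>\<^bsub>fib V x\<^esub> act V g v)"
proof -
  interpret x: module k "fib V x" by (rule V.fib_module[OF assms(1)])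
  show ?thesis
    using V.act_closed[OF assms(2) v] by (intro linear_mapI) (auto simp: x.smult_l_distr x.smult_assoc1)
qed

lemma yoneda_linear: "x \<in> Ob C \<Longrightarrow> linear_map k (fib F x) (fib V x) (yoneda V v x)"
  unfolding free_cmod_fib yoneda_def
  by (rule fsum_module.fext_linear[OF fm V.fib_module yoneda_coeff_linear])

lemma yoneda_basis:
  assumes "g \<in> Hom C n x"
  shows "yoneda V v x (basis k C n x g) = act V g v"
proof -
  have x: "x \<in> Ob C" by (rule category_Hom_Ob(2)[OF cat assms])
  interpret x: module k "fib V x" by (rule V.fib_module[OF x])
  have "yoneda V v x (basis k C n x g) = \<one>\<^bsub>k\<^esub> \<odot>\<^bsub>fib V x\<^esub> act V g v"
    unfolding yoneda_def basis_def
    by (rule fsum_module.fext_inc[OF fm V.fib_module[OF x] yoneda_coeff_linear[OF x] assms]) auto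
  then show ?thesis using V.act_closed[OF assms v] by simp
qed

lemma yoneda_hom: "cmod_hom k C F V (yoneda V v)"
proof (rule cmod_homI[OF yoneda_linear])
  fix f x y a assume f: "f \<in> Hom C x y" and a: "a \<in> car F x"
  note o = category_Hom_Ob[OF cat f]
  show "yoneda V v y (act F f a) = act V f (yoneda V v x a)"
    by (rule free_linear_ext[OF V.fib_module[OF o(2)] linear_map_comp[OF act_linear[OF f] yoneda_linear[OF o(2)]]
        linear_map_comp[OF yoneda_linear[OF o(1)] V.act_linear[OF f]] _ a])
      (simp add: act_basis[OF f] yoneda_basis category_Comp[OF cat _ f] V.act_Comp[OF _ f v])
qed

end

end

text \<open>Freeness of a single fibre over \<open>k\<close>, with no reference to the action;
  naturality of maps assembled in this way has to be checked separately.\<close>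

lemma (in free_module) free_extend:
  assumes N: "module k N" and b: "\<And>g. g \<in> Hom C n x \<Longrightarrow> b g \<in> carrier N"
  obtains L where "linear_map k (fib F x) N L" "\<And>g. g \<in> Hom C n x \<Longrightarrow> L (basis k C n x g) = b g"
proof -
  interpret N: module k N by (rule N)
  have l: "linear_map k (kmod k) N (\<lambda>c. c \<odot>\<^bsub>N\<^esub> b g)" if "g \<in> Hom C n x" for g
    using b[OF that] by (intro linear_mapI) (auto simp: N.smult_l_distr N.smult_assoc1)
  show thesis
  proof (rule that)
    show "linear_map k (fib F x) N (fext (Hom C n x) (\<lambda>_. kmod k) N (\<lambda>g c. c \<odot>\<^bsub>N\<^esub> b g))"
      unfolding free_cmod_fib by (rule fsum_module.fext_linear[OF fm N l])
    fix g assume g: "g \<in> Hom C n x"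
    have "fext (Hom C n x) (\<lambda>_. kmod k) N (\<lambda>g c. c \<odot>\<^bsub>N\<^esub> b g) (basis k C n x g) = \<one>\<^bsub>k\<^esub> \<odot>\<^bsub>N\<^esub> b g"
      unfolding basis_def by (rule fsum_module.fext_inc[OF fm N l g]) auto
    then show "fext (Hom C n x) (\<lambda>_. kmod k) N (\<lambda>g c. c \<odot>\<^bsub>N\<^esub> b g) (basis k C n x g) = b g"
      using b[OF g] by simp
  qed
qed

locale free_sum_module =
  fixes k :: "'k ring" and C :: "('o, 'a) cat" and c :: "'o \<Rightarrow> 'i set"
  assumes k: "cring k" and cat: "category C"
begin

abbreviation "J \<equiv> (SIGMA n:Ob C. c n)"
abbreviation "W \<equiv> (\<lambda>(n, i :: 'i). free_cmod k C n)"

lemma fr: "n \<in> Ob C \<Longrightarrow> free_module k C n"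
  using k cat by (simp add: free_module_def)

lemma family: "cmod_family k C J W"
proof (rule cmod_family.intro[OF k cat])
  fix j :: "'o \<times> 'i" assume "j \<in> J"
  then show "cmodule k C (W j)" using free_module.cmodule_free[OF fr] by auto
qed

lemma cmodule_free_sum: "cmodule k C (free_sum k C c)"
  unfolding free_sum_def by (rule cmod_family.cmodule_direct_sum[OF family])

lemma hom_proj: "n \<in> Ob C \<Longrightarrow> i \<in> c n \<Longrightarrow> cmod_hom k C (free_sum k C c) (free_cmod k C n) (\<lambda>x a. a (n, i))"
  unfolding free_sum_def using cmod_family.hom_proj[OF family, of "(n, i)"] by simp

text \<open>The identity of \<open>n\<close> in the copy of \<open>M(n)\<close> with index
  \<open>i\<close>. These elements form the standard generators of the sum.\<close>

definition gener :: "'o \<Rightarrow> 'i \<Rightarrow> 'o \<times> 'i \<Rightarrow> 'a \<Rightarrow> 'k" where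
  "gener n i = inc J (\<lambda>j. fib (W j) n) (n, i) (basis k C n n (Ident C n))"

lemma gener_closed: "n \<in> Ob C \<Longrightarrow> i \<in> c n \<Longrightarrow> gener n i \<in> car (free_sum k C c) n"
  unfolding gener_def free_sum_def direct_sum_fib
  by (rule fsum_module.inc_carrier[OF cmod_family.fm[OF family]])
    (auto intro: free_module.basis_closed[OF fr] category_Ident[OF cat])

lemma gen_gener:
  assumes x: "x \<in> Ob C" and a: "a \<in> car (free_sum k C c) x"
  shows "gen k C (free_sum k C c) (\<lambda>n. gener n ` c n) x a"
  using a unfolding free_sum_def direct_sum_fib
proof (induction rule: fsum_module.fsum_induct[OF cmod_family.fm[OF family x], consumes 1, case_names zero add inc])
  case zero
  show ?case using gen_zero[OF x, of k "direct_sum J W"] by (simp add: direct_sum_fib)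
next
  case (add a b)
  then show ?case using gen_add[of k C "direct_sum J W" _ x a b] by (simp add: direct_sum_fib)
next
  case (inc j m)
  then obtain n i where j: "j = (n, i)" "n \<in> Ob C" "i \<in> c n" by auto
  let ?V = "direct_sum J W"
  note L = fsum_module.inc_linear[OF cmod_family.fm[OF family x] inc(1)]
  have m: "m \<in> car (free_cmod k C n) x" using inc(2) j by simp
  show ?case using m
  proof (induction rule: free_module.free_induct[OF fr[OF j(2)], consumes 1, case_names zero add smult basis])
    case zero
    have "inc J (\<lambda>j. fib (W j) x) j \<zero>\<^bsub>fib (free_cmod k C n) x\<^esub> = \<zero>\<^bsub>fib ?V x\<^esub>"
      using linear_map_zero[OF _ _ L] fsum_module.module_fsum[OF cmod_family.fm[OF family x]]
        free_module.fib_module[OF fr[OF j(2)]] by (simp add: j direct_sum_fib)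
    then show ?case using gen_zero[OF x, of k ?V] by simp
  next
    case (add a b)
    then show ?case
      using linear_map_add[OF L, of a b] gen_add[of k C ?V _ x] by (simp add: j(1) direct_sum_fib)
  next
    case (smult r a)
    then show ?case
      using linear_map_smult[OF L, of r a] gen_smult[of r k C ?V _ x] by (simp add: j(1) direct_sum_fib)
  next
    case (basis g)
    have "act ?V g (gener n i) = inc J (\<lambda>j. fib (W j) x) (n, i) (act (free_cmod k C n) g (basis k C n n (Ident C n)))"
      unfolding gener_def using cmod_family.act_inc[OF family basis, of "(n, i)"] j by simp
    also have "act (free_cmod k C n) g (basis k C n n (Ident C n)) = basis k C n x g"
      using free_module.act_basis[OF fr[OF j(2)] basis category_Ident[OF cat j(2)]]
        category_Comp_Ident(1)[OF cat basis] by simp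
    finally show ?case
      using gen_gen[of "gener n i" "\<lambda>n. gener n ` c n" n g C x k ?V] j basis by simp
  qed
qed

lemma free_sum_lift:
  assumes V: "cmodule k C V" and v: "\<And>n i. n \<in> Ob C \<Longrightarrow> i \<in> c n \<Longrightarrow> v n i \<in> car V n"
  obtains \<Phi> where "cmod_hom k C (free_sum k C c) V \<Phi>"
    and "\<And>n i. n \<in> Ob C \<Longrightarrow> i \<in> c n \<Longrightarrow> \<Phi> n (gener n i) = v n i"
proof -
  interpret V: cmod k C V using cat V by unfold_locales
  define \<phi> where "\<phi> = (\<lambda>(n, i). free_module.yoneda k C n V (v n i))"
  define \<Phi> where "\<Phi> = (\<lambda>x. fext J (\<lambda>j. fib (W j) x) (fib V x) (\<lambda>j. \<phi> j x))"
  have h: "cmod_hom k C (W j) V (\<phi> j)" if "j \<in> J" for j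
    using that free_module.yoneda_hom[OF fr V v] by (auto simp: \<phi>_def)
  show thesis
  proof (rule that)
    show "cmod_hom k C (free_sum k C c) V \<Phi>"
      unfolding \<Phi>_def free_sum_def by (rule cmod_family.hom_fext[OF family V h])
    fix n i assume n: "n \<in> Ob C" and i: "i \<in> c n"
    note id = category_Ident[OF cat n]
    have j: "(n, i) \<in> J" using n i by auto
    have l: "linear_map k (fib (W j) n) (fib V n) (\<phi> j n)" if "j \<in> J" for j
      using h[OF that] n by (auto simp: cmod_hom_def)
    have "\<Phi> n (gener n i) = \<phi> (n, i) n (basis k C n n (Ident C n))"
      unfolding \<Phi>_def gener_def
      by (rule fsum_module.fext_inc[OF cmod_family.fm[OF family n] V.fib_module[OF n] l j])
        (auto intro: free_module.basis_closed[OF fr[OF n] id])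
    also have "\<dots> = v n i"
      using free_module.yoneda_basis[OF fr[OF n] V v[OF n i] id] V.act_Ident[OF n v[OF n i]]
      by (simp add: \<phi>_def)
    finally show "\<Phi> n (gener n i) = v n i" .
  qed
qed

end

lemma (in free_sum_module) gfd_free_sum:
  assumes "\<forall>n \<in> Ob C. N \<le> deg n \<longrightarrow> c n = {}"
  shows "gfd k C deg (free_sum k C c) (car (free_sum k C c))"
proof -
  interpret V: cmod k C "free_sum k C c" using cat cmodule_free_sum by unfold_locales
  show ?thesis
  proof (rule V.gfdI[where N=N and S="\<lambda>n. gener n ` c n"])
    fix n s assume "n \<in> Ob C" "s \<in> gener n ` c n"
    then show "deg n < N" using assms by fastforce
  qed (use gener_closed gen_gener in auto)
qed

lemma (in cmod_map) subm_image: "subm k C W (\<lambda>x. \<phi> x ` car V x)"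
  unfolding subm_def
proof (intro conjI ballI allI)
  fix x assume x: "x \<in> Ob C"
  show "\<phi> x ` car V x \<subseteq> car W x" using map_closed[OF x] by auto
  show "\<zero>\<^bsub>fib W x\<^esub> \<in> \<phi> x ` car V x"
    by (rule image_eqI[of _ _ "\<zero>\<^bsub>fib V x\<^esub>"]) (simp_all add: map_zero[OF x] V.zero_closed[OF x])
  show "u \<oplus>\<^bsub>fib W x\<^esub> v \<in> \<phi> x ` car V x" if uv: "u \<in> \<phi> x ` car V x" "v \<in> \<phi> x ` car V x" for u v
  proof -
    from uv obtain a b where ab: "u = \<phi> x a" "a \<in> car V x" "v = \<phi> x b" "b \<in> car V x" by blast
    then show ?thesis
      by (intro image_eqI[of _ _ "a \<oplus>\<^bsub>fib V x\<^esub> b"]) (simp_all add: map_add[OF x] V.add_closed[OF x])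
  qed
  show "c \<odot>\<^bsub>fib W x\<^esub> v \<in> \<phi> x ` car V x" if "c \<in> carrier k" "v \<in> \<phi> x ` car V x" for c v
  proof -
    from that(2) obtain a where "v = \<phi> x a" "a \<in> car V x" by blast
    then show ?thesis using that(1)
      by (intro image_eqI[of _ _ "c \<odot>\<^bsub>fib V x\<^esub> a"]) (simp_all add: map_smult[OF x] V.smult_closed[OF x])
  qed
next
  fix x y f w assume f: "f \<in> Hom C x y" and "w \<in> \<phi> x ` car V x"
  then obtain a where "w = \<phi> x a" "a \<in> car V x" by blast
  then show "act W f w \<in> \<phi> y ` car V y"
    by (intro image_eqI[of _ _ "act V f a"]) (simp_all add: map_act[OF f] V.act_closed[OF f])
qed

text \<open>The generators themselves serve as multiplicities: the copy with index \<open>i\<close>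
  in \<open>c n\<close> is mapped by sending its identity to \<open>i\<close>. Thus the index sets
  lie in the element type of the module, as the definition of finite generation degrees
  demands.\<close>

lemma (in cmod) free_cover:
  fixes c :: "'o \<Rightarrow> 'v set"
  assumes k: "cring k" and c: "\<forall>n \<in> Ob C. c n \<subseteq> car V n"
    and g: "\<And>x v. x \<in> Ob C \<Longrightarrow> v \<in> car V x \<Longrightarrow> gen k C V c x v"
  obtains \<phi> where "cmod_hom k C (free_sum k C c) V \<phi>" "cmod_surj C (free_sum k C c) V \<phi>"
proof -
  interpret F: free_sum_module k C c by (rule free_sum_module.intro[OF k cat])
  obtain \<phi> where \<phi>: "cmod_hom k C (free_sum k C c) V \<phi>"
      "\<And>n i. n \<in> Ob C \<Longrightarrow> i \<in> c n \<Longrightarrow> \<phi> n (F.gener n i) = i"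
    by (rule F.free_sum_lift[OF cm, of "\<lambda>n i. i"]) (use c in auto)
  interpret m: cmod_map k C "free_sum k C c" V \<phi>
    using F.cmodule_free_sum \<phi>(1) cat by unfold_locales
  have s: "\<forall>n \<in> Ob C. c n \<subseteq> \<phi> n ` car (free_sum k C c) n"
  proof (intro ballI subsetI)
    fix n i assume n: "n \<in> Ob C" and i: "i \<in> c n"
    show "i \<in> \<phi> n ` car (free_sum k C c) n"
      by (rule image_eqI[where x="F.gener n i"]) (simp_all add: \<phi>(2)[OF n i] F.gener_closed[OF n i])
  qed
  have "cmod_surj C (free_sum k C c) V \<phi>"
    unfolding cmod_surj_def
  proof (intro ballI equalityI subsetI)
    fix x v assume x: "x \<in> Ob C" and v: "v \<in> car V x"
    show "v \<in> \<phi> x ` car (free_sum k C c) x"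
      by (rule gen_subm[OF g[OF x v] m.subm_image cat s x])
  qed (use m.map_closed in auto)
  with \<phi>(1) show thesis by (rule that)
qed

text \<open>Translates between covers by free modules and the predicate \<open>gen\<close>. A cover
  of bounded degree carries the standard generators to generators of bounded degree; conversely, one
  copy of \<open>M(n)\<close> is taken for every element of degree less than
  \<open>N\<close>.\<close>

lemma (in cmod) gfd_iff:
  assumes k: "cring k"
  shows "generated_in_finite_degrees k C deg V \<longleftrightarrow> gfd k C deg V (car V)"
proof
  assume "generated_in_finite_degrees k C deg V"
  then obtain N and c :: "'o \<Rightarrow> 'v set" and \<phi> where c: "\<forall>n \<in> Ob C. N \<le> deg n \<longrightarrow> c n = {}"
    and \<phi>: "cmod_hom k C (free_sum k C c) V \<phi>" and s: "cmod_surj C (free_sum k C c) V \<phi>"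
    by (auto simp: generated_in_finite_degrees_def)
  interpret F: free_sum_module k C c by (rule free_sum_module.intro[OF k cat])
  interpret m: cmod_map k C "free_sum k C c" V \<phi>
    using F.cmodule_free_sum \<phi> cat by unfold_locales
  have "gfd k C deg (free_sum k C c) (car (free_sum k C c))"
    by (rule F.gfd_free_sum[OF c])
  then show "gfd k C deg V (car V)"
    by (rule m.gfd_image) (use s in \<open>auto simp: cmod_surj_def\<close>)
next
  assume g: "gfd k C deg V (car V)"
  obtain N where N: "\<And>M x v. M \<ge> N \<Longrightarrow> x \<in> Ob C \<Longrightarrow> v \<in> car V x \<Longrightarrow> gen k C V (below deg M (car V)) x v"
    using gfd_bound[OF g] by blast
  have "\<forall>n \<in> Ob C. below deg N (car V) n \<subseteq> car V n" by (auto simp: below_def)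
  then obtain \<phi> where "cmod_hom k C (free_sum k C (below deg N (car V))) V \<phi>"
      "cmod_surj C (free_sum k C (below deg N (car V))) V \<phi>"
    by (rule free_cover[OF k]) (use N in auto)
  moreover have "\<forall>n \<in> Ob C. N \<le> deg n \<longrightarrow> below deg N (car V) n = {}" by (auto simp: below_def)
  ultimately show "generated_in_finite_degrees k C deg V"
    unfolding generated_in_finite_degrees_def by blast
qed

subsection \<open>Cokernels by cosets\<close>

lemma abelian_subgroup_submodule:
  assumes "module k M" "submodule H k M"
  shows "abelian_subgroup H M"
  using assms by (intro abelian_subgroupI3 additive_subgroupI) (auto simp: submodule_def module_def)

text \<open>Scalars and arrows act on cosets by taking the image and adding the target submodule.
  This lemma identifies the result as the coset of the image of a representative and thereby serves
  both \<open>quotient_module\<close> and \<open>cokernel_cmod\<close>.\<close>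

lemma coset_image:
  assumes M: "module k M" and N: "module k N" and H: "submodule H k M" and K: "submodule K k N"
    and g: "linear_map k M N g" and HK: "g ` H \<subseteq> K" and v: "v \<in> carrier M"
  shows "K <+>\<^bsub>N\<^esub> g ` (H +>\<^bsub>M\<^esub> v) = K +>\<^bsub>N\<^esub> g v"
proof -
  interpret M: module k M by fact
  interpret N: module k N by fact
  interpret H: abelian_subgroup H M by (rule abelian_subgroup_submodule[OF M H])
  interpret K: abelian_subgroup K N by (rule abelian_subgroup_submodule[OF N K])
  have gv: "g v \<in> carrier N" by (rule linear_map_closed[OF g v])
  have HM: "h \<in> carrier M" if "h \<in> H" for h using H.a_subset that by auto
  have KN: "h \<in> carrier N" if "h \<in> K" for h using K.a_subset that by auto
  show ?thesis
  proof (intro equalityI subsetI)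
    fix w assume "w \<in> K <+>\<^bsub>N\<^esub> g ` (H +>\<^bsub>M\<^esub> v)"
    then obtain a h where a: "a \<in> K" and h: "h \<in> H" and w: "w = a \<oplus>\<^bsub>N\<^esub> g (h \<oplus>\<^bsub>M\<^esub> v)"
      by (auto simp: set_add_def' a_r_coset_def')
    have gh: "g h \<in> K" using HK h by auto
    have "w = (a \<oplus>\<^bsub>N\<^esub> g h) \<oplus>\<^bsub>N\<^esub> g v"
      unfolding w linear_map_add[OF g HM[OF h] v] using KN[OF a] KN[OF gh] gv by (simp add: N.M.a_assoc)
    then show "w \<in> K +>\<^bsub>N\<^esub> g v" using K.a_closed[OF a gh] by (auto simp: a_r_coset_def')
  next
    fix w assume "w \<in> K +>\<^bsub>N\<^esub> g v"
    then obtain a where a: "a \<in> K" and w: "w = a \<oplus>\<^bsub>N\<^esub> g v" by (auto simp: a_r_coset_def')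
    have "v \<in> H +>\<^bsub>M\<^esub> v" by (rule H.a_rcos_self[OF v])
    then show "w \<in> K <+>\<^bsub>N\<^esub> g ` (H +>\<^bsub>M\<^esub> v)" using a w by (auto simp: set_add_def')
  qed
qed

context cmod_map
begin

definition coset :: "'o \<Rightarrow> 'w \<Rightarrow> 'w set" where
  "coset x w = \<phi> x ` car V x +>\<^bsub>fib W x\<^esub> w"

abbreviation "coker \<equiv> cokernel_cmod C V W \<phi>"

lemma coset_surj: "car coker x = coset x ` car W x"
  by (auto simp: cokernel_cmod_def quotient_module_def A_RCOSETS_def' coset_def)

lemma coset_ker:
  assumes x: "x \<in> Ob C" and w: "w \<in> car W x"
  shows "coset x w = \<zero>\<^bsub>fib coker x\<^esub> \<longleftrightarrow> w \<in> \<phi> x ` car V x"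
proof -
  interpret H: abelian_subgroup "\<phi> x ` car V x" "fib W x"
    by (rule abelian_subgroup_submodule[OF W.fib_module[OF x] W.submodule_fib[OF subm_image x]])
  show ?thesis
    using H.a_rcos_self[OF w] H.a_rcos_const[of w]
    by (auto simp: cokernel_cmod_def quotient_module_def coset_def)
qed

lemma coset_hom: "cmod_hom k C W coker coset"
proof (rule cmod_homI)
  fix x assume x: "x \<in> Ob C"
  interpret x: module k "fib W x" by (rule W.fib_module[OF x])
  note H = W.submodule_fib[OF subm_image x]
  interpret H: abelian_subgroup "\<phi> x ` car V x" "fib W x"
    by (rule abelian_subgroup_submodule[OF W.fib_module[OF x] H])
  show "linear_map k (fib W x) (fib coker x) (coset x)"
  proof (rule linear_mapI)
    show "w \<in> car W x \<Longrightarrow> coset x w \<in> car coker x" for w by (auto simp: coset_surj)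
    fix u v assume "u \<in> car W x" "v \<in> car W x"
    then show "coset x (u \<oplus>\<^bsub>fib W x\<^esub> v) = coset x u \<oplus>\<^bsub>fib coker x\<^esub> coset x v"
      using H.a_rcos_sum by (simp add: cokernel_cmod_def quotient_module_def coset_def)
  next
    fix c v assume c: "c \<in> carrier k" and v: "v \<in> car W x"
    have "linear_map k (fib W x) (fib W x) (\<lambda>v. c \<odot>\<^bsub>fib W x\<^esub> v)"
      using c by (intro linear_mapI) (auto simp: x.smult_r_distr x.smult_assoc1[symmetric] x.R.m_comm)
    from coset_image[OF W.fib_module[OF x] W.fib_module[OF x] H H this _ v]
    show "coset x (c \<odot>\<^bsub>fib W x\<^esub> v) = c \<odot>\<^bsub>fib coker x\<^esub> coset x v"
      using submD(4)[OF subm_image x c] by (auto simp: cokernel_cmod_def quotient_module_def coset_def)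
  qed
next
  fix f x y v assume f: "f \<in> Hom C x y" and v: "v \<in> car W x"
  note o = category_Hom_Ob[OF W.cat f]
  have "act W f ` (\<phi> x ` car V x) \<subseteq> \<phi> y ` car V y"
    using submD(5)[OF subm_image f] by blast
  from coset_image[OF W.fib_module[OF o(1)] W.fib_module[OF o(2)] W.submodule_fib[OF subm_image o(1)]
      W.submodule_fib[OF subm_image o(2)] W.act_linear[OF f] this v]
  show "coset y (act W f v) = act coker f (coset x v)"
    using HomD[OF f] by (simp add: cokernel_cmod_def coset_def)
qed

end

section \<open>Categories with a shift functor\<close>

locale shift_category =
  fixes k :: "'k ring" and C :: "(nat, 'a) cat" and \<psi> :: "'a \<Rightarrow> 'a" and \<epsilon> :: "nat \<Rightarrow> 'a"
  assumes k: "cring k" and comb: "combinatorial_category C" and shift: "shift_structure k C \<psi> \<epsilon>"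
begin

lemma cat: "category C" and Ob [simp]: "Ob C = UNIV"
  using comb by (auto simp: combinatorial_category_def)

lemma Hom_le: "f \<in> Hom C r n \<Longrightarrow> r \<le> n"
  using comb by (auto simp: combinatorial_category_def)

lemma \<psi>: "is_functor C C Suc \<psi>"
  using shift by (simp add: shift_structure_def)

lemma \<epsilon>: "\<epsilon> n \<in> Hom C n (Suc n)"
  using shift by (auto simp: shift_structure_def natural_transformation_def)

lemma natural: "f \<in> Hom C x y \<Longrightarrow> Comp C (\<epsilon> y) f = Comp C (\<psi> f) (\<epsilon> x)"
  using shift by (auto simp: shift_structure_def natural_transformation_def Hom_def)

lemma split_arrow:
  assumes "r < l" "l < n" "f \<in> Hom C r n"
  obtains g h where "g \<in> Hom C r l" "h \<in> Hom C l n" "f = Comp C h g"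
  using assms comb unfolding combinatorial_category_def by meson

text \<open>This is where the transitivity of the automorphism groups, (C5), enters.\<close>

lemma factor_\<epsilon>:
  assumes f: "f \<in> Hom C n x" and "n < x"
  obtains w where "w \<in> Hom C (Suc n) x" "f = Comp C w (\<epsilon> n)"
proof -
  have trans: "\<exists>u \<in> Hom C (Suc n) (Suc n). Comp C u (\<epsilon> n) = g" if "g \<in> Hom C n (Suc n)" for g
    using comb \<epsilon>[of n] that unfolding combinatorial_category_def by (meson lessI)
  show thesis
  proof (cases "x = Suc n")
    case True
    then show thesis using trans f that by metis
  next
    case False
    then have "n < Suc n" "Suc n < x" using assms by auto
    then obtain g h where g: "g \<in> Hom C n (Suc n)" and h: "h \<in> Hom C (Suc n) x" and fe: "f = Comp C h g"
      by (rule split_arrow[OF _ _ f])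
    obtain u where u: "u \<in> Hom C (Suc n) (Suc n)" "Comp C u (\<epsilon> n) = g" using trans[OF g] by auto
    show thesis
    proof (rule that)
      show "Comp C h u \<in> Hom C (Suc n) x" by (rule category_Comp[OF cat u(1) h])
      show "f = Comp C (Comp C h u) (\<epsilon> n)"
        using category_assoc[OF cat \<epsilon> u(1) h] u(2) fe by simp
    qed
  qed
qed

abbreviation "Fr n \<equiv> free_cmod k C n"

lemma free: "free_module k C n"
  by (rule free_module.intro[OF k cat]) simp

lemma shift_hom:
  assumes V: "cmodule k C V"
  shows "cmod_map k C V (Shift \<psi> V) (shift_map \<epsilon> V)"
proof -
  interpret V: cmod k C V using cat V by unfold_locales
  have "cmodule k C (Shift \<psi> V)" by (rule cmodule_pullback[OF cat cat \<psi> V])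
  moreover have "cmod_hom k C V (Shift \<psi> V) (shift_map \<epsilon> V)"
  proof (rule cmod_homI)
    show "linear_map k (fib V x) (fib (Shift \<psi> V) x) (shift_map \<epsilon> V x)" for x
      using V.act_linear[OF \<epsilon>, of x] by (simp add: shift_map_def[abs_def])
    fix f x y v assume f: "f \<in> Hom C x y" and v: "v \<in> car V x"
    show "shift_map \<epsilon> V y (act V f v) = act (Shift \<psi> V) f (shift_map \<epsilon> V x v)"
      using V.act_Comp[OF f \<epsilon> v] V.act_Comp[OF \<epsilon> functor_Hom[OF \<psi> f] v]
      by (simp add: shift_map_def natural[OF f])
  qed
  ultimately show ?thesis using cat V by unfold_locales
qed

context
  fixes n :: nat
begin

interpretation F: free_module k C n by (rule free)
interpretation m: cmod_map k C "Fr n" "Shift \<psi> (Fr n)" "shift_map \<epsilon> (Fr n)"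
  by (rule shift_hom[OF F.cmodule_free])

lemma shift_inj:
  assumes "t \<in> car (Fr n) x" "act (Fr n) (\<epsilon> x) t = \<zero>\<^bsub>fib (Fr n) (Suc x)\<^esub>"
  shows "t = \<zero>\<^bsub>fib (Fr n) x\<^esub>"
proof -
  have "inj_on (shift_map \<epsilon> (Fr n) x) (car (Fr n) x)"
    using shift by (simp add: shift_structure_def Let_def cmod_inj_def)
  then show ?thesis
    by (rule inj_onD) (use m.map_zero[of x] m.V.zero_closed[of x] assms in \<open>auto simp: shift_map_def\<close>)
qed

lemma coker_projective: "projective k C m.coker"
  and coker_degree: "generation_degree k C m.coker \<le> ereal (real n - 1)"
  using shift unfolding shift_structure_def Let_def by blast+

lemma coker_map: "cmod_map k C (Shift \<psi> (Fr n)) m.coker m.coset"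
  using m.coset_hom m.W.cm cat coker_projective by unfold_locales (auto simp: projective_def)

text \<open>Strong induction on the object. Below \<open>n\<close> every element is itself a
  generator. From \<open>n\<close> on the bound on the generation degree says that the fibre is
  spanned by translates from smaller objects, and these are generated by the induction
  hypothesis.\<close>

lemma coker_gen:
  assumes "v \<in> car m.coker x"
  shows "gen k C m.coker (below id n (car m.coker)) x v"
  using assms
proof (induction x arbitrary: v rule: less_induct)
  case (less x)
  interpret p: cmod_map k C "Shift \<psi> (Fr n)" m.coker m.coset by (rule coker_map)
  let ?B = "below id n (car m.coker)"
  have B: "\<forall>r \<in> Ob C. ?B r \<subseteq> car m.coker r" by (auto simp: below_def)
  show ?case
  proof (cases "x < n")
    case True
    then show ?thesis using less.prems by (intro p.W.gen_base[OF _ _ B]) (auto simp: below_def)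
  next
    case False
    let ?G = "{act m.coker f w | f w r. r < x \<and> f \<in> Hom C r x \<and> w \<in> car m.coker r}"
    have "car m.coker x = submodule_span k (fib m.coker x) ?G"
    \<comment> \<open>Otherwise \<open>x\<close> belongs to the set whose supremum is the generation
      degree, so that \<open>x\<close> is at most \<open>n - 1\<close>. The subtraction is real: for
      \<open>n = 0\<close> the bound is -1, and no object can violate spanning.\<close>
    proof (rule ccontr)
      assume ne: "car m.coker x \<noteq> submodule_span k (fib m.coker x) ?G"
      define T where "T = {x. car m.coker x \<noteq> submodule_span k (fib m.coker x)
        {act m.coker f w | f w r. r < x \<and> f \<in> Hom C r x \<and> w \<in> car m.coker r}}"
      have x: "x \<in> T" unfolding T_def mem_Collect_eq by (fact ne)
      then have "T \<noteq> {}" by (metis empty_iff)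
      then have "generation_degree k C m.coker = (SUP n\<in>T. ereal (real n))"
        unfolding generation_degree_def Let_def T_def by (rule if_not_P)
      moreover have "ereal (real x) \<le> (SUP n\<in>T. ereal (real n))" by (rule SUP_upper[OF x])
      ultimately have "ereal (real x) \<le> ereal (real n - 1)" using coker_degree by (metis order_trans)
      then show False using False by simp
    qed
    moreover have "submodule {v. gen k C m.coker ?B x v} k (fib m.coker x)"
      by (rule p.W.submodule_fib[OF p.W.subm_gen[OF B]]) simp
    moreover have "?G \<subseteq> {v. gen k C m.coker ?B x v}"
      using less.IH p.W.gen_act[OF _ B] by blast
    ultimately show ?thesis using less.prems unfolding submodule_span_def by blast
  qed
qed

text \<open>Projectivity splits the surjection from a free module onto the cokernel of the shift map, so
  that this cokernel embeds into a sum of representables of smaller degree.\<close>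

lemma shift_embedding:
  obtains S :: "(nat \<times> (nat \<Rightarrow> ('a \<Rightarrow> 'k) \<Rightarrow> ('a \<Rightarrow> 'k))) set" where
    "\<And>r \<sigma>. (r, \<sigma>) \<in> S \<Longrightarrow> r < n \<and> cmod_hom k C (Shift \<psi> (Fr n)) (Fr r) \<sigma>"
    "\<And>x v. v \<in> car (Fr n) (Suc x) \<Longrightarrow>
       (\<forall>(r, \<sigma>) \<in> S. \<sigma> x v = \<zero>\<^bsub>fib (Fr r) x\<^esub>) \<longleftrightarrow> (\<exists>t \<in> car (Fr n) x. v = act (Fr n) (\<epsilon> x) t)"
proof -
  interpret p: cmod_map k C "Shift \<psi> (Fr n)" m.coker m.coset by (rule coker_map)
  define c where "c = below id n (car m.coker)"
  have c: "\<forall>r \<in> Ob C. c r \<subseteq> car m.coker r" by (auto simp: below_def c_def)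
  interpret A: free_sum_module k C c by (rule free_sum_module.intro[OF k cat])
  obtain \<pi> where \<pi>: "cmod_hom k C (free_sum k C c) m.coker \<pi>" "cmod_surj C (free_sum k C c) m.coker \<pi>"
    by (rule p.W.free_cover[OF k c]) (auto simp: c_def intro: coker_gen)
  \<comment> \<open>Lifting the identity of the cokernel along its free cover \<open>\<pi>\<close>
    gives a section \<open>\<alpha>\<close>, which is injective because \<open>\<pi>\<close> undoes
    it.\<close>
  have "cmod_hom k C m.coker m.coker (\<lambda>x w. w)"
    by (rule cmod_homI) (auto intro: linear_mapI)
  then obtain \<alpha> where \<alpha>: "cmod_hom k C m.coker (free_sum k C c) \<alpha>"
    and \<pi>\<alpha>: "\<And>x w. w \<in> car m.coker x \<Longrightarrow> \<pi> x (\<alpha> x w) = w"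
    using coker_projective A.cmodule_free_sum \<pi> p.W.cm unfolding projective_def by simp metis
  interpret \<alpha>: cmod_map k C m.coker "free_sum k C c" \<alpha>
    using \<alpha> A.cmodule_free_sum cat p.W.cm by unfold_locales
  interpret \<pi>: cmod_map k C "free_sum k C c" m.coker \<pi>
    using \<pi> A.cmodule_free_sum cat p.W.cm by unfold_locales
  \<comment> \<open>The functionals are the components of \<open>\<alpha>\<close> composed with the
    quotient map. All of them vanish at \<open>v\<close> exactly when the class of \<open>v\<close>
    is zero, that is, when \<open>v\<close> comes from the shift map.\<close>
  define \<sigma> where "\<sigma> = (\<lambda>r q x v. \<alpha> x (m.coset x v) (r, q))"
  define S where "S = {(r, \<sigma> r q) | r q. q \<in> c r}"
  have h: "cmod_hom k C (Shift \<psi> (Fr n)) (Fr r) (\<sigma> r q)" if "q \<in> c r" for r q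
    unfolding \<sigma>_def
    by (rule cmod_hom_comp[OF cat cmod_hom_comp[OF cat m.coset_hom \<alpha>] A.hom_proj]) (use that in auto)
  show thesis
  proof (rule that[of S])
    fix r s assume "(r, s) \<in> S"
    then show "r < n \<and> cmod_hom k C (Shift \<psi> (Fr n)) (Fr r) s"
      using h by (auto simp: S_def c_def below_def)
  next
    fix x v assume v: "v \<in> car (Fr n) (Suc x)"
    have q: "m.coset x v \<in> car m.coker x" using p.map_closed[of x v] v by simp
    have ker: "m.coset x v = \<zero>\<^bsub>fib m.coker x\<^esub> \<longleftrightarrow> (\<exists>t \<in> car (Fr n) x. v = act (Fr n) (\<epsilon> x) t)"
      using m.coset_ker[of x v] v by (auto simp: shift_map_def)
    have zero: "\<zero>\<^bsub>fib (free_sum k C c) x\<^esub> = (\<lambda>j \<in> Sigma (Ob C) c. \<zero>\<^bsub>fib (Fr (fst j)) x\<^esub>)"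
      by (auto simp: free_sum_def direct_sum_fib fsum_simps case_prod_beta)
    show "(\<forall>(r, s) \<in> S. s x v = \<zero>\<^bsub>fib (Fr r) x\<^esub>) \<longleftrightarrow> (\<exists>t \<in> car (Fr n) x. v = act (Fr n) (\<epsilon> x) t)"
    proof
      assume s: "\<forall>(r, s) \<in> S. s x v = \<zero>\<^bsub>fib (Fr r) x\<^esub>"
      have "\<alpha> x (m.coset x v) = \<zero>\<^bsub>fib (free_sum k C c) x\<^esub>"
      proof (rule extensionalityI)
        show "\<alpha> x (m.coset x v) \<in> extensional (Sigma (Ob C) c)"
          using \<alpha>.map_closed[OF _ q] by (auto simp: free_sum_def direct_sum_fib fsum_simps PiE_def)
        show "\<zero>\<^bsub>fib (free_sum k C c) x\<^esub> \<in> extensional (Sigma (Ob C) c)" unfolding zero by simp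
        fix j assume j: "j \<in> Sigma (Ob C) c"
        then obtain r q where "j = (r, q)" "q \<in> c r" by auto
        then show "\<alpha> x (m.coset x v) j = \<zero>\<^bsub>fib (free_sum k C c) x\<^esub> j"
          using s j unfolding zero by (auto simp: S_def \<sigma>_def)
      qed
      then have "m.coset x v = \<zero>\<^bsub>fib m.coker x\<^esub>"
        using \<pi>\<alpha>[OF q] \<pi>.map_zero[of x] by simp
      then show "\<exists>t \<in> car (Fr n) x. v = act (Fr n) (\<epsilon> x) t" using ker by blast
    next
      assume "\<exists>t \<in> car (Fr n) x. v = act (Fr n) (\<epsilon> x) t"
      then have "\<alpha> x (m.coset x v) = \<zero>\<^bsub>fib (free_sum k C c) x\<^esub>"
        using ker \<alpha>.map_zero[of x] by simp
      then show "\<forall>(r, s) \<in> S. s x v = \<zero>\<^bsub>fib (Fr r) x\<^esub>"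
        by (auto simp: S_def \<sigma>_def zero)
    qed
  qed
qed

text \<open>The shift of \<open>M(n)\<close> is an extension of the cokernel, generated at objects
  below \<open>n\<close>, by the image of \<open>M(n)\<close>, generated by the image of the
  identity at the object \<open>n\<close>. The inclusive bound \<open>r \<le> n\<close> accounts for
  the latter.\<close>

lemma gen_shift_free:
  assumes v: "v \<in> car (Fr n) (Suc x)"
  shows "gen k C (Shift \<psi> (Fr n)) (\<lambda>r. {w \<in> car (Fr n) (Suc r). r \<le> n}) x v"
proof -
  interpret p: cmod_map k C "Shift \<psi> (Fr n)" m.coker m.coset by (rule coker_map)
  let ?S = "\<lambda>r. {w \<in> car (Fr n) (Suc r). r \<le> n}"
  have b: "basis k C n n (Ident C n) \<in> car (Fr n) n"
    by (rule F.basis_closed[OF category_Ident[OF cat]]) simp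
  show ?thesis
  proof (rule p.gen_extension[OF m.W.subm_car])
    show "\<forall>r \<in> Ob C. ?S r \<subseteq> car (Shift \<psi> (Fr n)) r" by auto
  next
    fix x v assume "v \<in> car (Shift \<psi> (Fr n)) x" "m.coset x v = \<zero>\<^bsub>fib m.coker x\<^esub>"
    then obtain t where t: "t \<in> car (Fr n) x" "v = shift_map \<epsilon> (Fr n) x t"
      using m.coset_ker[of x v] by auto
    have "gen k C (Shift \<psi> (Fr n))
        (\<lambda>r. shift_map \<epsilon> (Fr n) r ` (if r = n then {basis k C n n (Ident C n)} else {})) x v"
      unfolding t(2)
      by (rule m.gen_image[OF F.gen_free[OF t(1)]]) (use b in auto)
    then show "gen k C (Shift \<psi> (Fr n)) ?S x v"
    proof (rule gen_mono[OF _ _ cat], intro ballI subsetI)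
      fix r w assume "w \<in> shift_map \<epsilon> (Fr n) r ` (if r = n then {basis k C n n (Ident C n)} else {})"
      then have "r = n" "w = shift_map \<epsilon> (Fr n) n (basis k C n n (Ident C n))" by (auto split: if_splits)
      then show "w \<in> ?S r"
        using m.map_closed[OF _ b] by auto
    qed
  next
    fix x v assume "v \<in> car (Shift \<psi> (Fr n)) x"
    then have "m.coset x v \<in> car m.coker x" using p.map_closed[of x v] by simp
    from coker_gen[OF this] show "gen k C m.coker (\<lambda>r. m.coset r ` ?S r) x (m.coset x v)"
    proof (rule gen_mono[OF _ _ cat], intro ballI subsetI)
      fix r w assume "w \<in> below id n (car m.coker) r"
      then show "w \<in> m.coset r ` ?S r" by (auto simp: below_def m.coset_surj)
    qed
  qed (use v in auto)
qed

end

end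

section \<open>Products of categories\<close>

lemma prod_cat_Ob: "Ob (prod_cat I C) = (\<Pi>\<^sub>E i\<in>I. Ob (C i))"
  by (simp add: prod_cat_def)

lemma prod_cat_Hom:
  "f \<in> Hom (prod_cat I C) x y \<longleftrightarrow>
     x \<in> extensional I \<and> y \<in> extensional I \<and> f \<in> (\<Pi>\<^sub>E i\<in>I. Hom (C i) (x i) (y i))"
proof
  assume f: "f \<in> Hom (prod_cat I C) x y"
  then have "x = (\<lambda>i\<in>I. Dom (C i) (f i))" "y = (\<lambda>i\<in>I. Cod (C i) (f i))" "f \<in> (\<Pi>\<^sub>E i\<in>I. Ar (C i))"
    by (auto simp: Hom_def prod_cat_def)
  then show "x \<in> extensional I \<and> y \<in> extensional I \<and> f \<in> (\<Pi>\<^sub>E i\<in>I. Hom (C i) (x i) (y i))"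
    by (auto simp: Hom_def PiE_iff)
next
  assume a: "x \<in> extensional I \<and> y \<in> extensional I \<and> f \<in> (\<Pi>\<^sub>E i\<in>I. Hom (C i) (x i) (y i))"
  then have "f \<in> (\<Pi>\<^sub>E i\<in>I. Ar (C i))" by (auto simp: Hom_def PiE_iff)
  moreover have "(\<lambda>i\<in>I. Dom (C i) (f i)) = x" "(\<lambda>i\<in>I. Cod (C i) (f i)) = y"
    using a by (auto simp: Hom_def PiE_iff extensional_def fun_eq_iff)
  ultimately show "f \<in> Hom (prod_cat I C) x y"
    by (simp add: Hom_def prod_cat_def)
qed

lemma prod_cat_Comp: "Comp (prod_cat I C) g f = (\<lambda>i\<in>I. Comp (C i) (g i) (f i))"
  by (simp add: prod_cat_def)

lemma prod_cat_Ident: "Ident (prod_cat I C) x = (\<lambda>i\<in>I. Ident (C i) (x i))"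
  by (simp add: prod_cat_def)

lemma category_prod:
  assumes "\<And>i. i \<in> I \<Longrightarrow> category (C i)"
  shows "category (prod_cat I C)"
proof -
  have H: "Ident (C i) a \<in> Ar (C i)" "Dom (C i) (Ident (C i) a) = a" "Cod (C i) (Ident (C i) a) = a"
    if "i \<in> I" "a \<in> Ob (C i)" for i a
    using HomD[OF category_Ident[OF assms[OF that(1)] that(2)]] .
  have K: "Comp (C i) g f \<in> Ar (C i)" "Dom (C i) (Comp (C i) g f) = Dom (C i) f"
      "Cod (C i) (Comp (C i) g f) = Cod (C i) g"
    if "i \<in> I" "f \<in> Ar (C i)" "g \<in> Ar (C i)" "Cod (C i) f = Dom (C i) g" for i f g
    using HomD[OF category_Comp[OF assms[OF that(1)] Ar_Hom[OF that(2)], of g "Cod (C i) g"]] that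
    by (auto simp: Hom_def)
  show ?thesis
    unfolding category_def
  proof (intro conjI ballI impI)
    fix f assume f: "f \<in> Ar (prod_cat I C)"
    show "Dom (prod_cat I C) f \<in> Ob (prod_cat I C)" "Cod (prod_cat I C) f \<in> Ob (prod_cat I C)"
      using f assms by (auto simp: prod_cat_def category_def PiE_iff)
    show "Comp (prod_cat I C) f (Ident (prod_cat I C) (Dom (prod_cat I C) f)) = f"
      "Comp (prod_cat I C) (Ident (prod_cat I C) (Cod (prod_cat I C) f)) f = f"
      using f category_Comp_Ident[OF assms Ar_Hom]
      by (auto simp: prod_cat_def PiE_iff extensional_def fun_eq_iff)
    fix g assume g: "g \<in> Ar (prod_cat I C)"
    {
      assume fg: "Cod (prod_cat I C) f = Dom (prod_cat I C) g"
      have e: "Cod (C i) (f i) = Dom (C i) (g i)" if "i \<in> I" for i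
        using fun_cong[OF fg, of i] that by (simp add: prod_cat_def)
      then show "Comp (prod_cat I C) g f \<in> Hom (prod_cat I C) (Dom (prod_cat I C) f) (Cod (prod_cat I C) g)"
        using f g K by (auto simp: prod_cat_def Hom_def PiE_iff fun_eq_iff)
      fix h assume h: "h \<in> Ar (prod_cat I C)" and gh: "Cod (prod_cat I C) g = Dom (prod_cat I C) h"
      have e': "Cod (C i) (g i) = Dom (C i) (h i)" if "i \<in> I" for i
        using fun_cong[OF gh, of i] that by (simp add: prod_cat_def)
      have "Comp (C i) (h i) (Comp (C i) (g i) (f i)) = Comp (C i) (Comp (C i) (h i) (g i)) (f i)"
        if "i \<in> I" for i
        using assms[OF that] f g h e[OF that] e'[OF that] that
        by (auto simp: category_def prod_cat_def PiE_iff)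
      then show "Comp (prod_cat I C) h (Comp (prod_cat I C) g f)
          = Comp (prod_cat I C) (Comp (prod_cat I C) h g) f"
        by (auto simp: prod_cat_def fun_eq_iff)
    }
  next
    fix x assume "x \<in> Ob (prod_cat I C)"
    then show "Ident (prod_cat I C) x \<in> Hom (prod_cat I C) x x"
      using H by (auto simp: prod_cat_def Hom_def PiE_iff extensional_def fun_eq_iff)
  qed
qed

text \<open>Restricting coefficients along an injection of sets of arrows projects one free
  \<open>k\<close>-module onto another: basis vectors in the image of \<open>h\<close> go to basis
  vectors, the remaining ones to zero. Injectivity keeps supports finite. It is applied to arrows of
  a product with one of their two parts held fixed.\<close>

lemma free_restrict:
  fixes k :: "'k ring"
  assumes k: "cring k" and C: "free_module k C m" and D: "free_module k D n"
    and h: "inj_on h (Hom C m y)" "h ` Hom C m y \<subseteq> Hom D n x"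
    and \<tau>_def: "\<And>\<alpha>. \<tau> \<alpha> = (\<lambda>w \<in> Hom C m y. \<alpha> (h w))"
  shows "linear_map k (fib (free_cmod k D n) x) (fib (free_cmod k C m) y) \<tau>"
    and "w \<in> Hom C m y \<Longrightarrow> \<tau> (basis k D n x (h w)) = basis k C m y w"
    and "g \<in> Hom D n x \<Longrightarrow> g \<notin> h ` Hom C m y \<Longrightarrow> \<tau> (basis k D n x g) = \<zero>\<^bsub>fib (free_cmod k C m) y\<^esub>"
proof -
  show "linear_map k (fib (free_cmod k D n) x) (fib (free_cmod k C m) y) \<tau>"
  proof (rule linear_mapI)
    fix \<alpha> assume a: "\<alpha> \<in> car (free_cmod k D n) x"
    have "finite (h -` {g \<in> Hom D n x. \<alpha> g \<noteq> \<zero>\<^bsub>k\<^esub>} \<inter> Hom C m y)"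
      by (rule finite_vimage_IntI[OF _ h(1)]) (use a in \<open>simp add: free_cmod_fib fsum_simps\<close>)
    moreover have "{w \<in> Hom C m y. \<tau> \<alpha> w \<noteq> \<zero>\<^bsub>k\<^esub>} = h -` {g \<in> Hom D n x. \<alpha> g \<noteq> \<zero>\<^bsub>k\<^esub>} \<inter> Hom C m y"
      using h(2) by (auto simp: \<tau>_def)
    ultimately show "\<tau> \<alpha> \<in> car (free_cmod k C m) y"
      using a h(2) by (auto simp: free_cmod_fib fsum_simps \<tau>_def PiE_iff)
  qed (use h(2) in \<open>auto simp: free_cmod_fib fsum_simps \<tau>_def fun_eq_iff\<close>)
  show "w \<in> Hom C m y \<Longrightarrow> \<tau> (basis k D n x (h w)) = basis k C m y w"
    using h by (auto simp: basis_def inc_def \<tau>_def fun_eq_iff dest: inj_onD)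
  show "g \<in> Hom D n x \<Longrightarrow> g \<notin> h ` Hom C m y \<Longrightarrow> \<tau> (basis k D n x g) = \<zero>\<^bsub>fib (free_cmod k C m) y\<^esub>"
    using h(2) by (auto simp: basis_def inc_def \<tau>_def fun_eq_iff free_cmod_fib fsum_simps)
qed

text \<open>The functor turns every arrow used upstairs into an arrow of \<open>D\<close> between
  the images of the objects, so a combination found in the pullback can be read in \<open>V\<close>.
  This is how generation in slices, lines and shifts is turned into generation in the whole
  module.\<close>

lemma gen_pullback:
  assumes "gen k C (pullback_cmod Fo Fa V) T x v" and G: "is_functor C D Fo Fa"
    and C: "category C" and T: "\<And>n. n \<in> Ob C \<Longrightarrow> T n \<subseteq> S (Fo n)"
  shows "gen k D V S (Fo x) v"
  using assms(1)
proof (induction rule: gen.induct)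
  case (gen_gen s n f x)
  then show ?case
    using gen.gen_gen[of s S "Fo n" "Fa f" D "Fo x" k V] functor_Hom[OF G gen_gen(2)]
      T[OF category_Hom_Ob(1)[OF C gen_gen(2)]] by auto
next
  case (gen_zero x)
  then show ?case using gen.gen_zero[of "Fo x" D k V S] functor_Ob[OF G] by simp
next
  case (gen_add x u v)
  then show ?case using gen.gen_add[of k D V S "Fo x" u v] by simp
next
  case (gen_smult c x v)
  then show ?case using gen.gen_smult[of c k D V S "Fo x" v] by simp
qed

abbreviation total_degree :: "'i set \<Rightarrow> ('i \<Rightarrow> nat) \<Rightarrow> nat" where
  "total_degree I x \<equiv> \<Sum>i\<in>I. x i"

text \<open>One factor \<open>i\<close>, with its shift, is separated from the others, which enter
  only as categories. With \<open>x\<close> an object and \<open>f\<close> an arrow of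
  \<open>D'\<close>, the objects and arrows of \<open>D\<close> are written \<open>x(i := a)\<close>
  and \<open>f(i := u)\<close>; the value of \<open>x\<close> or \<open>f\<close> at
  \<open>i\<close> is a default value and is always overwritten.\<close>

locale product_step = i: shift_category k "C i" \<psi> \<epsilon>
  for k :: "'k ring" and C :: "'i \<Rightarrow> (nat, 'a) cat" and i \<psi> \<epsilon> +
  fixes I :: "'i set"
  assumes fin: "finite I" and i: "i \<notin> I" and cats: "\<And>j. j \<in> I \<Longrightarrow> category (C j)"
begin

abbreviation "D \<equiv> prod_cat (insert i I) C"
abbreviation "D' \<equiv> prod_cat I C"

lemma cat: "category D"
  by (rule category_prod) (use cats i.cat in auto)

lemma cat': "category D'"
  by (rule category_prod[OF cats])

lemma Ob_pair: "x \<in> Ob D' \<Longrightarrow> x(i := a) \<in> Ob D"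
  using i by (auto simp: prod_cat_Ob PiE_iff extensional_def)

lemma Ob_cases:
  assumes "x \<in> Ob D"
  obtains x' a where "x = x'(i := a)" "x' \<in> Ob D'"
proof
  show "x = (restrict x I)(i := x i)" using assms by (auto simp: prod_cat_Ob PiE_iff extensional_def)
  show "restrict x I \<in> Ob D'" using assms by (auto simp: prod_cat_Ob PiE_iff)
qed

lemma Hom_pair:
  assumes "f \<in> Hom D' x y" "u \<in> Hom (C i) a b"
  shows "f(i := u) \<in> Hom D (x(i := a)) (y(i := b))"
  using assms i unfolding prod_cat_Hom by (auto simp: PiE_iff extensional_def)

lemma Hom_cases:
  assumes "f \<in> Hom D (x(i := a)) (y(i := b))" "x \<in> Ob D'" "y \<in> Ob D'"
  obtains f' u where "f = f'(i := u)" "f' \<in> Hom D' x y" "u \<in> Hom (C i) a b"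
proof
  have e: "x \<in> extensional I" "y \<in> extensional I" using assms by (auto simp: prod_cat_Ob PiE_iff)
  show "f = (restrict f I)(i := f i)" using assms(1) unfolding prod_cat_Hom
    by (auto simp: PiE_iff extensional_def)
  have "(x(i := a)) j = x j \<and> (y(i := b)) j = y j" if "j \<in> I" for j using i that by auto
  then show "restrict f I \<in> Hom D' x y" using assms(1) e unfolding prod_cat_Hom
    by (auto simp: PiE_iff)
  show "f i \<in> Hom (C i) a b" using assms(1) unfolding prod_cat_Hom by (auto simp: PiE_iff)
qed

lemma Comp_pair: "Comp D (g(i := v)) (f(i := u)) = (Comp D' g f)(i := Comp (C i) v u)"
  using i by (auto simp: prod_cat_Comp fun_eq_iff)

lemma Ident_pair: "Ident D (x(i := a)) = (Ident D' x)(i := Ident (C i) a)"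
  using i by (auto simp: prod_cat_Ident fun_eq_iff)

lemma pair_eq:
  assumes "f \<in> Hom D' x y" "f' \<in> Hom D' x y" "f(i := u) = f'(i := u')"
  shows "f = f'" "u = u'"
proof -
  have "f j = f' j" for j
    using assms(1,2) i fun_cong[OF assms(3), of j] unfolding prod_cat_Hom
    by (cases "j = i") (auto simp: PiE_iff extensional_def)
  then show "f = f'" by auto
  show "u = u'" using fun_cong[OF assms(3), of i] by simp
qed

lemma degree_pair: "total_degree (insert i I) (x(i := a)) = a + total_degree I x"
proof -
  have "(\<Sum>j\<in>I. (x(i := a)) j) = total_degree I x" using i by (intro sum.cong) auto
  then show ?thesis using fin i by simp
qed

abbreviation slice :: "nat \<Rightarrow> ('i \<Rightarrow> nat, 'i \<Rightarrow> 'a, 'k, 'v) cmod \<Rightarrow> ('i \<Rightarrow> nat, 'i \<Rightarrow> 'a, 'k, 'v) cmod" where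
  "slice a E \<equiv> pullback_cmod (\<lambda>x. x(i := a)) (\<lambda>f. f(i := Ident (C i) a)) E"

abbreviation line :: "('i \<Rightarrow> nat) \<Rightarrow> ('i \<Rightarrow> nat, 'i \<Rightarrow> 'a, 'k, 'v) cmod \<Rightarrow> (nat, 'a, 'k, 'v) cmod" where
  "line x E \<equiv> pullback_cmod (\<lambda>a. x(i := a)) (\<lambda>u. (Ident D' x)(i := u)) E"

abbreviation shift :: "('i \<Rightarrow> nat, 'i \<Rightarrow> 'a, 'k, 'v) cmod \<Rightarrow> ('i \<Rightarrow> nat, 'i \<Rightarrow> 'a, 'k, 'v) cmod" where
  "shift E \<equiv> pullback_cmod (\<lambda>x. x(i := Suc (x i))) (\<lambda>f. f(i := \<psi> (f i))) E"

lemma Ident_i: "Ident (C i) a \<in> Hom (C i) a a"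
  by (rule category_Ident[OF i.cat]) simp

lemma functor_slice: "is_functor D' D (\<lambda>x. x(i := a)) (\<lambda>f. f(i := Ident (C i) a))"
  unfolding is_functor_def
  using Ob_pair Hom_pair[OF Ar_Hom Ident_i] category_Comp_Ident(1)[OF i.cat Ident_i]
  by (auto simp: Ident_pair Comp_pair)

lemma functor_line: "x \<in> Ob D' \<Longrightarrow> is_functor (C i) D (\<lambda>a. x(i := a)) (\<lambda>u. (Ident D' x)(i := u))"
  unfolding is_functor_def
  using Ob_pair Hom_pair[OF category_Ident[OF cat'] Ar_Hom] category_Comp_Ident(1)[OF cat' category_Ident[OF cat']]
  by (auto simp: Ident_pair Comp_pair)

lemma functor_shift: "is_functor D D (\<lambda>x. x(i := Suc (x i))) (\<lambda>f. f(i := \<psi> (f i)))"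
  unfolding is_functor_def
proof (intro conjI ballI impI)
  fix x assume "x \<in> Ob D"
  then obtain x' a where x: "x = x'(i := a)" "x' \<in> Ob D'" by (rule Ob_cases)
  then show "x(i := Suc (x i)) \<in> Ob D" using Ob_pair by simp
  show "(Ident D x)(i := \<psi> (Ident D x i)) = Ident D (x(i := Suc (x i)))"
    using functor_Ident[OF i.\<psi>] by (simp add: x Ident_pair)
next
  fix f assume f: "f \<in> Ar D"
  then have fH: "f \<in> Hom D (Dom D f) (Cod D f)" by (rule Ar_Hom)
  obtain x' a where x: "Dom D f = x'(i := a)" "x' \<in> Ob D'" using category_Hom_Ob(1)[OF cat fH] by (rule Ob_cases)
  obtain y' b where y: "Cod D f = y'(i := b)" "y' \<in> Ob D'" using category_Hom_Ob(2)[OF cat fH] by (rule Ob_cases)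
  obtain f' u where fu: "f = f'(i := u)" "f' \<in> Hom D' x' y'" "u \<in> Hom (C i) a b"
    using fH unfolding x y by (rule Hom_cases[OF _ x(2) y(2)])
  show "f(i := \<psi> (f i)) \<in> Hom D ((Dom D f)(i := Suc (Dom D f i))) ((Cod D f)(i := Suc (Cod D f i)))"
    unfolding x(1) y(1) using Hom_pair[OF fu(2) functor_Hom[OF i.\<psi> fu(3)]] by (simp add: fu(1))
  fix g assume "g \<in> Ar D" "Cod D f = Dom D g"
  then have gH: "g \<in> Hom D (y'(i := b)) (Cod D g)" using y by (auto simp: Hom_def)
  obtain z' c where z: "Cod D g = z'(i := c)" "z' \<in> Ob D'" using category_Hom_Ob(2)[OF cat gH] by (rule Ob_cases)
  obtain g' v where gv: "g = g'(i := v)" "g' \<in> Hom D' y' z'" "v \<in> Hom (C i) b c"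
    using gH unfolding z by (rule Hom_cases[OF _ y(2) z(2)])
  show "(Comp D g f)(i := \<psi> (Comp D g f i)) = Comp D (g(i := \<psi> (g i))) (f(i := \<psi> (f i)))"
    using functor_Comp[OF i.\<psi> fu(3) gv(3)] by (simp add: fu(1) gv(1) Comp_pair)
qed

section \<open>Coordinates of free modules over a product\<close>

abbreviation Fr :: "('i \<Rightarrow> nat) \<Rightarrow> ('i \<Rightarrow> nat, 'i \<Rightarrow> 'a, 'k, ('i \<Rightarrow> 'a) \<Rightarrow> 'k) cmod" where
  "Fr n \<equiv> free_cmod k D n"

lemma free: "n \<in> Ob D \<Longrightarrow> free_module k D n"
  by (rule free_module.intro[OF i.k cat])

lemma free': "n \<in> Ob D' \<Longrightarrow> free_module k D' n"
  by (rule free_module.intro[OF i.k cat'])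

text \<open>At a fixed coordinate \<open>a\<close> in direction \<open>i\<close>, the representable
  module of \<open>n(i := r)\<close> is a direct sum of copies of the representable of
  \<open>n\<close> over \<open>D'\<close>, one for each arrow from \<open>r\<close> to
  \<open>a\<close>. This is the projection to the copy of \<open>u\<close>.\<close>

definition slice_coeff :: "('i \<Rightarrow> nat) \<Rightarrow> 'a \<Rightarrow> ('i \<Rightarrow> nat) \<Rightarrow> (('i \<Rightarrow> 'a) \<Rightarrow> 'k) \<Rightarrow> ('i \<Rightarrow> 'a) \<Rightarrow> 'k" where
  "slice_coeff n u x \<alpha> = (\<lambda>g \<in> Hom D' n x. \<alpha> (g(i := u)))"

text \<open>With the other coordinates fixed at \<open>x\<close>, the representable module of
  \<open>n(i := r)\<close> is a direct sum of copies of the representable of \<open>r\<close> over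
  \<open>C i\<close>, one for each arrow from \<open>n\<close> to \<open>x\<close>. This is the
  projection to the copy of \<open>g\<close>.\<close>

definition line_coeff :: "nat \<Rightarrow> ('i \<Rightarrow> 'a) \<Rightarrow> nat \<Rightarrow> (('i \<Rightarrow> 'a) \<Rightarrow> 'k) \<Rightarrow> 'a \<Rightarrow> 'k" where
  "line_coeff r g a \<alpha> = (\<lambda>u \<in> Hom (C i) r a. \<alpha> (g(i := u)))"

context
  fixes n :: "'i \<Rightarrow> nat" and r :: nat
  assumes n: "n \<in> Ob D'"
begin

interpretation F: free_module k D "n(i := r)" by (rule free[OF Ob_pair[OF n]])
interpretation F': free_module k D' n by (rule free'[OF n])
interpretation Fi: free_module k "C i" r by (rule i.free)

lemma slice_coeff:
  assumes u: "u \<in> Hom (C i) r a"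
  shows "linear_map k (fib (Fr (n(i := r))) (x(i := a))) (fib (free_cmod k D' n) x) (slice_coeff n u x)"
    and "g \<in> Hom D' n x \<Longrightarrow> slice_coeff n u x (basis k D (n(i := r)) (x(i := a)) (g(i := u))) = basis k D' n x g"
    and "g \<in> Hom D' n x \<Longrightarrow> v \<in> Hom (C i) r a \<Longrightarrow> v \<noteq> u \<Longrightarrow>
      slice_coeff n u x (basis k D (n(i := r)) (x(i := a)) (g(i := v))) = \<zero>\<^bsub>fib (free_cmod k D' n) x\<^esub>"
proof -
  have inj: "inj_on (\<lambda>g. g(i := u)) (Hom D' n x)" by (rule inj_onI) (rule pair_eq)
  have im: "(\<lambda>g. g(i := u)) ` Hom D' n x \<subseteq> Hom D (n(i := r)) (x(i := a))" using Hom_pair[OF _ u] by auto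
  note R = free_restrict[OF i.k F'.free_module_axioms F.free_module_axioms inj im slice_coeff_def]
  show "linear_map k (fib (Fr (n(i := r))) (x(i := a))) (fib (free_cmod k D' n) x) (slice_coeff n u x)" by (rule R(1))
  show "g \<in> Hom D' n x \<Longrightarrow> slice_coeff n u x (basis k D (n(i := r)) (x(i := a)) (g(i := u))) = basis k D' n x g" by (rule R(2))
  assume g: "g \<in> Hom D' n x" and v: "v \<in> Hom (C i) r a" "v \<noteq> u"
  show "slice_coeff n u x (basis k D (n(i := r)) (x(i := a)) (g(i := v))) = \<zero>\<^bsub>fib (free_cmod k D' n) x\<^esub>"
  proof (rule R(3)[OF Hom_pair[OF g v(1)]])
    show "g(i := v) \<notin> (\<lambda>g. g(i := u)) ` Hom D' n x" using v(2) by (auto dest: fun_cong[of _ _ i])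
  qed
qed

lemma line_coeff:
  assumes g: "g \<in> Hom D' n x"
  shows "linear_map k (fib (Fr (n(i := r))) (x(i := a))) (fib (i.Fr r) a) (line_coeff r g a)"
    and "u \<in> Hom (C i) r a \<Longrightarrow> line_coeff r g a (basis k D (n(i := r)) (x(i := a)) (g(i := u))) = basis k (C i) r a u"
    and "h \<in> Hom D' n x \<Longrightarrow> u \<in> Hom (C i) r a \<Longrightarrow> h \<noteq> g \<Longrightarrow>
      line_coeff r g a (basis k D (n(i := r)) (x(i := a)) (h(i := u))) = \<zero>\<^bsub>fib (i.Fr r) a\<^esub>"
proof -
  have inj: "inj_on (\<lambda>u. g(i := u)) (Hom (C i) r a)" by (rule inj_onI) (rule pair_eq(2)[OF g g])
  have im: "(\<lambda>u. g(i := u)) ` Hom (C i) r a \<subseteq> Hom D (n(i := r)) (x(i := a))" using Hom_pair[OF g] by auto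
  note R = free_restrict[OF i.k Fi.free_module_axioms F.free_module_axioms inj im line_coeff_def]
  show "linear_map k (fib (Fr (n(i := r))) (x(i := a))) (fib (i.Fr r) a) (line_coeff r g a)" by (rule R(1))
  show "u \<in> Hom (C i) r a \<Longrightarrow> line_coeff r g a (basis k D (n(i := r)) (x(i := a)) (g(i := u))) = basis k (C i) r a u" by (rule R(2))
  assume h: "h \<in> Hom D' n x" and u: "u \<in> Hom (C i) r a" and "h \<noteq> g"
  show "line_coeff r g a (basis k D (n(i := r)) (x(i := a)) (h(i := u))) = \<zero>\<^bsub>fib (i.Fr r) a\<^esub>"
  proof (rule R(3)[OF Hom_pair[OF h u]])
    show "h(i := u) \<notin> (\<lambda>u. g(i := u)) ` Hom (C i) r a" using pair_eq(1)[OF h g] \<open>h \<noteq> g\<close> by auto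
  qed
qed

text \<open>An arrow that is the identity in direction \<open>i\<close> does not change the part
  \<open>v\<close> of a basis arrow, so it respects the decomposition by \<open>v\<close>.\<close>

lemma slice_coeff_hom:
  assumes u: "u \<in> Hom (C i) r a"
  shows "cmod_hom k D' (slice a (Fr (n(i := r)))) (free_cmod k D' n) (slice_coeff n u)"
proof (rule cmod_homI)
  show "linear_map k (fib (slice a (Fr (n(i := r)))) x) (fib (free_cmod k D' n) x) (slice_coeff n u x)" for x
    using slice_coeff(1)[OF u] by simp
  fix f x y \<alpha> assume f: "f \<in> Hom D' x y" and a: "\<alpha> \<in> car (slice a (Fr (n(i := r)))) x"
  note o = category_Hom_Ob[OF cat' f]
  note fp = Hom_pair[OF f Ident_i[of a]]
  have L1: "linear_map k (fib (Fr (n(i := r))) (x(i := a))) (fib (free_cmod k D' n) y)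
      (\<lambda>\<alpha>. slice_coeff n u y (act (Fr (n(i := r))) (f(i := Ident (C i) a)) \<alpha>))"
    by (rule linear_map_comp[OF F.act_linear[OF fp] slice_coeff(1)[OF u]])
  have L2: "linear_map k (fib (Fr (n(i := r))) (x(i := a))) (fib (free_cmod k D' n) y)
      (\<lambda>\<alpha>. act (free_cmod k D' n) f (slice_coeff n u x \<alpha>))"
    by (rule linear_map_comp[OF slice_coeff(1)[OF u] F'.act_linear[OF f]])
  have a': "\<alpha> \<in> car (Fr (n(i := r))) (x(i := a))" using a by simp
  have "slice_coeff n u y (act (Fr (n(i := r))) (f(i := Ident (C i) a)) \<alpha>)
      = act (free_cmod k D' n) f (slice_coeff n u x \<alpha>)"
  proof (rule F.free_linear_ext[OF F'.fib_module L1 L2 _ a'])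
    fix w assume w: "w \<in> Hom D (n(i := r)) (x(i := a))"
    obtain g v where gv: "w = g(i := v)" "g \<in> Hom D' n x" "v \<in> Hom (C i) r a"
      using w by (rule Hom_cases[OF _ n o(1)])
    have e: "act (Fr (n(i := r))) (f(i := Ident (C i) a)) (basis k D (n(i := r)) (x(i := a)) w)
        = basis k D (n(i := r)) (y(i := a)) ((Comp D' f g)(i := v))"
      unfolding F.act_basis[OF fp w] by (simp add: gv(1) Comp_pair category_Comp_Ident(2)[OF i.cat gv(3)])
    note fg = category_Comp[OF cat' gv(2) f]
    show "slice_coeff n u y (act (Fr (n(i := r))) (f(i := Ident (C i) a)) (basis k D (n(i := r)) (x(i := a)) w))
        = act (free_cmod k D' n) f (slice_coeff n u x (basis k D (n(i := r)) (x(i := a)) w))"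
    proof (cases "v = u")
      case True
      then show ?thesis unfolding e unfolding gv(1)
        by (simp add: slice_coeff(2)[OF u gv(2)] slice_coeff(2)[OF u fg] F'.act_basis[OF f gv(2)])
    next
      case False
      then show ?thesis unfolding e unfolding gv(1)
        using linear_map_zero[OF F'.fib_module F'.fib_module F'.act_linear[OF f]]
        by (simp add: slice_coeff(3)[OF u gv(2,3)] slice_coeff(3)[OF u fg gv(3)])
    qed
  qed
  then show "slice_coeff n u y (act (slice a (Fr (n(i := r)))) f \<alpha>) = act (free_cmod k D' n) f (slice_coeff n u x \<alpha>)"
    by simp
qed

lemma line_coeff_act:
  assumes g: "g \<in> Hom D' n x" and f: "f \<in> Hom (C i) a b" and a: "\<alpha> \<in> car (Fr (n(i := r))) (x(i := a))"
  shows "line_coeff r g b (act (Fr (n(i := r))) ((Ident D' x)(i := f)) \<alpha>) = act (i.Fr r) f (line_coeff r g a \<alpha>)"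
proof -
  have x: "x \<in> Ob D'" by (rule category_Hom_Ob(2)[OF cat' g])
  note fp = Hom_pair[OF category_Ident[OF cat' x] f]
  have L1: "linear_map k (fib (Fr (n(i := r))) (x(i := a))) (fib (i.Fr r) b)
      (\<lambda>\<alpha>. line_coeff r g b (act (Fr (n(i := r))) ((Ident D' x)(i := f)) \<alpha>))"
    by (rule linear_map_comp[OF F.act_linear[OF fp] line_coeff(1)[OF g]])
  have L2: "linear_map k (fib (Fr (n(i := r))) (x(i := a))) (fib (i.Fr r) b)
      (\<lambda>\<alpha>. act (i.Fr r) f (line_coeff r g a \<alpha>))"
    by (rule linear_map_comp[OF line_coeff(1)[OF g] Fi.act_linear[OF f]])
  show ?thesis
  proof (rule F.free_linear_ext[OF Fi.fib_module L1 L2 _ a])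
  fix w assume w: "w \<in> Hom D (n(i := r)) (x(i := a))"
  obtain h v where hv: "w = h(i := v)" "h \<in> Hom D' n x" "v \<in> Hom (C i) r a"
    using w by (rule Hom_cases[OF _ n x])
  have e: "act (Fr (n(i := r))) ((Ident D' x)(i := f)) (basis k D (n(i := r)) (x(i := a)) w)
      = basis k D (n(i := r)) (x(i := b)) (h(i := Comp (C i) f v))"
    unfolding F.act_basis[OF fp w] by (simp add: hv(1) Comp_pair category_Comp_Ident(2)[OF cat' hv(2)])
  note fv = category_Comp[OF i.cat hv(3) f]
  show "line_coeff r g b (act (Fr (n(i := r))) ((Ident D' x)(i := f)) (basis k D (n(i := r)) (x(i := a)) w))
      = act (i.Fr r) f (line_coeff r g a (basis k D (n(i := r)) (x(i := a)) w))"
  proof (cases "h = g")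
    case True
    then show ?thesis unfolding e unfolding hv(1)
      by (simp add: line_coeff(2)[OF g hv(3)] line_coeff(2)[OF g fv] Fi.act_basis[OF f hv(3)])
  next
    case False
    then show ?thesis unfolding e unfolding hv(1)
      using linear_map_zero[OF Fi.fib_module Fi.fib_module Fi.act_linear[OF f]]
      by (simp add: line_coeff(3)[OF g hv(2,3)] line_coeff(3)[OF g hv(2) fv])
  qed
qed
qed

lemma line_coeff_eqI:
  assumes x: "x \<in> Ob D'" and a: "\<alpha> \<in> car (Fr (n(i := r))) (x(i := a))" and b: "\<beta> \<in> car (Fr (n(i := r))) (x(i := a))"
    and "\<And>g. g \<in> Hom D' n x \<Longrightarrow> line_coeff r g a \<alpha> = line_coeff r g a \<beta>"
  shows "\<alpha> = \<beta>"
proof (rule extensionalityI)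
  show "\<alpha> \<in> extensional (Hom D (n(i := r)) (x(i := a)))" "\<beta> \<in> extensional (Hom D (n(i := r)) (x(i := a)))"
    using a b by (auto simp: free_cmod_fib fsum_simps PiE_def)
  fix w assume "w \<in> Hom D (n(i := r)) (x(i := a))"
  then obtain h v where hv: "w = h(i := v)" "h \<in> Hom D' n x" "v \<in> Hom (C i) r a"
    by (rule Hom_cases[OF _ n x])
  then show "\<alpha> w = \<beta> w"
    using fun_cong[OF assms(4)[OF hv(2)], of v] by (simp add: line_coeff_def)
qed

lemma slice_coeff_eqI:
  assumes x: "x \<in> Ob D'" and a: "\<alpha> \<in> car (Fr (n(i := r))) (x(i := a))" and b: "\<beta> \<in> car (Fr (n(i := r))) (x(i := a))"
    and "\<And>u. u \<in> Hom (C i) r a \<Longrightarrow> slice_coeff n u x \<alpha> = slice_coeff n u x \<beta>"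
  shows "\<alpha> = \<beta>"
proof (rule extensionalityI)
  show "\<alpha> \<in> extensional (Hom D (n(i := r)) (x(i := a)))" "\<beta> \<in> extensional (Hom D (n(i := r)) (x(i := a)))"
    using a b by (auto simp: free_cmod_fib fsum_simps PiE_def)
  fix w assume "w \<in> Hom D (n(i := r)) (x(i := a))"
  then obtain h v where hv: "w = h(i := v)" "h \<in> Hom D' n x" "v \<in> Hom (C i) r a"
    by (rule Hom_cases[OF _ n x])
  then show "\<alpha> w = \<beta> w"
    using fun_cong[OF assms(4)[OF hv(3)], of h] by (simp add: slice_coeff_def)
qed

abbreviation eps :: "('i \<Rightarrow> nat) \<Rightarrow> nat \<Rightarrow> 'i \<Rightarrow> 'a" where
  "eps x a \<equiv> (Ident D' x)(i := \<epsilon> a)"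

text \<open>In each line coordinate the arrow \<open>eps\<close> acts as the shift map of a
  representable over \<open>C i\<close>, which is injective by (S3); the line coordinates together
  determine the element.\<close>

lemma free_eps_inj:
  assumes x: "x \<in> Ob D'" and a: "\<alpha> \<in> car (Fr (n(i := r))) (x(i := a))"
    and z: "act (Fr (n(i := r))) (eps x a) \<alpha> = \<zero>\<^bsub>fib (Fr (n(i := r))) (x(i := Suc a))\<^esub>"
  shows "\<alpha> = \<zero>\<^bsub>fib (Fr (n(i := r))) (x(i := a))\<^esub>"
proof (rule line_coeff_eqI[OF x a])
  interpret F: cmod k D "Fr (n(i := r))" using F.cmodule_free cat by unfold_locales
  show "\<zero>\<^bsub>fib (Fr (n(i := r))) (x(i := a))\<^esub> \<in> car (Fr (n(i := r))) (x(i := a))"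
    by (rule F.zero_closed[OF Ob_pair[OF x]])
  fix g assume g: "g \<in> Hom D' n x"
  have lz: "line_coeff r g b \<zero>\<^bsub>fib (Fr (n(i := r))) (x(i := b))\<^esub> = \<zero>\<^bsub>fib (i.Fr r) b\<^esub>" for b
    by (rule linear_map_zero[OF free_module.fib_module[OF free[OF Ob_pair[OF n]]] Fi.fib_module line_coeff(1)[OF g]])
  have "act (i.Fr r) (\<epsilon> a) (line_coeff r g a \<alpha>) = \<zero>\<^bsub>fib (i.Fr r) (Suc a)\<^esub>"
    unfolding line_coeff_act[OF g i.\<epsilon> a, symmetric] z by (rule lz)
  then have "line_coeff r g a \<alpha> = \<zero>\<^bsub>fib (i.Fr r) a\<^esub>"
    by (rule i.shift_inj[OF linear_map_closed[OF line_coeff(1)[OF g] a]])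
  then show "line_coeff r g a \<alpha> = line_coeff r g a \<zero>\<^bsub>fib (Fr (n(i := r))) (x(i := a))\<^esub>"
    by (simp add: lz)
qed

end

text \<open>The inclusion of the copy belonging to \<open>g\<close> into the line through
  \<open>x\<close>, in the opposite direction to \<open>line_coeff\<close>. Being a Yoneda map, it
  is linear and natural along the line without further work.\<close>

definition emb :: "('i \<Rightarrow> nat) \<Rightarrow> nat \<Rightarrow> ('i \<Rightarrow> nat) \<Rightarrow> ('i \<Rightarrow> 'a) \<Rightarrow> nat \<Rightarrow> ('a \<Rightarrow> 'k) \<Rightarrow> ('i \<Rightarrow> 'a) \<Rightarrow> 'k" where
  "emb n q x g = free_module.yoneda k (C i) q (line x (Fr (n(i := q))))
     (basis k D (n(i := q)) (x(i := q)) (g(i := Ident (C i) q)))"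

context
  fixes n :: "'i \<Rightarrow> nat" and q :: nat
  assumes n: "n \<in> Ob D'"
begin

interpretation F: free_module k D "n(i := q)" by (rule free[OF Ob_pair[OF n]])
interpretation Fi: free_module k "C i" q by (rule i.free)

context
  fixes x g
  assumes g: "g \<in> Hom D' n x"
begin

lemma emb_aux:
  shows "x \<in> Ob D'" "cmodule k (C i) (line x (Fr (n(i := q))))"
    "basis k D (n(i := q)) (x(i := q)) (g(i := Ident (C i) q)) \<in> car (line x (Fr (n(i := q)))) q"
proof -
  show x: "x \<in> Ob D'" by (rule category_Hom_Ob(2)[OF cat' g])
  show "cmodule k (C i) (line x (Fr (n(i := q))))"
    by (rule cmodule_pullback[OF i.cat cat functor_line[OF x] F.cmodule_free])
  show "basis k D (n(i := q)) (x(i := q)) (g(i := Ident (C i) q)) \<in> car (line x (Fr (n(i := q)))) q"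
    using F.basis_closed[OF Hom_pair[OF g Ident_i]] by simp
qed

lemma emb_linear: "linear_map k (fib (i.Fr q) a) (fib (Fr (n(i := q))) (x(i := a))) (emb n q x g a)"
  using Fi.yoneda_linear[OF emb_aux(2,3), of a] by (simp add: emb_def)

lemma emb_basis:
  assumes w: "w \<in> Hom (C i) q a"
  shows "emb n q x g a (basis k (C i) q a w) = basis k D (n(i := q)) (x(i := a)) (g(i := w))"
proof -
  note wp = Hom_pair[OF category_Ident[OF cat' emb_aux(1)] w]
  have "emb n q x g a (basis k (C i) q a w)
      = act (Fr (n(i := q))) ((Ident D' x)(i := w)) (basis k D (n(i := q)) (x(i := q)) (g(i := Ident (C i) q)))"
    using Fi.yoneda_basis[OF emb_aux(2,3) w] by (simp add: emb_def)
  also have "\<dots> = basis k D (n(i := q)) (x(i := a)) (g(i := w))"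
    unfolding F.act_basis[OF wp Hom_pair[OF g Ident_i]]
    by (simp add: Comp_pair category_Comp_Ident(2)[OF cat' g] category_Comp_Ident(1)[OF i.cat w])
  finally show ?thesis .
qed

text \<open>The two assumptions about the composite arrow are \<open>emb_linear\<close> and
  \<open>emb_basis\<close> at the object \<open>y\<close>. They are hypotheses because
  \<open>x\<close> and \<open>g\<close> are fixed in the surrounding context.\<close>

lemma emb_act:
  assumes f: "f \<in> Hom D' x y" and u: "u \<in> Hom (C i) a b" and \<beta>: "\<beta> \<in> car (i.Fr q) a"
    and emb': "linear_map k (fib (i.Fr q) b) (fib (Fr (n(i := q))) (y(i := b))) (emb n q y (Comp D' f g) b)"
      "\<And>w. w \<in> Hom (C i) q b \<Longrightarrow>
        emb n q y (Comp D' f g) b (basis k (C i) q b w) = basis k D (n(i := q)) (y(i := b)) ((Comp D' f g)(i := w))"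
  shows "act (Fr (n(i := q))) (f(i := u)) (emb n q x g a \<beta>) = emb n q y (Comp D' f g) b (act (i.Fr q) u \<beta>)"
proof -
  note fu = Hom_pair[OF f u]
  note L1 = linear_map_comp[OF emb_linear F.act_linear[OF fu]]
  note L2 = linear_map_comp[OF Fi.act_linear[OF u] emb'(1)]
  show ?thesis
  proof (rule Fi.free_linear_ext[OF F.fib_module L1 L2 _ \<beta>])
    fix w assume w: "w \<in> Hom (C i) q a"
    show "act (Fr (n(i := q))) (f(i := u)) (emb n q x g a (basis k (C i) q a w))
        = emb n q y (Comp D' f g) b (act (i.Fr q) u (basis k (C i) q a w))"
      unfolding emb_basis[OF w] F.act_basis[OF fu Hom_pair[OF g w]] Fi.act_basis[OF u w]
        emb'(2)[OF category_Comp[OF i.cat w u]] Comp_pair ..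
  qed
qed

lemma line_emb:
  assumes h: "h \<in> Hom D' n x" and \<beta>: "\<beta> \<in> car (i.Fr q) a"
  shows "line_coeff q h a (emb n q x g a \<beta>) = (if h = g then \<beta> else \<zero>\<^bsub>fib (i.Fr q) a\<^esub>)"
proof -
  interpret z: module k "fib (i.Fr q) a" by (rule Fi.fib_module)
  note L1 = linear_map_comp[OF emb_linear line_coeff(1)[OF n h]]
  have L2: "linear_map k (fib (i.Fr q) a) (fib (i.Fr q) a) (\<lambda>\<beta>. if h = g then \<beta> else \<zero>\<^bsub>fib (i.Fr q) a\<^esub>)"
    by (rule linear_mapI) auto
  show ?thesis
  proof (rule Fi.free_linear_ext[OF Fi.fib_module L1 L2 _ \<beta>])
    fix w assume w: "w \<in> Hom (C i) q a"
    show "line_coeff q h a (emb n q x g a (basis k (C i) q a w))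
        = (if h = g then basis k (C i) q a w else \<zero>\<^bsub>fib (i.Fr q) a\<^esub>)"
      unfolding emb_basis[OF w] using line_coeff(2)[OF n h w] line_coeff(3)[OF n h g w] by auto
  qed
qed

end

end

lemma restrict_pair: "x \<in> Ob D' \<Longrightarrow> restrict (x(i := a)) I = x"
  using i by (auto simp: prod_cat_Ob PiE_iff extensional_def restrict_def fun_eq_iff)

lemma restrict_pair_Hom: "f \<in> Hom D' x y \<Longrightarrow> restrict (f(i := u)) I = f"
  using i unfolding prod_cat_Hom by (auto simp: PiE_iff extensional_def restrict_def fun_eq_iff)

text \<open>The external tensor product of \<open>\<sigma>\<close> with the identity of a representable module in the
  remaining directions.\<close>

lemma extend_hom:
  assumes n: "n \<in> Ob D'" and \<sigma>: "cmod_hom k (C i) (Shift \<psi> (i.Fr r)) (i.Fr q) \<sigma>"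
  obtains h where "cmod_hom k D (shift (Fr (n(i := r)))) (Fr (n(i := q))) h"
    and "\<And>x a \<alpha> g. \<alpha> \<in> car (Fr (n(i := r))) (x(i := Suc a)) \<Longrightarrow> g \<in> Hom D' n x
      \<Longrightarrow> line_coeff q g a (h (x(i := a)) \<alpha>) = \<sigma> a (line_coeff r g (Suc a) \<alpha>)"
proof -
  interpret Fr: free_module k D "n(i := r)" by (rule free[OF Ob_pair[OF n]])
  interpret Fq: free_module k D "n(i := q)" by (rule free[OF Ob_pair[OF n]])
  interpret ir: free_module k "C i" r by (rule i.free)
  interpret iq: free_module k "C i" q by (rule i.free)
  have \<sigma>l: "linear_map k (fib (i.Fr r) (Suc a)) (fib (i.Fr q) a) (\<sigma> a)" for a
    using \<sigma> by (auto simp: cmod_hom_def)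
  have \<sigma>a: "\<sigma> b (act (i.Fr r) (\<psi> u) \<beta>) = act (i.Fr q) u (\<sigma> a \<beta>)"
    if "u \<in> Hom (C i) a b" "\<beta> \<in> car (i.Fr r) (Suc a)" for a b u \<beta>
    using \<sigma> that by (auto simp: cmod_hom_def Hom_def)
  have \<sigma>b: "\<sigma> a (basis k (C i) r (Suc a) u) \<in> car (i.Fr q) a" if "u \<in> Hom (C i) r (Suc a)" for a u
    by (rule linear_map_closed[OF \<sigma>l ir.basis_closed[OF that]])
  \<comment> \<open>On a basis arrow composed of \<open>g\<close> and \<open>u\<close>, the tensor
    product applies \<open>\<sigma>\<close> to the basis vector of \<open>u\<close> and puts the
    result into the copy belonging to \<open>g\<close>.\<close>
  define B where "B x a g = emb n q x (restrict g I) a (\<sigma> a (basis k (C i) r (Suc a) (g i)))" for x a g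
  have B: "B x a (g(i := u)) = emb n q x g a (\<sigma> a (basis k (C i) r (Suc a) u))"
    if "g \<in> Hom D' n x" for x a g u
    using restrict_pair_Hom[OF that] by (simp add: B_def)
  have "\<exists>L. linear_map k (fib (Fr (n(i := r))) (x(i := Suc a))) (fib (Fr (n(i := q))) (x(i := a))) L \<and>
      (\<forall>g \<in> Hom D (n(i := r)) (x(i := Suc a)). L (basis k D (n(i := r)) (x(i := Suc a)) g) = B x a g)"
    if x: "x \<in> Ob D'" for x a
  proof -
    have "B x a g \<in> car (Fr (n(i := q))) (x(i := a))" if "g \<in> Hom D (n(i := r)) (x(i := Suc a))" for g
      using that
    proof (rule Hom_cases[OF _ n x])
      fix g' u assume g: "g = g'(i := u)" "g' \<in> Hom D' n x" "u \<in> Hom (C i) r (Suc a)"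
      show ?thesis unfolding g(1) B[OF g(2)] by (rule linear_map_closed[OF emb_linear[OF n g(2)] \<sigma>b[OF g(3)]])
    qed
    then show ?thesis using Fr.free_extend[OF Fq.fib_module] by metis
  qed
  then obtain L where L: "\<And>x a. x \<in> Ob D' \<Longrightarrow>
      linear_map k (fib (Fr (n(i := r))) (x(i := Suc a))) (fib (Fr (n(i := q))) (x(i := a))) (L x a)"
    and Lb: "\<And>x a g. x \<in> Ob D' \<Longrightarrow> g \<in> Hom D (n(i := r)) (x(i := Suc a))
      \<Longrightarrow> L x a (basis k D (n(i := r)) (x(i := Suc a)) g) = B x a g"
    by metis
  define h where "h x = L (restrict x I) (x i)" for x :: "'i \<Rightarrow> nat"
  have h: "h (x(i := a)) = L x a" if "x \<in> Ob D'" for x a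
    using restrict_pair[OF that] by (simp add: h_def)
  show thesis
  proof (rule that[of h])
    show "cmod_hom k D (shift (Fr (n(i := r)))) (Fr (n(i := q))) h"
    proof (rule cmod_homI)
      fix x assume "x \<in> Ob D"
      then obtain x' a where x: "x = x'(i := a)" "x' \<in> Ob D'" by (rule Ob_cases)
      show "linear_map k (fib (shift (Fr (n(i := r)))) x) (fib (Fr (n(i := q))) x) (h x)"
        using L[OF x(2), of a] h[OF x(2), of a] by (simp add: x(1))
    next
      fix f x y \<alpha> assume f: "f \<in> Hom D x y" and a: "\<alpha> \<in> car (shift (Fr (n(i := r)))) x"
      obtain x' a where x: "x = x'(i := a)" "x' \<in> Ob D'" using category_Hom_Ob(1)[OF cat f] by (rule Ob_cases)
      obtain y' b where y: "y = y'(i := b)" "y' \<in> Ob D'" using category_Hom_Ob(2)[OF cat f] by (rule Ob_cases)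
      obtain f' u where fu: "f = f'(i := u)" "f' \<in> Hom D' x' y'" "u \<in> Hom (C i) a b"
        using f unfolding x y by (rule Hom_cases[OF _ x(2) y(2)])
      note fs = Hom_pair[OF fu(2) functor_Hom[OF i.\<psi> fu(3)]]
      note L1 = linear_map_comp[OF Fr.act_linear[OF fs] L[OF y(2)]]
      note L2 = linear_map_comp[OF L[OF x(2)] Fq.act_linear[OF Hom_pair[OF fu(2,3)]]]
      have a': "\<alpha> \<in> car (Fr (n(i := r))) (x'(i := Suc a))" using a by (simp add: x(1))
      have "L y' b (act (Fr (n(i := r))) (f'(i := \<psi> u)) \<alpha>) = act (Fr (n(i := q))) (f'(i := u)) (L x' a \<alpha>)"
      proof (rule Fr.free_linear_ext[OF Fq.fib_module L1 L2 _ a'])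
        fix w assume w: "w \<in> Hom D (n(i := r)) (x'(i := Suc a))"
        obtain g v where gv: "w = g(i := v)" "g \<in> Hom D' n x'" "v \<in> Hom (C i) r (Suc a)"
          using w by (rule Hom_cases[OF _ n x(2)])
        note fg = category_Comp[OF cat' gv(2) fu(2)]
        have "L y' b (act (Fr (n(i := r))) (f'(i := \<psi> u)) (basis k D (n(i := r)) (x'(i := Suc a)) w))
            = B y' b ((Comp D' f' g)(i := Comp (C i) (\<psi> u) v))"
          unfolding Fr.act_basis[OF fs w] using Lb[OF y(2) category_Comp[OF cat w fs]]
          by (simp add: gv(1) Comp_pair)
        also have "\<dots> = emb n q y' (Comp D' f' g) b (\<sigma> b (act (i.Fr r) (\<psi> u) (basis k (C i) r (Suc a) v)))"
          unfolding B[OF fg] ir.act_basis[OF functor_Hom[OF i.\<psi> fu(3)] gv(3)] ..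
        \<comment> \<open>Naturality of \<open>\<sigma>\<close> moves \<open>u\<close> past it, and
          \<open>emb_act\<close> lets \<open>f'\<close> change the copy from \<open>g\<close> to the
          composite of \<open>f'\<close> and \<open>g\<close>.\<close>
        also have "\<dots> = act (Fr (n(i := q))) (f'(i := u)) (emb n q x' g a (\<sigma> a (basis k (C i) r (Suc a) v)))"
          unfolding \<sigma>a[OF fu(3) ir.basis_closed[OF gv(3)]]
          by (rule emb_act[OF n gv(2) fu(2,3) \<sigma>b[OF gv(3)] emb_linear[OF n fg] emb_basis[OF n fg], symmetric])
        also have "\<dots> = act (Fr (n(i := q))) (f'(i := u)) (L x' a (basis k D (n(i := r)) (x'(i := Suc a)) w))"
          unfolding Lb[OF x(2) w] unfolding gv(1) B[OF gv(2)] ..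
        finally show "L y' b (act (Fr (n(i := r))) (f'(i := \<psi> u)) (basis k D (n(i := r)) (x'(i := Suc a)) w))
            = act (Fr (n(i := q))) (f'(i := u)) (L x' a (basis k D (n(i := r)) (x'(i := Suc a)) w))" .
      qed
      then show "h y (act (shift (Fr (n(i := r)))) f \<alpha>) = act (Fr (n(i := q))) f (h x \<alpha>)"
        by (simp add: x(1) y(1) fu(1) h[OF x(2)] h[OF y(2)])
    qed
  next
    fix x a \<alpha> g assume \<alpha>: "\<alpha> \<in> car (Fr (n(i := r))) (x(i := Suc a))" and g: "g \<in> Hom D' n x"
    have x: "x \<in> Ob D'" by (rule category_Hom_Ob(2)[OF cat' g])
    note L1 = linear_map_comp[OF L[OF x] line_coeff(1)[OF n g]]
    note L2 = linear_map_comp[OF line_coeff(1)[OF n g] \<sigma>l]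
    show "line_coeff q g a (h (x(i := a)) \<alpha>) = \<sigma> a (line_coeff r g (Suc a) \<alpha>)"
      unfolding h[OF x]
    proof (rule Fr.free_linear_ext[OF iq.fib_module L1 L2 _ \<alpha>])
      fix w assume w: "w \<in> Hom D (n(i := r)) (x(i := Suc a))"
      obtain g' v where gv: "w = g'(i := v)" "g' \<in> Hom D' n x" "v \<in> Hom (C i) r (Suc a)"
        using w by (rule Hom_cases[OF _ n x])
      show "line_coeff q g a (L x a (basis k D (n(i := r)) (x(i := Suc a)) w))
          = \<sigma> a (line_coeff r g (Suc a) (basis k D (n(i := r)) (x(i := Suc a)) w))"
        unfolding Lb[OF x w] unfolding gv(1) B[OF gv(2)] line_emb[OF n gv(2) g \<sigma>b[OF gv(3)]]
        using line_coeff(2)[OF n g gv(3)] line_coeff(3)[OF n g gv(2,3)]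
          linear_map_zero[OF ir.fib_module iq.fib_module \<sigma>l] by auto
    qed
  qed
qed

text \<open>The line coordinates decompose the shift map of a free module over the product into
  shift maps of representables over \<open>C i\<close>. Hence the functionals for the single factor,
  extended by the identity in the other directions, detect the image of \<open>eps\<close> one line
  coordinate at a time. Only the coordinate \<open>i\<close> of the representing object
  drops.\<close>

lemma shift_embedding:
  fixes r :: nat
  assumes n: "n \<in> Ob D'"
  obtains S :: "(('i \<Rightarrow> nat) \<times> (('i \<Rightarrow> nat) \<Rightarrow> (('i \<Rightarrow> 'a) \<Rightarrow> 'k) \<Rightarrow> (('i \<Rightarrow> 'a) \<Rightarrow> 'k))) set" where
    "\<And>m \<sigma>. (m, \<sigma>) \<in> S \<Longrightarrow> (\<exists>q<r. m = n(i := q)) \<and> cmod_hom k D (shift (Fr (n(i := r)))) (Fr m) \<sigma>"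
    "\<And>x a v. x \<in> Ob D' \<Longrightarrow> v \<in> car (Fr (n(i := r))) (x(i := Suc a)) \<Longrightarrow>
       (\<forall>(m, \<sigma>) \<in> S. \<sigma> (x(i := a)) v = \<zero>\<^bsub>fib (Fr m) (x(i := a))\<^esub>)
       \<longleftrightarrow> (\<exists>t \<in> car (Fr (n(i := r))) (x(i := a)). v = act (Fr (n(i := r))) (eps x a) t)"
proof -
  obtain T where T: "\<And>q \<sigma>. (q, \<sigma>) \<in> T \<Longrightarrow> q < r \<and> cmod_hom k (C i) (Shift \<psi> (i.Fr r)) (i.Fr q) \<sigma>"
    and Tker: "\<And>a v. v \<in> car (i.Fr r) (Suc a) \<Longrightarrow>
       (\<forall>(q, \<sigma>) \<in> T. \<sigma> a v = \<zero>\<^bsub>fib (i.Fr q) a\<^esub>) \<longleftrightarrow> (\<exists>t \<in> car (i.Fr r) a. v = act (i.Fr r) (\<epsilon> a) t)"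
    by (rule i.shift_embedding[of r]) (rule that, (assumption | blast)+)
  define P where "P q \<sigma> h \<longleftrightarrow> cmod_hom k D (shift (Fr (n(i := r)))) (Fr (n(i := q))) h \<and>
      (\<forall>x a \<alpha> g. \<alpha> \<in> car (Fr (n(i := r))) (x(i := Suc a)) \<longrightarrow> g \<in> Hom D' n x
        \<longrightarrow> line_coeff q g a (h (x(i := a)) \<alpha>) = \<sigma> a (line_coeff r g (Suc a) \<alpha>))" for q \<sigma> h
  have ex: "\<exists>h. P q \<sigma> h" if "(q, \<sigma>) \<in> T" for q \<sigma>
  proof (rule extend_hom[OF n conjunct2[OF T[OF that]]])
    fix h assume "cmod_hom k D (shift (Fr (n(i := r)))) (Fr (n(i := q))) h"
      and "\<And>x a \<alpha> g. \<alpha> \<in> car (Fr (n(i := r))) (x(i := Suc a)) \<Longrightarrow> g \<in> Hom D' n x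
        \<Longrightarrow> line_coeff q g a (h (x(i := a)) \<alpha>) = \<sigma> a (line_coeff r g (Suc a) \<alpha>)"
    then have "P q \<sigma> h" unfolding P_def by simp
    then show ?thesis by (rule exI[of _ h])
  qed
  define h where "h q \<sigma> = (SOME h. P q \<sigma> h)" for q \<sigma>
  have h: "P q \<sigma> (h q \<sigma>)" if "(q, \<sigma>) \<in> T" for q \<sigma>
    unfolding h_def by (rule someI_ex[OF ex[OF that]])
  have hh: "cmod_hom k D (shift (Fr (n(i := r)))) (Fr (n(i := q))) (h q \<sigma>)" if "(q, \<sigma>) \<in> T" for q \<sigma>
    using h[OF that] by (simp add: P_def)
  have hl: "line_coeff q g a (h q \<sigma> (x(i := a)) \<alpha>) = \<sigma> a (line_coeff r g (Suc a) \<alpha>)"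
    if "(q, \<sigma>) \<in> T" "\<alpha> \<in> car (Fr (n(i := r))) (x(i := Suc a))" "g \<in> Hom D' n x" for q \<sigma> x a \<alpha> g
    using h[OF that(1)] that(2,3) by (simp add: P_def)
  interpret F: free_module k D "n(i := r)" by (rule free[OF Ob_pair[OF n]])
  interpret ir: free_module k "C i" r by (rule i.free)
  interpret Fc: cmod k D "Fr (n(i := r))" using F.cmodule_free cat by unfold_locales
  interpret ic: cmod k "C i" "i.Fr r" using ir.cmodule_free i.cat by unfold_locales
  define S where "S = {(n(i := q), h q \<sigma>) | q \<sigma>. (q, \<sigma>) \<in> T}"
  have lz: "line_coeff q g b \<zero>\<^bsub>fib (Fr (n(i := q))) (x(i := b))\<^esub> = \<zero>\<^bsub>fib (i.Fr q) b\<^esub>"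
    if "g \<in> Hom D' n x" for q g x b
    by (rule linear_map_zero[OF free_module.fib_module[OF free[OF Ob_pair[OF n]]]
          free_module.fib_module[OF i.free] line_coeff(1)[OF n that]])
  show thesis
  proof (rule that[of S])
    fix m s assume "(m, s) \<in> S"
    then show "(\<exists>q<r. m = n(i := q)) \<and> cmod_hom k D (shift (Fr (n(i := r)))) (Fr m) s"
      using T hh by (auto simp: S_def)
  next
    fix x a v assume x: "x \<in> Ob D'" and v: "v \<in> car (Fr (n(i := r))) (x(i := Suc a))"
    have e: "eps x a \<in> Hom D (x(i := a)) (x(i := Suc a))"
      by (rule Hom_pair[OF category_Ident[OF cat' x] i.\<epsilon>])
    have lv: "line_coeff r g (Suc a) v \<in> car (i.Fr r) (Suc a)" if "g \<in> Hom D' n x" for g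
      by (rule linear_map_closed[OF line_coeff(1)[OF n that] v])
    show "(\<forall>(m, \<sigma>) \<in> S. \<sigma> (x(i := a)) v = \<zero>\<^bsub>fib (Fr m) (x(i := a))\<^esub>)
       \<longleftrightarrow> (\<exists>t \<in> car (Fr (n(i := r))) (x(i := a)). v = act (Fr (n(i := r))) (eps x a) t)"
    proof
      assume z: "\<forall>(m, \<sigma>) \<in> S. \<sigma> (x(i := a)) v = \<zero>\<^bsub>fib (Fr m) (x(i := a))\<^esub>"
      have "\<exists>t \<in> car (i.Fr r) a. line_coeff r g (Suc a) v = act (i.Fr r) (\<epsilon> a) t" if g: "g \<in> Hom D' n x" for g
      proof -
        have "\<sigma> a (line_coeff r g (Suc a) v) = \<zero>\<^bsub>fib (i.Fr q) a\<^esub>" if "(q, \<sigma>) \<in> T" for q \<sigma>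
        proof -
          have "h q \<sigma> (x(i := a)) v = \<zero>\<^bsub>fib (Fr (n(i := q))) (x(i := a))\<^esub>"
            using z that by (auto simp: S_def)
          then show ?thesis using hl[OF that v g] lz[OF g] by simp
        qed
        then show ?thesis using Tker[OF lv[OF g]] by blast
      qed
      then obtain t where t: "\<And>g. g \<in> Hom D' n x \<Longrightarrow> t g \<in> car (i.Fr r) a"
        and tv: "\<And>g. g \<in> Hom D' n x \<Longrightarrow> line_coeff r g (Suc a) v = act (i.Fr r) (\<epsilon> a) (t g)"
        by metis
      \<comment> \<open>The preimages \<open>t g\<close>, obtained for each line coordinate
        separately, are assembled into one family of coefficients. Finiteness of its support is not
        automatic, as there may be infinitely many \<open>g\<close>.\<close>
      define w where "w = (\<lambda>p \<in> Hom D (n(i := r)) (x(i := a)). t (restrict p I) (p i))"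
      have w: "w (g(i := u)) = t g u" if "g \<in> Hom D' n x" "u \<in> Hom (C i) r a" for g u
        using Hom_pair[OF that] restrict_pair_Hom[OF that(1)] by (simp add: w_def)
      have tc: "t g \<in> (\<Pi>\<^sub>E u\<in>Hom (C i) r a. carrier k)" "finite {u \<in> Hom (C i) r a. t g u \<noteq> \<zero>\<^bsub>k\<^esub>}"
        if "g \<in> Hom D' n x" for g
        using t[OF that] by (auto simp: free_cmod_fib fsum_simps)
      let ?G = "(\<lambda>p. restrict p I) ` {p \<in> Hom D (n(i := r)) (x(i := Suc a)). v p \<noteq> \<zero>\<^bsub>k\<^esub>}"
      \<comment> \<open>Outside the finitely many \<open>g\<close> that occur in the support of
        \<open>v\<close>, the line coordinate of \<open>v\<close> is zero, and injectivity of the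
        shift map forces \<open>t g\<close> to vanish too.\<close>
      have t0: "t g = \<zero>\<^bsub>fib (i.Fr r) a\<^esub>" if g: "g \<in> Hom D' n x" and "g \<notin> ?G" for g
      proof (rule i.shift_inj[OF t[OF g]])
        have "v (g(i := u)) = \<zero>\<^bsub>k\<^esub>" if "u \<in> Hom (C i) r (Suc a)" for u
        proof (rule ccontr)
          assume "v (g(i := u)) \<noteq> \<zero>\<^bsub>k\<^esub>"
          then have "g(i := u) \<in> {p \<in> Hom D (n(i := r)) (x(i := Suc a)). v p \<noteq> \<zero>\<^bsub>k\<^esub>}"
            using Hom_pair[OF g that] by simp
          from imageI[OF this, of "\<lambda>p. restrict p I"] show False
            using restrict_pair_Hom[OF g] \<open>g \<notin> ?G\<close> by simp
        qed
        then have "line_coeff r g (Suc a) v = \<zero>\<^bsub>fib (i.Fr r) (Suc a)\<^esub>"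
          by (auto simp: line_coeff_def free_cmod_fib fsum_simps fun_eq_iff)
        then show "act (i.Fr r) (\<epsilon> a) (t g) = \<zero>\<^bsub>fib (i.Fr r) (Suc a)\<^esub>" using tv[OF g] by simp
      qed
      have wc: "w \<in> car (Fr (n(i := r))) (x(i := a))"
      proof -
        have "finite {p \<in> Hom D (n(i := r)) (x(i := a)). w p \<noteq> \<zero>\<^bsub>k\<^esub>}"
        proof (rule finite_subset)
          show "finite (\<Union>g \<in> ?G \<inter> Hom D' n x. (\<lambda>u. g(i := u)) ` {u \<in> Hom (C i) r a. t g u \<noteq> \<zero>\<^bsub>k\<^esub>})"
            using v tc by (intro finite_UN_I finite_imageI finite_Int) (auto simp: free_cmod_fib fsum_simps)
          show "{p \<in> Hom D (n(i := r)) (x(i := a)). w p \<noteq> \<zero>\<^bsub>k\<^esub>}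
              \<subseteq> (\<Union>g \<in> ?G \<inter> Hom D' n x. (\<lambda>u. g(i := u)) ` {u \<in> Hom (C i) r a. t g u \<noteq> \<zero>\<^bsub>k\<^esub>})"
          proof
            fix p assume p: "p \<in> {p \<in> Hom D (n(i := r)) (x(i := a)). w p \<noteq> \<zero>\<^bsub>k\<^esub>}"
            then have "p \<in> Hom D (n(i := r)) (x(i := a))" by simp
            then obtain g u where g: "p = g(i := u)" "g \<in> Hom D' n x" "u \<in> Hom (C i) r a"
              by (rule Hom_cases[OF _ n x])
            then have nz: "t g u \<noteq> \<zero>\<^bsub>k\<^esub>" using p w by auto
            have "g \<in> ?G"
            proof (rule ccontr)
              assume "g \<notin> ?G"
              from t0[OF g(2) this] show False using nz g(3) by (simp add: free_cmod_fib fsum_simps)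
            qed
            then show "p \<in> (\<Union>g \<in> ?G \<inter> Hom D' n x. (\<lambda>u. g(i := u)) ` {u \<in> Hom (C i) r a. t g u \<noteq> \<zero>\<^bsub>k\<^esub>})"
              using g nz by blast
          qed
        qed
        moreover have "w p \<in> carrier k" if p: "p \<in> Hom D (n(i := r)) (x(i := a))" for p
          using p
        proof (rule Hom_cases[OF _ n x])
          fix g u assume "p = g(i := u)" "g \<in> Hom D' n x" "u \<in> Hom (C i) r a"
          then show "w p \<in> carrier k" using w tc(1) by auto
        qed
        ultimately show ?thesis by (auto simp: free_cmod_fib fsum_simps w_def)
      qed
      have "v = act (Fr (n(i := r))) (eps x a) w"
      proof (rule line_coeff_eqI[OF n x v Fc.act_closed[OF e wc]])
        fix g assume g: "g \<in> Hom D' n x"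
        have "line_coeff r g a w = t g"
          using w[OF g] tc(1)[OF g] by (auto simp: line_coeff_def fun_eq_iff PiE_def extensional_def)
        then show "line_coeff r g (Suc a) v = line_coeff r g (Suc a) (act (Fr (n(i := r))) (eps x a) w)"
          using line_coeff_act[OF n g i.\<epsilon> wc] tv[OF g] by simp
      qed
      then show "\<exists>t \<in> car (Fr (n(i := r))) (x(i := a)). v = act (Fr (n(i := r))) (eps x a) t"
        using wc by blast
    next
      assume "\<exists>t \<in> car (Fr (n(i := r))) (x(i := a)). v = act (Fr (n(i := r))) (eps x a) t"
      then obtain t where t: "t \<in> car (Fr (n(i := r))) (x(i := a))" "v = act (Fr (n(i := r))) (eps x a) t" by blast
      have "h q \<sigma> (x(i := a)) v = \<zero>\<^bsub>fib (Fr (n(i := q))) (x(i := a))\<^esub>" if T': "(q, \<sigma>) \<in> T" for q \<sigma>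
      proof -
        interpret q: cmod k D "Fr (n(i := q))"
          using free_module.cmodule_free[OF free[OF Ob_pair[OF n]]] cat by unfold_locales
        have "linear_map k (fib (Fr (n(i := r))) (x(i := Suc a))) (fib (Fr (n(i := q))) (x(i := a))) (h q \<sigma> (x(i := a)))"
          using hh[OF T'] Ob_pair[OF x, of a] by (auto simp: cmod_hom_def)
        note c = linear_map_closed[OF this v]
        show ?thesis
        proof (rule line_coeff_eqI[OF n x c q.zero_closed[OF Ob_pair[OF x]]])
          fix g assume g: "g \<in> Hom D' n x"
          have "line_coeff r g (Suc a) v = act (i.Fr r) (\<epsilon> a) (line_coeff r g a t)"
            unfolding t(2) by (rule line_coeff_act[OF n g i.\<epsilon> t(1)])
          moreover have "line_coeff r g a t \<in> car (i.Fr r) a"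
            by (rule linear_map_closed[OF line_coeff(1)[OF n g] t(1)])
          ultimately have "\<sigma> a (line_coeff r g (Suc a) v) = \<zero>\<^bsub>fib (i.Fr q) a\<^esub>"
            using Tker[OF lv[OF g]] T' by blast
          then show "line_coeff q g a (h q \<sigma> (x(i := a)) v)
              = line_coeff q g a \<zero>\<^bsub>fib (Fr (n(i := q))) (x(i := a))\<^esub>"
            using hl[OF T' v g] lz[OF g] by simp
        qed
      qed
      then show "\<forall>(m, \<sigma>) \<in> S. \<sigma> (x(i := a)) v = \<zero>\<^bsub>fib (Fr m) (x(i := a))\<^esub>"
        by (auto simp: S_def)
    qed
  qed
qed

end

section \<open>Coherence\<close>

text \<open>The kernel of the map to the product of the targets, without forming that product.
  Indexing by pairs allows any number of functionals with the same target.\<close>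

definition joint_kernel ::
  "'k ring \<Rightarrow> ('o, 'a) cat \<Rightarrow> ('o, 'a, 'k, 'v) cmod \<Rightarrow> ('o \<times> ('o \<Rightarrow> 'v \<Rightarrow> 'a \<Rightarrow> 'k)) set \<Rightarrow> 'o \<Rightarrow> 'v set" where
  "joint_kernel k C E R x = {e \<in> car E x. \<forall>(n, \<rho>) \<in> R. \<rho> x e = \<zero>\<^bsub>fib (free_cmod k C n) x\<^esub>}"

definition functionals ::
  "'k ring \<Rightarrow> ('o, 'a) cat \<Rightarrow> ('o, 'a, 'k, 'v) cmod \<Rightarrow> ('o \<times> ('o \<Rightarrow> 'v \<Rightarrow> 'a \<Rightarrow> 'k)) set \<Rightarrow> bool" where
  "functionals k C E R \<longleftrightarrow> (\<forall>(n, \<rho>) \<in> R. n \<in> Ob C \<and> cmod_hom k C E (free_cmod k C n) \<rho>)"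

lemma functionalsD:
  assumes "functionals k C E R" "(n, \<rho>) \<in> R" "cring k" "category C" "cmodule k C E"
  shows "n \<in> Ob C" "cmod_map k C E (free_cmod k C n) \<rho>"
proof -
  show n: "n \<in> Ob C" using assms by (auto simp: functionals_def)
  have "cmodule k C (free_cmod k C n)"
    by (rule free_module.cmodule_free[OF free_module.intro[OF assms(3,4) n]])
  moreover have "cmod_hom k C E (free_cmod k C n) \<rho>" using assms by (auto simp: functionals_def)
  ultimately show "cmod_map k C E (free_cmod k C n) \<rho>" using assms(4,5) by unfold_locales
qed

lemma (in cmod) subm_joint_kernel:
  assumes k: "cring k" and R: "functionals k C V R"
  shows "subm k C V (joint_kernel k C V R)"
proof -
  define K where "K p x = {v \<in> car V x. snd p x v = \<zero>\<^bsub>fib (free_cmod k C (fst p)) x\<^esub>}" for p x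
  have s: "subm k C V (K p)" if "p \<in> R" for p
    unfolding K_def[abs_def]
    by (rule cmod_map.subm_kernel[OF functionalsD(2)[OF R _ k cat cm]]) (use that in simp)
  have m: "joint_kernel k C V R x = car V x \<inter> (\<Inter>p\<in>R. K p x)" for x
    by (auto simp: joint_kernel_def K_def split_beta)
  show ?thesis
    unfolding subm_def m
    using submD(2-5)[OF subm_car] submD(2-5)[OF s] by auto
qed

section \<open>Shifts, slices and the inductive step of coherence\<close>

context product_step
begin

abbreviation "deg \<equiv> total_degree (insert i I)"
abbreviation "deg' \<equiv> total_degree I"

lemma shift_line: "Shift \<psi> (line n E) = line n (shift E)"
  by (simp add: pullback_cmod_def)

text \<open>An equality of modules and not merely an isomorphism, since \<open>\<psi>\<close>
  preserves identities. Generators found in a slice at \<open>Suc a\<close> can thus be used at the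
  coordinate \<open>a\<close> of the shift without transport.\<close>

lemma shift_slice: "slice (Suc a) E = slice a (shift E)"
  using functor_Ident[OF i.\<psi>] by (simp add: pullback_cmod_def)

lemma pair_factor:
  assumes "f \<in> Hom D' x y" "u \<in> Hom (C i) a b"
  shows "f(i := u) = Comp D (f(i := Ident (C i) b)) ((Ident D' x)(i := u))"
    "f(i := u) = Comp D ((Ident D' y)(i := u)) (f(i := Ident (C i) a))"
  using assms by (simp_all add: Comp_pair category_Comp_Ident[OF cat' assms(1)] category_Comp_Ident[OF i.cat assms(2)])

context
  fixes E :: "('i \<Rightarrow> nat, 'i \<Rightarrow> 'a, 'k, 'v) cmod"
  assumes E: "cmodule k D E"
begin

interpretation E: cmod k D E using cat E by unfold_locales

lemma cmodule_shift: "cmodule k D (shift E)"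
  by (rule cmodule_pullback[OF cat cat functor_shift E])

lemma cmodule_slice: "cmodule k D' (slice a E)"
  by (rule cmodule_pullback[OF cat' cat functor_slice E])

interpretation SE: cmod k D "shift E" using cat cmodule_shift by unfold_locales

text \<open>The natural map from a module to its shift in direction \<open>i\<close>: the arrow is
  \<open>\<epsilon>\<close> in that direction and the identity elsewhere.\<close>

definition mu :: "('i \<Rightarrow> nat) \<Rightarrow> 'v \<Rightarrow> 'v" where
  "mu x = act E ((Ident D x)(i := \<epsilon> (x i)))"

lemma mu_pair: "mu (x(i := a)) = act E (eps x a)"
  by (simp add: mu_def Ident_pair)

lemma mu_hom: "cmod_map k D E (shift E) mu"
proof -
  have "cmod_hom k D E (shift E) mu"
  proof (rule cmod_homI)
    fix x assume "x \<in> Ob D"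
    then obtain x' a where x: "x = x'(i := a)" "x' \<in> Ob D'" by (rule Ob_cases)
    show "linear_map k (fib E x) (fib (shift E) x) (mu x)"
      using E.act_linear[OF Hom_pair[OF category_Ident[OF cat' x(2)] i.\<epsilon>[of a]]]
      by (simp add: x(1) mu_pair)
  next
    fix f x y v assume f: "f \<in> Hom D x y" and v: "v \<in> car E x"
    obtain x' a where x: "x = x'(i := a)" "x' \<in> Ob D'" using category_Hom_Ob(1)[OF cat f] by (rule Ob_cases)
    obtain y' b where y: "y = y'(i := b)" "y' \<in> Ob D'" using category_Hom_Ob(2)[OF cat f] by (rule Ob_cases)
    obtain f' u where fu: "f = f'(i := u)" "f' \<in> Hom D' x' y'" "u \<in> Hom (C i) a b"
      using f unfolding x y by (rule Hom_cases[OF _ x(2) y(2)])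
    note ex = Hom_pair[OF category_Ident[OF cat' x(2)] i.\<epsilon>[of a]]
    note ey = Hom_pair[OF category_Ident[OF cat' y(2)] i.\<epsilon>[of b]]
    note fs = Hom_pair[OF fu(2) functor_Hom[OF i.\<psi> fu(3)]]
    have v': "v \<in> car E (x'(i := a))" using v by (simp add: x(1))
    have "act E (eps y' b) (act E (f'(i := u)) v) = act E (f'(i := \<psi> u)) (act E (eps x' a) v)"
      unfolding E.act_Comp[OF Hom_pair[OF fu(2,3)] ey v', symmetric] E.act_Comp[OF ex fs v', symmetric]
        Comp_pair category_Comp_Ident[OF cat' fu(2)] i.natural[OF fu(3)] ..
    then show "mu y (act E f v) = act (shift E) f (mu x v)"
      by (simp add: x(1) y(1) fu(1) mu_pair)
  qed
  then show ?thesis using cat E cmodule_shift by unfold_locales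
qed

text \<open>A translate of a generator \<open>s\<close> in direction \<open>i\<close> is the image
  of a basis vector under the Yoneda map of \<open>s\<close> along a line. The shift of a
  representable of \<open>r\<close> is generated at coordinates at most \<open>r\<close>, and the
  other coordinates stay as they were, so the total degree does not rise and the old bound
  \<open>N\<close> still works.\<close>

lemma gfd_shift:
  assumes g: "gfd k D deg E (car E)"
  shows "gfd k D deg (shift E) (car (shift E))"
proof -
  obtain N where N: "\<And>M x v. M \<ge> N \<Longrightarrow> x \<in> Ob D \<Longrightarrow> v \<in> car E x \<Longrightarrow> gen k D E (below deg M (car E)) x v"
    using E.gfd_bound[OF g] by blast
  let ?T = "below deg N (car (shift E))"
  have T: "\<forall>n \<in> Ob D. ?T n \<subseteq> car (shift E) n" by (auto simp: below_def)
  have main: "gen k D (shift E) ?T (x(i := a)) e"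
    if "gen k D E (below deg N (car E)) y e" "y = x(i := Suc a)" "x \<in> Ob D'" for x a y e
    using that
  proof (induction rule: gen.induct)
    case (gen_gen s n f y)
    obtain n' r where n: "n = n'(i := r)" "n' \<in> Ob D'" using category_Hom_Ob(1)[OF cat gen_gen(2)] by (rule Ob_cases)
    obtain f' u where fu: "f = f'(i := u)" "f' \<in> Hom D' n' x" "u \<in> Hom (C i) r (Suc a)"
      using gen_gen(2) unfolding gen_gen(3) n by (rule Hom_cases[OF _ n(2) gen_gen(4)])
    have s: "s \<in> car E (n'(i := r))" and dn: "r + deg' n' < N"
      using gen_gen(1) unfolding n(1) below_def degree_pair by auto
    note idu = Hom_pair[OF category_Ident[OF cat' n(2)] fu(3)]
    let ?s = "act E ((Ident D' n')(i := u)) s"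
    have s': "?s \<in> car E (n'(i := Suc a))" by (rule E.act_closed[OF idu s])
    have lc: "cmodule k (C i) (line n' E)" by (rule cmodule_pullback[OF i.cat cat functor_line[OF n(2)] E])
    have sl: "s \<in> car (line n' E) r" using s by simp
    interpret ir: free_module k "C i" r by (rule i.free)
    let ?Y = "ir.yoneda (line n' E) s"
    have Y: "cmod_hom k (C i) (i.Fr r) (line n' E) ?Y" by (rule ir.yoneda_hom[OF lc sl])
    interpret Y: cmod_map k "C i" "Shift \<psi> (i.Fr r)" "Shift \<psi> (line n' E)" "\<lambda>x. ?Y (Suc x)"
      using i.cat cmodule_pullback[OF i.cat i.cat i.\<psi> ir.cmodule_free]
        cmodule_pullback[OF i.cat i.cat i.\<psi> lc] cmod_hom_pullback[OF i.cat i.\<psi> Y] by unfold_locales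
    \<comment> \<open>Generators of the shifted representable are pushed forward along the Yoneda
      map of \<open>s\<close>, which carries the basis vector of \<open>u\<close> to the translate
      of \<open>s\<close> by \<open>u\<close>.\<close>
    have "gen k (C i) (Shift \<psi> (line n' E))
        (\<lambda>q. ?Y (Suc q) ` {w \<in> car (i.Fr r) (Suc q). q \<le> r}) a (?Y (Suc a) (basis k (C i) r (Suc a) u))"
      by (rule Y.gen_image[OF i.gen_shift_free[OF ir.basis_closed[OF fu(3)]]]) auto
    then have "gen k (C i) (line n' (shift E))
        (\<lambda>q. ?Y (Suc q) ` {w \<in> car (i.Fr r) (Suc q). q \<le> r}) a ?s"
      unfolding shift_line ir.yoneda_basis[OF lc sl fu(3)] by simp
    then have "gen k D (shift E) ?T (n'(i := a)) ?s"
    proof (rule gen_pullback[OF _ functor_line[OF n(2)] i.cat])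
      fix q
      show "?Y (Suc q) ` {w \<in> car (i.Fr r) (Suc q). q \<le> r} \<subseteq> ?T (n'(i := q))"
        using Y.map_closed[of q] dn unfolding below_def degree_pair by auto
    qed
    from SE.gen_act[OF this T Hom_pair[OF fu(2) Ident_i[of a]]]
    have "gen k D (shift E) ?T (x(i := a)) (act E (f'(i := Ident (C i) (Suc a))) ?s)"
      using functor_Ident[OF i.\<psi>, of a] by simp
    also have "act E (f'(i := Ident (C i) (Suc a))) ?s = act E f s"
      unfolding fu(1) pair_factor(1)[OF fu(2,3)]
      by (rule E.act_Comp[OF idu Hom_pair[OF fu(2) Ident_i] s, symmetric])
    finally show ?case .
  next
    case (gen_zero y)
    show ?case
      using gen.gen_zero[OF Ob_pair[OF gen_zero.prems(2), of a], of k "shift E" ?T]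
      unfolding gen_zero.prems(1) by (simp only: pullback_simps fun_upd_upd fun_upd_same)
  next
    case (gen_add y u v)
    show ?case
      using gen.gen_add[OF gen_add.IH[OF gen_add.prems]]
      unfolding gen_add.prems(1) by (simp only: pullback_simps fun_upd_upd fun_upd_same)
  next
    case (gen_smult c y v)
    show ?case
      using gen.gen_smult[OF gen_smult.hyps(1) gen_smult.IH[OF gen_smult.prems]]
      unfolding gen_smult.prems(1) by (simp only: pullback_simps fun_upd_upd fun_upd_same)
  qed
  show ?thesis
  proof (rule SE.gfdI[where N=N and S="?T"])
    fix x v assume o: "x \<in> Ob D" and v: "v \<in> car (shift E) x"
    obtain x' a where x: "x = x'(i := a)" "x' \<in> Ob D'" using o by (rule Ob_cases)
    have "gen k D E (below deg N (car E)) (x'(i := Suc a)) v"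
      by (rule N[OF _ Ob_pair[OF x(2)]]) (use v in \<open>auto simp: x(1)\<close>)
    then show "gen k D (shift E) ?T x v" unfolding x(1) by (rule main[OF _ refl x(2)])
  qed (auto simp: below_def)
qed

text \<open>An arrow ending in the slice is split so that its part in direction \<open>i\<close>
  acts before the rest. The translate of a generator by the first part already lies in the slice, at
  an object whose degree over \<open>D'\<close> does not exceed the original degree.\<close>

lemma gfd_slice:
  assumes g: "gfd k D deg E (car E)"
  shows "gfd k D' deg' (slice a E) (car (slice a E))"
proof -
  interpret sl: cmod k D' "slice a E" using cat' cmodule_slice by unfold_locales
  obtain N where N: "\<And>M x v. M \<ge> N \<Longrightarrow> x \<in> Ob D \<Longrightarrow> v \<in> car E x \<Longrightarrow> gen k D E (below deg M (car E)) x v"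
    using E.gfd_bound[OF g] by blast
  let ?T = "below deg' N (car (slice a E))"
  have main: "gen k D' (slice a E) ?T x e"
    if "gen k D E (below deg N (car E)) y e" "y = x(i := a)" "x \<in> Ob D'" for x y e
    using that
  proof (induction rule: gen.induct)
    case (gen_gen s n f y)
    obtain n' r where n: "n = n'(i := r)" "n' \<in> Ob D'" using category_Hom_Ob(1)[OF cat gen_gen(2)] by (rule Ob_cases)
    obtain f' u where fu: "f = f'(i := u)" "f' \<in> Hom D' n' x" "u \<in> Hom (C i) r a"
      using gen_gen(2) unfolding gen_gen(3) n by (rule Hom_cases[OF _ n(2) gen_gen(4)])
    have s: "s \<in> car E (n'(i := r))" and dn: "r + deg' n' < N"
      using gen_gen(1) unfolding n(1) below_def degree_pair by auto
    note idu = Hom_pair[OF category_Ident[OF cat' n(2)] fu(3)]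
    let ?s = "act E ((Ident D' n')(i := u)) s"
    have "?s \<in> ?T n'" using E.act_closed[OF idu s] dn by (simp add: below_def)
    from gen.gen_gen[of ?s ?T n' f' D' x k "slice a E", OF this fu(2)]
    have "gen k D' (slice a E) ?T x (act E (f'(i := Ident (C i) a)) ?s)" by simp
    also have "act E (f'(i := Ident (C i) a)) ?s = act E f s"
      unfolding fu(1) pair_factor(1)[OF fu(2,3)]
      by (rule E.act_Comp[OF idu Hom_pair[OF fu(2) Ident_i] s, symmetric])
    finally show ?case .
  next
    case (gen_zero y)
    show ?case
      using gen.gen_zero[OF gen_zero.prems(2), of k "slice a E" ?T]
      unfolding gen_zero.prems(1) by (simp only: pullback_simps)
  next
    case (gen_add y u v)
    show ?case
      using gen.gen_add[OF gen_add.IH[OF gen_add.prems]]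
      unfolding gen_add.prems(1) by (simp only: pullback_simps)
  next
    case (gen_smult c y v)
    show ?case
      using gen.gen_smult[OF gen_smult.hyps(1) gen_smult.IH[OF gen_smult.prems]]
      unfolding gen_smult.prems(1) by (simp only: pullback_simps)
  qed
  show ?thesis
  proof (rule sl.gfdI[where N=N and S="?T"])
    fix x v assume x: "x \<in> Ob D'" and v: "v \<in> car (slice a E) x"
    have "gen k D E (below deg N (car E)) (x(i := a)) v"
      by (rule N[OF _ Ob_pair[OF x]]) (use v in auto)
    then show "gen k D' (slice a E) ?T x v" by (rule main[OF _ refl x])
  qed (auto simp: below_def)
qed

text \<open>A functional with target \<open>M(n)\<close> breaks up over the slice into one
  functional for each arrow from \<open>n i\<close> to \<open>a\<close>, namely its coordinates in
  the decomposition of \<open>M(n)\<close>. The new targets keep the coordinates of \<open>n\<close>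
  outside \<open>i\<close>, so a bound on these is inherited. For \<open>n i > a\<close> there is no
  such arrow, and the fibre of \<open>M(n)\<close> is zero.\<close>

lemma joint_kernel_slice:
  fixes a :: nat
  assumes R: "functionals k D E R"
  defines "R' \<equiv> {(restrict n I, \<lambda>x e. slice_coeff (restrict n I) u x (\<rho> (x(i := a)) e)) | n \<rho> u.
    (n, \<rho>) \<in> R \<and> u \<in> Hom (C i) (n i) a}"
  shows "functionals k D' (slice a E) R'"
    and "x \<in> Ob D' \<Longrightarrow> joint_kernel k D' (slice a E) R' x = joint_kernel k D E R (x(i := a))"
proof -
  have nR: "n = (restrict n I)(i := n i)" "restrict n I \<in> Ob D'" if "(n, \<rho>) \<in> R" for n \<rho>
  proof -
    have "n \<in> Ob D" by (rule functionalsD(1)[OF R that i.k cat E])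
    then show "n = (restrict n I)(i := n i)" "restrict n I \<in> Ob D'"
      by (auto simp: prod_cat_Ob PiE_iff extensional_def)
  qed
  show "functionals k D' (slice a E) R'"
    unfolding functionals_def
  proof (intro ballI, clarify, intro conjI)
    fix m s assume "(m, s) \<in> R'"
    then obtain n \<rho> u where m: "m = restrict n I" and s: "s = (\<lambda>x e. slice_coeff (restrict n I) u x (\<rho> (x(i := a)) e))"
      and n: "(n, \<rho>) \<in> R" and u: "u \<in> Hom (C i) (n i) a" by (auto simp: R'_def)
    show "m \<in> Ob D'" unfolding m by (rule nR(2)[OF n])
    have "cmod_hom k D' (slice a E) (slice a (Fr n)) (\<lambda>x. \<rho> (x(i := a)))"
      by (rule cmod_hom_pullback[OF cat' functor_slice]) (use R n in \<open>auto simp: functionals_def\<close>)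
    moreover have "cmod_hom k D' (slice a (Fr n)) (free_cmod k D' (restrict n I)) (slice_coeff (restrict n I) u)"
      using slice_coeff_hom[OF nR(2)[OF n] u] unfolding nR(1)[OF n, symmetric] .
    ultimately show "cmod_hom k D' (slice a E) (free_cmod k D' m) s"
      unfolding m s by (rule cmod_hom_comp[OF cat'])
  qed
  assume x: "x \<in> Ob D'"
  have key: "(\<forall>u \<in> Hom (C i) (n i) a. slice_coeff (restrict n I) u x (\<rho> (x(i := a)) e) = \<zero>\<^bsub>fib (free_cmod k D' (restrict n I)) x\<^esub>)
      \<longleftrightarrow> \<rho> (x(i := a)) e = \<zero>\<^bsub>fib (Fr n) (x(i := a))\<^esub>" if n: "(n, \<rho>) \<in> R" and e: "e \<in> car E (x(i := a))" for n \<rho> e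
  proof -
    let ?n = "restrict n I"
    interpret \<rho>: cmod_map k D E "Fr n" \<rho> by (rule functionalsD(2)[OF R n i.k cat E])
    have c: "\<rho> (x(i := a)) e \<in> car (Fr (?n(i := n i))) (x(i := a))"
      using \<rho>.map_closed[OF Ob_pair[OF x] e] nR(1)[OF n] by simp
    have z: "\<zero>\<^bsub>fib (Fr (?n(i := n i))) (x(i := a))\<^esub> \<in> car (Fr (?n(i := n i))) (x(i := a))"
      using \<rho>.W.zero_closed[OF Ob_pair[OF x]] nR(1)[OF n] by simp
    have l: "slice_coeff ?n u x \<zero>\<^bsub>fib (Fr (?n(i := n i))) (x(i := a))\<^esub> = \<zero>\<^bsub>fib (free_cmod k D' ?n) x\<^esub>"
      if "u \<in> Hom (C i) (n i) a" for u
      by (rule linear_map_zero[OF free_module.fib_module[OF free[OF Ob_pair[OF nR(2)[OF n]]]]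
            free_module.fib_module[OF free'[OF nR(2)[OF n]]] slice_coeff(1)[OF nR(2)[OF n] that]])
    show ?thesis
    proof
      assume h: "\<forall>u \<in> Hom (C i) (n i) a. slice_coeff ?n u x (\<rho> (x(i := a)) e) = \<zero>\<^bsub>fib (free_cmod k D' ?n) x\<^esub>"
      have "\<rho> (x(i := a)) e = \<zero>\<^bsub>fib (Fr (?n(i := n i))) (x(i := a))\<^esub>"
        by (rule slice_coeff_eqI[OF nR(2)[OF n] x c z]) (use h l in simp)
      then show "\<rho> (x(i := a)) e = \<zero>\<^bsub>fib (Fr n) (x(i := a))\<^esub>" using nR(1)[OF n] by simp
    next
      assume "\<rho> (x(i := a)) e = \<zero>\<^bsub>fib (Fr n) (x(i := a))\<^esub>"
      then show "\<forall>u \<in> Hom (C i) (n i) a. slice_coeff ?n u x (\<rho> (x(i := a)) e) = \<zero>\<^bsub>fib (free_cmod k D' ?n) x\<^esub>"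
        using l nR(1)[OF n] by simp
    qed
  qed
  show "joint_kernel k D' (slice a E) R' x = joint_kernel k D E R (x(i := a))"
  proof (intro equalityI subsetI)
    fix e assume e: "e \<in> joint_kernel k D' (slice a E) R' x"
    then have ec: "e \<in> car E (x(i := a))" by (simp add: joint_kernel_def)
    have "\<rho> (x(i := a)) e = \<zero>\<^bsub>fib (Fr n) (x(i := a))\<^esub>" if n: "(n, \<rho>) \<in> R" for n \<rho>
    proof (subst key[OF n ec, symmetric], rule ballI)
      fix u assume "u \<in> Hom (C i) (n i) a"
      then have "(restrict n I, \<lambda>x e. slice_coeff (restrict n I) u x (\<rho> (x(i := a)) e)) \<in> R'"
        using n unfolding R'_def by blast
      with e show "slice_coeff (restrict n I) u x (\<rho> (x(i := a)) e) = \<zero>\<^bsub>fib (free_cmod k D' (restrict n I)) x\<^esub>"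
        unfolding joint_kernel_def by auto
    qed
    then show "e \<in> joint_kernel k D E R (x(i := a))" using ec by (auto simp: joint_kernel_def)
  next
    fix e assume e: "e \<in> joint_kernel k D E R (x(i := a))"
    then have ec: "e \<in> car E (x(i := a))" by (simp add: joint_kernel_def)
    have "s x e = \<zero>\<^bsub>fib (free_cmod k D' m) x\<^esub>" if ms: "(m, s) \<in> R'" for m s
    proof -
      obtain n \<rho> u where m: "m = restrict n I" and s: "s = (\<lambda>x e. slice_coeff (restrict n I) u x (\<rho> (x(i := a)) e))"
        and n: "(n, \<rho>) \<in> R" and u: "u \<in> Hom (C i) (n i) a" using ms by (auto simp: R'_def)
      have "\<rho> (x(i := a)) e = \<zero>\<^bsub>fib (Fr n) (x(i := a))\<^esub>" using e n by (auto simp: joint_kernel_def)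
      then show ?thesis using key[OF n ec] u unfolding m s by simp
    qed
    then show "e \<in> joint_kernel k D' (slice a E) R' x" using ec by (auto simp: joint_kernel_def)
  qed
qed

end

text \<open>Each shifted functional is followed by all the maps that cut out the image of
  \<open>M(n)\<close> in its shift. The common kernel then consists of the elements whose values
  under every old functional lie in that image. The last property of the new targets, a strict drop
  at \<open>i\<close> with all other coordinates kept, drives the inner induction.\<close>

lemma shift_functionals:
  assumes E: "cmodule k D E" and R: "functionals k D E R"
  obtains R' where "functionals k D (shift E) R'"
    and "\<And>x a z. x \<in> Ob D' \<Longrightarrow> z \<in> car E (x(i := Suc a)) \<Longrightarrow>
      z \<in> joint_kernel k D (shift E) R' (x(i := a)) \<longleftrightarrow>
      (\<forall>(n, \<rho>) \<in> R. \<exists>t \<in> car (Fr n) (x(i := a)). \<rho> (x(i := Suc a)) z = act (Fr n) (eps x a) t)"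
    and "\<And>m s. (m, s) \<in> R' \<Longrightarrow> \<exists>n \<rho> q. (n, \<rho>) \<in> R \<and> q < n i \<and> m = n(i := q)"
proof -
  define P where "P n S \<longleftrightarrow>
    (\<forall>m s. (m, s) \<in> S \<longrightarrow> (\<exists>q<n i. m = n(i := q)) \<and> cmod_hom k D (shift (Fr n)) (Fr m) s) \<and>
    (\<forall>x a v. x \<in> Ob D' \<longrightarrow> v \<in> car (Fr n) (x(i := Suc a)) \<longrightarrow>
       (\<forall>(m, s) \<in> S. s (x(i := a)) v = \<zero>\<^bsub>fib (Fr m) (x(i := a))\<^esub>)
       \<longleftrightarrow> (\<exists>t \<in> car (Fr n) (x(i := a)). v = act (Fr n) (eps x a) t))" for n S
  have ex: "\<exists>S. P n S" if n: "n \<in> Ob D" for n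
  proof -
    obtain n' r where n': "n = n'(i := r)" "n' \<in> Ob D'" using n by (rule Ob_cases)
    show ?thesis
    proof (rule shift_embedding[OF n'(2), of r])
      fix S assume 1: "\<And>m s. (m, s) \<in> S \<Longrightarrow> (\<exists>q<r. m = n'(i := q)) \<and> cmod_hom k D (shift (Fr (n'(i := r)))) (Fr m) s"
        and 2: "\<And>x a v. x \<in> Ob D' \<Longrightarrow> v \<in> car (Fr (n'(i := r))) (x(i := Suc a)) \<Longrightarrow>
         (\<forall>(m, s) \<in> S. s (x(i := a)) v = \<zero>\<^bsub>fib (Fr m) (x(i := a))\<^esub>)
         \<longleftrightarrow> (\<exists>t \<in> car (Fr (n'(i := r))) (x(i := a)). v = act (Fr (n'(i := r))) (eps x a) t)"
      have "P n S" unfolding P_def n'(1)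
        using 1 2 by simp
      then show ?thesis by (rule exI[of _ S])
    qed
  qed
  define S where "S n = (SOME S. P n S)" for n
  have S: "P n (S n)" if "n \<in> Ob D" for n unfolding S_def by (rule someI_ex[OF ex[OF that]])
  have S1: "(\<exists>q<n i. m = n(i := q)) \<and> cmod_hom k D (shift (Fr n)) (Fr m) s" if "n \<in> Ob D" "(m, s) \<in> S n" for n m s
    using S[OF that(1)] that(2) by (simp add: P_def)
  have S2: "(\<forall>(m, s) \<in> S n. s (x(i := a)) v = \<zero>\<^bsub>fib (Fr m) (x(i := a))\<^esub>)
       \<longleftrightarrow> (\<exists>t \<in> car (Fr n) (x(i := a)). v = act (Fr n) (eps x a) t)"
    if "n \<in> Ob D" "x \<in> Ob D'" "v \<in> car (Fr n) (x(i := Suc a))" for n x a v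
    using S[OF that(1)] that(2,3) by (simp add: P_def)
  define R' where "R' = {(m, \<lambda>x e. s x (\<rho> (x(i := Suc (x i))) e)) | m s n \<rho>. (n, \<rho>) \<in> R \<and> (m, s) \<in> S n}"
  have Rn: "n \<in> Ob D" "cmod_hom k D E (Fr n) \<rho>" if "(n, \<rho>) \<in> R" for n \<rho>
    using R that by (auto simp: functionals_def)
  show thesis
  proof (rule that[of R'])
    show "functionals k D (shift E) R'"
      unfolding functionals_def
    proof (intro ballI, clarify, intro conjI)
      fix m s' assume "(m, s') \<in> R'"
      then obtain s n \<rho> where s': "s' = (\<lambda>x e. s x (\<rho> (x(i := Suc (x i))) e))" and n: "(n, \<rho>) \<in> R" and m: "(m, s) \<in> S n"
        by (auto simp: R'_def)
      obtain n' r where n': "n = n'(i := r)" "n' \<in> Ob D'" using Rn(1)[OF n] by (rule Ob_cases)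
      show "m \<in> Ob D" using S1[OF Rn(1)[OF n] m] Ob_pair[OF n'(2)] by (auto simp: n'(1))
      show "cmod_hom k D (shift E) (Fr m) s'" unfolding s'
        by (rule cmod_hom_comp[OF cat cmod_hom_pullback[OF cat functor_shift Rn(2)[OF n]]
              conjunct2[OF S1[OF Rn(1)[OF n] m]]])
    qed
  next
    fix m s' assume "(m, s') \<in> R'"
    then obtain s n \<rho> where n: "(n, \<rho>) \<in> R" and m: "(m, s) \<in> S n" by (auto simp: R'_def)
    then show "\<exists>n \<rho> q. (n, \<rho>) \<in> R \<and> q < n i \<and> m = n(i := q)" using S1[OF Rn(1)[OF n] m] by blast
  next
    fix x a z assume x: "x \<in> Ob D'" and z: "z \<in> car E (x(i := Suc a))"
    have c: "\<rho> (x(i := Suc a)) z \<in> car (Fr n) (x(i := Suc a))" if "(n, \<rho>) \<in> R" for n \<rho>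
      using cmod_map.map_closed[OF functionalsD(2)[OF R that i.k cat E] Ob_pair[OF x] z] .
    have "z \<in> joint_kernel k D (shift E) R' (x(i := a)) \<longleftrightarrow>
        (\<forall>n \<rho>. (n, \<rho>) \<in> R \<longrightarrow> (\<forall>(m, s) \<in> S n. s (x(i := a)) (\<rho> (x(i := Suc a)) z) = \<zero>\<^bsub>fib (Fr m) (x(i := a))\<^esub>))"
    proof (intro iffI allI impI)
      fix n \<rho> assume zk: "z \<in> joint_kernel k D (shift E) R' (x(i := a))" and n: "(n, \<rho>) \<in> R"
      show "\<forall>(m, s) \<in> S n. s (x(i := a)) (\<rho> (x(i := Suc a)) z) = \<zero>\<^bsub>fib (Fr m) (x(i := a))\<^esub>"
      proof (intro ballI, clarify)
        fix m s assume "(m, s) \<in> S n"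
        then have "(m, \<lambda>x e. s x (\<rho> (x(i := Suc (x i))) e)) \<in> R'" using n unfolding R'_def by blast
        then show "s (x(i := a)) (\<rho> (x(i := Suc a)) z) = \<zero>\<^bsub>fib (Fr m) (x(i := a))\<^esub>"
          using zk unfolding joint_kernel_def by fastforce
      qed
    next
      assume h: "\<forall>n \<rho>. (n, \<rho>) \<in> R \<longrightarrow> (\<forall>(m, s) \<in> S n. s (x(i := a)) (\<rho> (x(i := Suc a)) z) = \<zero>\<^bsub>fib (Fr m) (x(i := a))\<^esub>)"
      have "s' (x(i := a)) z = \<zero>\<^bsub>fib (Fr m) (x(i := a))\<^esub>" if ms: "(m, s') \<in> R'" for m s'
      proof -
        obtain s n \<rho> where s': "s' = (\<lambda>x e. s x (\<rho> (x(i := Suc (x i))) e))" and n: "(n, \<rho>) \<in> R" and m: "(m, s) \<in> S n"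
          using ms by (auto simp: R'_def)
        show ?thesis using h[rule_format, OF n m] unfolding s' by simp
      qed
      then show "z \<in> joint_kernel k D (shift E) R' (x(i := a))" using z by (auto simp: joint_kernel_def)
    qed
    also have "\<dots> \<longleftrightarrow> (\<forall>n \<rho>. (n, \<rho>) \<in> R \<longrightarrow> (\<exists>t \<in> car (Fr n) (x(i := a)). \<rho> (x(i := Suc a)) z = act (Fr n) (eps x a) t))"
      using S2[OF Rn(1) x c] by simp
    finally show "z \<in> joint_kernel k D (shift E) R' (x(i := a)) \<longleftrightarrow>
      (\<forall>(n, \<rho>) \<in> R. \<exists>t \<in> car (Fr n) (x(i := a)). \<rho> (x(i := Suc a)) z = act (Fr n) (eps x a) t)"
      by auto
  qed
qed

text \<open>The inductive step. With \<open>L\<close> the joint kernel, the family \<open>Z\<close> consists of the elements of the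
  shift on which all functionals take values in the image of the shift map. It is a joint kernel of
  functionals of smaller degree, hence generated in finite degrees. The family \<open>Y\<close> is the sum of the
  shift of \<open>L\<close> and the image of \<open>E\<close>. Non-endomorphisms in direction \<open>i\<close> map \<open>Z\<close> into \<open>Y\<close>, so that
  finitely many slices of \<open>Y\<close> control \<open>Y\<close>, which in turn controls \<open>L\<close>.\<close>

lemma coherence_descent:
  fixes E :: "('i \<Rightarrow> nat, 'i \<Rightarrow> 'a, 'k, 'v) cmod"
  assumes E: "cmodule k D E" and gE: "gfd k D deg E (car E)" and R: "functionals k D E R"
    and R': "functionals k D (shift E) R'"
    and Zdef: "\<And>x a z. x \<in> Ob D' \<Longrightarrow> z \<in> car E (x(i := Suc a)) \<Longrightarrow>
      z \<in> joint_kernel k D (shift E) R' (x(i := a)) \<longleftrightarrow>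
      (\<forall>(n, \<rho>) \<in> R. \<exists>t \<in> car (Fr n) (x(i := a)). \<rho> (x(i := Suc a)) z = act (Fr n) (eps x a) t)"
    and gZ: "gfd k D deg (shift E) (joint_kernel k D (shift E) R')"
    and slices: "\<And>a. gfd k D' deg' (slice a E) (\<lambda>x. joint_kernel k D E R (x(i := a)))"
  shows "gfd k D deg E (joint_kernel k D E R)"
proof -
  interpret E: cmod k D E using cat E by unfold_locales
  interpret mu: cmod_map k D E "shift E" "mu E" by (rule mu_hom[OF E])
  define L where "L = joint_kernel k D E R"
  define Z where "Z = joint_kernel k D (shift E) R'"
  define Y where "Y x = {z. \<exists>l \<in> L (x(i := Suc (x i))). \<exists>e \<in> car E x. z = l \<oplus>\<^bsub>fib (shift E) x\<^esub> mu E x e}" for x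
  note sL = E.subm_joint_kernel[OF i.k R, folded L_def]
  note sZ = mu.W.subm_joint_kernel[OF i.k R', folded Z_def]
  note sLD = submD[OF sL] and sZD = submD[OF sZ]
  have sOb: "x(i := Suc (x i)) \<in> Ob D" if "x \<in> Ob D" for x
    using functor_Ob[OF functor_shift that] .
  have Lc: "l \<in> car (shift E) x" if "x \<in> Ob D" "l \<in> L (x(i := Suc (x i)))" for x l
    using sLD(1)[OF sOb[OF that(1)] that(2)] by simp
  have Yc: "Y x \<subseteq> car (shift E) x" if "x \<in> Ob D" for x
    using Lc[OF that] mu.map_closed[OF that] mu.W.add_closed[OF that] by (auto simp: Y_def)
  have LY: "l \<in> Y x" if x: "x \<in> Ob D" and l: "l \<in> L (x(i := Suc (x i)))" for x l
  proof -
    interpret x: module k "fib E (x(i := Suc (x i)))" by (rule E.fib_module[OF sOb[OF x]])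
    have "l = l \<oplus>\<^bsub>fib (shift E) x\<^esub> mu E x \<zero>\<^bsub>fib E x\<^esub>"
      using Lc[OF x l] mu.map_zero[OF x] by simp
    then show ?thesis using l E.zero_closed[OF x] unfolding Y_def by blast
  qed
  have muY: "mu E x e \<in> Y x" if x: "x \<in> Ob D" and e: "e \<in> car E x" for x e
  proof -
    interpret x: module k "fib E (x(i := Suc (x i)))" by (rule E.fib_module[OF sOb[OF x]])
    have "mu E x e = \<zero>\<^bsub>fib (shift E) x\<^esub> \<oplus>\<^bsub>fib (shift E) x\<^esub> mu E x e"
      using mu.map_closed[OF x e] by simp
    moreover have "\<zero>\<^bsub>fib (shift E) x\<^esub> \<in> L (x(i := Suc (x i)))"
      using sLD(2)[OF sOb[OF x]] by simp
    ultimately show ?thesis using e unfolding Y_def by blast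
  qed
  have \<rho>: "cmod_map k D E (Fr n) \<rho>" "n \<in> Ob D" if "(n, \<rho>) \<in> R" for n \<rho>
    using functionalsD[OF R that i.k cat E] by auto
  have L_iff: "e \<in> L x \<longleftrightarrow> e \<in> car E x \<and> (\<forall>n \<rho>. (n, \<rho>) \<in> R \<longrightarrow> \<rho> x e = \<zero>\<^bsub>fib (Fr n) x\<^esub>)" for e x
    by (auto simp: L_def joint_kernel_def)
  have epsH: "eps x a \<in> Hom D (x(i := a)) (x(i := Suc a))" if "x \<in> Ob D'" for x a
    by (rule Hom_pair[OF category_Ident[OF cat' that] i.\<epsilon>])
  have \<rho>mu: "\<rho> (x(i := Suc a)) (mu E (x(i := a)) e) = act (Fr n) (eps x a) (\<rho> (x(i := a)) e)"
    if "(n, \<rho>) \<in> R" "x \<in> Ob D'" "e \<in> car E (x(i := a))" for n \<rho> x a e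
    unfolding mu_pair[OF E] by (rule cmod_map.map_act[OF \<rho>(1)[OF that(1)] epsH[OF that(2)] that(3)])
  \<comment> \<open>Cancellation: the value of a functional at \<open>mu e\<close> is the image
    under \<open>eps\<close> of its value at \<open>e\<close>, and \<open>eps\<close> acts
    injectively on representables.\<close>
  have muL: "e \<in> L (x(i := a))" if x: "x \<in> Ob D'" and e: "e \<in> car E (x(i := a))"
    and m: "mu E (x(i := a)) e \<in> L (x(i := Suc a))" for x a e
    unfolding L_iff
  proof (intro conjI allI impI e)
    fix n \<rho> assume n: "(n, \<rho>) \<in> R"
    obtain n' r where n': "n = n'(i := r)" "n' \<in> Ob D'" using \<rho>(2)[OF n] by (rule Ob_cases)
    have "act (Fr n) (eps x a) (\<rho> (x(i := a)) e) = \<zero>\<^bsub>fib (Fr n) (x(i := Suc a))\<^esub>"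
      using \<rho>mu[OF n x e] m n by (simp add: L_iff)
    moreover have "\<rho> (x(i := a)) e \<in> car (Fr n) (x(i := a))"
      by (rule cmod_map.map_closed[OF \<rho>(1)[OF n] Ob_pair[OF x] e])
    ultimately show "\<rho> (x(i := a)) e = \<zero>\<^bsub>fib (Fr n) (x(i := a))\<^esub>"
      using free_eps_inj[OF n'(2) x] unfolding n'(1) by blast
  qed
  have YZ: "z \<in> Z (x(i := a))" if x: "x \<in> Ob D'" and z: "z \<in> Y (x(i := a))" for x a z
  proof -
    have zc: "z \<in> car E (x(i := Suc a))" using Yc[OF Ob_pair[OF x]] z by auto
    obtain l e where l: "l \<in> L (x(i := Suc a))" and e: "e \<in> car E (x(i := a))"
      and ze: "z = l \<oplus>\<^bsub>fib E (x(i := Suc a))\<^esub> mu E (x(i := a)) e" using z by (auto simp: Y_def)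
    have "\<exists>t \<in> car (Fr n) (x(i := a)). \<rho> (x(i := Suc a)) z = act (Fr n) (eps x a) t" if n: "(n, \<rho>) \<in> R" for n \<rho>
    proof -
      interpret \<rho>: cmod_map k D E "Fr n" \<rho> by (rule \<rho>(1)[OF n])
      interpret x: module k "fib (Fr n) (x(i := Suc a))" by (rule \<rho>.W.fib_module[OF Ob_pair[OF x]])
      have c: "\<rho> (x(i := a)) e \<in> car (Fr n) (x(i := a))" by (rule \<rho>.map_closed[OF Ob_pair[OF x] e])
      have lc: "l \<in> car E (x(i := Suc a))" and l0: "\<rho> (x(i := Suc a)) l = \<zero>\<^bsub>fib (Fr n) (x(i := Suc a))\<^esub>"
        using l n by (auto simp: L_iff)
      have mc: "mu E (x(i := a)) e \<in> car E (x(i := Suc a))" using mu.map_closed[OF Ob_pair[OF x] e] by simp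
      have "\<rho> (x(i := Suc a)) z = act (Fr n) (eps x a) (\<rho> (x(i := a)) e)"
        unfolding ze \<rho>.map_add[OF Ob_pair[OF x] lc mc] l0 \<rho>mu[OF n x e]
        using \<rho>.W.act_closed[OF epsH[OF x] c] by simp
      then show ?thesis using c by blast
    qed
    then show ?thesis unfolding Z_def using Zdef[OF x zc] by auto
  qed
  \<comment> \<open>Write the part of \<open>f\<close> in direction \<open>i\<close> as
    \<open>\<epsilon>\<close> at \<open>b\<close> followed by \<open>w\<close>, and let
    \<open>?e\<close> be the translate of \<open>z\<close> by \<open>w\<close>. If a functional
    takes the value \<open>\<epsilon>\<close> applied to \<open>t\<close> at \<open>z\<close>, then
    naturality of \<open>\<epsilon>\<close> shows that the translate of \<open>z\<close> in the
    shift and \<open>mu\<close> of \<open>?e\<close> have the same value, obtained from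
    \<open>t\<close> by \<open>u\<close> and then \<open>\<epsilon>\<close> at \<open>a\<close>.
    Their difference therefore lies in the shift of \<open>L\<close>.\<close>
  have ZY: "act (shift E) f z \<in> Y (x(i := a))"
    if n: "n \<in> Ob D'" and x: "x \<in> Ob D'" and z: "z \<in> Z (n(i := b))" and f: "f \<in> Hom D (n(i := b)) (x(i := a))"
      and ba: "b < a" for n x a b z f
  proof -
    have zc: "z \<in> car E (n(i := Suc b))" using sZD(1)[OF Ob_pair[OF n] z] by simp
    obtain f' u where fu: "f = f'(i := u)" "f' \<in> Hom D' n x" "u \<in> Hom (C i) b a"
      using f by (rule Hom_cases[OF _ n x])
    obtain w where w: "w \<in> Hom (C i) (Suc b) a" "u = Comp (C i) w (\<epsilon> b)" by (rule i.factor_\<epsilon>[OF fu(3) ba])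
    note fs = Hom_pair[OF fu(2) functor_Hom[OF i.\<psi> fu(3)]]
    note fw = Hom_pair[OF fu(2) w(1)]
    let ?e = "act E (f'(i := w)) z" and ?z = "act E (f'(i := \<psi> u)) z"
    have e: "?e \<in> car E (x(i := a))" by (rule E.act_closed[OF fw zc])
    have zz: "?z \<in> car E (x(i := Suc a))" by (rule E.act_closed[OF fs zc])
    have me: "mu E (x(i := a)) ?e \<in> car E (x(i := Suc a))" using mu.map_closed[OF Ob_pair[OF x] e] by simp
    note xo = Ob_pair[OF x, of "Suc a"]
    interpret xs: module k "fib E (x(i := Suc a))" by (rule E.fib_module[OF xo])
    let ?l = "?z \<ominus>\<^bsub>fib E (x(i := Suc a))\<^esub> mu E (x(i := a)) ?e"
    have "?l \<in> L (x(i := Suc a))"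
      unfolding L_iff
    proof (intro conjI allI impI)
      show "?l \<in> car E (x(i := Suc a))" by (rule E.minus_closed[OF xo zz me])
      fix m \<rho> assume m: "(m, \<rho>) \<in> R"
      interpret \<rho>: cmod_map k D E "Fr m" \<rho> by (rule \<rho>(1)[OF m])
      interpret y: module k "fib (Fr m) (x(i := Suc a))" by (rule \<rho>.W.fib_module[OF xo])
      obtain t where t: "t \<in> car (Fr m) (n(i := b))" "\<rho> (n(i := Suc b)) z = act (Fr m) (eps n b) t"
        using Zdef[OF n zc] z m unfolding Z_def by auto
      note en = epsH[OF n, of b] and ex = epsH[OF x, of a]
      have "\<rho> (x(i := Suc a)) ?z = act (Fr m) (f'(i := \<psi> u)) (act (Fr m) (eps n b) t)"
        unfolding \<rho>.map_act[OF fs zc] t(2) ..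
      also have "\<dots> = act (Fr m) (f'(i := Comp (C i) (\<epsilon> a) u)) t"
        unfolding \<rho>.W.act_Comp[OF en fs t(1), symmetric] Comp_pair
        by (simp add: category_Comp_Ident(1)[OF cat' fu(2)] i.natural[OF fu(3)])
      also have "\<dots> = act (Fr m) (eps x a) (act (Fr m) (f'(i := w)) (act (Fr m) (eps n b) t))"
        unfolding \<rho>.W.act_Comp[OF en fw t(1), symmetric]
        unfolding \<rho>.W.act_Comp[OF category_Comp[OF cat en fw] ex t(1), symmetric]
        unfolding Comp_pair
        by (simp add: category_Comp_Ident[OF cat' fu(2)] w(2))
      also have "\<dots> = \<rho> (x(i := Suc a)) (mu E (x(i := a)) ?e)"
        unfolding \<rho>mu[OF m x e] \<rho>.map_act[OF fw zc] t(2) ..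
      finally show "\<rho> (x(i := Suc a)) ?l = \<zero>\<^bsub>fib (Fr m) (x(i := Suc a))\<^esub>"
        unfolding \<rho>.map_minus[OF xo zz me] using \<rho>.map_closed[OF xo me] by (simp add: y.r_neg a_minus_def)
    qed
    moreover have "?z = ?l \<oplus>\<^bsub>fib E (x(i := Suc a))\<^esub> mu E (x(i := a)) ?e"
      using zz me by (simp add: a_minus_def xs.M.add.m_assoc xs.l_neg)
    ultimately have "?z \<in> Y (x(i := a))" using e unfolding Y_def by auto
    then show ?thesis by (simp add: fu(1))
  qed
  obtain N0 where N0: "\<And>M x v. M \<ge> N0 \<Longrightarrow> x \<in> Ob D \<Longrightarrow> v \<in> Z x \<Longrightarrow> gen k D (shift E) (below deg M Z) x v"
    using mu.W.gfd_bound[OF gZ[folded Z_def]] by blast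
  obtain N1 where N1: "\<And>M x v. M \<ge> N1 \<Longrightarrow> x \<in> Ob D \<Longrightarrow> v \<in> car E x \<Longrightarrow> gen k D E (below deg M (car E)) x v"
    using E.gfd_bound[OF gE] by blast
  \<comment> \<open>The bound supplied by fewer factors depends on the slice. It is usable because
    only the slices up to \<open>Suc N0\<close> will matter.\<close>
  have "\<exists>NL. \<forall>x \<in> Ob D'. \<forall>v \<in> L (x(i := a)). gen k D' (slice a E) (below deg' NL (\<lambda>x. L (x(i := a)))) x v" for a
    using slices[of a] unfolding gfd_def L_def .
  then obtain NL where NL: "\<And>a x v. x \<in> Ob D' \<Longrightarrow> v \<in> L (x(i := a)) \<Longrightarrow>
      gen k D' (slice a E) (below deg' (NL a) (\<lambda>x. L (x(i := a)))) x v"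
    by metis
  \<comment> \<open>The summand \<open>N1\<close> covers the generators of \<open>E\<close>. A
    generator of the slice of \<open>L\<close> at \<open>Suc a\<close> is placed at the coordinate
    \<open>a \<le> N0\<close> of the shift, which adds at most \<open>N0\<close> to its degree;
    hence the sum runs up to \<open>Suc N0\<close>, and \<open>N0\<close> is added once
    more.\<close>
  define M where "M = Suc (N0 + N1 + (\<Sum>a\<le>Suc N0. NL a))"
  have NLM: "NL a + N0 < M" if "a \<le> Suc N0" for a
    using member_le_sum[of a "{..Suc N0}" NL] that unfolding M_def by simp
  let ?G = "gen k D (shift E) (below deg M Y)"
  have Ys: "\<forall>n \<in> Ob D. below deg M Y n \<subseteq> car (shift E) n" using Yc by (auto simp: below_def)
  have G1: "?G (x(i := a)) z" if a: "a \<le> N0" and x: "x \<in> Ob D'" and z: "z \<in> Y (x(i := a))" for a x z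
  proof -
    obtain l e where l: "l \<in> L (x(i := Suc a))" and e: "e \<in> car E (x(i := a))"
      and ze: "z = l \<oplus>\<^bsub>fib (shift E) (x(i := a))\<^esub> mu E (x(i := a)) e" using z by (auto simp: Y_def)
    have "?G (x(i := a)) l"
    proof (rule gen_pullback[OF NL[OF x l, unfolded shift_slice] functor_slice cat'])
      fix n assume n: "n \<in> Ob D'"
      show "below deg' (NL (Suc a)) (\<lambda>x. L (x(i := Suc a))) n \<subseteq> below deg M Y (n(i := a))"
        using LY[OF Ob_pair[OF n], of _ a] NLM[of "Suc a"] a
        unfolding below_def degree_pair by auto
    qed
    moreover have "?G (x(i := a)) (mu E (x(i := a)) e)"
    proof (rule gen_mono[OF mu.gen_image[OF N1[OF _ Ob_pair[OF x] e, of M] _ Ob_pair[OF x]] _ cat])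
      show "N1 \<le> M" by (simp add: M_def)
      show "\<forall>n\<in>Ob D. below deg M (car E) n \<subseteq> car E n" by (auto simp: below_def)
      show "\<forall>n\<in>Ob D. mu E n ` below deg M (car E) n \<subseteq> below deg M Y n"
        using muY by (auto simp: below_def)
    qed
    ultimately show ?thesis unfolding ze by (rule gen.gen_add)
  qed
  \<comment> \<open>Generators of \<open>Z\<close> have total degree below \<open>N0\<close>, so
    their coordinate \<open>b\<close> in direction \<open>i\<close> is strictly below
    \<open>N0\<close>. An arrow to \<open>a > N0\<close> splits through the coordinate
    \<open>N0\<close>: its first half is not an endomorphism in direction \<open>i\<close> and lands
    in \<open>Y\<close> by \<open>ZY\<close>, where the slice at \<open>N0\<close> is already under
    control.\<close>
  have G2: "?G (x(i := a)) z"
    if "gen k D (shift E) (below deg N0 Z) y z" "y = x(i := a)" "x \<in> Ob D'" "N0 < a" for x a y z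
    using that
  proof (induction rule: gen.induct)
    case (gen_gen s n f y)
    note x = gen_gen.prems(2)
    obtain n' b where n: "n = n'(i := b)" "n' \<in> Ob D'" using category_Hom_Ob(1)[OF cat gen_gen(2)] by (rule Ob_cases)
    have s: "s \<in> Z (n'(i := b))" and b: "b < N0"
      using gen_gen(1) unfolding n(1) below_def degree_pair by auto
    have sc: "s \<in> car (shift E) (n'(i := b))" by (rule sZD(1)[OF Ob_pair[OF n(2)] s])
    obtain f' u where fu: "f = f'(i := u)" "f' \<in> Hom D' n' x" "u \<in> Hom (C i) b a"
      using gen_gen(2) unfolding gen_gen.prems(1) n by (rule Hom_cases[OF _ n(2) x])
    obtain g h where gh: "g \<in> Hom (C i) b N0" "h \<in> Hom (C i) N0 a" "u = Comp (C i) h g"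
      by (rule i.split_arrow[OF b gen_gen.prems(3) fu(3)])
    note fg = Hom_pair[OF fu(2) gh(1)] and ih = Hom_pair[OF category_Ident[OF cat' x] gh(2)]
    have "?G (x(i := N0)) (act (shift E) (f'(i := g)) s)"
      by (rule G1[OF order_refl x ZY[OF n(2) x s fg b]])
    from mu.W.gen_act[OF this Ys ih]
    have "?G (x(i := a)) (act (shift E) (Comp D ((Ident D' x)(i := h)) (f'(i := g))) s)"
      unfolding mu.W.act_Comp[OF fg ih sc] .
    then show ?case
      unfolding gen_gen.prems(1) fu(1) gh(3) Comp_pair category_Comp_Ident(2)[OF cat' fu(2)] .
  next
    case (gen_zero y)
    show ?case unfolding gen_zero.prems(1) by (rule gen.gen_zero[OF Ob_pair[OF gen_zero.prems(2)]])
  next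
    case (gen_add y u v)
    show ?case
      using gen.gen_add[OF gen_add.IH[OF gen_add.prems]] unfolding gen_add.prems(1) .
  next
    case (gen_smult c y v)
    show ?case
      using gen.gen_smult[OF gen_smult.hyps(1) gen_smult.IH[OF gen_smult.prems]] unfolding gen_smult.prems(1) .
  qed
  have G: "?G (x(i := a)) z" if x: "x \<in> Ob D'" and z: "z \<in> Y (x(i := a))" for x a z
  proof (cases "a \<le> N0")
    case True
    then show ?thesis by (rule G1[OF _ x z])
  next
    case False
    then show ?thesis by (intro G2[OF N0[OF order_refl Ob_pair[OF x] YZ[OF x z]] refl x]) simp
  qed
  define LS where "LS n = L (n(i := Suc (n i)))" for n
  have LSc: "\<forall>n \<in> Ob D. below deg M LS n \<subseteq> car (shift E) n" using Lc by (auto simp: below_def LS_def)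
  have LS0: "\<zero>\<^bsub>fib (shift E) x\<^esub> \<in> LS x" if "x \<in> Ob D" for x
    using sLD(2)[OF sOb[OF that]] by (simp add: LS_def)
  \<comment> \<open>Each generator of \<open>Y\<close> is an element of the shift of
    \<open>L\<close> plus an image from \<open>E\<close>, and this splitting survives arrows, sums
    and scalars. Only the first part needs to be generated in bounded degree; the second is removed
    by cancellation.\<close>
  have dec: "\<exists>l e. l \<in> LS x \<and> gen k D (shift E) (below deg M LS) x l \<and> e \<in> car E x \<and>
      z = l \<oplus>\<^bsub>fib (shift E) x\<^esub> mu E x e" if "?G x z" "x \<in> Ob D" for x z
    using that
  proof (induction rule: gen.induct)
    case (gen_gen s n f x)
    note o = category_Hom_Ob[OF cat gen_gen(2)]
    obtain l e where l: "l \<in> LS n" and e: "e \<in> car E n" and s: "s = l \<oplus>\<^bsub>fib (shift E) n\<^esub> mu E n e"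
      and dn: "deg n < M" using gen_gen(1) unfolding below_def Y_def LS_def by blast
    have lc: "l \<in> car (shift E) n" using Lc[OF o(1)] l by (simp add: LS_def)
    have "act (shift E) f l \<in> LS x"
      using sLD(5)[OF functor_Hom[OF functor_shift gen_gen(2)]] l by (simp add: LS_def)
    moreover have "gen k D (shift E) (below deg M LS) x (act (shift E) f l)"
      by (rule gen.gen_gen[where n=n, OF _ gen_gen(2)]) (use l dn in \<open>simp add: below_def\<close>)
    moreover have "act (shift E) f s = act (shift E) f l \<oplus>\<^bsub>fib (shift E) x\<^esub> mu E x (act E f e)"
      unfolding s mu.W.act_add[OF gen_gen(2) lc mu.map_closed[OF o(1) e]] mu.map_act[OF gen_gen(2) e] ..
    ultimately show ?case using E.act_closed[OF gen_gen(2) e] by blast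
  next
    case (gen_zero x)
    interpret x: module k "fib (shift E) x" by (rule mu.W.fib_module[OF gen_zero(1)])
    have "\<zero>\<^bsub>fib (shift E) x\<^esub> = \<zero>\<^bsub>fib (shift E) x\<^esub> \<oplus>\<^bsub>fib (shift E) x\<^esub> mu E x \<zero>\<^bsub>fib E x\<^esub>"
      unfolding mu.map_zero[OF gen_zero(1)] by (rule x.M.r_zero[symmetric]) (rule x.M.zero_closed)
    then show ?case
      using gen.gen_zero[OF gen_zero(1), of k "shift E" "below deg M LS"] LS0[OF gen_zero(1)]
        E.zero_closed[OF gen_zero(1)] by blast
  next
    case (gen_add x z1 z2)
    note x = gen_add.prems
    interpret x: module k "fib (shift E) x" by (rule mu.W.fib_module[OF x])
    obtain l1 e1 where 1: "l1 \<in> LS x" "gen k D (shift E) (below deg M LS) x l1" "e1 \<in> car E x"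
      "z1 = l1 \<oplus>\<^bsub>fib (shift E) x\<^esub> mu E x e1" using gen_add.IH(1)[OF x] by blast
    obtain l2 e2 where 2: "l2 \<in> LS x" "gen k D (shift E) (below deg M LS) x l2" "e2 \<in> car E x"
      "z2 = l2 \<oplus>\<^bsub>fib (shift E) x\<^esub> mu E x e2" using gen_add.IH(2)[OF x] by blast
    note c = Lc[OF x 1(1)[unfolded LS_def]] Lc[OF x 2(1)[unfolded LS_def]] mu.map_closed[OF x 1(3)] mu.map_closed[OF x 2(3)]
    have "l1 \<oplus>\<^bsub>fib (shift E) x\<^esub> l2 \<in> LS x"
      using sLD(3)[OF sOb[OF x]] 1(1) 2(1) by (simp add: LS_def)
    moreover have "z1 \<oplus>\<^bsub>fib (shift E) x\<^esub> z2
        = (l1 \<oplus>\<^bsub>fib (shift E) x\<^esub> l2) \<oplus>\<^bsub>fib (shift E) x\<^esub> mu E x (e1 \<oplus>\<^bsub>fib E x\<^esub> e2)"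
      unfolding 1(4) 2(4) mu.map_add[OF x 1(3) 2(3)] using c by (simp only: x.M.a_ac x.M.a_closed)
    ultimately show ?case
      using gen.gen_add[OF 1(2) 2(2)] E.add_closed[OF x 1(3) 2(3)] by blast
  next
    case (gen_smult c x z1)
    note x = gen_smult.prems
    interpret x: module k "fib (shift E) x" by (rule mu.W.fib_module[OF x])
    obtain l1 e1 where 1: "l1 \<in> LS x" "gen k D (shift E) (below deg M LS) x l1" "e1 \<in> car E x"
      "z1 = l1 \<oplus>\<^bsub>fib (shift E) x\<^esub> mu E x e1" using gen_smult.IH[OF x] by blast
    have "c \<odot>\<^bsub>fib (shift E) x\<^esub> l1 \<in> LS x"
      using sLD(4)[OF sOb[OF x] gen_smult.hyps(1)] 1(1) by (simp add: LS_def)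
    moreover have "c \<odot>\<^bsub>fib (shift E) x\<^esub> z1
        = c \<odot>\<^bsub>fib (shift E) x\<^esub> l1 \<oplus>\<^bsub>fib (shift E) x\<^esub> mu E x (c \<odot>\<^bsub>fib E x\<^esub> e1)"
      unfolding 1(4) mu.map_smult[OF x gen_smult.hyps(1) 1(3)]
      by (rule x.smult_r_distr[OF gen_smult.hyps(1) Lc[OF x 1(1)[unfolded LS_def]] mu.map_closed[OF x 1(3)]])
    ultimately show ?case
      using gen.gen_smult[OF gen_smult.hyps(1) 1(2)] E.smult_closed[OF x gen_smult.hyps(1) 1(3)] by blast
  qed
  have Lc': "below deg (Suc M) L n \<subseteq> car E n" if "n \<in> Ob D" for n
    using sLD(1)[OF that] by (auto simp: below_def)
  \<comment> \<open>Induction on the coordinate in direction \<open>i\<close>. At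
    \<open>Suc a\<close> the element is \<open>l'\<close> plus \<open>mu e\<close>, where
    \<open>l'\<close> is generated by \<open>L\<close> in bounded degree. Then \<open>mu e\<close>
    lies in \<open>L\<close> as a difference, so \<open>e\<close> lies in \<open>L\<close> at the
    coordinate \<open>a\<close> by \<open>muL\<close> and the induction hypothesis applies to it.
    Reading generators of the shift in \<open>E\<close> raises their degree by one, whence
    \<open>Suc M\<close>; the slice at zero starts the induction.\<close>
  have fin: "gen k D E (below deg (Suc M) L) (x(i := a)) l" if "x \<in> Ob D'" "l \<in> L (x(i := a))" for x a l
    using that
  proof (induction a arbitrary: l)
    case 0
    show ?case
    proof (rule gen_pullback[OF NL[OF 0] functor_slice cat'])
      fix n assume "n \<in> Ob D'"
      show "below deg' (NL 0) (\<lambda>x. L (x(i := 0))) n \<subseteq> below deg (Suc M) L (n(i := 0))"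
        using NLM[of 0] unfolding below_def degree_pair by auto
    qed
  next
    case (Suc a)
    note x = Suc.prems(1) and l = Suc.prems(2)
    note xo = Ob_pair[OF x, of a]
    interpret x: module k "fib E (x(i := Suc a))" by (rule E.fib_module[OF Ob_pair[OF x]])
    have "?G (x(i := a)) l" by (rule G[OF x LY[OF xo]]) (use l in \<open>simp only: fun_upd_upd fun_upd_same\<close>)
    from dec[OF this xo] obtain l' e where l': "l' \<in> L (x(i := Suc a))"
      and gl': "gen k D (shift E) (below deg M LS) (x(i := a)) l'"
      and e: "e \<in> car E (x(i := a))" and le: "l = l' \<oplus>\<^bsub>fib E (x(i := Suc a))\<^esub> mu E (x(i := a)) e"
      by (auto simp: LS_def)
    have c: "l' \<in> car E (x(i := Suc a))" "mu E (x(i := a)) e \<in> car E (x(i := Suc a))"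
      using sLD(1)[OF Ob_pair[OF x] l'] mu.map_closed[OF xo e] by auto
    have eq: "l \<ominus>\<^bsub>fib E (x(i := Suc a))\<^esub> l' = mu E (x(i := a)) e"
      unfolding le by (rule x.M.add_minus_cancel[OF c])
    have "mu E (x(i := a)) e \<in> L (x(i := Suc a))"
      unfolding eq[symmetric] by (rule E.subm_minus[OF sL Ob_pair[OF x] l l'])
    then have "e \<in> L (x(i := a))" by (rule muL[OF x e])
    then have "gen k D E (below deg (Suc M) L) (x(i := a)) e" by (rule Suc.IH[OF x])
    then have "gen k D E (below deg (Suc M) L) (x(i := Suc a)) (mu E (x(i := a)) e)"
      unfolding mu_pair[OF E] by (rule E.gen_act[OF _ _ epsH[OF x]]) (use Lc' in blast)
    moreover have g2: "gen k D E (below deg (Suc M) L) ((x(i := a))(i := Suc ((x(i := a)) i))) l'"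
    proof (rule gen_pullback[OF gl' functor_shift cat])
      fix n assume n: "n \<in> Ob D"
      obtain n' b where n': "n = n'(i := b)" "n' \<in> Ob D'" using n by (rule Ob_cases)
      show "below deg M LS n \<subseteq> below deg (Suc M) L (n(i := Suc (n i)))"
        unfolding n'(1) below_def LS_def fun_upd_upd fun_upd_same degree_pair by auto
    qed
    ultimately show ?case unfolding le fun_upd_upd fun_upd_same by (rule gen.gen_add[rotated])
  qed
  show ?thesis
    unfolding L_def[symmetric]
  proof (rule E.gfdI[where N="Suc M" and S="below deg (Suc M) L"])
    fix x v assume x: "x \<in> Ob D" and v: "v \<in> L x"
    obtain x' a where x': "x = x'(i := a)" "x' \<in> Ob D'" using x by (rule Ob_cases)
    show "gen k D E (below deg (Suc M) L) x v"
      using fin[OF x'(2)] v unfolding x'(1) by blast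
  qed (auto simp: below_def)
qed

text \<open>The inner induction is on the strict bound \<open>d\<close> for the coordinate
  \<open>i\<close> of the targets. Shifts and slices have the same element type as \<open>E\<close>,
  so the hypothesis for fewer factors can be stated for one fixed type even though it is used for
  all slices of all iterated shifts.\<close>

lemma coherence_step:
  fixes E :: "('i \<Rightarrow> nat, 'i \<Rightarrow> 'a, 'k, 'v) cmod"
  assumes IH: "\<And>(E' :: ('i \<Rightarrow> nat, 'i \<Rightarrow> 'a, 'k, 'v) cmod) R' B. cmodule k D' E' \<Longrightarrow>
      gfd k D' deg' E' (car E') \<Longrightarrow> functionals k D' E' R' \<Longrightarrow> \<forall>(n, \<rho>) \<in> R'. \<forall>j \<in> I. n j < B \<Longrightarrow>
      gfd k D' deg' E' (joint_kernel k D' E' R')"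
    and "cmodule k D E" "gfd k D deg E (car E)" "functionals k D E R"
    and "\<forall>(n, \<rho>) \<in> R. \<forall>j \<in> I. n j < B" "\<forall>(n, \<rho>) \<in> R. n i < d"
  shows "gfd k D deg E (joint_kernel k D E R)"
  using assms(2-)
proof (induction d arbitrary: E R)
  case 0
  \<comment> \<open>No natural number is below zero, so there are no functionals left and the common
    kernel is all of \<open>E\<close>.\<close>
  then have "R = {}" by auto
  then have "joint_kernel k D E R = car E" by (auto simp: joint_kernel_def)
  then show ?case using 0 by simp
next
  case (Suc d)
  note E = Suc.prems(1) and gE = Suc.prems(2) and R = Suc.prems(3) and B = Suc.prems(4) and d = Suc.prems(5)
  obtain R' where R': "functionals k D (shift E) R'"
    and Z: "\<And>x a z. x \<in> Ob D' \<Longrightarrow> z \<in> car E (x(i := Suc a)) \<Longrightarrow>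
      z \<in> joint_kernel k D (shift E) R' (x(i := a)) \<longleftrightarrow>
      (\<forall>(n, \<rho>) \<in> R. \<exists>t \<in> car (Fr n) (x(i := a)). \<rho> (x(i := Suc a)) z = act (Fr n) (eps x a) t)"
    and q: "\<And>m s. (m, s) \<in> R' \<Longrightarrow> \<exists>n \<rho> q. (n, \<rho>) \<in> R \<and> q < n i \<and> m = n(i := q)"
    by (rule shift_functionals[OF E R]) (rule that, (assumption | blast)+)
  show ?case
  proof (rule coherence_descent[OF E gE R R' Z])
    show "gfd k D deg (shift E) (joint_kernel k D (shift E) R')"
    proof (rule Suc.IH[OF cmodule_shift[OF E] gfd_shift[OF E gE] R'])
      show "\<forall>(n, \<rho>) \<in> R'. \<forall>j \<in> I. n j < B"
      proof (clarify)
        fix m s j assume "(m, s) \<in> R'" and j: "j \<in> I"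
        then obtain n \<rho> q' where "(n, \<rho>) \<in> R" "m = n(i := q')" using q by blast
        then show "m j < B" using B j i by auto
      qed
      show "\<forall>(n, \<rho>) \<in> R'. n i < d"
      proof (clarify)
        fix m s assume "(m, s) \<in> R'"
        then obtain n \<rho> q' where "(n, \<rho>) \<in> R" "q' < n i" "m = n(i := q')" using q by blast
        then show "m i < d" using d by fastforce
      qed
    qed
  next
    fix a
    note S = joint_kernel_slice[OF E R, where a = a]
    have g: "gfd k D' deg' (slice a E) (joint_kernel k D' (slice a E) {(restrict n I,
        \<lambda>x e. slice_coeff (restrict n I) u x (\<rho> (x(i := a)) e)) | n \<rho> u. (n, \<rho>) \<in> R \<and> u \<in> Hom (C i) (n i) a})"
      by (rule IH[OF cmodule_slice[OF E] gfd_slice[OF E gE] S(1), of B]) (use B in auto)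
    have c: "cmod k D' (slice a E)" using cat' cmodule_slice[OF E] by unfold_locales
    show "gfd k D' deg' (slice a E) (\<lambda>x. joint_kernel k D E R (x(i := a)))"
      using cmod.gfd_cong[OF c g, of "\<lambda>x. joint_kernel k D E R (x(i := a))"] S(2) by blast
  qed
qed

end

theorem coherence:
  fixes E :: "('i \<Rightarrow> nat, 'i \<Rightarrow> 'a, 'k, 'v) cmod"
  assumes "finite I" "cring k" "\<And>i. i \<in> I \<Longrightarrow> combinatorial_category (C i)"
    and "\<And>i. i \<in> I \<Longrightarrow> shift_structure k (C i) (\<psi> i) (\<epsilon> i)"
    and "cmodule k (prod_cat I C) E" "gfd k (prod_cat I C) (total_degree I) E (car E)"
    and "functionals k (prod_cat I C) E R" "\<forall>(n, \<rho>) \<in> R. \<forall>j \<in> I. n j < B"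
  shows "gfd k (prod_cat I C) (total_degree I) E (joint_kernel k (prod_cat I C) E R)"
  using assms(1,3-)
proof (induction I arbitrary: E R B rule: finite_induct)
  case empty
  have c: "category (prod_cat {} C)" by (rule category_prod) simp
  interpret E: cmod k "prod_cat {} C" E using c empty.prems by unfold_locales
  have "subm k (prod_cat {} C) E (joint_kernel k (prod_cat {} C) E R)"
    by (rule E.subm_joint_kernel[OF \<open>cring k\<close> empty.prems(5)])
  \<comment> \<open>The empty product has a single object, and its total degree is an empty sum.
    Every element is thus a generator of degree 0, and the strict bound is 1.\<close>
  then show ?case
    by (intro E.gfdI[where N=1 and S="joint_kernel k (prod_cat {} C) E R"])
      (auto intro!: E.gen_base simp: joint_kernel_def)
next
  case (insert i I)
  interpret product_step k C i "\<psi> i" "\<epsilon> i" I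
  proof (intro product_step.intro shift_category.intro product_step_axioms.intro)
    show "\<And>j. j \<in> I \<Longrightarrow> category (C j)" using insert.prems(1) by (auto simp: combinatorial_category_def)
  qed (use insert.hyps insert.prems \<open>cring k\<close> in auto)
  show ?case
  proof (rule coherence_step[OF _ insert.prems(3-5)])
    fix E' :: "('i \<Rightarrow> nat, 'i \<Rightarrow> 'a, 'k, 'v) cmod" and R' B
    assume "cmodule k (prod_cat I C) E'" "gfd k (prod_cat I C) (total_degree I) E' (car E')"
      "functionals k (prod_cat I C) E' R'" "\<forall>(n, \<rho>) \<in> R'. \<forall>j \<in> I. n j < B"
    then show "gfd k (prod_cat I C) (total_degree I) E' (joint_kernel k (prod_cat I C) E' R')"
      by (intro insert.IH) (use insert.prems(1,2) in auto)
  qed (use insert.prems(6) in auto)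
qed

section \<open>Modules presented in finite degrees\<close>

lemma kernel_cmod_sub:
  "kernel_cmod V W \<phi> = sub_cmod V (\<lambda>x. {v \<in> car V x. \<phi> x v = \<zero>\<^bsub>fib W x\<^esub>})"
  by (simp add: kernel_cmod_def sub_cmod_def a_kernel_def')

lemma gen_trivial:
  assumes "gen k C V S x v" "category C" "cmodule k C V" "\<forall>n \<in> Ob C. S n \<subseteq> {\<zero>\<^bsub>fib V n\<^esub>}"
  shows "x \<in> Ob C \<Longrightarrow> v = \<zero>\<^bsub>fib V x\<^esub>"
proof -
  interpret V: cmod k C V using assms by unfold_locales
  from gen_subm[OF assms(1) V.subm_zero assms(2,4)] show "x \<in> Ob C \<Longrightarrow> v = \<zero>\<^bsub>fib V x\<^esub>" by blast
qed

definition fibre_product ::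
  "('o, 'a, 'k, 'v) cmod \<Rightarrow> ('o, 'a, 'k, 'p) cmod \<Rightarrow> ('o \<Rightarrow> 'v \<Rightarrow> 'u) \<Rightarrow> ('o \<Rightarrow> 'p \<Rightarrow> 'u) \<Rightarrow> 'o \<Rightarrow> ('v \<times> 'p) set" where
  "fibre_product V P f \<phi> x = {a \<in> car (prod_cmod V P) x. f x (fst a) = \<phi> x (snd a)}"

text \<open>The second projection has kernel isomorphic to the kernel of \<open>f\<close>, through
  the first projection. The first projection has kernel isomorphic to the kernel of
  \<open>\<phi>\<close> and is onto if \<open>\<phi>\<close> is, so the fibre product is an
  extension of \<open>V\<close> by that kernel. Together these replace a map to \<open>U\<close> by
  a map to its cover \<open>P\<close>.\<close>

lemma fibre_product:
  assumes f: "cmod_map k C V U f" and \<phi>: "cmod_map k C P U \<phi>"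
  shows "subm k C (prod_cmod V P) (fibre_product V P f \<phi>)"
    and "x \<in> Ob C \<Longrightarrow> fst ` {e \<in> fibre_product V P f \<phi> x. snd e = \<zero>\<^bsub>fib P x\<^esub>} = {v \<in> car V x. f x v = \<zero>\<^bsub>fib U x\<^esub>}"
    and "\<lbrakk>gfd k C deg V (car V); gfd k C deg P (\<lambda>x. {p \<in> car P x. \<phi> x p = \<zero>\<^bsub>fib U x\<^esub>}); cmod_surj C P U \<phi>\<rbrakk>
      \<Longrightarrow> gfd k C deg (prod_cmod V P) (fibre_product V P f \<phi>)"
proof -
  interpret f: cmod_map k C V U f by (rule f)
  interpret \<phi>: cmod_map k C P U \<phi> by (rule \<phi>)
  let ?X = "prod_cmod V P" and ?L = "fibre_product V P f \<phi>"
  have X: "cmodule k C ?X" by (rule cmodule_prod[OF f.V.cat f.V.cm \<phi>.V.cm])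
  show sL: "subm k C ?X ?L"
    unfolding subm_def fibre_product_def
  proof (intro conjI ballI allI)
    fix x assume x: "x \<in> Ob C"
    show "{a \<in> car ?X x. f x (fst a) = \<phi> x (snd a)} \<subseteq> car ?X x" by blast
    show "\<zero>\<^bsub>fib ?X x\<^esub> \<in> {a \<in> car ?X x. f x (fst a) = \<phi> x (snd a)}"
      by (simp add: f.map_zero[OF x] \<phi>.map_zero[OF x] f.V.zero_closed[OF x] \<phi>.V.zero_closed[OF x])
    show "u \<oplus>\<^bsub>fib ?X x\<^esub> v \<in> {a \<in> car ?X x. f x (fst a) = \<phi> x (snd a)}"
      if "u \<in> {a \<in> car ?X x. f x (fst a) = \<phi> x (snd a)}" "v \<in> {a \<in> car ?X x. f x (fst a) = \<phi> x (snd a)}" for u v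
      using that by (auto simp: f.map_add[OF x] \<phi>.map_add[OF x] f.V.add_closed[OF x] \<phi>.V.add_closed[OF x])
    show "c \<odot>\<^bsub>fib ?X x\<^esub> v \<in> {a \<in> car ?X x. f x (fst a) = \<phi> x (snd a)}"
      if "c \<in> carrier k" "v \<in> {a \<in> car ?X x. f x (fst a) = \<phi> x (snd a)}" for c v
      using that by (auto simp: f.map_smult[OF x] \<phi>.map_smult[OF x] f.V.smult_closed[OF x] \<phi>.V.smult_closed[OF x])
  next
    fix x y h v assume h: "h \<in> Hom C x y" and "v \<in> {a \<in> car ?X x. f x (fst a) = \<phi> x (snd a)}"
    then show "act ?X h v \<in> {a \<in> car ?X y. f y (fst a) = \<phi> y (snd a)}"
      by (auto simp: f.map_act[OF h] \<phi>.map_act[OF h] f.V.act_closed[OF h] \<phi>.V.act_closed[OF h])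
  qed
  have z: "(v, \<zero>\<^bsub>fib P x\<^esub>) \<in> ?L x" if "x \<in> Ob C" "v \<in> car V x" "f x v = \<zero>\<^bsub>fib U x\<^esub>" for v x
    using that by (simp add: fibre_product_def \<phi>.map_zero \<phi>.V.zero_closed)
  show "fst ` {e \<in> ?L x. snd e = \<zero>\<^bsub>fib P x\<^esub>} = {v \<in> car V x. f x v = \<zero>\<^bsub>fib U x\<^esub>}" if x: "x \<in> Ob C"
  proof (intro equalityI subsetI)
    fix v assume "v \<in> {v \<in> car V x. f x v = \<zero>\<^bsub>fib U x\<^esub>}"
    then have "(v, \<zero>\<^bsub>fib P x\<^esub>) \<in> {e \<in> ?L x. snd e = \<zero>\<^bsub>fib P x\<^esub>}" using z[OF x] by simp
    then show "v \<in> fst ` {e \<in> ?L x. snd e = \<zero>\<^bsub>fib P x\<^esub>}" by force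
  qed (use \<phi>.map_zero[OF x] in \<open>auto simp: fibre_product_def\<close>)
  assume gV: "gfd k C deg V (car V)" and gK: "gfd k C deg P (\<lambda>x. {p \<in> car P x. \<phi> x p = \<zero>\<^bsub>fib U x\<^esub>})"
    and sur: "cmod_surj C P U \<phi>"
  interpret p1: cmod_map k C ?X V "\<lambda>x. fst"
    using f.V.cat X f.V.cm prod_cmod_fst by unfold_locales
  have inc: "cmod_hom k C P ?X (\<lambda>x p. (\<zero>\<^bsub>fib V x\<^esub>, p))"
  proof (rule cmod_homI)
    fix x assume x: "x \<in> Ob C"
    interpret x: module k "fib V x" by (rule f.V.fib_module[OF x])
    show "linear_map k (fib P x) (fib ?X x) (\<lambda>p. (\<zero>\<^bsub>fib V x\<^esub>, p))"
      by (rule linear_mapI) auto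
  qed (auto simp: f.V.act_zero)
  interpret inc: cmod_map k C P ?X "\<lambda>x p. (\<zero>\<^bsub>fib V x\<^esub>, p)"
    using f.V.cat X \<phi>.V.cm inc by unfold_locales
  have gK': "gfd k C deg ?X (\<lambda>x. (\<lambda>p. (\<zero>\<^bsub>fib V x\<^esub>, p)) ` {p \<in> car P x. \<phi> x p = \<zero>\<^bsub>fib U x\<^esub>})"
    by (rule inc.gfd_image[OF gK]) auto
  show "gfd k C deg ?X ?L"
  proof (rule p1.gfd_extension[OF gK' _ sL gV])
    fix x assume x: "x \<in> Ob C"
    show "(\<lambda>p. (\<zero>\<^bsub>fib V x\<^esub>, p)) ` {p \<in> car P x. \<phi> x p = \<zero>\<^bsub>fib U x\<^esub>} = {v \<in> ?L x. fst v = \<zero>\<^bsub>fib V x\<^esub>}"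
      using f.map_zero[OF x] f.V.zero_closed[OF x] by (auto simp: fibre_product_def)
    show "fst ` ?L x = car V x"
    proof (intro equalityI subsetI)
      fix v assume v: "v \<in> car V x"
      then have "f x v \<in> \<phi> x ` car P x" using f.map_closed[OF x v] sur x by (auto simp: cmod_surj_def)
      then obtain p where "p \<in> car P x" "f x v = \<phi> x p" by blast
      then have "(v, p) \<in> ?L x" using v by (simp add: fibre_product_def)
      then show "v \<in> fst ` ?L x" by force
    qed (auto simp: fibre_product_def)
  qed
qed

locale coherent_product =
  fixes k :: "'k ring" and C :: "'i \<Rightarrow> (nat, 'a) cat" and \<psi> \<epsilon> and I :: "'i set"
  assumes fin: "finite I" and k: "cring k"
    and comb: "\<And>i. i \<in> I \<Longrightarrow> combinatorial_category (C i)"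
    and shift: "\<And>i. i \<in> I \<Longrightarrow> shift_structure k (C i) (\<psi> i) (\<epsilon> i)"
begin

abbreviation "D \<equiv> prod_cat I C"
abbreviation "deg \<equiv> total_degree I"

lemma cat: "category D"
  by (rule category_prod) (use comb in \<open>auto simp: combinatorial_category_def\<close>)

lemma Hom_degree: "f \<in> Hom D x y \<Longrightarrow> deg x \<le> deg y"
proof (rule sum_mono)
  fix i assume f: "f \<in> Hom D x y" and i: "i \<in> I"
  have "f i \<in> Hom (C i) (x i) (y i)" using f i unfolding prod_cat_Hom by (auto simp: PiE_iff)
  then show "x i \<le> y i"
    by (rule shift_category.Hom_le[OF shift_category.intro[OF k comb[OF i] shift[OF i]]])
qed

text \<open>The functionals are the components of the map. Those of large degree vanish because the free
  module is generated in finite degrees.\<close>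

lemma gfd_kernel_free:
  fixes E :: "('i \<Rightarrow> nat, 'i \<Rightarrow> 'a, 'k, 'v) cmod" and c :: "('i \<Rightarrow> nat) \<Rightarrow> 'j set"
  assumes E: "cmodule k D E" and gE: "gfd k D deg E (car E)"
    and gP: "gfd k D deg (free_sum k D c) (car (free_sum k D c))"
    and \<rho>: "cmod_hom k D E (free_sum k D c) \<rho>"
  shows "gfd k D deg E (\<lambda>x. {e \<in> car E x. \<rho> x e = \<zero>\<^bsub>fib (free_sum k D c) x\<^esub>})"
proof -
  interpret P: free_sum_module k D c by (rule free_sum_module.intro[OF k cat])
  interpret \<rho>: cmod_map k D E "free_sum k D c" \<rho> using cat E P.cmodule_free_sum \<rho> by unfold_locales
  obtain N where N: "\<And>M x v. M \<ge> N \<Longrightarrow> x \<in> Ob D \<Longrightarrow> v \<in> car (free_sum k D c) x \<Longrightarrow>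
      gen k D (free_sum k D c) (below deg M (car (free_sum k D c))) x v"
    using \<rho>.W.gfd_bound[OF gP] by blast
  have big: "p (n, j) = \<zero>\<^bsub>fib (free_cmod k D n) x\<^esub>"
    if x: "x \<in> Ob D" and p: "p \<in> car (free_sum k D c) x" and n: "n \<in> Ob D" "j \<in> c n" "N \<le> deg n" for x p n j
  proof -
    interpret F: free_module k D n by (rule P.fr[OF n(1)])
    interpret \<pi>: cmod_map k D "free_sum k D c" "free_cmod k D n" "\<lambda>x a. a (n, j)"
      using cat P.cmodule_free_sum F.cmodule_free P.hom_proj[OF n(1,2)] by unfold_locales
    have "gen k D (free_cmod k D n) (\<lambda>r. (\<lambda>a. a (n, j)) ` below deg N (car (free_sum k D c)) r) x (p (n, j))"
      by (rule \<pi>.gen_image[OF N[OF order_refl x p] _ x]) (auto simp: below_def)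
    then show ?thesis
    proof (rule gen_trivial[OF _ cat F.cmodule_free _ x], intro ballI subsetI)
      fix r a assume r: "r \<in> Ob D" and "a \<in> (\<lambda>a. a (n, j)) ` below deg N (car (free_sum k D c)) r"
      then obtain q where q: "a = q (n, j)" "q \<in> car (free_sum k D c) r" "deg r < N" by (auto simp: below_def)
      have "a \<in> car (free_cmod k D n) r" unfolding q(1) by (rule \<pi>.map_closed[OF r q(2)])
      \<comment> \<open>Arrows never lower the total degree, and \<open>r\<close> has smaller degree
        than \<open>n\<close>. The fibre of \<open>M(n)\<close> at \<open>r\<close> is therefore
        zero, and all generators have zero component there.\<close>
      moreover have "Hom D n r = {}" using Hom_degree n(3) q(3) by force
      ultimately show "a \<in> {\<zero>\<^bsub>fib (free_cmod k D n) r\<^esub>}" by (simp add: free_cmod_fib fsum_simps fun_eq_iff)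
    qed
  qed
  define R where "R = {(n, \<lambda>x e. \<rho> x e (n, j)) | n j. n \<in> Ob D \<and> j \<in> c n \<and> deg n < N}"
  have z: "\<zero>\<^bsub>fib (free_sum k D c) x\<^esub> = (\<lambda>j \<in> Sigma (Ob D) c. \<zero>\<^bsub>fib (free_cmod k D (fst j)) x\<^esub>)" for x
    by (auto simp: free_sum_def direct_sum_fib fsum_simps case_prod_beta)
  have eq: "joint_kernel k D E R x = {e \<in> car E x. \<rho> x e = \<zero>\<^bsub>fib (free_sum k D c) x\<^esub>}" if x: "x \<in> Ob D" for x
  proof (intro equalityI subsetI)
    fix e assume e: "e \<in> joint_kernel k D E R x"
    then have ec: "e \<in> car E x" by (simp add: joint_kernel_def)
    note rc = \<rho>.map_closed[OF x ec]
    have "\<rho> x e = \<zero>\<^bsub>fib (free_sum k D c) x\<^esub>"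
    proof (rule extensionalityI)
      show "\<rho> x e \<in> extensional (Sigma (Ob D) c)"
        using rc by (auto simp: free_sum_def direct_sum_fib fsum_simps PiE_def)
      show "\<zero>\<^bsub>fib (free_sum k D c) x\<^esub> \<in> extensional (Sigma (Ob D) c)" unfolding z by simp
      fix p assume p: "p \<in> Sigma (Ob D) c"
      then obtain n j where nj: "p = (n, j)" "n \<in> Ob D" "j \<in> c n" by auto
      have "\<rho> x e (n, j) = \<zero>\<^bsub>fib (free_cmod k D n) x\<^esub>"
      proof (cases "deg n < N")
        case True
        then have "(n, \<lambda>x e. \<rho> x e (n, j)) \<in> R" using nj unfolding R_def by blast
        then show ?thesis using e unfolding joint_kernel_def by fastforce
      next
        case False
        then show ?thesis using big[OF x rc nj(2,3)] by simp
      qed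
      then show "\<rho> x e p = \<zero>\<^bsub>fib (free_sum k D c) x\<^esub> p" unfolding z using p nj(1) by simp
    qed
    then show "e \<in> {e \<in> car E x. \<rho> x e = \<zero>\<^bsub>fib (free_sum k D c) x\<^esub>}" using ec by simp
  next
    fix e assume "e \<in> {e \<in> car E x. \<rho> x e = \<zero>\<^bsub>fib (free_sum k D c) x\<^esub>}"
    then show "e \<in> joint_kernel k D E R x" by (auto simp: joint_kernel_def R_def z)
  qed
  have fR: "functionals k D E R"
    unfolding functionals_def
  proof (intro ballI, clarify, intro conjI)
    fix n s assume "(n, s) \<in> R"
    then obtain j where s: "s = (\<lambda>x e. \<rho> x e (n, j))" and n: "n \<in> Ob D" "j \<in> c n" by (auto simp: R_def)
    show "n \<in> Ob D" by (rule n(1))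
    show "cmod_hom k D E (free_cmod k D n) s" unfolding s by (rule cmod_hom_comp[OF cat \<rho> P.hom_proj[OF n]])
  qed
  have "\<forall>(n, s) \<in> R. \<forall>i \<in> I. n i < N"
  proof clarify
    fix n s i assume "(n, s) \<in> R" and i: "i \<in> I"
    then have "deg n < N" by (auto simp: R_def)
    moreover have "n i \<le> deg n" by (rule member_le_sum[OF i]) (use fin in auto)
    ultimately show "n i < N" by simp
  qed
  then have "gfd k D deg E (joint_kernel k D E R)"
    by (intro coherence[OF fin k _ _ E gE fR]) (auto intro: comb shift)
  then show ?thesis by (rule \<rho>.V.gfd_cong) (rule eq)
qed

abbreviation "presented \<equiv> presented_in_finite_degrees k D deg"

lemma presented_gfd:
  assumes "cmodule k D V" "presented V"
  shows "gfd k D deg V (car V)"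
proof -
  interpret V: cmod k D V using assms(1) cat by unfold_locales
  show ?thesis using assms(2) V.gfd_iff[OF k, of deg] by (auto simp: presented_in_finite_degrees_def)
qed

lemma gfd_kernel:
  fixes V :: "('i \<Rightarrow> nat, 'i \<Rightarrow> 'a, 'k, 'v) cmod" and W :: "('i \<Rightarrow> nat, 'i \<Rightarrow> 'a, 'k, 'w) cmod"
  assumes V: "cmodule k D V" and gV: "gfd k D deg V (car V)"
    and W: "cmodule k D W" and pW: "presented W" and f: "cmod_hom k D V W f"
  shows "gfd k D deg V (\<lambda>x. {v \<in> car V x. f x v = \<zero>\<^bsub>fib W x\<^esub>})"
proof -
  obtain c :: "('i \<Rightarrow> nat) \<Rightarrow> 'w set" and \<phi> where \<phi>: "cmod_hom k D (free_sum k D c) W \<phi>"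
    and sur: "cmod_surj D (free_sum k D c) W \<phi>"
    and gK: "generated_in_finite_degrees k D deg (kernel_cmod (free_sum k D c) W \<phi>)"
    using pW unfolding presented_in_finite_degrees_def by blast
  define P where "P = free_sum k D c"
  interpret FS: free_sum_module k D c by (rule free_sum_module.intro[OF k cat])
  interpret \<phi>: cmod_map k D P W \<phi>
    using cat W \<phi> FS.cmodule_free_sum unfolding P_def by unfold_locales
  interpret f: cmod_map k D V W f using cat V W f by unfold_locales
  let ?K = "\<lambda>x. {p \<in> car P x. \<phi> x p = \<zero>\<^bsub>fib W x\<^esub>}"
  interpret K: cmod k D "sub_cmod P ?K"
    using \<phi>.V.cmodule_sub[OF \<phi>.subm_kernel] cat by unfold_locales
  have gK: "gfd k D deg P ?K"
    using gK K.gfd_iff[OF k, of deg] unfolding kernel_cmod_sub P_def[symmetric] gfd_sub_cmod by simp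
  \<comment> \<open>A presentation prescribes no bound on the degrees of its free module.
    \<open>P\<close> is nevertheless generated in finite degrees, being an extension of
    \<open>W\<close> by the kernel.\<close>
  have gP: "gfd k D deg P (car P)"
    by (rule \<phi>.gfd_extension[OF gK _ \<phi>.V.subm_car presented_gfd[OF W pW]])
      (use sur in \<open>auto simp: cmod_surj_def P_def\<close>)
  let ?X = "prod_cmod V P" and ?L = "fibre_product V P f \<phi>"
  note F = fibre_product[OF f.cmod_map_axioms \<phi>.cmod_map_axioms]
  interpret X: cmod k D ?X using cat cmodule_prod[OF cat V \<phi>.V.cm] by unfold_locales
  interpret p1: cmod_map k D ?X V "\<lambda>x. fst" using prod_cmod_fst by unfold_locales
  have gL: "gfd k D deg ?X ?L" by (rule F(3)[OF gV gK]) (simp add: P_def sur)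
  have p2: "cmod_hom k D (sub_cmod ?X ?L) P (\<lambda>x. snd)"
    by (rule cmod_hom_sub[OF F(1) prod_cmod_snd cat])
  have gE: "gfd k D deg (sub_cmod ?X ?L) (car (sub_cmod ?X ?L))" using gL by (simp add: gfd_sub_cmod)
  \<comment> \<open>On the fibre product the map to the free module \<open>P\<close> is the second
    projection, so coherence applies to it. Its kernel is carried onto the kernel of
    \<open>f\<close> by the first projection.\<close>
  from gfd_kernel_free[where c = c, folded P_def, OF X.cmodule_sub[OF F(1)] gE gP p2]
  have g: "gfd k D deg ?X (\<lambda>x. {e \<in> ?L x. snd e = \<zero>\<^bsub>fib P x\<^esub>})"
    by (simp add: gfd_sub_cmod)
  show ?thesis
    by (rule p1.gfd_image[OF g _ F(2)[symmetric]]) (auto simp: fibre_product_def)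
qed

text \<open>Reduces presentability to a statement about kernels. The element type of
  \<open>Q\<close> is that of a free module with multiplicities in \<open>'v\<close>, so the cover
  with one copy of \<open>M(n)\<close> for each element of degree below \<open>N\<close> is among
  the \<open>Q\<close>. Quantifying over all such \<open>Q\<close> hides the shape of the cover from
  later arguments.\<close>

lemma presentedI:
  fixes V :: "('i \<Rightarrow> nat, 'i \<Rightarrow> 'a, 'k, 'v) cmod"
  assumes V: "cmodule k D V" and gV: "gfd k D deg V (car V)"
    and Q: "\<And>(Q :: ('i \<Rightarrow> nat, 'i \<Rightarrow> 'a, 'k, ('i \<Rightarrow> nat) \<times> 'v \<Rightarrow> ('i \<Rightarrow> 'a) \<Rightarrow> 'k) cmod) \<gamma>.
      cmodule k D Q \<Longrightarrow> gfd k D deg Q (car Q) \<Longrightarrow> cmod_hom k D Q V \<gamma> \<Longrightarrow> cmod_surj D Q V \<gamma> \<Longrightarrow>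
      gfd k D deg Q (\<lambda>x. {q \<in> car Q x. \<gamma> x q = \<zero>\<^bsub>fib V x\<^esub>})"
  shows "presented V"
proof -
  interpret V: cmod k D V using cat V by unfold_locales
  obtain N where N: "\<And>M x v. M \<ge> N \<Longrightarrow> x \<in> Ob D \<Longrightarrow> v \<in> car V x \<Longrightarrow> gen k D V (below deg M (car V)) x v"
    using V.gfd_bound[OF gV] by blast
  define c where "c = below deg N (car V)"
  have c: "\<forall>n \<in> Ob D. c n \<subseteq> car V n" by (auto simp: below_def c_def)
  obtain \<phi> where \<phi>: "cmod_hom k D (free_sum k D c) V \<phi>" "cmod_surj D (free_sum k D c) V \<phi>"
    by (rule V.free_cover[OF k c]) (use N in \<open>auto simp: c_def\<close>)
  interpret P: free_sum_module k D c by (rule free_sum_module.intro[OF k cat])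
  interpret \<phi>: cmod_map k D "free_sum k D c" V \<phi> using cat V \<phi> P.cmodule_free_sum by unfold_locales
  let ?K = "\<lambda>x. {q \<in> car (free_sum k D c) x. \<phi> x q = \<zero>\<^bsub>fib V x\<^esub>}"
  interpret K: cmod k D "sub_cmod (free_sum k D c) ?K"
    using \<phi>.V.cmodule_sub[OF \<phi>.subm_kernel] cat by unfold_locales
  have "gfd k D deg (free_sum k D c) ?K"
    by (rule Q[OF P.cmodule_free_sum P.gfd_free_sum[of N] \<phi>]) (auto simp: c_def below_def)
  then have "generated_in_finite_degrees k D deg (kernel_cmod (free_sum k D c) V \<phi>)"
    using K.gfd_iff[OF k, of deg] unfolding kernel_cmod_sub gfd_sub_cmod by simp
  moreover have "generated_in_finite_degrees k D deg V" using V.gfd_iff[OF k, of deg] gV by simp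
  ultimately show ?thesis unfolding presented_in_finite_degrees_def using \<phi> by blast
qed

text \<open>The kernel of a map \<open>\<gamma>\<close> to \<open>B\<close> equals the common kernel
  of its composites with \<open>p\<close> and \<open>q\<close>. It is computed in two stages, the
  kernel of the second composite and then the kernel of the first on it, each with a presented
  target. This treats submodules and sums alike and needs no presentation of the sum of
  \<open>V\<close> and \<open>W\<close>.\<close>

lemma presented_jointly_injective:
  assumes B: "cmodule k D B" "gfd k D deg B (car B)" and V: "cmodule k D V" "presented V"
    and W: "cmodule k D W" "presented W" and p: "cmod_hom k D B V p" and q: "cmod_hom k D B W q"
    and inj: "\<And>x b. x \<in> Ob D \<Longrightarrow> b \<in> car B x \<Longrightarrow> p x b = \<zero>\<^bsub>fib V x\<^esub> \<Longrightarrow> q x b = \<zero>\<^bsub>fib W x\<^esub> \<Longrightarrow>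
      b = \<zero>\<^bsub>fib B x\<^esub>"
  shows "presented B"
proof (rule presentedI[OF B])
  fix Q :: "('i \<Rightarrow> nat, 'i \<Rightarrow> 'a, 'k, ('i \<Rightarrow> nat) \<times> 'b \<Rightarrow> ('i \<Rightarrow> 'a) \<Rightarrow> 'k) cmod" and \<gamma>
  assume Q: "cmodule k D Q" "gfd k D deg Q (car Q)" and \<gamma>: "cmod_hom k D Q B \<gamma>"
  note q\<gamma> = cmod_hom_comp[OF cat \<gamma> q] and p\<gamma> = cmod_hom_comp[OF cat \<gamma> p]
  interpret q\<gamma>: cmod_map k D Q W "\<lambda>x a. q x (\<gamma> x a)" using cat Q(1) W(1) q\<gamma> by unfold_locales
  interpret \<gamma>: cmod_map k D Q B \<gamma> using cat Q(1) B(1) \<gamma> by unfold_locales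
  interpret p: cmod_map k D B V p using cat V(1) B(1) p by unfold_locales
  interpret q: cmod_map k D B W q using cat W(1) B(1) q by unfold_locales
  let ?K = "\<lambda>x. {a \<in> car Q x. q x (\<gamma> x a) = \<zero>\<^bsub>fib W x\<^esub>}"
  have K: "cmodule k D (sub_cmod Q ?K)" by (rule q\<gamma>.V.cmodule_sub[OF q\<gamma>.subm_kernel])
  have gK: "gfd k D deg (sub_cmod Q ?K) (car (sub_cmod Q ?K))"
    using gfd_kernel[OF Q W q\<gamma>] by (simp add: gfd_sub_cmod)
  have hK: "cmod_hom k D (sub_cmod Q ?K) V (\<lambda>x a. p x (\<gamma> x a))"
    by (rule cmod_hom_sub[OF q\<gamma>.subm_kernel p\<gamma> cat])
  have g: "gfd k D deg Q (\<lambda>x. {a \<in> ?K x. p x (\<gamma> x a) = \<zero>\<^bsub>fib V x\<^esub>})"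
    using gfd_kernel[OF K gK V hK] by (simp add: gfd_sub_cmod)
  show "gfd k D deg Q (\<lambda>x. {a \<in> car Q x. \<gamma> x a = \<zero>\<^bsub>fib B x\<^esub>})"
  proof (rule q\<gamma>.V.gfd_cong[OF g])
    fix x assume x: "x \<in> Ob D"
    show "{a \<in> ?K x. p x (\<gamma> x a) = \<zero>\<^bsub>fib V x\<^esub>} = {a \<in> car Q x. \<gamma> x a = \<zero>\<^bsub>fib B x\<^esub>}"
    proof (intro equalityI subsetI)
      fix a assume a: "a \<in> {a \<in> ?K x. p x (\<gamma> x a) = \<zero>\<^bsub>fib V x\<^esub>}"
      then have "a \<in> car Q x" "p x (\<gamma> x a) = \<zero>\<^bsub>fib V x\<^esub>" "q x (\<gamma> x a) = \<zero>\<^bsub>fib W x\<^esub>" by blast+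
      then show "a \<in> {a \<in> car Q x. \<gamma> x a = \<zero>\<^bsub>fib B x\<^esub>}"
        using inj[OF x \<gamma>.map_closed[OF x]] by blast
    next
      fix a assume "a \<in> {a \<in> car Q x. \<gamma> x a = \<zero>\<^bsub>fib B x\<^esub>}"
      then show "a \<in> {a \<in> ?K x. p x (\<gamma> x a) = \<zero>\<^bsub>fib V x\<^esub>}"
        using p.map_zero[OF x] q.map_zero[OF x] by simp
    qed
  qed
qed

lemma presented_sub:
  assumes V: "cmodule k D V" "presented V" and L: "subm k D V L" "gfd k D deg V L"
  shows "presented (sub_cmod V L)"
proof -
  interpret V: cmod k D V using cat V by unfold_locales
  have i: "cmod_hom k D (sub_cmod V L) V (\<lambda>x v. v)"
    by (rule cmod_hom_sub[OF L(1) _ cat]) (auto intro!: cmod_homI linear_mapI)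
  show ?thesis
    by (rule presented_jointly_injective[OF V.cmodule_sub[OF L(1)] _ V V i i])
      (use L(2) in \<open>auto simp: gfd_sub_cmod\<close>)
qed

text \<open>A free cover of the quotient is compared with its pullback along the quotient map.\<close>

lemma presented_quotient:
  assumes W: "cmodule k D W" "presented W" and U: "cmodule k D U" and \<pi>: "cmod_hom k D W U \<pi>"
    and sur: "cmod_surj D W U \<pi>" and g: "gfd k D deg W (\<lambda>x. {w \<in> car W x. \<pi> x w = \<zero>\<^bsub>fib U x\<^esub>})"
  shows "presented U"
proof (rule presentedI[OF U])
  interpret \<pi>: cmod_map k D W U \<pi> using cat W(1) U \<pi> by unfold_locales
  show "gfd k D deg U (car U)"
    by (rule \<pi>.gfd_image[OF presented_gfd[OF W]]) (use sur in \<open>auto simp: cmod_surj_def\<close>)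
  fix Q :: "('i \<Rightarrow> nat, 'i \<Rightarrow> 'a, 'k, ('i \<Rightarrow> nat) \<times> 'c \<Rightarrow> ('i \<Rightarrow> 'a) \<Rightarrow> 'k) cmod" and \<gamma>
  assume Q: "cmodule k D Q" "gfd k D deg Q (car Q)" and \<gamma>: "cmod_hom k D Q U \<gamma>"
  interpret \<gamma>: cmod_map k D Q U \<gamma> using cat Q(1) U \<gamma> by unfold_locales
  let ?X = "prod_cmod Q W" and ?L = "fibre_product Q W \<gamma> \<pi>"
  note F = fibre_product[OF \<gamma>.cmod_map_axioms \<pi>.cmod_map_axioms]
  interpret X: cmod k D ?X using cat cmodule_prod[OF cat Q(1) W(1)] by unfold_locales
  interpret p1: cmod_map k D ?X Q "\<lambda>x. fst" using prod_cmod_fst by unfold_locales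
  have p2: "cmod_hom k D (sub_cmod ?X ?L) W (\<lambda>x. snd)"
    by (rule cmod_hom_sub[OF F(1) prod_cmod_snd cat])
  \<comment> \<open>The roles are reversed here: the fibre product covers \<open>Q\<close> with
    kernel that of \<open>\<pi>\<close>, and the presented target is \<open>W\<close>.\<close>
  have gE: "gfd k D deg (sub_cmod ?X ?L) (car (sub_cmod ?X ?L))"
    using F(3)[OF Q(2) g sur] by (simp add: gfd_sub_cmod)
  from gfd_kernel[OF X.cmodule_sub[OF F(1)] gE W p2]
  have g: "gfd k D deg ?X (\<lambda>x. {e \<in> ?L x. snd e = \<zero>\<^bsub>fib W x\<^esub>})"
    by (simp add: gfd_sub_cmod)
  show "gfd k D deg Q (\<lambda>x. {q \<in> car Q x. \<gamma> x q = \<zero>\<^bsub>fib U x\<^esub>})"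
    by (rule p1.gfd_image[OF g _ F(2)[symmetric]]) (auto simp: fibre_product_def)
qed

end

section \<open>Abelian full subcategories of module categories\<close>

lemma cmod_hom_cong:
  assumes "category C" "cmodule k C V" "cmod_hom k C V W \<phi>"
    and "\<And>x v. x \<in> Ob C \<Longrightarrow> v \<in> car V x \<Longrightarrow> \<chi> x v = \<phi> x v"
  shows "cmod_hom k C V W \<chi>"
proof -
  interpret V: cmod k C V using assms by unfold_locales
  have l: "linear_map k (fib V x) (fib W x) (\<phi> x)" if "x \<in> Ob C" for x
    using assms(3) that by (simp add: cmod_hom_def)
  show ?thesis
  proof (rule cmod_homI)
    fix x assume x: "x \<in> Ob C"
    show "linear_map k (fib V x) (fib W x) (\<chi> x)"
      by (rule linear_mapI)
        (simp_all add: assms(4)[OF x] V.add_closed[OF x] V.smult_closed[OF x] linear_map_closed[OF l[OF x]]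
          linear_map_add[OF l[OF x]] linear_map_smult[OF l[OF x]])
  next
    fix f x y v assume f: "f \<in> Hom C x y" and v: "v \<in> car V x"
    note o = category_Hom_Ob[OF assms(1) f]
    show "\<chi> y (act V f v) = act W f (\<chi> x v)"
      using assms(3) f v by (simp add: assms(4)[OF o(1)] assms(4)[OF o(2)] V.act_closed[OF f] cmod_hom_def Hom_def) blast
  qed
qed

text \<open>The extensional representative of a family of maps. Arrows of
  \<open>module_category\<close> are compared as functions, so every composite has to be brought to
  this form.\<close>

definition hom_restrict ::
  "('o, 'a) cat \<Rightarrow> ('o, 'a, 'k, 'v) cmod \<Rightarrow> ('o \<Rightarrow> 'v \<Rightarrow> 'w) \<Rightarrow> 'o \<Rightarrow> 'v \<Rightarrow> 'w" where
  "hom_restrict C V \<phi> = (\<lambda>x \<in> Ob C. \<lambda>v \<in> car V x. \<phi> x v)"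

lemma hom_restrict_apply [simp]: "x \<in> Ob C \<Longrightarrow> v \<in> car V x \<Longrightarrow> hom_restrict C V \<phi> x v = \<phi> x v"
  by (simp add: hom_restrict_def)

definition ext_hom ::
  "'k ring \<Rightarrow> ('o, 'a) cat \<Rightarrow> ('o, 'a, 'k, 'v) cmod \<Rightarrow> ('o, 'a, 'k, 'w) cmod \<Rightarrow> ('o \<Rightarrow> 'v \<Rightarrow> 'w) \<Rightarrow> bool"
  where "ext_hom k C V W \<phi> \<longleftrightarrow> cmod_hom k C V W \<phi> \<and> \<phi> \<in> extensional (Ob C) \<and>
    (\<forall>x \<in> Ob C. \<phi> x \<in> extensional (car V x))"

lemma ext_hom_restrict:
  "category C \<Longrightarrow> cmodule k C V \<Longrightarrow> cmod_hom k C V W \<phi> \<Longrightarrow> ext_hom k C V W (hom_restrict C V \<phi>)"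
  using cmod_hom_cong[of C k V W \<phi> "hom_restrict C V \<phi>"]
  by (simp add: ext_hom_def) (simp add: hom_restrict_def)

lemma ext_hom_eqI:
  assumes "ext_hom k C V W \<phi>" "ext_hom k' C V W' \<chi>"
    and "\<And>x v. x \<in> Ob C \<Longrightarrow> v \<in> car V x \<Longrightarrow> \<phi> x v = \<chi> x v"
  shows "\<phi> = \<chi>"
proof (rule extensionalityI)
  show "\<phi> \<in> extensional (Ob C)" "\<chi> \<in> extensional (Ob C)" using assms by (auto simp: ext_hom_def)
  fix x assume x: "x \<in> Ob C"
  show "\<phi> x = \<chi> x"
    by (rule extensionalityI[where A="car V x"]) (use assms x in \<open>auto simp: ext_hom_def\<close>)
qed

lemma cmod_hom_zero:
  assumes "category C" "cmodule k C W"
  shows "cmod_hom k C V W (\<lambda>x v. \<zero>\<^bsub>fib W x\<^esub>)"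
proof -
  interpret W: cmod k C W using assms by unfold_locales
  show ?thesis
  proof (rule cmod_homI)
    fix x assume x: "x \<in> Ob C"
    interpret x: module k "fib W x" by (rule W.fib_module[OF x])
    show "linear_map k (fib V x) (fib W x) (\<lambda>v. \<zero>\<^bsub>fib W x\<^esub>)" by (rule linear_mapI) simp_all
  qed (simp add: W.act_zero)
qed

lemma cmod_hom_add:
  assumes "cmod_map k C V W \<phi>" "cmod_map k C V W \<chi>"
  shows "cmod_hom k C V W (\<lambda>x v. \<phi> x v \<oplus>\<^bsub>fib W x\<^esub> \<chi> x v)"
proof -
  interpret p: cmod_map k C V W \<phi> by fact
  interpret q: cmod_map k C V W \<chi> by fact
  show ?thesis
  proof (rule cmod_homI)
    fix x assume x: "x \<in> Ob C"
    interpret x: module k "fib W x" by (rule p.W.fib_module[OF x])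
    show "linear_map k (fib V x) (fib W x) (\<lambda>v. \<phi> x v \<oplus>\<^bsub>fib W x\<^esub> \<chi> x v)"
      by (rule linear_mapI)
        (simp_all add: p.map_closed[OF x] q.map_closed[OF x] p.map_add[OF x] q.map_add[OF x]
          p.map_smult[OF x] q.map_smult[OF x] x.smult_r_distr x.M.a_ac)
  next
    fix f x y v assume f: "f \<in> Hom C x y" and v: "v \<in> car V x"
    note o = category_Hom_Ob(1)[OF p.V.cat f]
    show "\<phi> y (act V f v) \<oplus>\<^bsub>fib W y\<^esub> \<chi> y (act V f v) = act W f (\<phi> x v \<oplus>\<^bsub>fib W x\<^esub> \<chi> x v)"
      by (simp add: p.map_act[OF f v] q.map_act[OF f v] p.W.act_add[OF f p.map_closed[OF o v] q.map_closed[OF o v]])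
  qed
qed

lemma cmod_hom_neg:
  assumes "cmod_map k C V W \<phi>"
  shows "cmod_hom k C V W (\<lambda>x v. \<ominus>\<^bsub>fib W x\<^esub> \<phi> x v)"
proof -
  interpret p: cmod_map k C V W \<phi> by fact
  show ?thesis
  proof (rule cmod_homI)
    fix x assume x: "x \<in> Ob C"
    interpret x: module k "fib W x" by (rule p.W.fib_module[OF x])
    show "linear_map k (fib V x) (fib W x) (\<lambda>v. \<ominus>\<^bsub>fib W x\<^esub> \<phi> x v)"
      by (rule linear_mapI)
        (simp_all add: p.map_closed[OF x] p.map_add[OF x] p.map_smult[OF x] x.smult_r_minus x.M.minus_add)
  next
    fix f x y v assume f: "f \<in> Hom C x y" and v: "v \<in> car V x"
    note o = category_Hom_Ob[OF p.V.cat f]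
    show "\<ominus>\<^bsub>fib W y\<^esub> \<phi> y (act V f v) = act W f (\<ominus>\<^bsub>fib W x\<^esub> \<phi> x v)"
      unfolding p.map_act[OF f v]
      by (rule linear_map_neg[OF p.W.fib_module[OF o(1)] p.W.fib_module[OF o(2)] p.W.act_linear[OF f]
            p.map_closed[OF o(1) v], symmetric])
  qed
qed

text \<open>\<open>Pr\<close> is an arbitrary property of modules. The additive structure of the
  full subcategory is independent of it; closure properties become hypotheses only when abelianness
  is stated.\<close>

locale module_subcategory =
  fixes k :: "'k ring" and C :: "('o, 'a) cat" and Pr :: "('o, 'a, 'k, 'v) cmod \<Rightarrow> bool"
  assumes cat: "category C"
begin

abbreviation "S \<equiv> full_subcategory (module_category k C) Pr"

definition ob :: "('o, 'a, 'k, 'v) cmod \<Rightarrow> bool" where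
  "ob V \<longleftrightarrow> cmodule k C V \<and> Pr V"

lemma S_Ob: "V \<in> Ob S \<longleftrightarrow> ob V"
  by (auto simp: full_subcategory_def module_category_def ob_def)

lemma S_Ar: "(V, W, \<phi>) \<in> Ar S \<longleftrightarrow> ob V \<and> ob W \<and> ext_hom k C V W \<phi>"
  by (auto simp: full_subcategory_def module_category_def ob_def ext_hom_def)

lemma S_simps:
  "Dom S (V, W, \<phi>) = V" "Cod S (V, W, \<phi>) = W"
  "Ident S V = (V, V, hom_restrict C V (\<lambda>x v. v))"
  "Comp S (W', X, \<chi>) (V, W, \<phi>) = (V, X, hom_restrict C V (\<lambda>x v. \<chi> x (\<phi> x v)))"
  by (simp_all add: full_subcategory_def module_category_def hom_restrict_def)

lemma S_Hom: "(V', W', \<phi>) \<in> Hom S V W \<longleftrightarrow> V' = V \<and> W' = W \<and> ob V \<and> ob W \<and> ext_hom k C V W \<phi>"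
  unfolding Hom_def mem_Collect_eq S_Ar S_simps by blast

lemma S_Hom_cases:
  assumes "f \<in> Hom S V W"
  obtains \<phi> where "f = (V, W, \<phi>)" "ob V" "ob W" "ext_hom k C V W \<phi>"
  using assms S_Hom by (cases f) auto

lemma S_Ar_cases:
  assumes "f \<in> Ar S"
  obtains V W \<phi> where "f = (V, W, \<phi>)" "ob V" "ob W" "ext_hom k C V W \<phi>"
  using assms S_Ar by (cases f) auto

lemma map:
  assumes "ob V" "ob W" "cmod_hom k C V W \<phi>"
  shows "cmod_map k C V W \<phi>"
  using assms cat unfolding ob_def by unfold_locales auto

lemma ext_map: "ob V \<Longrightarrow> ob W \<Longrightarrow> ext_hom k C V W \<phi> \<Longrightarrow> cmod_map k C V W \<phi>"
  by (rule map) (auto simp: ext_hom_def)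

lemma restrict_ext: "ob V \<Longrightarrow> cmod_hom k C V W \<phi> \<Longrightarrow> ext_hom k C V W (hom_restrict C V \<phi>)"
  by (rule ext_hom_restrict[OF cat]) (auto simp: ob_def)

lemma id_hom: "cmod_hom k C V V (\<lambda>x v. v)"
  by (auto intro!: cmod_homI linear_mapI)

lemma ext_comp:
  "ob U \<Longrightarrow> ext_hom k C U V \<phi> \<Longrightarrow> ext_hom k C V W \<chi> \<Longrightarrow>
    ext_hom k C U W (hom_restrict C U (\<lambda>x v. \<chi> x (\<phi> x v)))"
  by (rule restrict_ext) (auto intro: cmod_hom_comp[OF cat] simp: ext_hom_def)

lemma ext_closed: "ext_hom k C V W \<phi> \<Longrightarrow> x \<in> Ob C \<Longrightarrow> v \<in> car V x \<Longrightarrow> \<phi> x v \<in> car W x"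
  by (auto simp: ext_hom_def cmod_hom_def intro: linear_map_closed)

lemma category_S: "category S"
  unfolding category_def
proof (intro conjI ballI impI)
  fix f assume "f \<in> Ar S"
  then obtain V W \<phi> where f: "f = (V, W, \<phi>)" "ob V" "ob W" "ext_hom k C V W \<phi>" by (rule S_Ar_cases)
  note c = ext_closed[OF f(4)]
  show "Dom S f \<in> Ob S" "Cod S f \<in> Ob S" unfolding f(1) S_simps S_Ob by fact+
  have "hom_restrict C V (\<lambda>x v. \<phi> x (hom_restrict C V (\<lambda>x v. v) x v)) = \<phi>"
    by (rule ext_hom_eqI[OF ext_comp[OF f(2) restrict_ext[OF f(2) id_hom] f(4)] f(4)]) simp
  then show "Comp S f (Ident S (Dom S f)) = f" unfolding f(1) S_simps by simp
  have "hom_restrict C V (\<lambda>x v. hom_restrict C W (\<lambda>x v. v) x (\<phi> x v)) = \<phi>"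
    by (rule ext_hom_eqI[OF ext_comp[OF f(2) f(4) restrict_ext[OF f(3) id_hom]] f(4)]) (simp add: c)
  then show "Comp S (Ident S (Cod S f)) f = f" unfolding f(1) S_simps by simp
  fix g assume "g \<in> Ar S"
  then obtain W' X \<chi> where g: "g = (W', X, \<chi>)" "ob W'" "ob X" "ext_hom k C W' X \<chi>" by (rule S_Ar_cases)
  {
    assume "Cod S f = Dom S g"
    then have W: "W' = W" unfolding f(1) g(1) S_simps by simp
    show "Comp S g f \<in> Hom S (Dom S f) (Cod S g)"
      unfolding f(1) g(1) W S_simps S_Hom using f g ext_comp W by blast
    fix h assume "h \<in> Ar S" and gh: "Cod S g = Dom S h"
    then obtain X' Y \<eta> where h: "h = (X', Y, \<eta>)" "ob X'" "ob Y" "ext_hom k C X' Y \<eta>" by (metis S_Ar_cases)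
    have X: "X' = X" using gh unfolding h(1) g(1) S_simps by simp
    have g4: "ext_hom k C W X \<chi>" and h4: "ext_hom k C X Y \<eta>" using g h W X by auto
    have "hom_restrict C V (\<lambda>x v. \<eta> x (hom_restrict C V (\<lambda>x v. \<chi> x (\<phi> x v)) x v))
        = hom_restrict C V (\<lambda>x v. hom_restrict C W (\<lambda>x v. \<eta> x (\<chi> x v)) x (\<phi> x v))"
      by (rule ext_hom_eqI[OF ext_comp[OF f(2) ext_comp[OF f(2) f(4) g4] h4] ext_comp[OF f(2) f(4) ext_comp[OF f(3) g4 h4]]])
        (simp add: c)
    then show "Comp S h (Comp S g f) = Comp S (Comp S h g) f"
      unfolding f(1) g(1) h(1) W X S_simps by simp
  }
next
  fix V assume "V \<in> Ob S"
  then show "Ident S V \<in> Hom S V V" unfolding S_Ob S_simps S_Hom using restrict_ext[OF _ id_hom] by blast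
qed

text \<open>Addition is defined on all pairs of triples and takes source and target from the first
  one. It is used only on parallel arrows.\<close>

definition pl where
  "pl = (\<lambda>(V :: ('o, 'a, 'k, 'v) cmod, W :: ('o, 'a, 'k, 'v) cmod, \<phi>) (V' :: ('o, 'a, 'k, 'v) cmod, W' :: ('o, 'a, 'k, 'v) cmod, \<chi>).
     (V, W, hom_restrict C V (\<lambda>x v. \<phi> x v \<oplus>\<^bsub>fib W x\<^esub> \<chi> x v)))"

definition zr where
  "zr V W = (V, W, hom_restrict C V (\<lambda>x v. \<zero>\<^bsub>fib (W :: ('o, 'a, 'k, 'v) cmod) x\<^esub>))"

lemma pl_simp: "pl (V, W, \<phi>) (V', W', \<chi>) = (V, W, hom_restrict C V (\<lambda>x v. \<phi> x v \<oplus>\<^bsub>fib W x\<^esub> \<chi> x v))"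
  by (simp add: pl_def)

lemma ext_add:
  "ob V \<Longrightarrow> ob W \<Longrightarrow> ext_hom k C V W \<phi> \<Longrightarrow> ext_hom k C V W \<chi> \<Longrightarrow>
    ext_hom k C V W (hom_restrict C V (\<lambda>x v. \<phi> x v \<oplus>\<^bsub>fib W x\<^esub> \<chi> x v))"
  by (rule restrict_ext[OF _ cmod_hom_add]) (auto intro: ext_map)

lemma ext_zero: "ob V \<Longrightarrow> ob W \<Longrightarrow> ext_hom k C V W (hom_restrict C V (\<lambda>x v. \<zero>\<^bsub>fib W x\<^esub>))"
  by (rule restrict_ext[OF _ cmod_hom_zero[OF cat]]) (auto simp: ob_def)

lemma ob_module: "ob V \<Longrightarrow> x \<in> Ob C \<Longrightarrow> module k (fib V x)"
  by (auto simp: ob_def cmodule_def)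

lemma hom_group:
  assumes V: "ob V" and W: "ob W"
  shows "comm_group \<lparr>carrier = Hom S V W, mult = pl, one = zr V W\<rparr>" (is "comm_group ?G")
proof (rule comm_groupI)
  note E = ext_add[OF V W] and Z = ext_zero[OF V W]
  show "\<one>\<^bsub>?G\<^esub> \<in> carrier ?G"
    using V W Z by (simp add: zr_def S_Hom)
  fix f assume "f \<in> carrier ?G"
  then have "f \<in> Hom S V W" by simp
  then obtain \<phi> where f: "f = (V, W, \<phi>)" and f': "ext_hom k C V W \<phi>" by (rule S_Hom_cases)
  have "hom_restrict C V (\<lambda>x v. hom_restrict C V (\<lambda>x v. \<zero>\<^bsub>fib W x\<^esub>) x v \<oplus>\<^bsub>fib W x\<^esub> \<phi> x v) = \<phi>"
  proof (rule ext_hom_eqI[OF E[OF Z f'] f'])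
    fix x v assume x: "x \<in> Ob C" and v: "v \<in> car V x"
    interpret x: module k "fib W x" by (rule ob_module[OF W x])
    show "hom_restrict C V (\<lambda>x v. hom_restrict C V (\<lambda>x v. \<zero>\<^bsub>fib W x\<^esub>) x v \<oplus>\<^bsub>fib W x\<^esub> \<phi> x v) x v = \<phi> x v"
      using ext_closed[OF f' x v] x v by simp
  qed
  then show "\<one>\<^bsub>?G\<^esub> \<otimes>\<^bsub>?G\<^esub> f = f"
    by (simp add: f zr_def pl_simp)
  have n: "ext_hom k C V W (hom_restrict C V (\<lambda>x v. \<ominus>\<^bsub>fib W x\<^esub> \<phi> x v))"
    by (rule restrict_ext[OF V cmod_hom_neg[OF ext_map[OF V W f']]])
  have "hom_restrict C V (\<lambda>x v. hom_restrict C V (\<lambda>x v. \<ominus>\<^bsub>fib W x\<^esub> \<phi> x v) x v \<oplus>\<^bsub>fib W x\<^esub> \<phi> x v)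
      = hom_restrict C V (\<lambda>x v. \<zero>\<^bsub>fib W x\<^esub>)"
  proof (rule ext_hom_eqI[OF E[OF n f'] Z])
    fix x v assume x: "x \<in> Ob C" and v: "v \<in> car V x"
    interpret x: module k "fib W x" by (rule ob_module[OF W x])
    show "hom_restrict C V (\<lambda>x v. hom_restrict C V (\<lambda>x v. \<ominus>\<^bsub>fib W x\<^esub> \<phi> x v) x v \<oplus>\<^bsub>fib W x\<^esub> \<phi> x v) x v
        = hom_restrict C V (\<lambda>x v. \<zero>\<^bsub>fib W x\<^esub>) x v"
      using ext_closed[OF f' x v] x v by (simp add: x.l_neg)
  qed
  then show "\<exists>g \<in> carrier ?G.
      g \<otimes>\<^bsub>?G\<^esub> f = \<one>\<^bsub>?G\<^esub>"
    using V W n by (intro bexI[of _ "(V, W, hom_restrict C V (\<lambda>x v. \<ominus>\<^bsub>fib W x\<^esub> \<phi> x v))"])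
      (simp_all add: f zr_def pl_simp S_Hom)
  fix g assume "g \<in> carrier ?G"
  then have "g \<in> Hom S V W" by simp
  then obtain \<chi> where g: "g = (V, W, \<chi>)" and g': "ext_hom k C V W \<chi>" by (rule S_Hom_cases)
  show "f \<otimes>\<^bsub>?G\<^esub> g \<in> carrier ?G"
    using V W E[OF f' g'] by (simp add: f g pl_simp S_Hom)
  have "hom_restrict C V (\<lambda>x v. \<phi> x v \<oplus>\<^bsub>fib W x\<^esub> \<chi> x v) = hom_restrict C V (\<lambda>x v. \<chi> x v \<oplus>\<^bsub>fib W x\<^esub> \<phi> x v)"
  proof (rule ext_hom_eqI[OF E[OF f' g'] E[OF g' f']])
    fix x v assume x: "x \<in> Ob C" and v: "v \<in> car V x"
    interpret x: module k "fib W x" by (rule ob_module[OF W x])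
    show "hom_restrict C V (\<lambda>x v. \<phi> x v \<oplus>\<^bsub>fib W x\<^esub> \<chi> x v) x v = hom_restrict C V (\<lambda>x v. \<chi> x v \<oplus>\<^bsub>fib W x\<^esub> \<phi> x v) x v"
      using ext_closed[OF f' x v] ext_closed[OF g' x v] x v by (simp add: x.M.a_comm)
  qed
  then show "f \<otimes>\<^bsub>?G\<^esub> g = g \<otimes>\<^bsub>?G\<^esub> f"
    by (simp add: f g pl_simp)
  fix h assume "h \<in> carrier ?G"
  then have "h \<in> Hom S V W" by simp
  then obtain \<eta> where h: "h = (V, W, \<eta>)" and h': "ext_hom k C V W \<eta>" by (rule S_Hom_cases)
  have "hom_restrict C V (\<lambda>x v. hom_restrict C V (\<lambda>x v. \<phi> x v \<oplus>\<^bsub>fib W x\<^esub> \<chi> x v) x v \<oplus>\<^bsub>fib W x\<^esub> \<eta> x v)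
      = hom_restrict C V (\<lambda>x v. \<phi> x v \<oplus>\<^bsub>fib W x\<^esub> hom_restrict C V (\<lambda>x v. \<chi> x v \<oplus>\<^bsub>fib W x\<^esub> \<eta> x v) x v)"
    (is "?l = ?r")
  proof (rule ext_hom_eqI[OF E[OF E[OF f' g'] h'] E[OF f' E[OF g' h']]])
    fix x v assume x: "x \<in> Ob C" and v: "v \<in> car V x"
    interpret x: module k "fib W x" by (rule ob_module[OF W x])
    show "?l x v = ?r x v"
      using ext_closed[OF f' x v] ext_closed[OF g' x v] ext_closed[OF h' x v] x v by (simp add: x.M.a_assoc)
  qed
  then show "f \<otimes>\<^bsub>?G\<^esub> g \<otimes>\<^bsub>?G\<^esub> h
      = f \<otimes>\<^bsub>?G\<^esub> (g \<otimes>\<^bsub>?G\<^esub> h)"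
    by (simp add: f g h pl_simp)
qed

lemma preadditive_S: "preadditive S pl zr"
  unfolding preadditive_def
proof (intro conjI ballI category_S)
  fix V W assume V: "V \<in> Ob S" and W: "W \<in> Ob S"
  then show "comm_group \<lparr>carrier = Hom S V W, mult = pl, one = zr V W\<rparr>" by (intro hom_group) (simp_all add: S_Ob)
  fix X f f' g g' assume "X \<in> Ob S" "f \<in> Hom S V W" "f' \<in> Hom S V W" "g \<in> Hom S W X" "g' \<in> Hom S W X"
  then obtain \<phi> \<phi>' \<chi> \<chi>' where f: "f = (V, W, \<phi>)" "ext_hom k C V W \<phi>" and f': "f' = (V, W, \<phi>')" "ext_hom k C V W \<phi>'"
    and g: "g = (W, X, \<chi>)" "ext_hom k C W X \<chi>" and g': "g' = (W, X, \<chi>')" "ext_hom k C W X \<chi>'"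
    and o: "ob V" "ob W" "ob X" by (metis S_Hom_cases)
  interpret \<chi>: cmod_map k C W X \<chi> by (rule ext_map[OF o(2,3) g(2)])
  have "hom_restrict C V (\<lambda>x v. \<chi> x (hom_restrict C V (\<lambda>x v. \<phi> x v \<oplus>\<^bsub>fib W x\<^esub> \<phi>' x v) x v))
      = hom_restrict C V (\<lambda>x v. hom_restrict C V (\<lambda>x v. \<chi> x (\<phi> x v)) x v \<oplus>\<^bsub>fib X x\<^esub> hom_restrict C V (\<lambda>x v. \<chi> x (\<phi>' x v)) x v)"
    by (rule ext_hom_eqI[OF ext_comp[OF o(1) ext_add[OF o(1,2) f(2) f'(2)] g(2)]
          ext_add[OF o(1,3) ext_comp[OF o(1) f(2) g(2)] ext_comp[OF o(1) f'(2) g(2)]]])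
      (simp add: \<chi>.map_add ext_closed[OF f(2)] ext_closed[OF f'(2)])
  then show "Comp S g (pl f f') = pl (Comp S g f) (Comp S g f')"
    unfolding f(1) f'(1) g(1) pl_simp S_simps by simp
  have "hom_restrict C V (\<lambda>x v. hom_restrict C W (\<lambda>x v. \<chi> x v \<oplus>\<^bsub>fib X x\<^esub> \<chi>' x v) x (\<phi> x v))
      = hom_restrict C V (\<lambda>x v. hom_restrict C V (\<lambda>x v. \<chi> x (\<phi> x v)) x v \<oplus>\<^bsub>fib X x\<^esub> hom_restrict C V (\<lambda>x v. \<chi>' x (\<phi> x v)) x v)"
    by (rule ext_hom_eqI[OF ext_comp[OF o(1) f(2) ext_add[OF o(2,3) g(2) g'(2)]]
          ext_add[OF o(1,3) ext_comp[OF o(1) f(2) g(2)] ext_comp[OF o(1) f(2) g'(2)]]])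
      (simp add: ext_closed[OF f(2)])
  then show "Comp S (pl g g') f = pl (Comp S g f) (Comp S g' f)"
    unfolding f(1) g(1) g'(1) pl_simp S_simps by simp
qed

end

section \<open>Kernels and cokernels in a full subcategory of modules\<close>

lemma inj_lift:
  assumes \<iota>: "cmod_map k C U V \<iota>" and \<gamma>: "cmod_map k C X V \<gamma>"
    and inj: "\<And>x. x \<in> Ob C \<Longrightarrow> inj_on (\<iota> x) (car U x)"
    and im: "\<And>x v. x \<in> Ob C \<Longrightarrow> v \<in> car X x \<Longrightarrow> \<gamma> x v \<in> \<iota> x ` car U x"
  obtains \<eta> where "cmod_hom k C X U \<eta>" "\<And>x v. x \<in> Ob C \<Longrightarrow> v \<in> car X x \<Longrightarrow> \<iota> x (\<eta> x v) = \<gamma> x v"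
proof -
  interpret i: cmod_map k C U V \<iota> by fact
  interpret g: cmod_map k C X V \<gamma> by fact
  define \<eta> where "\<eta> x v = inv_into (car U x) (\<iota> x) (\<gamma> x v)" for x v
  have c: "\<eta> x v \<in> car U x" and e: "\<iota> x (\<eta> x v) = \<gamma> x v" if "x \<in> Ob C" "v \<in> car X x" for x v
    unfolding \<eta>_def using im[OF that] by (auto intro: inv_into_into f_inv_into_f)
  have u: "\<eta> x v = w" if "x \<in> Ob C" "v \<in> car X x" "w \<in> car U x" "\<iota> x w = \<gamma> x v" for x v w
    by (rule inj_onD[OF inj[OF that(1)] _ c[OF that(1,2)] that(3)]) (simp add: e[OF that(1,2)] that(4))
  show thesis
  proof (rule that[of \<eta>])
    show "cmod_hom k C X U \<eta>"
    proof (rule cmod_homI)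
      fix x assume x: "x \<in> Ob C"
      show "linear_map k (fib X x) (fib U x) (\<eta> x)"
      proof (rule linear_mapI)
        show "\<And>v. v \<in> car X x \<Longrightarrow> \<eta> x v \<in> car U x" by (rule c[OF x])
        show "\<eta> x (v \<oplus>\<^bsub>fib X x\<^esub> w) = \<eta> x v \<oplus>\<^bsub>fib U x\<^esub> \<eta> x w" if "v \<in> car X x" "w \<in> car X x" for v w
          using that by (intro u[OF x]) (simp_all add: g.V.add_closed[OF x] i.V.add_closed[OF x] c[OF x]
            e[OF x] i.map_add[OF x] g.map_add[OF x])
        show "\<eta> x (r \<odot>\<^bsub>fib X x\<^esub> v) = r \<odot>\<^bsub>fib U x\<^esub> \<eta> x v" if "r \<in> carrier k" "v \<in> car X x" for r v
          using that by (intro u[OF x]) (simp_all add: g.V.smult_closed[OF x] i.V.smult_closed[OF x] c[OF x]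
            e[OF x] i.map_smult[OF x] g.map_smult[OF x])
      qed
    next
      fix f x y v assume f: "f \<in> Hom C x y" and v: "v \<in> car X x"
      note o = category_Hom_Ob[OF i.V.cat f]
      show "\<eta> y (act X f v) = act U f (\<eta> x v)"
        by (rule u[OF o(2) g.V.act_closed[OF f v] i.V.act_closed[OF f c[OF o(1) v]]])
          (simp add: i.map_act[OF f c[OF o(1) v]] e[OF o(1) v] g.map_act[OF f v])
    qed
  qed (rule e)
qed

text \<open>The value at \<open>u\<close> is computed from an arbitrary preimage. Two preimages
  differ by an element of the kernel of \<open>\<pi>\<close>, which \<open>\<gamma>\<close>
  kills.\<close>

lemma surj_lift:
  assumes \<pi>: "cmod_map k C W U \<pi>" and \<gamma>: "cmod_map k C W X \<gamma>" and sur: "cmod_surj C W U \<pi>"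
    and ker: "\<And>x w. x \<in> Ob C \<Longrightarrow> w \<in> car W x \<Longrightarrow> \<pi> x w = \<zero>\<^bsub>fib U x\<^esub> \<Longrightarrow> \<gamma> x w = \<zero>\<^bsub>fib X x\<^esub>"
  obtains \<eta> where "cmod_hom k C U X \<eta>" "\<And>x w. x \<in> Ob C \<Longrightarrow> w \<in> car W x \<Longrightarrow> \<eta> x (\<pi> x w) = \<gamma> x w"
proof -
  interpret p: cmod_map k C W U \<pi> by fact
  interpret g: cmod_map k C W X \<gamma> by fact
  define \<eta> where "\<eta> x u = \<gamma> x (inv_into (car W x) (\<pi> x) u)" for x u
  have e: "\<eta> x (\<pi> x w) = \<gamma> x w" if x: "x \<in> Ob C" and w: "w \<in> car W x" for x w
  proof -
    interpret u: module k "fib U x" by (rule p.W.fib_module[OF x])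
    interpret x: module k "fib X x" by (rule g.W.fib_module[OF x])
    let ?w = "inv_into (car W x) (\<pi> x) (\<pi> x w)"
    have c: "?w \<in> car W x" "\<pi> x ?w = \<pi> x w"
      using w by (auto intro: inv_into_into f_inv_into_f)
    have "\<pi> x (?w \<ominus>\<^bsub>fib W x\<^esub> w) = \<zero>\<^bsub>fib U x\<^esub>"
      using c p.map_closed[OF x w] by (simp add: p.map_minus[OF x c(1) w] u.M.minus_eq_zero_iff)
    from ker[OF x p.V.minus_closed[OF x c(1) w] this] show ?thesis
      using g.map_closed[OF x c(1)] g.map_closed[OF x w]
      by (simp add: g.map_minus[OF x c(1) w] x.M.minus_eq_zero_iff \<eta>_def)
  qed
  have s: "\<exists>w \<in> car W x. u = \<pi> x w" if "x \<in> Ob C" "u \<in> car U x" for x u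
    using sur that unfolding cmod_surj_def by blast
  show thesis
  proof (rule that[of \<eta>])
    show "cmod_hom k C U X \<eta>"
    proof (rule cmod_homI)
      fix x assume x: "x \<in> Ob C"
      show "linear_map k (fib U x) (fib X x) (\<eta> x)"
      proof (rule linear_mapI)
        fix u assume "u \<in> car U x"
        then obtain w where w: "w \<in> car W x" "u = \<pi> x w" using s[OF x] by blast
        then show "\<eta> x u \<in> car X x" using e[OF x] g.map_closed[OF x] by simp
        show "\<eta> x (r \<odot>\<^bsub>fib U x\<^esub> u) = r \<odot>\<^bsub>fib X x\<^esub> \<eta> x u" if r: "r \<in> carrier k" for r
          using w r by (simp add: p.map_smult[OF x, symmetric] e[OF x] p.V.smult_closed[OF x] g.map_smult[OF x])
        fix v assume "v \<in> car U x"
        then obtain w' where w': "w' \<in> car W x" "v = \<pi> x w'" using s[OF x] by blast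
        show "\<eta> x (u \<oplus>\<^bsub>fib U x\<^esub> v) = \<eta> x u \<oplus>\<^bsub>fib X x\<^esub> \<eta> x v"
          using w w' by (simp add: p.map_add[OF x, symmetric] e[OF x] p.V.add_closed[OF x] g.map_add[OF x])
      qed
    next
      fix f x y u assume f: "f \<in> Hom C x y" and u: "u \<in> car U x"
      note o = category_Hom_Ob[OF p.V.cat f]
      obtain w where w: "w \<in> car W x" "u = \<pi> x w" using s[OF o(1) u] by blast
      show "\<eta> y (act U f u) = act X f (\<eta> x u)"
        using w by (simp add: p.map_act[OF f, symmetric] e[OF o(1)] e[OF o(2)] p.V.act_closed[OF f] g.map_act[OF f])
    qed
  qed (rule e)
qed

lemma monicD:
  "monic C f \<Longrightarrow> Comp C f g = Comp C f h \<Longrightarrow> g \<in> Ar C \<Longrightarrow> h \<in> Ar C \<Longrightarrow> Cod C g = Dom C f \<Longrightarrow>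
    Cod C h = Dom C f \<Longrightarrow> Dom C g = Dom C h \<Longrightarrow> g = h"
  by (simp add: monic_def)

lemma epicD:
  "epic C f \<Longrightarrow> Comp C g f = Comp C h f \<Longrightarrow> g \<in> Ar C \<Longrightarrow> h \<in> Ar C \<Longrightarrow> Dom C g = Cod C f \<Longrightarrow>
    Dom C h = Cod C f \<Longrightarrow> Cod C g = Cod C h \<Longrightarrow> g = h"
  by (simp add: epic_def)

context module_subcategory
begin

lemma arrow_eqI:
  assumes "ext_hom k C V W \<phi>" "ext_hom k C V W \<chi>" "\<And>x v. x \<in> Ob C \<Longrightarrow> v \<in> car V x \<Longrightarrow> \<phi> x v = \<chi> x v"
  shows "(V, W, \<phi>) = (V, W, \<chi>)"
  using ext_hom_eqI[OF assms] by simp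

lemma arrow_eqD: "(V, W, \<phi>) = (V', W', \<chi>) \<Longrightarrow> \<phi> x v = \<chi> x v"
  by simp

text \<open>Any injective homomorphism onto the set-theoretic kernel is a categorical kernel,
  because the factorisation is a homomorphism between objects of a full subcategory. The general
  form covers both the inclusion of a kernel and a monomorphism recognised as the kernel of its
  cokernel.\<close>

lemma is_kernelI:
  assumes o: "ob U" "ob V" "ob W" and \<phi>: "ext_hom k C V W \<phi>" and \<iota>: "ext_hom k C U V \<iota>"
    and inj: "\<And>x. x \<in> Ob C \<Longrightarrow> inj_on (\<iota> x) (car U x)"
    and im: "\<And>x v. x \<in> Ob C \<Longrightarrow> v \<in> car V x \<Longrightarrow> \<phi> x v = \<zero>\<^bsub>fib W x\<^esub> \<longleftrightarrow> v \<in> \<iota> x ` car U x"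
  shows "is_kernel S zr (V, W, \<phi>) (U, V, \<iota>)"
  unfolding is_kernel_def S_simps
proof (intro conjI ballI impI refl)
  show "(U, V, \<iota>) \<in> Ar S" using o \<iota> by (simp add: S_Ar)
  show "(U, W, hom_restrict C U (\<lambda>x v. \<phi> x (\<iota> x v))) = zr U W"
    unfolding zr_def
    by (rule arrow_eqI[OF ext_comp[OF o(1) \<iota> \<phi>] ext_zero[OF o(1,3)]]) (use im ext_closed[OF \<iota>] in auto)
  fix g assume "g \<in> Ar S" and "Cod S g = V" and z: "Comp S (V, W, \<phi>) g = zr (Dom S g) W"
  then obtain X \<gamma> where g: "g = (X, V, \<gamma>)" "ob X" "ext_hom k C X V \<gamma>" by (metis S_Ar_cases S_simps(2))
  have \<gamma>: "\<gamma> x v \<in> \<iota> x ` car U x" if x: "x \<in> Ob C" and v: "v \<in> car X x" for x v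
  proof -
    have "hom_restrict C X (\<lambda>x v. \<phi> x (\<gamma> x v)) = hom_restrict C X (\<lambda>x v. \<zero>\<^bsub>fib W x\<^esub>)"
      using z unfolding g(1) zr_def S_simps by simp
    from fun_cong[OF fun_cong[OF this, of x], of v]
    show ?thesis using im[OF x ext_closed[OF g(3) x v]] x v by simp
  qed
  obtain \<eta> where \<eta>: "cmod_hom k C X U \<eta>" "\<And>x v. x \<in> Ob C \<Longrightarrow> v \<in> car X x \<Longrightarrow> \<iota> x (\<eta> x v) = \<gamma> x v"
    by (rule inj_lift[OF ext_map[OF o(1,2) \<iota>] ext_map[OF g(2) o(2) g(3)] inj \<gamma>]) (assumption | rule that | blast)+
  note \<eta>' = restrict_ext[OF g(2) \<eta>(1)]
  show "\<exists>!h. h \<in> Hom S (Dom S g) U \<and> Comp S (U, V, \<iota>) h = g"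
    unfolding g(1) S_simps
  proof (rule ex1I[of _ "(X, U, hom_restrict C X \<eta>)"], intro conjI)
    show "(X, U, hom_restrict C X \<eta>) \<in> Hom S X U" using g o \<eta>' by (simp add: S_Hom)
    show "Comp S (U, V, \<iota>) (X, U, hom_restrict C X \<eta>) = (X, V, \<gamma>)"
      unfolding S_simps by (rule arrow_eqI[OF ext_comp[OF g(2) \<eta>' \<iota>] g(3)]) (simp add: \<eta>(2))
    fix h assume h: "h \<in> Hom S X U \<and> Comp S (U, V, \<iota>) h = (X, V, \<gamma>)"
    then obtain \<theta> where \<theta>: "h = (X, U, \<theta>)" "ext_hom k C X U \<theta>" by (metis S_Hom_cases)
    have "\<theta> x v = \<eta> x v" if x: "x \<in> Ob C" and v: "v \<in> car X x" for x v
    proof -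
      have "hom_restrict C X (\<lambda>x v. \<iota> x (\<theta> x v)) = \<gamma>" using h unfolding \<theta>(1) S_simps by simp
      from fun_cong[OF fun_cong[OF this, of x], of v] have "\<iota> x (\<theta> x v) = \<iota> x (\<eta> x v)"
        using \<eta>(2)[OF x v] x v by simp
      then show ?thesis
        using inj_onD[OF inj[OF x] _ ext_closed[OF \<theta>(2) x v]] ext_closed[OF \<eta>' x v] x v by simp
    qed
    then show "h = (X, U, hom_restrict C X \<eta>)"
      unfolding \<theta>(1) by (intro arrow_eqI[OF \<theta>(2) \<eta>']) simp
  qed
qed

text \<open>Dual form, again general enough for two uses: the constructed cokernel of an arrow, and
  an epimorphism recognised as the cokernel of the inclusion of its kernel.\<close>

lemma is_cokernelI:
  assumes o: "ob V" "ob W" "ob U" and \<phi>: "ext_hom k C V W \<phi>" and \<pi>: "ext_hom k C W U \<pi>"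
    and sur: "cmod_surj C W U \<pi>"
    and ker: "\<And>x w. x \<in> Ob C \<Longrightarrow> w \<in> car W x \<Longrightarrow> \<pi> x w = \<zero>\<^bsub>fib U x\<^esub> \<longleftrightarrow> w \<in> \<phi> x ` car V x"
  shows "is_cokernel S zr (V, W, \<phi>) (W, U, \<pi>)"
  unfolding is_cokernel_def S_simps
proof (intro conjI ballI impI refl)
  show "(W, U, \<pi>) \<in> Ar S" using o \<pi> by (simp add: S_Ar)
  show "(V, U, hom_restrict C V (\<lambda>x v. \<pi> x (\<phi> x v))) = zr V U"
    unfolding zr_def
    by (rule arrow_eqI[OF ext_comp[OF o(1) \<phi> \<pi>] ext_zero[OF o(1,3)]]) (use ker ext_closed[OF \<phi>] in auto)
  fix g assume "g \<in> Ar S" and "Dom S g = W" and z: "Comp S g (V, W, \<phi>) = zr V (Cod S g)"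
  then obtain X \<gamma> where g: "g = (W, X, \<gamma>)" "ob X" "ext_hom k C W X \<gamma>" by (metis S_Ar_cases S_simps(1))
  have \<gamma>: "\<gamma> x w = \<zero>\<^bsub>fib X x\<^esub>" if x: "x \<in> Ob C" and w: "w \<in> car W x" and p: "\<pi> x w = \<zero>\<^bsub>fib U x\<^esub>" for x w
  proof -
    obtain v where v: "v \<in> car V x" "w = \<phi> x v" using ker[OF x w] p by blast
    have "hom_restrict C V (\<lambda>x v. \<gamma> x (\<phi> x v)) = hom_restrict C V (\<lambda>x v. \<zero>\<^bsub>fib X x\<^esub>)"
      using z unfolding g(1) zr_def S_simps by simp
    from fun_cong[OF fun_cong[OF this, of x], of v]
    show ?thesis using x v by simp
  qed
  obtain \<eta> where \<eta>: "cmod_hom k C U X \<eta>" "\<And>x w. x \<in> Ob C \<Longrightarrow> w \<in> car W x \<Longrightarrow> \<eta> x (\<pi> x w) = \<gamma> x w"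
    by (rule surj_lift[OF ext_map[OF o(2,3) \<pi>] ext_map[OF o(2) g(2,3)] sur \<gamma>]) (assumption | rule that | blast)+
  note \<eta>' = restrict_ext[OF o(3) \<eta>(1)]
  show "\<exists>!h. h \<in> Hom S U (Cod S g) \<and> Comp S h (W, U, \<pi>) = g"
    unfolding g(1) S_simps
  proof (rule ex1I[of _ "(U, X, hom_restrict C U \<eta>)"], intro conjI)
    show "(U, X, hom_restrict C U \<eta>) \<in> Hom S U X" using g o \<eta>' by (simp add: S_Hom)
    show "Comp S (U, X, hom_restrict C U \<eta>) (W, U, \<pi>) = (W, X, \<gamma>)"
      unfolding S_simps by (rule arrow_eqI[OF ext_comp[OF o(2) \<pi> \<eta>'] g(3)]) (simp add: \<eta>(2) ext_closed[OF \<pi>])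
    fix h assume h: "h \<in> Hom S U X \<and> Comp S h (W, U, \<pi>) = (W, X, \<gamma>)"
    then obtain \<theta> where \<theta>: "h = (U, X, \<theta>)" "ext_hom k C U X \<theta>" by (metis S_Hom_cases)
    have "\<theta> x u = \<eta> x u" if x: "x \<in> Ob C" and u: "u \<in> car U x" for x u
    proof -
      obtain w where w: "w \<in> car W x" "u = \<pi> x w" using sur x u unfolding cmod_surj_def by blast
      have "hom_restrict C W (\<lambda>x v. \<theta> x (\<pi> x v)) = \<gamma>" using h unfolding \<theta>(1) S_simps by simp
      from fun_cong[OF fun_cong[OF this, of x], of w] show ?thesis
        using \<eta>(2)[OF x w(1)] x w by simp
    qed
    then show "h = (U, X, hom_restrict C U \<eta>)"
      unfolding \<theta>(1) by (intro arrow_eqI[OF \<theta>(2) \<eta>']) simp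
  qed
qed

text \<open>A full subcategory of modules is abelian once it contains a zero module and has sums,
  kernels and cokernels computed fibrewise. Those fibrewise kernels and cokernels also show that its
  monomorphisms are injective and its epimorphisms surjective, which reduces normality to the two
  criteria above.\<close>

theorem abelian_S:
  assumes zero: "\<exists>Z. ob Z \<and> (\<forall>x \<in> Ob C. car Z x = {\<zero>\<^bsub>fib Z x\<^esub>})"
    and prod: "\<And>V W. ob V \<Longrightarrow> ob W \<Longrightarrow> \<exists>B i j p q. ob B \<and>
      cmod_hom k C V B i \<and> cmod_hom k C W B j \<and> cmod_hom k C B V p \<and> cmod_hom k C B W q \<and>
      (\<forall>x \<in> Ob C. (\<forall>v \<in> car V x. p x (i x v) = v \<and> q x (i x v) = \<zero>\<^bsub>fib W x\<^esub>) \<and>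
         (\<forall>w \<in> car W x. q x (j x w) = w \<and> p x (j x w) = \<zero>\<^bsub>fib V x\<^esub>) \<and>
         (\<forall>b \<in> car B x. i x (p x b) \<oplus>\<^bsub>fib B x\<^esub> j x (q x b) = b))"
    and kernel: "\<And>V W \<phi>. ob V \<Longrightarrow> ob W \<Longrightarrow> cmod_hom k C V W \<phi> \<Longrightarrow>
      ob (sub_cmod V (\<lambda>x. {v \<in> car V x. \<phi> x v = \<zero>\<^bsub>fib W x\<^esub>}))"
    and cokernel: "\<And>V W \<phi>. ob V \<Longrightarrow> ob W \<Longrightarrow> cmod_hom k C V W \<phi> \<Longrightarrow> \<exists>U \<pi>. ob U \<and>
      cmod_hom k C W U \<pi> \<and> cmod_surj C W U \<pi> \<and>
      (\<forall>x \<in> Ob C. \<forall>w \<in> car W x. \<pi> x w = \<zero>\<^bsub>fib U x\<^esub> \<longleftrightarrow> w \<in> \<phi> x ` car V x)"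
  shows "abelian_category S"
proof -
  let ?K = "\<lambda>V W \<phi>. sub_cmod V (\<lambda>x. {v \<in> car V x. \<phi> x v = \<zero>\<^bsub>fib W x\<^esub>})"
  have ker: "ob (?K V W \<phi>)" "ext_hom k C (?K V W \<phi>) V (hom_restrict C (?K V W \<phi>) (\<lambda>x v. v))"
    if "ob V" "ob W" "ext_hom k C V W \<phi>" for V W \<phi>
  proof -
    interpret m: cmod_map k C V W \<phi> by (rule ext_map[OF that])
    show o: "ob (?K V W \<phi>)" by (rule kernel[OF that(1,2) m.hom])
    show "ext_hom k C (?K V W \<phi>) V (hom_restrict C (?K V W \<phi>) (\<lambda>x v. v))"
      by (rule restrict_ext[OF o cmod_hom_sub[OF m.subm_kernel id_hom cat]])
  qed
  have coker: "\<exists>U \<pi>. ob U \<and> ext_hom k C W U \<pi> \<and> cmod_surj C W U \<pi> \<and>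
      (\<forall>x \<in> Ob C. \<forall>w \<in> car W x. \<pi> x w = \<zero>\<^bsub>fib U x\<^esub> \<longleftrightarrow> w \<in> \<phi> x ` car V x)"
    if o: "ob V" "ob W" and "ext_hom k C V W \<phi>" for V W \<phi>
  proof -
    interpret m: cmod_map k C V W \<phi> by (rule ext_map[OF that])
    obtain U \<pi> where U: "ob U" "cmod_hom k C W U \<pi>" "cmod_surj C W U \<pi>"
      "\<forall>x \<in> Ob C. \<forall>w \<in> car W x. \<pi> x w = \<zero>\<^bsub>fib U x\<^esub> \<longleftrightarrow> w \<in> \<phi> x ` car V x"
      using cokernel[OF o m.hom] by blast
    then show ?thesis
      using restrict_ext[OF o(2) U(2)]
      by (intro exI[of _ U] exI[of _ "hom_restrict C W \<pi>"]) (simp add: cmod_surj_def)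
  qed
  have "\<exists>z. zero_object S z"
  proof -
    obtain Z where Z: "ob Z" "\<forall>x \<in> Ob C. car Z x = {\<zero>\<^bsub>fib Z x\<^esub>}" using zero by blast
    have u1: "\<exists>!f. f \<in> Hom S V Z" if V: "ob V" for V
    proof (rule ex1I[of _ "zr V Z"])
      show "zr V Z \<in> Hom S V Z" using ext_zero[OF V Z(1)] V Z by (simp add: zr_def S_Hom)
      fix f assume "f \<in> Hom S V Z"
      then obtain \<phi> where f: "f = (V, Z, \<phi>)" "ext_hom k C V Z \<phi>" by (rule S_Hom_cases)
      show "f = zr V Z" unfolding f(1) zr_def
      proof (rule arrow_eqI[OF f(2) ext_zero[OF V Z(1)]])
        fix x v assume "x \<in> Ob C" "v \<in> car V x"
        then show "\<phi> x v = hom_restrict C V (\<lambda>x v. \<zero>\<^bsub>fib Z x\<^esub>) x v" using ext_closed[OF f(2)] Z(2) by auto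
      qed
    qed
    have u2: "\<exists>!f. f \<in> Hom S Z V" if V: "ob V" for V
    proof (rule ex1I[of _ "zr Z V"])
      show "zr Z V \<in> Hom S Z V" using ext_zero[OF Z(1) V] V Z by (simp add: zr_def S_Hom)
      fix f assume "f \<in> Hom S Z V"
      then obtain \<phi> where f: "f = (Z, V, \<phi>)" "ext_hom k C Z V \<phi>" by (rule S_Hom_cases)
      interpret m: cmod_map k C Z V \<phi> by (rule ext_map[OF Z(1) V f(2)])
      show "f = zr Z V" unfolding f(1) zr_def
        by (rule arrow_eqI[OF f(2) ext_zero[OF Z(1) V]]) (use m.map_zero Z(2) in auto)
    qed
    show ?thesis
      unfolding zero_object_def
    proof (intro exI[of _ Z] conjI ballI)
      show "Z \<in> Ob S" using Z(1) by (simp add: S_Ob)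
      fix V assume "V \<in> Ob S"
      then have V: "ob V" by (simp add: S_Ob)
      show "\<exists>!f. f \<in> Hom S V Z" by (rule u1[OF V])
      show "\<exists>!f. f \<in> Hom S Z V" by (rule u2[OF V])
    qed
  qed
  moreover have "\<exists>b i j p q. biproduct S pl zr V W b i j p q" if V: "V \<in> Ob S" and W: "W \<in> Ob S" for V W
  proof -
    note o = V[unfolded S_Ob] W[unfolded S_Ob]
    obtain B i j p q where B: "ob B" and h: "cmod_hom k C V B i" "cmod_hom k C W B j"
      "cmod_hom k C B V p" "cmod_hom k C B W q"
      and P: "\<forall>x \<in> Ob C. (\<forall>v \<in> car V x. p x (i x v) = v \<and> q x (i x v) = \<zero>\<^bsub>fib W x\<^esub>) \<and>
         (\<forall>w \<in> car W x. q x (j x w) = w \<and> p x (j x w) = \<zero>\<^bsub>fib V x\<^esub>) \<and>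
         (\<forall>b \<in> car B x. i x (p x b) \<oplus>\<^bsub>fib B x\<^esub> j x (q x b) = b)"
      using prod[OF o] by (elim exE conjE) (rule that)
    have pi: "p x (i x v) = v" "q x (i x v) = \<zero>\<^bsub>fib W x\<^esub>" if "x \<in> Ob C" "v \<in> car V x" for x v
      using P that by simp_all
    have pi': "q x (j x w) = w" "p x (j x w) = \<zero>\<^bsub>fib V x\<^esub>" if "x \<in> Ob C" "w \<in> car W x" for x w
      using P that by simp_all
    have pi'': "i x (p x b) \<oplus>\<^bsub>fib B x\<^esub> j x (q x b) = b" if "x \<in> Ob C" "b \<in> car B x" for x b
      using P that by simp
    note e = restrict_ext[OF o(1) h(1)] restrict_ext[OF o(2) h(2)] restrict_ext[OF B h(3)] restrict_ext[OF B h(4)]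
    let ?i = "(V, B, hom_restrict C V i)" and ?j = "(W, B, hom_restrict C W j)"
      and ?p = "(B, V, hom_restrict C B p)" and ?q = "(B, W, hom_restrict C B q)"
    have c1: "i x v \<in> car B x" if "x \<in> Ob C" "v \<in> car V x" for x v
      using ext_closed[OF e(1) that] that by simp
    have c2: "j x v \<in> car B x" if "x \<in> Ob C" "v \<in> car W x" for x v
      using ext_closed[OF e(2) that] that by simp
    have c3: "p x v \<in> car V x" "q x v \<in> car W x" if "x \<in> Ob C" "v \<in> car B x" for x v
      using ext_closed[OF e(3) that] ext_closed[OF e(4) that] that by simp_all
    have "biproduct S pl zr V W B ?i ?j ?p ?q"
      unfolding biproduct_def S_simps S_Ob S_Hom zr_def pl_simp
    proof (intro conjI refl o B e)
      show "(V, V, hom_restrict C V (\<lambda>x v. hom_restrict C B p x (hom_restrict C V i x v))) = (V, V, hom_restrict C V (\<lambda>x v. v))"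
        by (rule arrow_eqI[OF ext_comp[OF o(1) e(1,3)] restrict_ext[OF o(1) id_hom]]) (simp add: c1 pi)
      show "(W, W, hom_restrict C W (\<lambda>x v. hom_restrict C B q x (hom_restrict C W j x v))) = (W, W, hom_restrict C W (\<lambda>x v. v))"
        by (rule arrow_eqI[OF ext_comp[OF o(2) e(2,4)] restrict_ext[OF o(2) id_hom]]) (simp add: c2 pi')
      show "(W, V, hom_restrict C W (\<lambda>x v. hom_restrict C B p x (hom_restrict C W j x v))) = (W, V, hom_restrict C W (\<lambda>x v. \<zero>\<^bsub>fib V x\<^esub>))"
        by (rule arrow_eqI[OF ext_comp[OF o(2) e(2,3)] ext_zero[OF o(2,1)]]) (simp add: c2 pi')
      show "(V, W, hom_restrict C V (\<lambda>x v. hom_restrict C B q x (hom_restrict C V i x v))) = (V, W, hom_restrict C V (\<lambda>x v. \<zero>\<^bsub>fib W x\<^esub>))"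
        by (rule arrow_eqI[OF ext_comp[OF o(1) e(1,4)] ext_zero[OF o(1,2)]]) (simp add: c1 pi)
      show "(B, B, hom_restrict C B (\<lambda>x v. hom_restrict C B (\<lambda>x v. hom_restrict C V i x (hom_restrict C B p x v)) x v
          \<oplus>\<^bsub>fib B x\<^esub> hom_restrict C B (\<lambda>x v. hom_restrict C W j x (hom_restrict C B q x v)) x v))
          = (B, B, hom_restrict C B (\<lambda>x v. v))"
        by (rule arrow_eqI[OF ext_add[OF B B ext_comp[OF B e(3,1)] ext_comp[OF B e(4,2)]] restrict_ext[OF B id_hom]])
          (simp add: c3 pi'')
    qed
    then show ?thesis by blast
  qed
  moreover have "\<exists>i. is_kernel S zr f i" if "f \<in> Ar S" for f
  proof -
    obtain V W \<phi> where f: "f = (V, W, \<phi>)" "ob V" "ob W" "ext_hom k C V W \<phi>" using \<open>f \<in> Ar S\<close> by (rule S_Ar_cases)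
    have "is_kernel S zr (V, W, \<phi>) (?K V W \<phi>, V, hom_restrict C (?K V W \<phi>) (\<lambda>x v. v))"
      by (rule is_kernelI[OF ker(1)[OF f(2-4)] f(2-4) ker(2)[OF f(2-4)]])
        (auto intro!: inj_onI simp: image_iff)
    then show ?thesis unfolding f(1) by blast
  qed
  moreover have "\<exists>p. is_cokernel S zr f p" if "f \<in> Ar S" for f
  proof -
    obtain V W \<phi> where f: "f = (V, W, \<phi>)" "ob V" "ob W" "ext_hom k C V W \<phi>" using \<open>f \<in> Ar S\<close> by (rule S_Ar_cases)
    obtain U \<pi> where U: "ob U" "ext_hom k C W U \<pi>" "cmod_surj C W U \<pi>"
      "\<forall>x \<in> Ob C. \<forall>w \<in> car W x. \<pi> x w = \<zero>\<^bsub>fib U x\<^esub> \<longleftrightarrow> w \<in> \<phi> x ` car V x"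
      using coker[OF f(2-4)] by blast
    have "is_cokernel S zr (V, W, \<phi>) (W, U, \<pi>)"
      by (rule is_cokernelI[OF f(2,3) U(1) f(4) U(2,3)]) (use U(4) in blast)
    then show ?thesis unfolding f(1) by blast
  qed
  moreover have "\<exists>g \<in> Ar S. is_kernel S zr g f" if m: "monic S f" for f
  proof -
    have "f \<in> Ar S" using m by (simp add: monic_def)
    then obtain V W \<phi> where f: "f = (V, W, \<phi>)" "ob V" "ob W" "ext_hom k C V W \<phi>" by (rule S_Ar_cases)
    interpret m: cmod_map k C V W \<phi> by (rule ext_map[OF f(2-4)])
    let ?k = "?K V W \<phi>"
    note K = ker[OF f(2-4)]
    \<comment> \<open>The inclusion of the kernel and the zero map have the same composite with
      \<open>f\<close>, so they are equal; the kernel is zero and \<open>f\<close> is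
      injective.\<close>
    have "Comp S f (?k, V, hom_restrict C ?k (\<lambda>x v. v)) = Comp S f (zr ?k V)"
      unfolding f(1) zr_def S_simps
      by (rule arrow_eqI[OF ext_comp[OF K(1,2) f(4)] ext_comp[OF K(1) ext_zero[OF K(1) f(2)] f(4)]])
        (simp add: m.map_zero)
    then have eq: "(?k, V, hom_restrict C ?k (\<lambda>x v. v)) = zr ?k V"
      by (rule monicD[OF m]) (use K ext_zero[OF K(1) f(2)] f in \<open>simp_all add: S_simps S_Ar zr_def\<close>)
    have z: "v = \<zero>\<^bsub>fib V x\<^esub>" if "x \<in> Ob C" "v \<in> car V x" "\<phi> x v = \<zero>\<^bsub>fib W x\<^esub>" for x v
      using arrow_eqD[OF eq[unfolded zr_def], of x v] that by simp
    have inj: "inj_on (\<phi> x) (car V x)" if x: "x \<in> Ob C" for x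
    proof (rule inj_onI)
      fix u v assume uv: "u \<in> car V x" "v \<in> car V x" "\<phi> x u = \<phi> x v"
      interpret v: module k "fib V x" by (rule ob_module[OF f(2) x])
      interpret w: module k "fib W x" by (rule ob_module[OF f(3) x])
      have "\<phi> x (u \<ominus>\<^bsub>fib V x\<^esub> v) = \<zero>\<^bsub>fib W x\<^esub>"
        using m.map_closed[OF x uv(2)] by (simp add: m.map_minus[OF x uv(1,2)] uv(3) w.M.minus_eq_zero_iff)
      from z[OF x m.V.minus_closed[OF x uv(1,2)] this] show "u = v" using uv by (simp add: v.M.minus_eq_zero_iff)
    qed
    obtain U \<pi> where U: "ob U" "ext_hom k C W U \<pi>" "cmod_surj C W U \<pi>"
      "\<forall>x \<in> Ob C. \<forall>w \<in> car W x. \<pi> x w = \<zero>\<^bsub>fib U x\<^esub> \<longleftrightarrow> w \<in> \<phi> x ` car V x"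
      using coker[OF f(2-4)] by blast
    have "is_kernel S zr (W, U, \<pi>) (V, W, \<phi>)"
      by (rule is_kernelI[OF f(2,3) U(1,2) f(4) inj]) (use U(4) in blast)+
    then show ?thesis unfolding f(1) using U f by (intro bexI[of _ "(W, U, \<pi>)"]) (simp_all add: S_Ar)
  qed
  moreover have "\<exists>g \<in> Ar S. is_cokernel S zr g f" if e: "epic S f" for f
  proof -
    have "f \<in> Ar S" using e by (simp add: epic_def)
    then obtain V W \<phi> where f: "f = (V, W, \<phi>)" "ob V" "ob W" "ext_hom k C V W \<phi>" by (rule S_Ar_cases)
    interpret m: cmod_map k C V W \<phi> by (rule ext_map[OF f(2-4)])
    obtain U \<pi> where U: "ob U" "ext_hom k C W U \<pi>" "cmod_surj C W U \<pi>"
      and Uk: "\<forall>x \<in> Ob C. \<forall>w \<in> car W x. \<pi> x w = \<zero>\<^bsub>fib U x\<^esub> \<longleftrightarrow> w \<in> \<phi> x ` car V x"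
      using coker[OF f(2-4)] by blast
    \<comment> \<open>The cokernel projection and the zero map agree after \<open>f\<close>, so they
      are equal; the cokernel is zero and \<open>f\<close> is surjective.\<close>
    have "Comp S (W, U, \<pi>) f = Comp S (zr W U) f"
      unfolding f(1) zr_def S_simps
      by (rule arrow_eqI[OF ext_comp[OF f(2,4) U(2)] ext_comp[OF f(2,4) ext_zero[OF f(3) U(1)]]])
        (use Uk m.map_closed in auto)
    then have eq: "(W, U, \<pi>) = zr W U"
      by (rule epicD[OF e]) (use U ext_zero[OF f(3) U(1)] f in \<open>simp_all add: S_simps S_Ar zr_def\<close>)
    have im: "w \<in> \<phi> x ` car V x" if "x \<in> Ob C" "w \<in> car W x" for x w
      using arrow_eqD[OF eq[unfolded zr_def], of x w] that Uk by simp
    have sur: "cmod_surj C V W \<phi>" unfolding cmod_surj_def using im m.map_closed by blast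
    let ?k = "?K V W \<phi>"
    note K = ker[OF f(2-4)]
    have "is_cokernel S zr (?k, V, hom_restrict C ?k (\<lambda>x v. v)) (V, W, \<phi>)"
      by (rule is_cokernelI[OF K(1) f(2,3) K(2) f(4) sur]) (auto simp: image_iff)
    then show ?thesis unfolding f(1) using K f
      by (intro bexI[of _ "(?k, V, hom_restrict C ?k (\<lambda>x v. v))"]) (simp_all add: S_Ar)
  qed
  ultimately show ?thesis unfolding abelian_category_def using preadditive_S by blast
qed

end

section \<open>The category of modules presented in finite degrees\<close>

text \<open>The element \<open>u\<close> is a parameter because an arbitrary type has no
  distinguished element to serve as zero.\<close>

definition zero_cmod :: "'v \<Rightarrow> ('o, 'a, 'k, 'v) cmod" where
  "zero_cmod u =
     \<lparr> fib = (\<lambda>x. \<lparr> carrier = {u}, mult = undefined, one = undefined,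
         zero = u, add = (\<lambda>a b. u), smult = (\<lambda>c a. u) \<rparr>),
       act = (\<lambda>f a. u) \<rparr>"

lemma zero_cmod_simps [simp]:
  "carrier (fib (zero_cmod u) x) = {u}" "\<zero>\<^bsub>fib (zero_cmod u) x\<^esub> = u"
  "a \<oplus>\<^bsub>fib (zero_cmod u) x\<^esub> b = u" "c \<odot>\<^bsub>fib (zero_cmod u) x\<^esub> a = u" "act (zero_cmod u) f a = u"
  by (simp_all add: zero_cmod_def)

lemma cmodule_zero:
  assumes "cring k" "category C"
  shows "cmodule k C (zero_cmod u)"
proof (rule cmoduleI[OF assms(2)])
  fix x
  show "module k (fib (zero_cmod u) x)"
  proof (rule moduleI[OF assms(1)])
    show "abelian_group (fib (zero_cmod u) x)" by (rule abelian_groupI) auto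
  qed auto
qed (auto intro: linear_mapI)

text \<open>An infinite set is equipotent with its square. This is what an infinite universe
  contributes: pairs can be coded by single elements.\<close>

lemma infinite_pairing:
  assumes "infinite (UNIV :: 'v set)"
  obtains r :: "'v \<times> 'v \<Rightarrow> 'v" where "inj r"
proof -
  have "(card_of (UNIV \<times> UNIV :: ('v \<times> 'v) set), card_of (UNIV :: 'v set)) \<in> ordIso"
    by (rule card_of_Times_same_infinite[OF assms])
  then obtain r :: "'v \<times> 'v \<Rightarrow> 'v" where "bij_betw r (UNIV \<times> UNIV) UNIV"
    unfolding card_of_ordIso[symmetric] by blast
  then show thesis using that by (auto simp: bij_betw_def)
qed

text \<open>Cosets are disjoint, so chosen representatives coincide exactly when the cosets do. This
  realises the cokernel on the element type of \<open>W\<close> instead of the type of its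
  subsets.\<close>

lemma (in cmod_map) coset_eq_iff:
  assumes x: "x \<in> Ob C" and u: "u \<in> car W x" and v: "v \<in> car W x"
  shows "(SOME w. w \<in> coset x u) = (SOME w. w \<in> coset x v) \<longleftrightarrow> u \<ominus>\<^bsub>fib W x\<^esub> v \<in> \<phi> x ` car V x"
proof -
  interpret H: abelian_subgroup "\<phi> x ` car V x" "fib W x"
    by (rule abelian_subgroup_submodule[OF W.fib_module[OF x] W.submodule_fib[OF subm_image x]])
  have s: "(SOME w. w \<in> coset x w') \<in> coset x w'" if "w' \<in> car W x" for w'
    using H.a_rcos_self[OF that] unfolding coset_def by (rule someI)
  have "u \<ominus>\<^bsub>fib W x\<^esub> v \<in> \<phi> x ` car V x \<longleftrightarrow> u \<in> coset x v"
    unfolding coset_def a_minus_def using H.a_rcos_module[OF v u] by simp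
  also have "\<dots> \<longleftrightarrow> coset x v = coset x u"
    using H.a_repr_independence'[of u v] H.a_rcos_self[OF u] v unfolding coset_def by blast
  also have "\<dots> \<longleftrightarrow> (SOME w. w \<in> coset x u) = (SOME w. w \<in> coset x v)"
  proof
    assume e: "(SOME w. w \<in> coset x u) = (SOME w. w \<in> coset x v)"
    have "coset x u = coset x (SOME w. w \<in> coset x u)"
      using H.a_repr_independence'[OF s[OF u, unfolded coset_def] u] unfolding coset_def .
    also have "\<dots> = coset x v"
      using H.a_repr_independence'[OF s[OF v, unfolded coset_def] v] unfolding e unfolding coset_def by simp
    finally show "coset x v = coset x u" by simp
  qed simp
  finally show ?thesis by simp
qed

section \<open>Closure of the presented modules under zero, sums and cokernels\<close>

context coherent_product
begin

lemma presented_zero: "presented (zero_cmod u :: ('i \<Rightarrow> nat, 'i \<Rightarrow> 'a, 'k, 'v) cmod)"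
proof (rule presentedI)
  show Z: "cmodule k D (zero_cmod u)" by (rule cmodule_zero[OF k cat])
  interpret Z: cmod k D "zero_cmod u" using cat Z by unfold_locales
  show "gfd k D deg (zero_cmod u) (car (zero_cmod u))"
    by (rule Z.gfdI[where N=0 and S="\<lambda>_. {}"]) (use gen_zero[of _ D k "zero_cmod u"] in auto)
  fix Q :: "('i \<Rightarrow> nat, 'i \<Rightarrow> 'a, 'k, ('i \<Rightarrow> nat) \<times> 'v \<Rightarrow> ('i \<Rightarrow> 'a) \<Rightarrow> 'k) cmod" and \<gamma>
  assume Q: "cmodule k D Q" "gfd k D deg Q (car Q)" and \<gamma>: "cmod_hom k D Q (zero_cmod u) \<gamma>"
  interpret \<gamma>: cmod_map k D Q "zero_cmod u" \<gamma> using Q cat \<gamma> Z by unfold_locales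
  show "gfd k D deg Q (\<lambda>x. {q \<in> car Q x. \<gamma> x q = \<zero>\<^bsub>fib (zero_cmod u) x\<^esub>})"
    by (rule \<gamma>.V.gfd_cong[OF Q(2)]) (use \<gamma>.map_closed in auto)
qed

text \<open>The product is the fibre product over the zero module, here on the unit type, so the
  extension argument for fibre products applies.\<close>

lemma gfd_prod:
  assumes V: "cmodule k D V" "gfd k D deg V (car V)" and W: "cmodule k D W" "gfd k D deg W (car W)"
  shows "gfd k D deg (prod_cmod V W) (car (prod_cmod V W))"
proof -
  interpret V: cmod k D V using V(1) cat by unfold_locales
  interpret W: cmod k D W using W(1) cat by unfold_locales
  let ?Z = "zero_cmod ()" and ?z = "\<lambda>x v. ()"
  note Z = cmodule_zero[OF k cat, of "()"]
  have h: "cmod_hom k D V ?Z ?z" "cmod_hom k D W ?Z ?z" by (auto intro!: cmod_homI linear_mapI)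
  have f: "cmod_map k D V ?Z ?z" using cat V(1) Z h by unfold_locales
  have g: "cmod_map k D W ?Z ?z" using cat W(1) Z h by unfold_locales
  have "fibre_product V W ?z ?z = car (prod_cmod V W)" by (auto simp: fibre_product_def fun_eq_iff)
  moreover have "cmod_surj D W ?Z ?z" using W.zero_closed by (auto simp: cmod_surj_def)
  ultimately show ?thesis using fibre_product(3)[OF f g V(2)] W(2) by simp
qed

text \<open>The product is moved to the prescribed type by coding pairs injectively. Its two
  projections are jointly injective with presented targets, which makes it presented.\<close>

lemma presented_biproduct:
  fixes V W :: "('i \<Rightarrow> nat, 'i \<Rightarrow> 'a, 'k, 'v) cmod"
  assumes inf: "infinite (UNIV :: 'v set)"
    and V: "cmodule k D V" "presented V" and W: "cmodule k D W" "presented W"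
  shows "\<exists>(B :: ('i \<Rightarrow> nat, 'i \<Rightarrow> 'a, 'k, 'v) cmod) i j p q. (cmodule k D B \<and> presented B) \<and>
      cmod_hom k D V B i \<and> cmod_hom k D W B j \<and> cmod_hom k D B V p \<and> cmod_hom k D B W q \<and>
      (\<forall>x \<in> Ob D. (\<forall>v \<in> car V x. p x (i x v) = v \<and> q x (i x v) = \<zero>\<^bsub>fib W x\<^esub>) \<and>
         (\<forall>w \<in> car W x. q x (j x w) = w \<and> p x (j x w) = \<zero>\<^bsub>fib V x\<^esub>) \<and>
         (\<forall>b \<in> car B x. i x (p x b) \<oplus>\<^bsub>fib B x\<^esub> j x (q x b) = b))"
proof -
  obtain r0 :: "'v \<times> 'v \<Rightarrow> 'v" where r0: "inj r0" by (rule infinite_pairing[OF inf])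
  define r where "r = (\<lambda>x :: 'i \<Rightarrow> nat. r0)"
  let ?X = "prod_cmod V W"
  interpret V: cmod k D V using V(1) cat by unfold_locales
  interpret W: cmod k D W using W(1) cat by unfold_locales
  interpret X: cmod k D ?X using cmodule_prod[OF cat V(1) W(1)] cat by unfold_locales
  interpret B: cmod_congruence k D ?X r "\<lambda>x. {\<zero>\<^bsub>fib ?X x\<^esub>}"
  proof
    show "subm k D ?X (\<lambda>x. {\<zero>\<^bsub>fib ?X x\<^esub>})" by (rule X.subm_zero)
    fix x u v assume x: "x \<in> Ob D" and uv: "u \<in> car ?X x" "v \<in> car ?X x"
    interpret x: module k "fib ?X x" by (rule X.fib_module[OF x])
    have "r x u = r x v \<longleftrightarrow> u = v" using r0 by (auto simp: r_def dest: injD)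
    then show "r x u = r x v \<longleftrightarrow> u \<ominus>\<^bsub>fib ?X x\<^esub> v \<in> {\<zero>\<^bsub>fib ?X x\<^esub>}"
      using x.M.minus_eq_zero_iff[OF uv] by simp
  qed
  define p where "p x b = fst (B.sec x b)" for x b
  define q where "q x b = snd (B.sec x b)" for x b
  define i where "i x v = r x (v, \<zero>\<^bsub>fib W x\<^esub>)" for x v
  define j where "j x w = r x (\<zero>\<^bsub>fib V x\<^esub>, w)" for x w
  have p: "cmod_hom k D B.img V p" "\<And>x a. x \<in> Ob D \<Longrightarrow> a \<in> car ?X x \<Longrightarrow> p x (r x a) = fst a"
    unfolding p_def[abs_def] using B.img_lift[OF V(1) prod_cmod_fst] by simp_all
  have q: "cmod_hom k D B.img W q" "\<And>x a. x \<in> Ob D \<Longrightarrow> a \<in> car ?X x \<Longrightarrow> q x (r x a) = snd a"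
    unfolding q_def[abs_def] using B.img_lift[OF W(1) prod_cmod_snd] by simp_all
  have "cmod_hom k D V ?X (\<lambda>x v. (v, \<zero>\<^bsub>fib W x\<^esub>))"
  proof (rule cmod_homI)
    fix x assume x: "x \<in> Ob D"
    interpret x: module k "fib W x" by (rule W.fib_module[OF x])
    show "linear_map k (fib V x) (fib ?X x) (\<lambda>v. (v, \<zero>\<^bsub>fib W x\<^esub>))" by (rule linear_mapI) auto
  qed (auto simp: W.act_zero)
  from cmod_hom_comp[OF cat this B.hom_img] have i: "cmod_hom k D V B.img i" unfolding i_def[abs_def] .
  have "cmod_hom k D W ?X (\<lambda>x w. (\<zero>\<^bsub>fib V x\<^esub>, w))"
  proof (rule cmod_homI)
    fix x assume x: "x \<in> Ob D"
    interpret x: module k "fib V x" by (rule V.fib_module[OF x])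
    show "linear_map k (fib W x) (fib ?X x) (\<lambda>v. (\<zero>\<^bsub>fib V x\<^esub>, v))" by (rule linear_mapI) auto
  qed (auto simp: V.act_zero)
  from cmod_hom_comp[OF cat this B.hom_img] have j: "cmod_hom k D W B.img j" unfolding j_def[abs_def] .
  interpret rm: cmod_map k D ?X B.img r using cat X.cm B.cmodule_img B.hom_img by unfold_locales
  have gB: "gfd k D deg B.img (car B.img)"
    by (rule rm.gfd_image[OF gfd_prod[OF V(1) presented_gfd[OF V] W(1) presented_gfd[OF W]]])
      (auto simp: B.img_simps(1))
  have pB: "presented B.img"
  proof (rule presented_jointly_injective[OF B.cmodule_img gB V W p(1) q(1)])
    fix x b assume x: "x \<in> Ob D" and "b \<in> car B.img x" and z: "p x b = \<zero>\<^bsub>fib V x\<^esub>" "q x b = \<zero>\<^bsub>fib W x\<^esub>"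
    then obtain a where a: "b = r x a" "a \<in> car ?X x" by (auto simp: B.img_simps(1))
    have "a = \<zero>\<^bsub>fib ?X x\<^esub>" using z p(2)[OF x a(2)] q(2)[OF x a(2)] unfolding a(1) by (simp add: prod_eq_iff)
    then show "b = \<zero>\<^bsub>fib B.img x\<^esub>" unfolding a(1) B.img_simps(2) by simp
  qed
  have id: "i x (p x b) \<oplus>\<^bsub>fib B.img x\<^esub> j x (q x b) = b" if x: "x \<in> Ob D" and b: "b \<in> car B.img x" for x b
  proof -
    obtain a where a: "b = r x a" "a \<in> car ?X x" using b by (auto simp: B.img_simps(1))
    interpret v: module k "fib V x" by (rule V.fib_module[OF x])
    interpret w: module k "fib W x" by (rule W.fib_module[OF x])
    have c: "(fst a, \<zero>\<^bsub>fib W x\<^esub>) \<in> car ?X x" "(\<zero>\<^bsub>fib V x\<^esub>, snd a) \<in> car ?X x" using a(2) by auto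
    have "(fst a, \<zero>\<^bsub>fib W x\<^esub>) \<oplus>\<^bsub>fib ?X x\<^esub> (\<zero>\<^bsub>fib V x\<^esub>, snd a) = a" using a(2) by auto
    then show ?thesis
      unfolding a(1) p(2)[OF x a(2)] q(2)[OF x a(2)] i_def j_def B.img_simps(3)[OF x c] by simp
  qed
  have pi: "p x (i x v) = v" "q x (i x v) = \<zero>\<^bsub>fib W x\<^esub>" if x: "x \<in> Ob D" and v: "v \<in> car V x" for x v
  proof -
    have "(v, \<zero>\<^bsub>fib W x\<^esub>) \<in> car ?X x" using v W.zero_closed[OF x] by simp
    then show "p x (i x v) = v" "q x (i x v) = \<zero>\<^bsub>fib W x\<^esub>" using p(2)[OF x] q(2)[OF x] by (simp_all add: i_def)
  qed
  have pj: "q x (j x w) = w" "p x (j x w) = \<zero>\<^bsub>fib V x\<^esub>" if x: "x \<in> Ob D" and w: "w \<in> car W x" for x w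
  proof -
    have "(\<zero>\<^bsub>fib V x\<^esub>, w) \<in> car ?X x" using w V.zero_closed[OF x] by simp
    then show "q x (j x w) = w" "p x (j x w) = \<zero>\<^bsub>fib V x\<^esub>" using p(2)[OF x] q(2)[OF x] by (simp_all add: j_def)
  qed
  show ?thesis
    by (rule exI[of _ B.img], rule exI[of _ i], rule exI[of _ j], rule exI[of _ p], rule exI[of _ q])
      (simp add: B.cmodule_img pB i j p(1) q(1) pi pj id)
qed

text \<open>The quotient lives on chosen representatives of cosets. The kernel of the quotient map
  is the image of \<open>V\<close>, which is generated in finite degrees because \<open>V\<close>
  is.\<close>

lemma presented_cokernel:
  fixes V W :: "('i \<Rightarrow> nat, 'i \<Rightarrow> 'a, 'k, 'v) cmod"
  assumes V: "cmodule k D V" "presented V" and W: "cmodule k D W" "presented W" and \<phi>: "cmod_hom k D V W \<phi>"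
  shows "\<exists>(U :: ('i \<Rightarrow> nat, 'i \<Rightarrow> 'a, 'k, 'v) cmod) \<pi>. (cmodule k D U \<and> presented U) \<and> cmod_hom k D W U \<pi> \<and>
      cmod_surj D W U \<pi> \<and> (\<forall>x \<in> Ob D. \<forall>w \<in> car W x. \<pi> x w = \<zero>\<^bsub>fib U x\<^esub> \<longleftrightarrow> w \<in> \<phi> x ` car V x)"
proof -
  interpret \<phi>: cmod_map k D V W \<phi> using cat V(1) W(1) \<phi> by unfold_locales
  interpret U: cmod_congruence k D W "\<lambda>x w. SOME w'. w' \<in> \<phi>.coset x w" "\<lambda>x. \<phi> x ` car V x"
    by unfold_locales (auto intro: \<phi>.subm_image simp: \<phi>.coset_eq_iff)
  have ker: "(SOME w'. w' \<in> \<phi>.coset x w) = \<zero>\<^bsub>fib U.img x\<^esub> \<longleftrightarrow> w \<in> \<phi> x ` car V x" if "x \<in> Ob D" "w \<in> car W x" for x w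
    by (rule U.img_ker[OF that])
  have sur: "cmod_surj D W U.img (\<lambda>x w. SOME w'. w' \<in> \<phi>.coset x w)"
    unfolding cmod_surj_def U.img_simps(1) by simp
  have "gfd k D deg W (\<lambda>x. {w \<in> car W x. (SOME w'. w' \<in> \<phi>.coset x w) = \<zero>\<^bsub>fib U.img x\<^esub>})"
    by (rule \<phi>.gfd_image[OF presented_gfd[OF V]]) (use ker \<phi>.map_closed in auto)
  from presented_quotient[OF W U.cmodule_img U.hom_img sur this]
  show ?thesis
    using U.cmodule_img U.hom_img sur ker
    by (intro exI[of _ U.img] exI[of _ "\<lambda>x w. SOME w'. w' \<in> \<phi>.coset x w"]) simp
qed

theorem abelian_presented:
  assumes "infinite (UNIV :: 'v set)"
  shows "abelian_category (full_subcategory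
    (module_category k D :: (('i \<Rightarrow> nat, 'i \<Rightarrow> 'a, 'k, 'v) cmod, _) cat) presented)"
proof -
  interpret module_subcategory k D "presented :: ('i \<Rightarrow> nat, 'i \<Rightarrow> 'a, 'k, 'v) cmod \<Rightarrow> bool"
    using cat by unfold_locales
  show ?thesis
  proof (rule abelian_S)
    show "\<exists>Z. ob Z \<and> (\<forall>x \<in> Ob D. car Z x = {\<zero>\<^bsub>fib Z x\<^esub>})"
      by (intro exI[of _ "zero_cmod undefined"]) (simp add: ob_def presented_zero cmodule_zero[OF k cat])
  next
    fix V W assume "ob V" "ob W"
    then show "\<exists>B i j p q. ob B \<and>
      cmod_hom k D V B i \<and> cmod_hom k D W B j \<and> cmod_hom k D B V p \<and> cmod_hom k D B W q \<and>
      (\<forall>x \<in> Ob D. (\<forall>v \<in> car V x. p x (i x v) = v \<and> q x (i x v) = \<zero>\<^bsub>fib W x\<^esub>) \<and>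
         (\<forall>w \<in> car W x. q x (j x w) = w \<and> p x (j x w) = \<zero>\<^bsub>fib V x\<^esub>) \<and>
         (\<forall>b \<in> car B x. i x (p x b) \<oplus>\<^bsub>fib B x\<^esub> j x (q x b) = b))"
      unfolding ob_def by (intro presented_biproduct[OF assms]) simp_all
  next
    fix V W \<phi> assume "ob V" "ob W" and \<phi>: "cmod_hom k D V W \<phi>"
    then have o: "cmodule k D V" "presented V" "cmodule k D W" "presented W" by (simp_all add: ob_def)
    interpret \<phi>: cmod_map k D V W \<phi> using cat o \<phi> by unfold_locales
    show "ob (sub_cmod V (\<lambda>x. {v \<in> car V x. \<phi> x v = \<zero>\<^bsub>fib W x\<^esub>}))"
      unfolding ob_def using \<phi>.V.cmodule_sub[OF \<phi>.subm_kernel]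
        presented_sub[OF o(1,2) \<phi>.subm_kernel gfd_kernel[OF o(1) presented_gfd[OF o(1,2)] o(3,4) \<phi>]] by simp
    show "\<exists>U \<pi>. ob U \<and> cmod_hom k D W U \<pi> \<and> cmod_surj D W U \<pi> \<and>
      (\<forall>x \<in> Ob D. \<forall>w \<in> car W x. \<pi> x w = \<zero>\<^bsub>fib U x\<^esub> \<longleftrightarrow> w \<in> \<phi> x ` car V x)"
      unfolding ob_def by (rule presented_cokernel[OF o \<phi>])
  qed
qed

end

theorem corollary5p1:
  fixes m :: nat
    and k :: "'k ring"
    and C :: "nat \<Rightarrow> (nat, 'a) cat"
    and \<psi> :: "nat \<Rightarrow> 'a \<Rightarrow> 'a"
    and \<epsilon> :: "nat \<Rightarrow> nat \<Rightarrow> 'a"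
  assumes "m \<ge> 1"
    and "cring k"
    and "\<And>i. i \<in> {1..m} \<Longrightarrow> combinatorial_category (C i)"
    and "\<And>i. i \<in> {1..m} \<Longrightarrow> shift_structure k (C i) (\<psi> i) (\<epsilon> i)"
    and universe: "infinite (UNIV :: 'v set)"
  shows "abelian_category
    (full_subcategory
      (module_category k (prod_cat {1..m} C) ::
        ((nat \<Rightarrow> nat, nat \<Rightarrow> 'a, 'k, 'v) cmod, _) cat)
      (presented_in_finite_degrees k (prod_cat {1..m} C) (\<lambda>n. \<Sum>i\<in>{1..m}. n i)))"
proof -
  interpret coherent_product k C \<psi> \<epsilon> "{1..m}"
    by (rule coherent_product.intro[OF _ assms(2-4)]) simp_all
  show ?thesis by (rule abelian_presented[OF universe])
qed

end
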